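(* Let $A$ be a separable C*-algebra. The following are equivalent: (i) $A$ is MF; (ii) every $*$-homomorphism from $A$ to $B(H)$ lifts to a discrete asymptotic homomorphism from $A$ to $\mathcal D$; (iii) every $*$-homomorphism from $A$ to $B(H)$ asymptotically lifts to a discrete asymptotic homomorphism from $A$ to $\mathcal D$; (iv) there exists an embedding of $A$ into $B(H)$ that asymptotically lifts to a discrete asymptotic homomorphism from $A$ to $\mathcal D$.
   Context: A separable C*-algebra $A$ is MF if it embeds into $\prod_nM_{k_n}/\bigoplus_nM_{k_n}$ for some $k_n\in\mathbb N$, where $\prod$ denotes bounded sequences and $\bigoplus$ sequences converging to $0$ in norm. $H$ is a (separable, infinite-dimensional) Hilbert space with an increasing sequence of projections $P_n$, $n\in\mathbb N$, $\dim P_nH=n$, converging $*$-strongly to $1_{B(H)}$; $M_n$ is identified with $P_nB(H)P_n$. $\mathcal D\subset\prod_{n\in\mathbb N}M_n$ is the C*-algebra of all $*$-strongly convergent (bounded) sequences of matrices, and $q:\mathcal D\to B(H)$ is the surjection sending a sequence to its $*$-strong limit. A discrete asymptotic homomorphism from $A$ to a C*-algebra $E$ is a sequence of maps $f_n:A\to E$, $n\in\mathbb N$ (not assumed linear), with $\sup_n\|f_n(a)\|<\infty$, $\|f_n(a^* )-f_n(a)^*\|\to0$, $\|f_n(\mu_1a+\mu_2b)-\mu_1f_n(a)-\mu_2f_n(b)\|\to0$ and $\|f_n(ab)-f_n(a)f_n(b)\|\to0$ for all $a,b\in A$, $\mu_1,\mu_2\in\mathbb C$. A $*$-homomorphism $f:A\to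 B(H)$ lifts to a discrete asymptotic homomorphism $(\phi_n)$ from $A$ to $\mathcal D$ if $q\circ\phi_n=f$ for every $n$; it asymptotically lifts to $(\phi_n)$ if $\lim_{n\to\infty}\|q(\phi_n(a))-f(a)\|=0$ for every $a\in A$. An embedding is an injective $*$-homomorphism. *)

theory Defs
  imports "HOL-Analysis.Analysis" "Jordan_Normal_Form.Schur_Decomposition"
begin

section \<open>Complex normed spaces, C*-algebras and Hilbert spaces\<close>

class complex_vector = real_vector +
  fixes scaleC :: "complex \<Rightarrow> 'a \<Rightarrow> 'a"  (infixr \<open>*\<^sub>C\<close> 75)
  assumes scaleC_add_right: "c *\<^sub>C (x + y) = c *\<^sub>C x + c *\<^sub>C y"
    and scaleC_add_left: "(c + d) *\<^sub>C x = c *\<^sub>C x + d *\<^sub>C x"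
    and scaleC_scaleC: "c *\<^sub>C (d *\<^sub>C x) = (c * d) *\<^sub>C x"
    and scaleC_one: "1 *\<^sub>C x = x"
    and scaleR_scaleC: "r *\<^sub>R x = complex_of_real r *\<^sub>C x"

interpretation complex_vector: vector_space "scaleC :: complex \<Rightarrow> 'a \<Rightarrow> 'a::complex_vector"
  by unfold_locales (simp_all add: scaleC_add_right scaleC_add_left scaleC_scaleC scaleC_one)

class complex_normed_vector = complex_vector + real_normed_vector +
  assumes norm_scaleC: "norm (c *\<^sub>C x) = cmod c * norm x"

text \<open>C*-algebras are not required to have a unit, and the zero algebra is allowed.\<close>

class cstar_algebra = complex_normed_vector + real_normed_algebra + banach +
  fixes cstar :: "'a \<Rightarrow> 'a"
  assumes mult_scaleC_left: "(c *\<^sub>C x) * y = c *\<^sub>C (x * y)"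
    and mult_scaleC_right: "x * (c *\<^sub>C y) = c *\<^sub>C (x * y)"
    and cstar_add: "cstar (x + y) = cstar x + cstar y"
    and cstar_scaleC: "cstar (c *\<^sub>C x) = cnj c *\<^sub>C cstar x"
    and cstar_mult: "cstar (x * y) = cstar y * cstar x"
    and cstar_cstar: "cstar (cstar x) = x"
    and cstar_identity: "norm (cstar x * x) = (norm x)\<^sup>2"

text \<open>The inner product is linear in the second argument.\<close>

class chilbert_space = complex_normed_vector + banach +
  fixes cinner :: "'a \<Rightarrow> 'a \<Rightarrow> complex"
  assumes cinner_commute: "cinner x y = cnj (cinner y x)"
    and cinner_add_right: "cinner x (y + z) = cinner x y + cinner x z"
    and cinner_scaleC_right: "cinner x (c *\<^sub>C y) = c * cinner x y"
    and cinner_self_nonneg: "0 \<le> Re (cinner x x)"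
    and norm_eq_sqrt_cinner: "norm x = sqrt (Re (cinner x x))"


section \<open>Bounded operators on a Hilbert space and their adjoints\<close>

text \<open>The type \<open>'h \<Rightarrow>\<^sub>L 'h\<close> consists of the bounded real-linear maps; its norm is the operator norm.\<close>

definition bounded_ops :: "('h::chilbert_space \<Rightarrow>\<^sub>L 'h) set" where
  "bounded_ops = {T :: 'h \<Rightarrow>\<^sub>L 'h. \<forall>c x. T (c *\<^sub>C x) = c *\<^sub>C T x}"

definition cadjoint :: "('h::chilbert_space \<Rightarrow>\<^sub>L 'h) \<Rightarrow> ('h \<Rightarrow>\<^sub>L 'h)" where
  "cadjoint T = (THE S :: 'h \<Rightarrow>\<^sub>L 'h. \<forall>x y. cinner (S x) y = cinner x (T y))"

lemma cinner_add_left: "cinner (x + y) z = cinner x z + cinner y (z::'a::chilbert_space)"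
  by (metis cinner_commute cinner_add_right complex_cnj_add)

lemma cinner_scaleC_left: "cinner (c *\<^sub>C x) y = cnj c * cinner x (y::'a::chilbert_space)"
  by (metis cinner_commute cinner_scaleC_right complex_cnj_mult)

lemma uminus_scaleC: "- x = (-1) *\<^sub>C (x::'a::complex_vector)"
  using scaleR_scaleC[of "-1" x] by simp

lemma cinner_diff_right: "cinner x (y - z) = cinner x y - cinner x (z::'a::chilbert_space)"
  unfolding diff_conv_add_uminus uminus_scaleC cinner_add_right cinner_scaleC_right by simp

lemma cinner_diff_left: "cinner (x - y) z = cinner x z - cinner y (z::'a::chilbert_space)"
  by (metis cinner_commute cinner_diff_right complex_cnj_diff)

lemma cinner_self: "cinner x x = complex_of_real ((norm (x::'a::chilbert_space))\<^sup>2)"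
proof (rule complex_eqI)
  show "Re (cinner x x) = Re (complex_of_real ((norm x)\<^sup>2))"
    using cinner_self_nonneg[of x] by (simp add: norm_eq_sqrt_cinner)
  have "Im (cinner x x) = - Im (cinner x x)"
    using arg_cong[OF cinner_commute[of x x], of Im] by simp
  then show "Im (cinner x x) = Im (complex_of_real ((norm x)\<^sup>2))" by simp
qed

lemma norm_sq_cinner: "(norm (x::'a::chilbert_space))\<^sup>2 = Re (cinner x x)"
  by (simp add: cinner_self)

lemma cinner_zero_right: "cinner x (0::'a::chilbert_space) = 0"
  using cinner_add_right[of x 0 0] by simp

lemma parallelogram:
  "(norm (x + y))\<^sup>2 + (norm (x - y))\<^sup>2 = 2 * (norm x)\<^sup>2 + 2 * (norm (y::'a::chilbert_space))\<^sup>2"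
  unfolding norm_sq_cinner
  by (simp add: cinner_add_left cinner_add_right cinner_diff_left cinner_diff_right)

lemma norm_diff_scaleC_sq:
  fixes x y :: "'a::chilbert_space"
  shows "(norm (x - c *\<^sub>C y))\<^sup>2
    = (norm x)\<^sup>2 - 2 * Re (c * cinner x y) + (cmod c)\<^sup>2 * (norm y)\<^sup>2"
proof -
  have "Re (cinner (c *\<^sub>C y) x) = Re (c * cinner x y)"
    using arg_cong[OF cinner_commute[of "c *\<^sub>C y" x], of Re] by (simp add: cinner_scaleC_right)
  moreover have "Re (cinner (c *\<^sub>C y) (c *\<^sub>C y)) = (cmod c)\<^sup>2 * (norm y)\<^sup>2"
    by (simp add: norm_sq_cinner[symmetric] norm_scaleC power_mult_distrib)
  moreover have "(norm (x - c *\<^sub>C y))\<^sup>2 = Re (cinner x x) - Re (cinner x (c *\<^sub>C y))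
      - Re (cinner (c *\<^sub>C y) x) + Re (cinner (c *\<^sub>C y) (c *\<^sub>C y))"
    by (simp add: norm_sq_cinner cinner_diff_left cinner_diff_right)
  ultimately show ?thesis
    by (simp only: cinner_scaleC_right norm_sq_cinner[of x])
qed

lemma minimal_orthogonal:
  fixes x y :: "'a::chilbert_space"
  assumes "\<And>c. norm x \<le> norm (x - c *\<^sub>C y)"
  shows "cinner x y = 0"
proof (cases "y = 0")
  case True
  then show ?thesis by (simp add: cinner_zero_right)
next
  case False
  define w where "w = cinner x y"
  define c where "c = cnj w / complex_of_real ((norm y)\<^sup>2)"
  have y: "norm y > 0" using False by simp
  have "c * w = complex_of_real ((cmod w)\<^sup>2 / (norm y)\<^sup>2)"
    using complex_norm_square[of w] by (simp add: c_def mult.commute)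
  then have 1: "Re (c * w) = (cmod w)\<^sup>2 / (norm y)\<^sup>2" by simp
  have "cmod c = cmod w / (norm y)\<^sup>2"
    unfolding c_def by (simp add: norm_divide norm_power)
  then have 2: "(cmod c)\<^sup>2 * (norm y)\<^sup>2 = (cmod w)\<^sup>2 / (norm y)\<^sup>2"
    using y by (simp add: power_divide power2_eq_square field_simps)
  have "(norm x)\<^sup>2 \<le> (norm (x - c *\<^sub>C y))\<^sup>2" using assms[of c] by (simp add: power_mono)
  then have "(cmod w)\<^sup>2 / (norm y)\<^sup>2 \<le> 0"
    unfolding norm_diff_scaleC_sq w_def[symmetric] 1 2 by simp
  then have "(cmod w)\<^sup>2 \<le> 0" using y by (simp add: divide_le_0_iff)
  then show ?thesis by (simp add: w_def)
qed

lemma riesz_representation: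
  fixes f :: "'a::chilbert_space \<Rightarrow> complex"
  assumes bl: "bounded_linear f" and lin: "\<And>c x. f (c *\<^sub>C x) = c * f x"
  shows "\<exists>z. \<forall>x. f x = cinner z x"
proof (cases "\<forall>x. f x = 0")
  case True
  have "cinner 0 x = 0" for x :: 'a
    using cinner_add_left[of 0 0 x] by simp
  with True show ?thesis by metis
next
  case False
  interpret f: bounded_linear f by (rule bl)
  obtain u where u: "f u \<noteq> 0" using False by blast
  define C where "C = {x. f x = 1}"
  have "f ((1 / f u) *\<^sub>C u) = 1" using u by (simp add: lin)
  then have ne: "C \<noteq> {}" by (auto simp: C_def)
  define d where "d = Inf (norm ` C)"
  have bdd: "bdd_below (norm ` C)" by (rule bdd_belowI[of _ 0]) auto
  have d_le: "d \<le> norm x" if "x \<in> C" for x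
    unfolding d_def by (rule cInf_lower) (use that bdd in auto)
  have d0: "0 \<le> d" unfolding d_def by (rule cInf_greatest) (use ne in auto)
  have "\<exists>x\<in>C. norm x < d + 1 / real (Suc n)" for n
  proof -
    have "Inf (norm ` C) < d + 1 / real (Suc n)" by (simp add: d_def)
    then show ?thesis using cInf_less_iff[of "norm ` C"] ne bdd by auto
  qed
  then obtain X where X: "\<And>n. X n \<in> C" "\<And>n. norm (X n) < d + 1 / real (Suc n)" by metis
  have gap: "(norm (x - y))\<^sup>2 \<le> 2 * (norm x)\<^sup>2 + 2 * (norm y)\<^sup>2 - 4 * d\<^sup>2"
    if "x \<in> C" "y \<in> C" for x y
  proof -
    have "f ((1/2) *\<^sub>R (x + y)) = 1"
      using that by (simp add: C_def f.scaleR f.add scaleR_conv_of_real)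
    then have "d \<le> norm ((1/2) *\<^sub>R (x + y))" by (intro d_le) (simp add: C_def)
    then have "2 * d \<le> norm (x + y)" by simp
    then have "(2 * d)\<^sup>2 \<le> (norm (x + y))\<^sup>2" using d0 by (intro power_mono) auto
    then show ?thesis using parallelogram[of x y] by (simp add: power_mult_distrib)
  qed
  have lim: "(\<lambda>n. norm (X n)) \<longlonglongrightarrow> d"
  proof (rule real_tendsto_sandwich[of "\<lambda>_. d" _ _ "\<lambda>n. d + 1 / real (Suc n)"])
    show "(\<lambda>n. d + 1 / real (Suc n)) \<longlonglongrightarrow> d"
      using tendsto_add[OF tendsto_const[of d] LIMSEQ_inverse_real_of_nat]
      by (simp add: inverse_eq_divide)
    show "\<forall>\<^sub>F n in sequentially. norm (X n) \<le> d + 1 / real (Suc n)"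
      using X(2) by (simp add: less_imp_le)
  qed (use d_le X(1) in auto)
  have "Cauchy X"
  proof (rule metric_CauchyI)
    fix e :: real assume e: "e > 0"
    have "(\<lambda>n. 2 * (norm (X n))\<^sup>2 - 2 * d\<^sup>2) \<longlonglongrightarrow> 2 * d\<^sup>2 - 2 * d\<^sup>2"
      by (intro tendsto_intros lim)
    then have "(\<lambda>n. 2 * (norm (X n))\<^sup>2 - 2 * d\<^sup>2) \<longlonglongrightarrow> 0" by simp
    then have "\<forall>\<^sub>F n in sequentially. 2 * (norm (X n))\<^sup>2 - 2 * d\<^sup>2 < e\<^sup>2 / 2"
      by (rule order_tendstoD) (use e in simp)
    then obtain N where N: "\<And>n. n \<ge> N \<Longrightarrow> 2 * (norm (X n))\<^sup>2 - 2 * d\<^sup>2 < e\<^sup>2 / 2"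
      by (auto simp: eventually_sequentially)
    have "dist (X m) (X n) < e" if "m \<ge> N" "n \<ge> N" for m n
    proof -
      have "(norm (X m - X n))\<^sup>2 < e\<^sup>2"
        using gap[OF X(1) X(1), of m n] N[OF that(1)] N[OF that(2)] by linarith
      then show ?thesis using e by (simp add: dist_norm power2_less_imp_less)
    qed
    then show "\<exists>M. \<forall>m\<ge>M. \<forall>n\<ge>M. dist (X m) (X n) < e" by blast
  qed
  then obtain x0 where x0: "X \<longlonglongrightarrow> x0" using Cauchy_convergent convergent_def by blast
  have "(\<lambda>n. f (X n)) \<longlonglongrightarrow> f x0" by (rule f.tendsto[OF x0])
  moreover have "(\<lambda>n. f (X n)) = (\<lambda>_. 1)" using X(1) by (auto simp: C_def)
  ultimately have fx0: "f x0 = 1" by (simp add: LIMSEQ_const_iff)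
  have nx0: "norm x0 = d"
    using LIMSEQ_unique[OF tendsto_norm[OF x0] lim] .
  have orth: "cinner x0 y = 0" if "f y = 0" for y
  proof (rule minimal_orthogonal)
    fix c
    have "f (x0 - c *\<^sub>C y) = 1" by (simp add: f.diff lin fx0 that)
    then show "norm x0 \<le> norm (x0 - c *\<^sub>C y)" using d_le nx0 by (simp add: C_def)
  qed
  define a where "a = cinner x0 x0"
  have "x0 \<noteq> 0" using fx0 f.zero by auto
  then have a0: "a \<noteq> 0" by (simp add: a_def cinner_self)
  have ar: "cnj a = a" by (simp add: a_def cinner_self)
  have "f x = cinner ((1 / a) *\<^sub>C x0) x" for x
  proof -
    have "f (x - f x *\<^sub>C x0) = 0" by (simp add: f.diff lin fx0)
    then have "cinner x0 (x - f x *\<^sub>C x0) = 0" by (rule orth)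
    then have "cinner x0 x = f x * a" by (simp add: cinner_diff_right cinner_scaleC_right a_def)
    then show ?thesis using a0 by (simp add: cinner_scaleC_left ar)
  qed
  then show ?thesis by blast
qed

lemma cauchy_schwarz: "cmod (cinner x y) \<le> norm x * norm (y::'a::chilbert_space)"
proof (cases "x = 0")
  case True
  then show ?thesis using cinner_add_left[of 0 0 y] by simp
next
  case False
  define w where "w = cinner y x"
  define c where "c = cnj w / complex_of_real ((norm x)\<^sup>2)"
  have x: "norm x > 0" using False by simp
  have "c * w = complex_of_real ((cmod w)\<^sup>2 / (norm x)\<^sup>2)"
    using complex_norm_square[of w] by (simp add: c_def mult.commute)
  then have 1: "Re (c * w) = (cmod w)\<^sup>2 / (norm x)\<^sup>2" by simp
  have "cmod c = cmod w / (norm x)\<^sup>2"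
    unfolding c_def by (simp add: norm_divide norm_power)
  then have 2: "(cmod c)\<^sup>2 * (norm x)\<^sup>2 = (cmod w)\<^sup>2 / (norm x)\<^sup>2"
    using x by (simp add: power_divide power2_eq_square field_simps)
  have "0 \<le> (norm (y - c *\<^sub>C x))\<^sup>2" by simp
  then have "(cmod w)\<^sup>2 / (norm x)\<^sup>2 \<le> (norm y)\<^sup>2"
    unfolding norm_diff_scaleC_sq w_def[symmetric] 1 2 by simp
  then have "(cmod w)\<^sup>2 \<le> (norm x * norm y)\<^sup>2"
    using x by (simp add: divide_le_eq power_mult_distrib mult.commute)
  then have "cmod w \<le> norm x * norm y" by (rule power2_le_imp_le) simp
  moreover have "cmod w = cmod (cinner x y)" unfolding w_def by (metis cinner_commute complex_mod_cnj)
  ultimately show ?thesis by simp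
qed

lemma cinner_eqI:
  assumes "\<And>y. cinner x y = cinner x' (y::'a::chilbert_space)"
  shows "x = x'"
proof -
  have "cinner (x - x') (x - x') = 0" by (simp add: cinner_diff_left assms)
  then show ?thesis by (simp add: cinner_self)
qed

lemma cadjoint_exists:
  fixes T :: "'h::chilbert_space \<Rightarrow>\<^sub>L 'h"
  assumes T: "T \<in> bounded_ops"
  shows "\<exists>!S::'h \<Rightarrow>\<^sub>L 'h. \<forall>x y. cinner (S x) y = cinner x (T y)"
proof -
  have "\<exists>z. \<forall>y. cinner x (T y) = cinner z y" for x
  proof (rule riesz_representation)
    show "bounded_linear (\<lambda>y. cinner x (T y))"
    proof (rule bounded_linear_intro)
      fix y z :: 'h and r :: real
      show "cinner x (T (y + z)) = cinner x (T y) + cinner x (T z)"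
        by (simp add: blinfun.add_right cinner_add_right)
      show "cinner x (T (r *\<^sub>R y)) = r *\<^sub>R cinner x (T y)"
        by (simp add: blinfun.scaleR_right scaleR_scaleC[of r "T y"] cinner_scaleC_right
            scaleR_conv_of_real)
      have "cmod (cinner x (T y)) \<le> norm x * norm (T y)" by (rule cauchy_schwarz)
      also have "\<dots> \<le> norm x * (norm T * norm y)" by (intro mult_left_mono norm_blinfun) simp
      finally show "norm (cinner x (T y)) \<le> norm y * (norm x * norm T)" by (simp add: algebra_simps)
    qed
    show "cinner x (T (c *\<^sub>C y)) = c * cinner x (T y)" for c y
      using T by (simp add: bounded_ops_def cinner_scaleC_right)
  qed
  then obtain s where s: "\<And>x y. cinner x (T y) = cinner (s x) y" by metis
  have "bounded_linear s"
  proof (rule bounded_linear_intro)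
    fix x y :: 'h and r :: real
    show "s (x + y) = s x + s y"
      by (rule cinner_eqI) (simp add: cinner_add_left s[symmetric])
    show "s (r *\<^sub>R x) = r *\<^sub>R s x"
      by (rule cinner_eqI) (simp add: scaleR_scaleC cinner_scaleC_left s[symmetric])
    show "norm (s x) \<le> norm x * norm T"
    proof (cases "s x = 0")
      case False
      have "(norm (s x))\<^sup>2 = cmod (cinner x (T (s x)))" by (simp add: s cinner_self norm_power)
      also have "\<dots> \<le> norm x * norm (T (s x))" by (rule cauchy_schwarz)
      also have "\<dots> \<le> norm x * (norm T * norm (s x))" by (intro mult_left_mono norm_blinfun) simp
      finally show ?thesis using False by (simp add: power2_eq_square)
    qed simp
  qed
  then have "\<forall>x y. cinner (Blinfun s x) y = cinner x (T y)"
    by (simp add: bounded_linear_Blinfun_apply s)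
  moreover have "S = S'" if "\<forall>x y. cinner (S x) y = cinner x (T y)"
    "\<forall>x y. cinner (S' x) y = cinner x (T y)" for S S' :: "'h \<Rightarrow>\<^sub>L 'h"
    using that by (intro blinfun_eqI cinner_eqI) simp
  ultimately show ?thesis by blast
qed

lemma cinner_cadjoint:
  fixes T :: "'h::chilbert_space \<Rightarrow>\<^sub>L 'h"
  assumes "T \<in> bounded_ops"
  shows "cinner (cadjoint T x) y = cinner x (T y)"
  using theI'[OF cadjoint_exists[OF assms]] unfolding cadjoint_def by blast

lemma cadjoint_bounded_ops:
  fixes T :: "'h::chilbert_space \<Rightarrow>\<^sub>L 'h"
  assumes "T \<in> bounded_ops"
  shows "cadjoint T \<in> bounded_ops"
proof -
  have "cadjoint T (c *\<^sub>C x) = c *\<^sub>C cadjoint T x" for c x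
    by (rule cinner_eqI) (simp add: cinner_cadjoint[OF assms] cinner_scaleC_left)
  then show ?thesis by (simp add: bounded_ops_def)
qed


section \<open>C*-algebras with explicit carrier\<close>

text \<open>
  The algebras below depend on parameters (matrix sizes, projections), so they are given as
  records with an explicit carrier; the operations are only meaningful on the carrier.
\<close>

record 'e star_algebra =
  elems :: "'e set"
  add_sa :: "'e \<Rightarrow> 'e \<Rightarrow> 'e"
  mult_sa :: "'e \<Rightarrow> 'e \<Rightarrow> 'e"
  scale_sa :: "complex \<Rightarrow> 'e \<Rightarrow> 'e"
  star_sa :: "'e \<Rightarrow> 'e"
  norm_sa :: "'e \<Rightarrow> real"

definition diff_sa :: "'e star_algebra \<Rightarrow> 'e \<Rightarrow> 'e \<Rightarrow> 'e" where
  "diff_sa E x y = add_sa E x (scale_sa E (- 1) y)"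

definition bounded_op_alg :: "('h::chilbert_space \<Rightarrow>\<^sub>L 'h) star_algebra" where
  "bounded_op_alg = \<lparr>
     elems = bounded_ops,
     add_sa = (+),
     mult_sa = (o\<^sub>L),
     scale_sa = (\<lambda>c (T :: 'h \<Rightarrow>\<^sub>L 'h). Blinfun (\<lambda>x. c *\<^sub>C T x)),
     star_sa = cadjoint,
     norm_sa = norm \<rparr>"

definition corner_alg :: "('h::chilbert_space \<Rightarrow>\<^sub>L 'h) \<Rightarrow> ('h \<Rightarrow>\<^sub>L 'h) star_algebra" where
  "corner_alg p = bounded_op_alg \<lparr> elems := {p o\<^sub>L T o\<^sub>L p | T. T \<in> bounded_ops} \<rparr>"

definition vec_l2norm :: "complex Matrix.vec \<Rightarrow> real" where
  "vec_l2norm v = L2_set (\<lambda>i. cmod (vec_index v i)) {..<dim_vec v}"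

definition mat_opnorm :: "complex mat \<Rightarrow> real" where
  "mat_opnorm A = Sup {vec_l2norm (A *\<^sub>v v) | v. v \<in> carrier_vec (dim_col A) \<and> vec_l2norm v \<le> 1}"

definition matrix_alg :: "nat \<Rightarrow> complex mat star_algebra" where
  "matrix_alg k = \<lparr>
     elems = carrier_mat k k,
     add_sa = (+),
     mult_sa = (*),
     scale_sa = (\<cdot>\<^sub>m),
     star_sa = mat_adjoint,
     norm_sa = mat_opnorm \<rparr>"

definition bounded_prod :: "(nat \<Rightarrow> 'e star_algebra) \<Rightarrow> (nat \<Rightarrow> 'e) star_algebra" where
  "bounded_prod E = \<lparr>
     elems = {x. (\<forall>n. x n \<in> elems (E n)) \<and> bdd_above (range (\<lambda>n. norm_sa (E n) (x n)))},
     add_sa = (\<lambda>x y n. add_sa (E n) (x n) (y n)),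
     mult_sa = (\<lambda>x y n. mult_sa (E n) (x n) (y n)),
     scale_sa = (\<lambda>c x n. scale_sa (E n) c (x n)),
     star_sa = (\<lambda>x n. star_sa (E n) (x n)),
     norm_sa = (\<lambda>x. SUP n. norm_sa (E n) (x n)) \<rparr>"

definition c0_sum :: "(nat \<Rightarrow> 'e star_algebra) \<Rightarrow> (nat \<Rightarrow> 'e) set" where
  "c0_sum E = {x \<in> elems (bounded_prod E). (\<lambda>n. norm_sa (E n) (x n)) \<longlonglongrightarrow> 0}"

definition coset_sa :: "'e star_algebra \<Rightarrow> 'e set \<Rightarrow> 'e \<Rightarrow> 'e set" where
  "coset_sa E I x = {y \<in> elems E. diff_sa E y x \<in> I}"

text \<open>
  For an ideal \<open>I\<close>, each union of cosets below is a union of copies of one and the same coset.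
\<close>

definition quotient_alg :: "'e star_algebra \<Rightarrow> 'e set \<Rightarrow> 'e set star_algebra" where
  "quotient_alg E I = \<lparr>
     elems = coset_sa E I ` elems E,
     add_sa = (\<lambda>X Y. \<Union>x\<in>X. \<Union>y\<in>Y. coset_sa E I (add_sa E x y)),
     mult_sa = (\<lambda>X Y. \<Union>x\<in>X. \<Union>y\<in>Y. coset_sa E I (mult_sa E x y)),
     scale_sa = (\<lambda>c X. \<Union>x\<in>X. coset_sa E I (scale_sa E c x)),
     star_sa = (\<lambda>X. \<Union>x\<in>X. coset_sa E I (star_sa E x)),
     norm_sa = (\<lambda>X. INF x\<in>X. norm_sa E x) \<rparr>"


section \<open>Homomorphisms and MF algebras\<close>

definition star_hom :: "'e star_algebra \<Rightarrow> ('a::cstar_algebra \<Rightarrow> 'e) \<Rightarrow> bool" where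
  "star_hom E f \<longleftrightarrow>
     (\<forall>a. f a \<in> elems E) \<and>
     (\<forall>a b. f (a + b) = add_sa E (f a) (f b)) \<and>
     (\<forall>c a. f (c *\<^sub>C a) = scale_sa E c (f a)) \<and>
     (\<forall>a b. f (a * b) = mult_sa E (f a) (f b)) \<and>
     (\<forall>a. f (cstar a) = star_sa E (f a))"

definition embedding :: "'e star_algebra \<Rightarrow> ('a::cstar_algebra \<Rightarrow> 'e) \<Rightarrow> bool" where
  "embedding E f \<longleftrightarrow> star_hom E f \<and> inj f"

text \<open>Separability, which belongs to the notion of an MF algebra, is a separate hypothesis.\<close>

definition MF :: "'a::cstar_algebra itself \<Rightarrow> bool" where
  "MF _ \<longleftrightarrow> (\<exists>k :: nat \<Rightarrow> nat. (\<forall>n. 0 < k n) \<and>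
     (\<exists>f :: 'a \<Rightarrow> (nat \<Rightarrow> complex mat) set.
        embedding (quotient_alg (bounded_prod (\<lambda>n. matrix_alg (k n)))
                                (c0_sum (\<lambda>n. matrix_alg (k n)))) f))"

definition discrete_asymptotic_hom ::
    "'e star_algebra \<Rightarrow> (nat \<Rightarrow> 'a::cstar_algebra \<Rightarrow> 'e) \<Rightarrow> bool" where
  "discrete_asymptotic_hom E f \<longleftrightarrow>
     (\<forall>n a. f n a \<in> elems E) \<and>
     (\<forall>a. bdd_above (range (\<lambda>n. norm_sa E (f n a)))) \<and>
     (\<forall>a. (\<lambda>n. norm_sa E (diff_sa E (f n (cstar a)) (star_sa E (f n a)))) \<longlonglongrightarrow> 0) \<and>
     (\<forall>a b c d. (\<lambda>n. norm_sa E (diff_sa E (f n (c *\<^sub>C a + d *\<^sub>C b))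
        (add_sa E (scale_sa E c (f n a)) (scale_sa E d (f n b))))) \<longlonglongrightarrow> 0) \<and>
     (\<forall>a b. (\<lambda>n. norm_sa E (diff_sa E (f n (a * b)) (mult_sa E (f n a) (f n b)))) \<longlonglongrightarrow> 0)"


section \<open>The algebra of *-strongly convergent sequences of matrices\<close>

definition star_strong_limit ::
    "(nat \<Rightarrow> 'h::chilbert_space \<Rightarrow>\<^sub>L 'h) \<Rightarrow> ('h \<Rightarrow>\<^sub>L 'h) \<Rightarrow> bool" where
  "star_strong_limit X T \<longleftrightarrow> T \<in> bounded_ops \<and>
     (\<forall>v. (\<lambda>n. X n v) \<longlonglongrightarrow> T v) \<and>
     (\<forall>v. (\<lambda>n. cadjoint (X n) v) \<longlonglongrightarrow> cadjoint T v)"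

definition orthogonal_projection :: "('h::chilbert_space \<Rightarrow>\<^sub>L 'h) \<Rightarrow> bool" where
  "orthogonal_projection p \<longleftrightarrow> p \<in> bounded_ops \<and> p o\<^sub>L p = p \<and> cadjoint p = p"

text \<open>
  The existence of such a sequence forces \<open>'h\<close> to be separable and infinite-dimensional.
  Finite-dimensionality is stated explicitly because \<^term>\<open>complex_vector.dim\<close> is \<open>0\<close> on
  infinite-dimensional subspaces. Indices start at \<open>0\<close>, so \<open>P 0 = 0\<close> and the coordinate \<open>0\<close> of a
  sequence of matrices is trivial.
\<close>

definition projection_filtration :: "(nat \<Rightarrow> 'h::chilbert_space \<Rightarrow>\<^sub>L 'h) \<Rightarrow> bool" where
  "projection_filtration P \<longleftrightarrow>
     (\<forall>n. orthogonal_projection (P n)) \<and>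
     (\<forall>m n. m \<le> n \<longrightarrow> range (P m) \<subseteq> range (P n)) \<and>
     (\<forall>n. (\<exists>B. finite B \<and> complex_vector.span B = range (P n)) \<and>
          complex_vector.dim (range (P n)) = n) \<and>
     star_strong_limit P id_blinfun"

text \<open>The \<open>n \<times> n\<close> matrices are identified with the corner \<open>P\<^sub>n B(H) P\<^sub>n\<close>.\<close>

definition convergent_matrix_alg ::
    "(nat \<Rightarrow> 'h::chilbert_space \<Rightarrow>\<^sub>L 'h) \<Rightarrow> (nat \<Rightarrow> 'h \<Rightarrow>\<^sub>L 'h) star_algebra" where
  "convergent_matrix_alg P = (bounded_prod (\<lambda>n. corner_alg (P n)))
     \<lparr> elems := {X \<in> elems (bounded_prod (\<lambda>n. corner_alg (P n))). \<exists>T. star_strong_limit X T} \<rparr>"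

definition limit_map :: "(nat \<Rightarrow> 'h::chilbert_space \<Rightarrow>\<^sub>L 'h) \<Rightarrow> ('h \<Rightarrow>\<^sub>L 'h)" where
  "limit_map X = (THE T. star_strong_limit X T)"

lemma limit_map_eq:
  assumes "star_strong_limit X T"
  shows "limit_map X = T"
  unfolding limit_map_def
proof (rule the_equality, rule assms)
  fix S assume "star_strong_limit X S"
  with assms show "S = T"
    unfolding star_strong_limit_def by (intro blinfun_eqI) (blast intro: LIMSEQ_unique)
qed

definition lifts :: "(nat \<Rightarrow> 'h::chilbert_space \<Rightarrow>\<^sub>L 'h) \<Rightarrow> ('a::cstar_algebra \<Rightarrow> 'h \<Rightarrow>\<^sub>L 'h) \<Rightarrow> bool" where
  "lifts P f \<longleftrightarrow> (\<exists>\<phi>. discrete_asymptotic_hom (convergent_matrix_alg P) \<phi> \<and>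
     (\<forall>n a. limit_map (\<phi> n a) = f a))"

definition asymptotically_lifts ::
    "(nat \<Rightarrow> 'h::chilbert_space \<Rightarrow>\<^sub>L 'h) \<Rightarrow> ('a::cstar_algebra \<Rightarrow> 'h \<Rightarrow>\<^sub>L 'h) \<Rightarrow> bool" where
  "asymptotically_lifts P f \<longleftrightarrow> (\<exists>\<phi>. discrete_asymptotic_hom (convergent_matrix_alg P) \<phi> \<and>
     (\<forall>a. (\<lambda>n. norm (limit_map (\<phi> n a) - f a)) \<longlonglongrightarrow> 0))"

end

theory Submission
  imports Defs
begin

text \<open>
  The theorem rests on a description of MF algebras by operators on the given Hilbert space.  An
  orthonormal basis \<open>e\<close> adapted to the filtration makes \<open>P n\<close> the projection onto the span of the
  first \<open>n\<close> basis vectors, and matrix entries identify \<open>n \<times> n\<close> matrices with the corner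
  \<open>P n B(H) P n\<close>.  Choosing representatives of cosets then turns an embedding of \<open>A\<close> into a
  quotient of matrix products into a sequence of maps \<open>\<psi> n\<close> from \<open>A\<close> into corners that is an
  asymptotic homomorphism and is faithful: \<open>\<psi> n a\<close> tends to \<open>0\<close> only for \<open>a = 0\<close>
  (\<open>MF_iff_faithful_asymptotic_rep\<close>).

  Let \<open>A\<close> be MF and let \<open>f\<close> be any representation on \<open>H\<close>.  Faithfulness makes \<open>\<psi>\<close> detect the
  order: if \<open>x\<close> is self-adjoint and asymptotically \<open>\<psi> n x \<le> \<delta>\<close>, then \<open>f x \<le> \<delta>\<close>, because otherwise
  \<open>\<psi>\<close> would asymptotically annihilate the nonzero part of \<open>x\<close> above \<open>\<delta>\<close> (\<open>truncation\<close>,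
  \<open>upper_bound_transfer\<close>).  The vector states of block sums of maps \<open>\<psi> n\<close> form convex sets, so
  separation by a hyperplane shows that every vector state of \<open>f\<close> is a limit of vector states of such
  block sums (\<open>vector_state_approx\<close>).  This handles a cyclic vector and therefore its cyclic subspace.
  As orthogonal invariant subspaces correspond to block sums, all coefficients of \<open>f\<close> on finitely many
  vectors are limits of coefficients of block sums (\<open>realized_basis\<close>).  Unitaries made of
  Householder reflections move the approximating vectors to basis vectors (\<open>align_orthonormal\<close>), and a
  diagonal choice produces an asymptotic representation that converges weakly to \<open>f\<close>; since it converges
  on \<open>a^* a\<close> as well, it converges *-strongly (\<open>strong_approximants\<close>).  Spread over the matrix sizes, it
  gives one sequence \<open>X a\<close> in \<open>\<D>\<close> with limit \<open>f a\<close>.  The lift is obtained by replacing the first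
  \<open>n\<close> entries of \<open>X a\<close> by \<open>0\<close>: the limit stays \<open>f a\<close>, and the defects are now suprema over the tail
  \<open>m \<ge> n\<close>, which tend to \<open>0\<close> (\<open>lifts_proj\<close>).

  Conversely, let \<open>\<phi>\<close> be an asymptotic lift of an embedding \<open>f\<close>.  A sufficiently late entry of
  \<open>\<phi> n a\<close> almost has the norm of the limit of \<open>\<phi> n a\<close>, which is close to \<open>f a\<close>.  Choosing such an entry
  for each \<open>n\<close>, late enough for the first \<open>n\<close> elements of a dense sequence, yields a faithful sequence
  of maps into corners (\<open>diagonal_rep\<close>).

  An embedding into \<open>B(H)\<close> exists because a separable C*-algebra has a faithful positive
  functional, whose representation can be realized on \<open>H\<close> (\<open>gelfand_naimark_separable\<close>).
\<close>

section \<open>C*-algebras and their unitization\<close>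

class unital_cstar = cstar_algebra + real_normed_algebra_1

lemma cstar_zero [simp]: "cstar (0::'a::cstar_algebra) = 0"
  using cstar_add[of "0::'a" 0] by simp

lemma cstar_minus [simp]: "cstar (- x) = - cstar (x::'a::cstar_algebra)"
  using cstar_add[of x "- x"] by (simp add: add_eq_0_iff)

lemma cstar_diff: "cstar (x - y) = cstar x - cstar (y::'a::cstar_algebra)"
  using cstar_add[of x "- y"] by simp

lemma cstar_scaleR: "cstar (r *\<^sub>R x) = r *\<^sub>R cstar (x::'a::cstar_algebra)"
  by (simp add: scaleR_scaleC cstar_scaleC)

lemma norm_cstar [simp]: "norm (cstar x) = norm (x::'a::cstar_algebra)"
proof -
  have le: "norm y \<le> norm (cstar y)" for y :: 'a
  proof (cases "y = 0")
    case False
    have "norm y * norm y \<le> norm (cstar y) * norm y"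
      using norm_mult_ineq[of "cstar y" y] by (simp add: cstar_identity power2_eq_square)
    then show ?thesis using False by simp
  qed simp
  show ?thesis using le[of x] le[of "cstar x"] by (simp add: cstar_cstar)
qed

lemma bounded_linear_cstar: "bounded_linear (cstar :: 'a::cstar_algebra \<Rightarrow> 'a)"
  by (rule bounded_linear_intro[of _ 1]) (simp_all add: cstar_add cstar_scaleR)

lemma cstar_one [simp]: "cstar (1::'a::unital_cstar) = 1"
  by (metis cstar_cstar cstar_mult mult_1_right mult_1_left)

datatype 'a unitized = Unitized (base: 'a) (scal: complex)

lemma unitized_eqI: "base u = base v \<Longrightarrow> scal u = scal v \<Longrightarrow> u = v"
  by (rule unitized.expand) simp

instantiation unitized :: (cstar_algebra) complex_vector
begin
definition "zero_unitized = Unitized (0::'a) 0"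
definition "plus_unitized u v = Unitized (base u + base v :: 'a) (scal u + scal v)"
definition "minus_unitized u v = Unitized (base u - base v :: 'a) (scal u - scal v)"
definition "uminus_unitized u = Unitized (- base u :: 'a) (- scal u)"
definition "scaleR_unitized r u = Unitized (r *\<^sub>R base u :: 'a) (r *\<^sub>R scal u)"
definition "scaleC_unitized c u = Unitized (c *\<^sub>C base u :: 'a) (c * scal u)"
instance
  by standard
    (auto simp: zero_unitized_def plus_unitized_def minus_unitized_def uminus_unitized_def
      scaleR_unitized_def scaleC_unitized_def algebra_simps scaleR_scaleC scaleC_scaleC
      scaleC_add_left scaleC_add_right scaleC_one scaleR_conv_of_real intro: unitized_eqI)
end

lemma base_simps [simp]:
  "base 0 = 0" "base (u + v) = base u + base v" "base (u - v) = base u - base v"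
  "base (- u) = - base u" "base (r *\<^sub>R u) = r *\<^sub>R base u" "base (c *\<^sub>C u) = c *\<^sub>C base u"
  by (simp_all add: zero_unitized_def plus_unitized_def minus_unitized_def uminus_unitized_def
      scaleR_unitized_def scaleC_unitized_def)

lemma scal_simps [simp]:
  "scal 0 = 0" "scal (u + v) = scal u + scal v" "scal (u - v) = scal u - scal v"
  "scal (- u) = - scal u" "scal (r *\<^sub>R u) = r *\<^sub>R scal u" "scal (c *\<^sub>C u) = c * scal u"
  by (simp_all add: zero_unitized_def plus_unitized_def minus_unitized_def uminus_unitized_def
      scaleR_unitized_def scaleC_unitized_def)

text \<open>
  The operator norm of this action satisfies the C*-identity.  It is only a seminorm: if \<open>A\<close> has a
  unit \<open>p\<close>, then \<open>1 - emb p\<close> acts as \<open>0\<close>.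
\<close>

definition left_mult :: "'a::cstar_algebra unitized \<Rightarrow> 'a \<Rightarrow> 'a" where
  "left_mult u y = base u * y + scal u *\<^sub>C y"

lemma scaleC_scaleR: "c *\<^sub>C (r *\<^sub>R x) = r *\<^sub>R (c *\<^sub>C (x::'a::complex_vector))"
  by (simp add: scaleR_scaleC scaleC_scaleC mult.commute)

lemma bounded_linear_left_mult: "bounded_linear (left_mult u)"
proof (rule bounded_linear_intro[of _ "norm (base u) + cmod (scal u)"])
  show "norm (left_mult u x) \<le> norm x * (norm (base u) + cmod (scal u))" for x
    using norm_triangle_ineq[of "base u * x" "scal u *\<^sub>C x"] norm_mult_ineq[of "base u" x]
    by (simp add: left_mult_def norm_scaleC algebra_simps)
qed (simp_all add: left_mult_def algebra_simps scaleC_add_right scaleC_scaleR)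

lemma norm_left_mult: "norm (left_mult u y) \<le> onorm (left_mult u) * norm y"
  by (rule onorm[OF bounded_linear_left_mult])

lemma onorm_left_mult_pos: "0 \<le> onorm (left_mult u)"
  by (rule onorm_pos_le[OF bounded_linear_left_mult])

lemma onorm_left_mult_add: "onorm (left_mult (u + v)) \<le> onorm (left_mult u) + onorm (left_mult v)"
proof -
  have "left_mult (u + v) = (\<lambda>x. left_mult u x + left_mult v x)"
    by (auto simp: left_mult_def algebra_simps scaleC_add_left)
  then show ?thesis
    using onorm_triangle[OF bounded_linear_left_mult bounded_linear_left_mult, of u v] by simp
qed

lemma onorm_left_mult_scaleC: "onorm (left_mult (c *\<^sub>C u)) = cmod c * onorm (left_mult u)"
proof -
  have le: "onorm (left_mult (c *\<^sub>C u)) \<le> cmod c * onorm (left_mult u)" for c and u :: "'a unitized"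
  proof (rule onorm_bound)
    show "norm (left_mult (c *\<^sub>C u) x) \<le> cmod c * onorm (left_mult u) * norm x" for x
    proof -
      have "left_mult (c *\<^sub>C u) x = c *\<^sub>C left_mult u x"
        by (simp add: left_mult_def mult_scaleC_left scaleC_add_right scaleC_scaleC)
      then show ?thesis using mult_left_mono[OF norm_left_mult[of u x], of "cmod c"]
        by (simp add: norm_scaleC mult.assoc)
    qed
  qed (simp add: onorm_left_mult_pos)
  show ?thesis
  proof (cases "c = 0")
    case True then show ?thesis
      using le[of 0 u] onorm_left_mult_pos[of "0 *\<^sub>C u"] by simp
  next
    case False
    have "onorm (left_mult u) \<le> cmod (inverse c) * onorm (left_mult (c *\<^sub>C u))"
      using le[of "inverse c" "c *\<^sub>C u"] False by (simp add: scaleC_scaleC scaleC_one)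
    then have "cmod c * onorm (left_mult u) \<le> onorm (left_mult (c *\<^sub>C u))"
      using False by (simp add: norm_inverse norm_divide field_simps)
    with le[of c u] show ?thesis by simp
  qed
qed

text \<open>
  Testing \<open>left_mult u\<close> on the adjoint of the \<open>A\<close>-part shows that the norm of the unitization
  dominates that of \<open>A\<close>, which gives completeness.
\<close>

lemma onorm_left_mult_base: "norm (base u) \<le> onorm (left_mult u) + cmod (scal u)"
proof (cases "base u = 0")
  case True then show ?thesis using onorm_left_mult_pos[of u] by simp
next
  case False
  let ?y = "cstar (base u)"
  have "norm (base u) * norm (base u) = norm (base u * ?y)"
    using cstar_identity[of ?y] by (simp add: cstar_cstar power2_eq_square)
  also have "\<dots> = norm (left_mult u ?y - scal u *\<^sub>C ?y)" by (simp add: left_mult_def)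
  also have "\<dots> \<le> norm (left_mult u ?y) + norm (scal u *\<^sub>C ?y)" by (rule norm_triangle_ineq4)
  also have "\<dots> \<le> (onorm (left_mult u) + cmod (scal u)) * norm (base u)"
    using norm_left_mult[of u ?y] by (simp add: norm_scaleC distrib_right)
  finally show ?thesis using False by simp
qed

instantiation unitized :: (cstar_algebra) complex_normed_vector
begin
text \<open>
  The maximum with the scalar part removes the kernel of the operator seminorm when \<open>A\<close> has a unit
  or is zero, and it is a C*-norm in all cases.
\<close>
definition norm_unitized :: "'a unitized \<Rightarrow> real" where
  "norm_unitized u = max (onorm (left_mult u)) (cmod (scal u))"
definition "sgn_unitized u = inverse (norm u) *\<^sub>R (u::'a unitized)"
definition "dist_unitized u v = norm (u - v :: 'a unitized)"
definition uniformity_unitized :: "('a unitized \<times> 'a unitized) filter" where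
  "uniformity_unitized = (INF e\<in>{0<..}. principal {(x, y). dist x y < e})"
definition open_unitized :: "'a unitized set \<Rightarrow> bool" where
  "open_unitized U \<longleftrightarrow> (\<forall>x\<in>U. eventually (\<lambda>(x', y). x' = x \<longrightarrow> y \<in> U) uniformity)"
instance
proof
  fix u v :: "'a unitized" and r :: real and c :: complex
  show "norm u = 0 \<longleftrightarrow> u = 0"
  proof
    assume "norm u = 0"
    then have "scal u = 0" "onorm (left_mult u) = 0"
      using onorm_left_mult_pos[of u] norm_ge_zero[of "scal u"]
      by (auto simp: norm_unitized_def max_def split: if_splits)
    then show "u = 0" using onorm_left_mult_base[of u] by (intro unitized_eqI) auto
  next
    assume "u = 0"
    moreover have "left_mult (0::'a unitized) = (\<lambda>x. 0)" by (auto simp: left_mult_def)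
    ultimately show "norm u = 0" by (simp add: norm_unitized_def onorm_zero)
  qed
  show "norm (u + v) \<le> norm u + norm v"
    using onorm_left_mult_add[of u v] norm_triangle_ineq[of "scal u" "scal v"]
    unfolding norm_unitized_def scal_simps by linarith
  show C: "norm (c *\<^sub>C u) = cmod c * norm u" for c
    by (simp add: norm_unitized_def onorm_left_mult_scaleC norm_mult max_mult_distrib_left)
  show "norm (r *\<^sub>R u) = \<bar>r\<bar> * norm u"
    using C[of "complex_of_real r"] by (simp add: scaleR_scaleC)
qed (simp_all add: sgn_unitized_def dist_unitized_def uniformity_unitized_def open_unitized_def)
end

lemma norm_scal_le: "cmod (scal u) \<le> norm u"
  and onorm_left_mult_le: "onorm (left_mult u) \<le> norm u"
  by (simp_all add: norm_unitized_def)

lemma norm_base_le: "norm (base u) \<le> 2 * norm u"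
  using onorm_left_mult_base[of u] norm_scal_le[of u] onorm_left_mult_le[of u] by linarith

lemma norm_unitized_le: "norm u \<le> norm (base u) + cmod (scal u)"
proof -
  have "onorm (left_mult u) \<le> norm (base u) + cmod (scal u)"
  proof (rule onorm_bound)
    show "norm (left_mult u x) \<le> (norm (base u) + cmod (scal u)) * norm x" for x
      using norm_triangle_ineq[of "base u * x" "scal u *\<^sub>C x"] norm_mult_ineq[of "base u" x]
      by (simp add: left_mult_def norm_scaleC algebra_simps)
  qed simp
  then show ?thesis by (simp add: norm_unitized_def)
qed

instance unitized :: (cstar_algebra) banach
proof
  fix X :: "nat \<Rightarrow> 'a unitized" assume X: "Cauchy X"
  have "Cauchy (\<lambda>n. base (X n))"
    using bounded_linear.Cauchy[OF bounded_linear_intro[of base 2] X] norm_base_le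
    by (auto simp: mult.commute)
  moreover have "Cauchy (\<lambda>n. scal (X n))"
    using bounded_linear.Cauchy[OF bounded_linear_intro[of scal 1] X] norm_scal_le by auto
  ultimately obtain b s where bs: "(\<lambda>n. base (X n)) \<longlonglongrightarrow> b" "(\<lambda>n. scal (X n)) \<longlonglongrightarrow> s"
    by (auto simp: Cauchy_convergent_iff convergent_def)
  have "(\<lambda>n. norm (base (X n) - b) + cmod (scal (X n) - s)) \<longlonglongrightarrow> 0 + 0"
    using bs by (intro tendsto_add) (simp_all add: LIM_zero tendsto_norm_zero)
  then have lim: "(\<lambda>n. norm (base (X n) - b) + cmod (scal (X n) - s)) \<longlonglongrightarrow> 0" by simp
  have "norm (X n - Unitized b s) \<le> norm (base (X n) - b) + cmod (scal (X n) - s)" for n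
    using norm_unitized_le[of "X n - Unitized b s"] by simp
  then have "(\<lambda>n. norm (X n - Unitized b s)) \<longlonglongrightarrow> 0"
    by (intro tendsto_sandwich[OF _ _ tendsto_const lim]) simp_all
  then have "X \<longlonglongrightarrow> Unitized b s" by (simp add: tendsto_norm_zero_iff LIM_zero_iff)
  then show "convergent X" by (auto simp: convergent_def)
qed

instantiation unitized :: (cstar_algebra) unital_cstar
begin
definition "one_unitized = Unitized (0::'a) 1"
definition "times_unitized u v =
  Unitized (base u * base v + scal u *\<^sub>C base v + scal v *\<^sub>C base u :: 'a) (scal u * scal v)"
definition "cstar_unitized u = Unitized (cstar (base u) :: 'a) (cnj (scal u))"
instance
proof
  fix u v w :: "'a unitized" and r :: real and c :: complex
  show "u * v * w = u * (v * w)"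
    by (rule unitized_eqI) (simp_all add: times_unitized_def algebra_simps scaleC_add_right
        scaleC_scaleC mult_scaleC_left mult_scaleC_right)
  show "(u + v) * w = u * w + v * w" "u * (v + w) = u * v + u * w"
    by (rule unitized_eqI; simp add: times_unitized_def algebra_simps scaleC_add_left scaleC_add_right)+
  show C: "c *\<^sub>C u * v = c *\<^sub>C (u * v)" "u * c *\<^sub>C v = c *\<^sub>C (u * v)" for c
    by (rule unitized_eqI; simp add: times_unitized_def algebra_simps scaleC_add_right
        scaleC_scaleC mult_scaleC_left mult_scaleC_right)+
  show "r *\<^sub>R u * v = r *\<^sub>R (u * v)" "u * r *\<^sub>R v = r *\<^sub>R (u * v)"
    by (simp_all add: scaleR_scaleC C)
  show "1 * u = u" "u * 1 = u"
    by (rule unitized_eqI; simp add: one_unitized_def times_unitized_def scaleC_one)+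
  show "(0::'a unitized) \<noteq> 1" by (simp add: one_unitized_def zero_unitized_def)
  show "cstar (u + v) = cstar u + cstar v" "cstar (c *\<^sub>C u) = cnj c *\<^sub>C cstar u"
    "cstar (u * v) = cstar v * cstar u" "cstar (cstar u) = u"
    by (rule unitized_eqI; simp add: cstar_unitized_def times_unitized_def cstar_add cstar_scaleC
        cstar_mult cstar_cstar algebra_simps)+
  have lm: "left_mult (u * v) y = left_mult u (left_mult v y)" for u v :: "'a unitized" and y
    by (simp add: times_unitized_def left_mult_def algebra_simps scaleC_add_right
        scaleC_scaleC mult_scaleC_left mult_scaleC_right)
  have sub: "onorm (left_mult (u * v)) \<le> onorm (left_mult u) * onorm (left_mult v)" for u v :: "'a unitized"
    using onorm_compose[OF bounded_linear_left_mult bounded_linear_left_mult, of u v]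
    by (simp add: comp_def lm[symmetric])
  have "onorm (left_mult (u * v)) \<le> norm u * norm v"
    by (rule order_trans[OF sub mult_mono[OF onorm_left_mult_le onorm_left_mult_le]])
      (simp_all add: onorm_left_mult_pos)
  moreover have "cmod (scal (u * v)) \<le> norm u * norm v"
    using mult_mono[OF norm_scal_le[of u] norm_scal_le[of v]] by (simp add: times_unitized_def norm_mult)
  ultimately show "norm (u * v) \<le> norm u * norm v" by (simp add: norm_unitized_def[of "u * v"])
  have sq: "(onorm (left_mult u))\<^sup>2 \<le> onorm (left_mult (cstar u * u))" for u :: "'a unitized"
  proof -
    have "onorm (left_mult u) \<le> sqrt (onorm (left_mult (cstar u * u)))"
    proof (rule onorm_bound)
      fix y
      have "cstar (left_mult u y) * left_mult u y = cstar y * left_mult (cstar u * u) y"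
        by (simp add: lm) (simp add: left_mult_def cstar_unitized_def cstar_add cstar_mult cstar_scaleC
            algebra_simps mult_scaleC_left mult_scaleC_right scaleC_add_right)
      then have "(norm (left_mult u y))\<^sup>2 = norm (cstar y * left_mult (cstar u * u) y)"
        by (metis cstar_identity)
      also have "\<dots> \<le> norm y * (onorm (left_mult (cstar u * u)) * norm y)"
        using norm_mult_ineq[of "cstar y" "left_mult (cstar u * u) y"]
          mult_left_mono[OF norm_left_mult[of "cstar u * u" y], of "norm y"] by simp
      also have "\<dots> = (sqrt (onorm (left_mult (cstar u * u))) * norm y)\<^sup>2"
        by (simp add: power_mult_distrib onorm_left_mult_pos power2_eq_square)
      finally show "norm (left_mult u y) \<le> sqrt (onorm (left_mult (cstar u * u))) * norm y"
        by (rule power2_le_imp_le) (simp add: onorm_left_mult_pos)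
    qed (simp add: onorm_left_mult_pos)
    then have "(onorm (left_mult u))\<^sup>2 \<le> (sqrt (onorm (left_mult (cstar u * u))))\<^sup>2"
      by (rule power_mono) (rule onorm_left_mult_pos)
    then show ?thesis by (simp add: onorm_left_mult_pos)
  qed
  have le: "onorm (left_mult u) \<le> onorm (left_mult (cstar u))" for u :: "'a unitized"
  proof (cases "onorm (left_mult u) = 0")
    case False
    then show ?thesis using order_trans[OF sq[of u] sub[of "cstar u" u]] onorm_left_mult_pos[of u]
      by (simp add: power2_eq_square)
  qed (simp add: onorm_left_mult_pos)
  have "onorm (left_mult (cstar u)) = onorm (left_mult u)"
    using le[of u] le[of "cstar u"] by (simp add: cstar_unitized_def cstar_cstar)
  then have "onorm (left_mult (cstar u * u)) = (onorm (left_mult u))\<^sup>2"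
    using sq[of u] sub[of "cstar u" u] by (simp add: power2_eq_square)
  moreover have "cmod (scal (cstar u * u)) = (cmod (scal u))\<^sup>2"
    by (simp add: times_unitized_def cstar_unitized_def norm_mult power2_eq_square)
  moreover have "max (x\<^sup>2) (y\<^sup>2) = (max x y)\<^sup>2" if "0 \<le> x" "0 \<le> y" for x y :: real
    using that by (simp add: max_def power2_le_iff_abs_le)
  ultimately show "norm (cstar u * u) = (norm u)\<^sup>2"
    by (simp add: norm_unitized_def onorm_left_mult_pos)
  have "left_mult (1::'a unitized) = (\<lambda>x. x)"
    by (auto simp: left_mult_def one_unitized_def scaleC_one)
  moreover have "onorm (\<lambda>x::'a. x) \<le> 1" by (rule onorm_bound) auto
  ultimately show "norm (1::'a unitized) = 1" by (simp add: norm_unitized_def one_unitized_def)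
qed
end

definition emb :: "'a::cstar_algebra \<Rightarrow> 'a unitized" where
  "emb a = Unitized a 0"

lemma base_emb [simp]: "base (emb a) = a" and scal_emb [simp]: "scal (emb a) = 0"
  by (simp_all add: emb_def)

lemma unitized_mult_one_cstar [simp]: "scal (u * v) = scal u * scal v" "scal 1 = 1" "scal (cstar u) = cnj (scal u)"
  "base 1 = 0" "base (cstar u) = cstar (base u)"
  by (simp_all add: times_unitized_def one_unitized_def cstar_unitized_def)

lemma base_mult: "base (u * v) = base u * base v + scal u *\<^sub>C base v + scal v *\<^sub>C base u"
  by (simp add: times_unitized_def)

lemma emb_add: "emb (a + b) = emb a + emb b"
  and emb_diff: "emb (a - b) = emb a - emb b"
  and emb_mult: "emb (a * b) = emb a * emb b"
  and emb_cstar: "emb (cstar a) = cstar (emb a)"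
  and emb_scaleC: "emb (c *\<^sub>C a) = c *\<^sub>C emb a"
  and emb_scaleR: "emb (r *\<^sub>R a) = r *\<^sub>R emb a"
  and emb_zero [simp]: "emb 0 = 0"
  by (auto intro!: unitized_eqI simp: base_mult)

lemma emb_inject [simp]: "emb a = emb b \<longleftrightarrow> a = b"
  by (simp add: emb_def)

lemma emb_base: "scal u = 0 \<Longrightarrow> emb (base u) = u"
  by (rule unitized_eqI) auto

lemma norm_emb [simp]: "norm (emb a) = norm a"
  using onorm_left_mult_base[of "emb a"] norm_unitized_le[of "emb a"] onorm_left_mult_le[of "emb a"]
  by simp

section \<open>Square roots and positive elements\<close>

text \<open>
  The coefficients of the binomial series of \<open>sqrt (1 - t)\<close>.
\<close>

definition sqrt_coeff :: "nat \<Rightarrow> real" where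
  "sqrt_coeff k = ((1/2) gchoose k) * (-1) ^ k"

lemma sqrt_coeff_0 [simp]: "sqrt_coeff 0 = 1"
  by (simp add: sqrt_coeff_def)

lemma sqrt_coeff_nonpos:
  assumes "k \<ge> 1" shows "sqrt_coeff k \<le> 0"
proof -
  obtain j where k: "k = Suc j" using assms by (cases k) auto
  have "sqrt_coeff k = pochhammer (- (1/2)) k / fact k"
    by (simp add: sqrt_coeff_def gbinomial_pochhammer power_mult_distrib[symmetric] mult.commute)
  also have "pochhammer (- (1/2)) k = - (1/2) * pochhammer (1/2::real) j"
    by (simp add: k pochhammer_rec)
  finally have eq: "sqrt_coeff k = - (1/2) * pochhammer (1/2::real) j / fact k" .
  have "pochhammer (1/2::real) j > 0" by (rule pochhammer_pos) simp
  then show ?thesis by (simp add: eq)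
qed

lemma sqrt_coeff_sums:
  assumes "\<bar>t\<bar> < 1" shows "(\<lambda>k. sqrt_coeff k * t ^ k) sums sqrt (1 - t)"
proof -
  have "(\<lambda>n. ((1/2) gchoose n) * (- t) ^ n) sums (1 + - t) powr (1/2)"
    by (rule gen_binomial_real) (use assms in simp)
  moreover have "(- t) ^ n = (-1) ^ n * t ^ n" for n using power_mult_distrib[of "-1" t n] by simp
  ultimately show ?thesis using assms by (simp add: sqrt_coeff_def powr_half_sqrt mult.assoc)
qed

text \<open>
  All terms have the same sign, so for \<open>t < 1\<close> the partial sums of the power series are at most
  \<open>1 - sqrt (1 - t)\<close>, and \<open>t\<close> can tend to \<open>1\<close>.  This gives absolute convergence on the closed
  unit ball, which is what replaces the continuous functional calculus below.
\<close>

lemma sum_sqrt_coeff_le: "(\<Sum>k\<in>{1..n}. - sqrt_coeff k) \<le> 1"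
proof -
  have le: "(\<Sum>k\<in>{1..n}. - sqrt_coeff k * t ^ k) \<le> 1" if t: "0 < t" "t < 1" for t :: real
  proof -
    have sm: "(\<lambda>k. sqrt_coeff k * t ^ k) sums sqrt (1 - t)"
      by (rule sqrt_coeff_sums) (use t in simp)
    then have "(\<lambda>k. - (sqrt_coeff (k + 1) * t ^ (k + 1))) sums - (sqrt (1 - t) - 1)"
      by (intro sums_minus) (use sums_iff_shift[of "\<lambda>k. sqrt_coeff k * t ^ k" 1] in simp)
    then have s: "summable (\<lambda>k. - (sqrt_coeff (k + 1) * t ^ (k + 1)))"
      "(\<Sum>k. - (sqrt_coeff (k + 1) * t ^ (k + 1))) = - (sqrt (1 - t) - 1)"
      by (auto dest: sums_summable sums_unique[symmetric])
    have nn: "0 \<le> - (sqrt_coeff (k + 1) * t ^ (k + 1))" for k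
      using sqrt_coeff_nonpos[of "k + 1"] t by (simp add: mult_nonpos_nonneg)
    have "(\<Sum>k<n. - (sqrt_coeff (k + 1) * t ^ (k + 1))) \<le> 1"
      using sum_le_suminf[OF s(1) finite_lessThan, of n] nn t unfolding s(2)
      by (simp add: order_trans[of _ "1 - sqrt (1 - t)" 1])
    moreover have "(\<Sum>k\<in>{1..n}. - sqrt_coeff k * t ^ k) = (\<Sum>k<n. - (sqrt_coeff (k + 1) * t ^ (k + 1)))"
      by (rule sum.reindex_bij_witness[of _ Suc "\<lambda>k. k - 1"]) auto
    ultimately show ?thesis by simp
  qed
  have "((\<lambda>t. \<Sum>k\<in>{1..n}. - sqrt_coeff k * t ^ k) \<longlongrightarrow> (\<Sum>k\<in>{1..n}. - sqrt_coeff k * 1 ^ k)) (at_left (1::real))"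
    by (intro tendsto_intros)
  moreover have "\<forall>\<^sub>F t in at_left (1::real). (\<Sum>k\<in>{1..n}. - sqrt_coeff k * t ^ k) \<le> 1"
    by (rule eventually_at_leftI[of 0]) (use le in \<open>simp_all only: greaterThanLessThan_iff zero_less_one\<close>)
  ultimately have "(\<Sum>k\<in>{1..n}. - sqrt_coeff k * 1 ^ k) \<le> 1"
    by (rule tendsto_upperbound) simp
  then show ?thesis by simp
qed

lemma abs_sqrt_coeff: "\<bar>sqrt_coeff (Suc k)\<bar> = - sqrt_coeff (Suc k)"
  using sqrt_coeff_nonpos[of "Suc k"] by simp

lemma sum_abs_sqrt_coeff: "(\<Sum>k<n. \<bar>sqrt_coeff (Suc k)\<bar>) \<le> 1"
proof -
  have "(\<Sum>k<n. \<bar>sqrt_coeff (Suc k)\<bar>) = (\<Sum>k\<in>{1..n}. - sqrt_coeff k)"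
    by (simp only: abs_sqrt_coeff) (rule sum.reindex_bij_witness[of _ "\<lambda>k. k - 1" Suc]; auto)
  then show ?thesis using sum_sqrt_coeff_le[of n] by simp
qed

lemma summable_abs_sqrt_coeff_Suc: "summable (\<lambda>k. \<bar>sqrt_coeff (Suc k)\<bar>)"
  by (rule bounded_imp_summable[of _ 1]) (use sum_abs_sqrt_coeff[of "Suc _"] in \<open>auto simp: lessThan_Suc_atMost\<close>)

lemma summable_abs_sqrt_coeff: "summable (\<lambda>k. \<bar>sqrt_coeff k\<bar>)"
  using summable_abs_sqrt_coeff_Suc by (simp add: summable_Suc_iff[of "\<lambda>k. \<bar>sqrt_coeff k\<bar>"])

text \<open>
  Vandermonde's identity for the exponents \<open>1/2 + 1/2 = 1\<close>; it says that the series squares to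
  \<open>1 - t\<close>.
\<close>

lemma sqrt_coeff_convolution:
  "(\<Sum>i\<le>n. sqrt_coeff i * sqrt_coeff (n - i)) = (if n = 0 then 1 else if n = 1 then -1 else 0)"
proof -
  have "(\<Sum>i\<le>n. sqrt_coeff i * sqrt_coeff (n - i))
      = (\<Sum>i\<le>n. ((1/2) gchoose i) * ((1/2) gchoose (n - i)) * (-1) ^ n)"
  proof (rule sum.cong)
    fix i assume "i \<in> {..n}"
    then have "(-1::real) ^ n = (-1) ^ i * (-1) ^ (n - i)" by (simp add: power_add[symmetric])
    then show "sqrt_coeff i * sqrt_coeff (n - i) = ((1/2) gchoose i) * ((1/2) gchoose (n - i)) * (-1) ^ n"
      by (simp add: sqrt_coeff_def)
  qed simp
  also have "\<dots> = ((1/2 + 1/2) gchoose n) * (-1) ^ n"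
    unfolding sum_distrib_right[symmetric] using gbinomial_Vandermonde[of "1/2::real" "1/2" n]
    by (simp add: atMost_atLeast0)
  also have "(1/2 + 1/2 :: real) = of_nat 1" by simp
  also have "(of_nat 1 gchoose n :: real) = of_nat (1 choose n)" by (simp only: binomial_gbinomial)
  finally show ?thesis by (cases n rule: nat.exhaust) (auto simp: binomial_eq_0)
qed

definition sqrt_one_minus :: "'a::unital_cstar \<Rightarrow> 'a" where
  "sqrt_one_minus y = (\<Sum>k. sqrt_coeff k *\<^sub>R y ^ k)"

context
  fixes y :: "'a::unital_cstar" assumes y: "norm y \<le> 1"
begin

lemma sqrt_one_minus_summable_norm: "summable (\<lambda>k. norm (sqrt_coeff k *\<^sub>R y ^ k))"
proof (rule summable_comparison_test'[OF summable_abs_sqrt_coeff])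
  fix k
  have "norm (y ^ k) \<le> 1" using norm_power_ineq[of y k] power_le_one[OF norm_ge_zero y, of k] by linarith
  then show "norm (norm (sqrt_coeff k *\<^sub>R y ^ k)) \<le> \<bar>sqrt_coeff k\<bar>"
    by (simp add: mult_left_le)
qed

lemma sqrt_one_minus_sums: "(\<lambda>k. sqrt_coeff k *\<^sub>R y ^ k) sums sqrt_one_minus y"
  unfolding sqrt_one_minus_def
  by (rule summable_sums[OF summable_norm_cancel[OF sqrt_one_minus_summable_norm]])

lemma sqrt_one_minus_square: "sqrt_one_minus y * sqrt_one_minus y = 1 - y"
proof -
  have "(\<lambda>n. \<Sum>i\<le>n. (sqrt_coeff i *\<^sub>R y ^ i) * (sqrt_coeff (n - i) *\<^sub>R y ^ (n - i)))
      sums (sqrt_one_minus y * sqrt_one_minus y)"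
    unfolding sqrt_one_minus_def
    by (rule Cauchy_product_sums[OF sqrt_one_minus_summable_norm sqrt_one_minus_summable_norm])
  moreover have "(\<Sum>i\<le>n. (sqrt_coeff i *\<^sub>R y ^ i) * (sqrt_coeff (n - i) *\<^sub>R y ^ (n - i)))
      = (if n = 0 then 1 else if n = 1 then -1 else 0) *\<^sub>R y ^ n" for n
    unfolding sqrt_coeff_convolution[symmetric] scaleR_sum_left
    by (rule sum.cong) (simp_all add: power_add[symmetric])
  moreover have "(\<lambda>n. (if n = 0 then 1 else if n = 1 then -1 else 0) *\<^sub>R y ^ n)
      sums (\<Sum>n\<in>{0,1}. (if n = 0 then 1 else if n = 1 then -1 else 0) *\<^sub>R y ^ n)"
    by (rule sums_finite) auto
  ultimately show ?thesis by (auto dest: sums_unique2)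
qed

lemma sqrt_one_minus_commute:
  assumes "z * y = y * z" shows "z * sqrt_one_minus y = sqrt_one_minus y * z"
proof -
  have p: "z * y ^ k = y ^ k * z" for k
    by (induction k) (simp_all add: mult.assoc, metis assms mult.assoc)
  have "(\<lambda>k. z * (sqrt_coeff k *\<^sub>R y ^ k)) sums (z * sqrt_one_minus y)"
    by (rule sums_mult[OF sqrt_one_minus_sums])
  moreover have "(\<lambda>k. (sqrt_coeff k *\<^sub>R y ^ k) * z) sums (sqrt_one_minus y * z)"
    by (rule sums_mult2[OF sqrt_one_minus_sums])
  ultimately show ?thesis by (simp add: p sums_unique2)
qed

lemma sqrt_one_minus_cstar:
  assumes "cstar y = y" shows "cstar (sqrt_one_minus y) = sqrt_one_minus y"
proof -
  have p: "cstar (y ^ k) = y ^ k" for k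
    by (induction k) (simp_all add: cstar_mult assms power_commutes)
  have "(\<lambda>k. cstar (sqrt_coeff k *\<^sub>R y ^ k)) sums cstar (sqrt_one_minus y)"
    by (rule bounded_linear.sums[OF bounded_linear_cstar sqrt_one_minus_sums])
  then show ?thesis using sqrt_one_minus_sums by (simp add: p cstar_scaleR sums_unique2)
qed

text \<open>
  The coefficients of \<open>1 - sqrt (1 - t)\<close> are nonnegative and sum to at most \<open>1\<close>.  This bound makes
  the square roots themselves satisfy the norm criterion for positivity.
\<close>

lemma norm_one_minus_sqrt_one_minus: "norm (1 - sqrt_one_minus y) \<le> 1"
proof -
  have "(\<lambda>k. - (sqrt_coeff (k + 1) *\<^sub>R y ^ (k + 1))) sums - (sqrt_one_minus y - 1)"
    by (intro sums_minus) (use sqrt_one_minus_sums sums_iff_shift[of "\<lambda>k. sqrt_coeff k *\<^sub>R y ^ k" 1] in simp)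
  then have eq: "1 - sqrt_one_minus y = (\<Sum>k. - (sqrt_coeff (Suc k) *\<^sub>R y ^ Suc k))"
    by (simp add: sums_iff)
  have b: "norm (- (sqrt_coeff (Suc k) *\<^sub>R y ^ Suc k)) \<le> \<bar>sqrt_coeff (Suc k)\<bar>" for k
  proof -
    have "norm (y ^ Suc k) \<le> 1"
      using norm_power_ineq[of y "Suc k"] power_le_one[OF norm_ge_zero y, of "Suc k"] by linarith
    then show ?thesis by (simp add: mult_left_le del: power_Suc)
  qed
  have "norm (1 - sqrt_one_minus y) \<le> (\<Sum>k. \<bar>sqrt_coeff (Suc k)\<bar>)"
    unfolding eq
  proof -
    have "summable (\<lambda>k. norm (- (sqrt_coeff (Suc k) *\<^sub>R y ^ Suc k)))"
      by (rule summable_comparison_test'[OF summable_abs_sqrt_coeff_Suc]) (use b in simp)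
    then show "norm (\<Sum>k. - (sqrt_coeff (Suc k) *\<^sub>R y ^ Suc k)) \<le> (\<Sum>k. \<bar>sqrt_coeff (Suc k)\<bar>)"
      using summable_norm[of "\<lambda>k. - (sqrt_coeff (Suc k) *\<^sub>R y ^ Suc k)"]
        suminf_le[OF b _ summable_abs_sqrt_coeff_Suc] by linarith
  qed
  also have "\<dots> \<le> 1"
    by (rule suminf_le_const[OF summable_abs_sqrt_coeff_Suc sum_abs_sqrt_coeff])
  finally show ?thesis .
qed

end

definition positive :: "'a::unital_cstar \<Rightarrow> bool" where
  "positive x \<longleftrightarrow> (\<exists>h. cstar h = h \<and> x = h * h)"

lemma positive_square: "cstar h = h \<Longrightarrow> positive (h * h)"
  unfolding positive_def by blast

lemma positive_cstar: "positive x \<Longrightarrow> cstar x = x"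
  unfolding positive_def by (auto simp: cstar_mult)

lemma norm_square_sa: "cstar h = h \<Longrightarrow> norm (h * h) = (norm (h::'a::cstar_algebra))\<^sup>2"
  using cstar_identity[of h] by simp

lemma square_sa_eq_0: "cstar h = h \<Longrightarrow> h * h = 0 \<Longrightarrow> h = (0::'a::cstar_algebra)"
  using norm_square_sa[of h] by simp

lemma cstar_imaginary: "cstar (\<i> *\<^sub>C x) = - (\<i> *\<^sub>C cstar (x::'a::cstar_algebra))"
  by (simp add: cstar_scaleC)

text \<open>
  The element \<open>h\<close> is the real part of \<open>h + \<i> k\<close>, to which the C*-identity applies.
\<close>

lemma norm_sum_squares:
  fixes h k :: "'a::unital_cstar"
  assumes h: "cstar h = h" and k: "cstar k = k" and hk: "h * k = k * h"
  shows "(norm h)\<^sup>2 \<le> norm (h * h + k * k)"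
proof -
  define w where "w = h + \<i> *\<^sub>C k"
  have cw: "cstar w = h - \<i> *\<^sub>C k" by (simp add: w_def cstar_add cstar_imaginary h k)
  have "cstar w * w = h * h + k * k"
    unfolding cw by (simp add: w_def algebra_simps mult_scaleC_left mult_scaleC_right scaleC_scaleC hk scaleC_one)
  then have n: "(norm w)\<^sup>2 = norm (h * h + k * k)" by (metis cstar_identity)
  have "w + cstar w = 2 *\<^sub>R h" unfolding cw by (simp add: w_def scaleR_2)
  then have "2 * norm h = norm (w + cstar w)" by simp
  also have "\<dots> \<le> 2 * norm w" using norm_triangle_ineq[of w "cstar w"] by simp
  finally have "norm h \<le> norm w" by simp
  then show ?thesis unfolding n[symmetric] by (rule power_mono) simp
qed

text \<open>
  Here \<open>1 - h^2 = k^2\<close> for a root \<open>k\<close> that commutes with \<open>h\<close>, and \<open>k^2 + h^2 = 1\<close>.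
\<close>

lemma norm_one_minus_square_le:
  fixes h :: "'a::unital_cstar"
  assumes h: "cstar h = h" and n: "norm h \<le> 1"
  shows "norm (1 - h * h) \<le> 1"
proof -
  have y: "norm (h * h) \<le> 1" using n by (simp add: norm_square_sa[OF h] power_le_one)
  define k where "k = sqrt_one_minus (h * h)"
  have k: "cstar k = k" "k * k = 1 - h * h" "h * k = k * h"
    unfolding k_def
    by (simp_all add: sqrt_one_minus_cstar[OF y] sqrt_one_minus_square[OF y] sqrt_one_minus_commute[OF y]
        h cstar_mult mult.assoc)
  have "(norm k)\<^sup>2 \<le> norm (k * k + h * h)" by (rule norm_sum_squares) (simp_all add: k h)
  also have "\<dots> = 1" by (simp add: k)
  finally show ?thesis by (simp add: k(2)[symmetric] norm_square_sa[OF k(1)])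
qed

text \<open>
  Together with \<open>positiveI\<close> this characterizes positivity by a norm inequality, without any spectral
  theory; sums of positive elements are positive because of this criterion.
\<close>

lemma positive_norm_le:
  assumes x: "positive x" and t: "norm x \<le> t"
  shows "norm (t *\<^sub>R 1 - x) \<le> t"
proof (cases "t = 0")
  case True then show ?thesis using t by simp
next
  case False
  then have t0: "t > 0" using t norm_ge_zero[of x] by linarith
  obtain h where h: "cstar h = h" "x = h * h" using x by (auto simp: positive_def)
  let ?g = "(1 / sqrt t) *\<^sub>R h"
  have "(norm h)\<^sup>2 \<le> t" using t by (simp add: h(2) norm_square_sa[OF h(1)])
  then have "norm h \<le> sqrt t" by (rule real_le_rsqrt)
  then have "norm ?g \<le> 1" using t0 by simp
  then have "norm (1 - ?g * ?g) \<le> 1" by (intro norm_one_minus_square_le) (simp_all add: cstar_scaleR h)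
  moreover have "t *\<^sub>R 1 - x = t *\<^sub>R (1 - ?g * ?g)"
    using t0 by (simp add: h(2) scaleR_diff_right)
  ultimately show ?thesis using t0 by (simp add: mult_left_le)
qed

lemma positive_commuting_root:
  fixes x :: "'a::unital_cstar"
  assumes x: "cstar x = x" and t: "norm (t *\<^sub>R 1 - x) \<le> t" "t > 0"
  shows "\<exists>r. cstar r = r \<and> r * r = x \<and> norm (sqrt t *\<^sub>R 1 - r) \<le> sqrt t
    \<and> (\<forall>z. z * x = x * z \<longrightarrow> z * r = r * z)"
proof -
  define y where "y = 1 - (1 / t) *\<^sub>R x"
  have "y = (1 / t) *\<^sub>R (t *\<^sub>R 1 - x)" using t by (simp add: y_def scaleR_diff_right)
  then have y: "norm y \<le> 1" using t by simp
  define r where "r = sqrt t *\<^sub>R sqrt_one_minus y"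
  have "cstar y = y" by (simp add: y_def cstar_diff cstar_scaleR x)
  then have "cstar r = r" by (simp add: r_def cstar_scaleR sqrt_one_minus_cstar[OF y])
  moreover have "r * r = x" using t by (simp add: r_def sqrt_one_minus_square[OF y]) (simp add: y_def)
  moreover have "sqrt t *\<^sub>R 1 - r = sqrt t *\<^sub>R (1 - sqrt_one_minus y)"
    by (simp add: r_def scaleR_diff_right)
  then have "norm (sqrt t *\<^sub>R 1 - r) \<le> sqrt t"
    using norm_one_minus_sqrt_one_minus[OF y] t by (simp add: mult_left_le)
  moreover have "z * r = r * z" if "z * x = x * z" for z
    using sqrt_one_minus_commute[OF y, of z] that by (simp add: r_def y_def algebra_simps)
  ultimately show ?thesis by blast
qed

text \<open>
  After division by \<open>t\<close> the hypothesis says \<open>x = t (1 - y)\<close> with \<open>y\<close> in the unit ball, where the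
  binomial series provides a square root.
\<close>

lemma positiveI:
  fixes x :: "'a::unital_cstar"
  assumes x: "cstar x = x" and t: "norm (t *\<^sub>R 1 - x) \<le> t"
  shows "positive x"
proof (cases "t > 0")
  case True
  then show ?thesis using positive_commuting_root[OF x t] by (auto simp: positive_def)
next
  case False
  then have "t = 0" using t norm_ge_zero[of "t *\<^sub>R 1 - x"] by linarith
  then have "x = 0" using t by simp
  then show ?thesis unfolding positive_def by (intro exI[of _ 0]) simp
qed

lemma positive_sqrt:
  fixes x :: "'a::unital_cstar"
  assumes "positive x"
  obtains r where "positive r" "r * r = x" "\<And>z. z * x = x * z \<Longrightarrow> z * r = r * z"
proof -
  have "norm ((norm x + 1) *\<^sub>R 1 - x) \<le> norm x + 1" by (rule positive_norm_le[OF assms]) simp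
  moreover have "norm x + 1 > 0" by (simp add: add_nonneg_pos)
  ultimately have "\<exists>r. cstar r = r \<and> r * r = x \<and> norm (sqrt (norm x + 1) *\<^sub>R 1 - r) \<le> sqrt (norm x + 1)
      \<and> (\<forall>z. z * x = x * z \<longrightarrow> z * r = r * z)"
    by (rule positive_commuting_root[OF positive_cstar[OF assms]])
  then
  obtain r where r: "cstar r = r" "r * r = x" "norm (sqrt (norm x + 1) *\<^sub>R 1 - r) \<le> sqrt (norm x + 1)"
    "\<forall>z. z * x = x * z \<longrightarrow> z * r = r * z" by blast
  show ?thesis by (rule that[OF positiveI[OF r(1,3)] r(2)]) (use r(4) in blast)
qed

lemma positive_add:
  fixes x y :: "'a::unital_cstar"
  assumes "positive x" "positive y" shows "positive (x + y)"
proof (rule positiveI)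
  show "cstar (x + y) = x + y" using assms by (simp add: cstar_add positive_cstar)
  have "(norm x + norm y) *\<^sub>R 1 - (x + y) = (norm x *\<^sub>R 1 - x) + (norm y *\<^sub>R 1 - y)"
    by (simp add: scaleR_add_left)
  also have "norm \<dots> \<le> norm x + norm y"
    by (rule norm_triangle_mono) (use assms in \<open>auto intro: positive_norm_le\<close>)
  finally show "norm ((norm x + norm y) *\<^sub>R 1 - (x + y)) \<le> norm x + norm y" .
qed

lemma positive_scaleR:
  fixes x :: "'a::unital_cstar"
  assumes "positive x" "0 \<le> r" shows "positive (r *\<^sub>R x)"
proof -
  obtain h where h: "cstar h = h" "x = h * h" using assms(1) by (auto simp: positive_def)
  have "r *\<^sub>R x = (sqrt r *\<^sub>R h) * (sqrt r *\<^sub>R h)" using assms(2) by (simp add: h(2))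
  then show ?thesis using h(1) by (auto simp: positive_def cstar_scaleR intro!: exI[of _ "sqrt r *\<^sub>R h"])
qed

lemma positive_one: "positive (1::'a::unital_cstar)"
  using positive_square[of "1::'a"] by simp

lemma positive_zero: "positive (0::'a::unital_cstar)"
  using positive_square[of "0::'a"] by simp

lemma positive_power:
  fixes x :: "'a::unital_cstar"
  assumes "positive x" shows "positive (x ^ n)"
proof -
  obtain h where h: "cstar h = h" "x = h * h" using assms(1) by (auto simp: positive_def)
  have s: "cstar (h ^ n) = h ^ n" by (induction n) (simp_all add: cstar_mult h power_commutes)
  have "x ^ n = h ^ n * h ^ n"
    using power_add[of h n n] by (simp add: h(2) power2_eq_square[symmetric] power_mult[symmetric] mult_2)
  then show ?thesis using positive_square[OF s] by simp
qed

text \<open>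
  Both \<open>w = h^2\<close> and \<open>t - w = k^2\<close> are squares, with \<open>h\<close> and \<open>k\<close> commuting, so that
  \<open>norm_sum_squares\<close> bounds \<open>h^2\<close> by \<open>h^2 + k^2 = t\<close>.
\<close>

lemma norm_le_of_positive_diff:
  fixes w :: "'a::unital_cstar"
  assumes w: "positive w" and d: "positive (t *\<^sub>R 1 - w)" and t: "0 \<le> t"
  shows "norm w \<le> t"
proof -
  obtain h where h: "cstar h = h" "w = h * h" using w by (auto simp: positive_def)
  obtain k where k: "positive k" "k * k = t *\<^sub>R 1 - w" "\<And>z. z * (t *\<^sub>R 1 - w) = (t *\<^sub>R 1 - w) * z \<Longrightarrow> z * k = k * z"
    using positive_sqrt[OF d] by blast
  have "h * k = k * h" by (rule k(3)) (simp add: h(2) algebra_simps)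
  then have "(norm h)\<^sup>2 \<le> norm (h * h + k * k)"
    using norm_sum_squares h(1) positive_cstar[OF k(1)] by blast
  also have "\<dots> = t" using t by (simp add: k(2) h(2))
  finally show ?thesis by (simp add: h(2) norm_square_sa[OF h(1)])
qed

lemma positive_norm_diff: "positive x \<Longrightarrow> norm x \<le> t \<Longrightarrow> positive (t *\<^sub>R 1 - x)"
proof (rule positiveI[where t = t])
  assume x: "positive x" "norm x \<le> t"
  show "cstar (t *\<^sub>R 1 - x) = t *\<^sub>R 1 - x" by (simp add: cstar_diff cstar_scaleR positive_cstar[OF x(1)])
  show "norm (t *\<^sub>R 1 - (t *\<^sub>R 1 - x)) \<le> t" using x by simp
qed

lemma norm_mono_positive:
  fixes x :: "'a::unital_cstar"
  assumes x: "positive x" and y: "positive y" shows "norm x \<le> norm (x + y)"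
proof (rule norm_le_of_positive_diff[OF x])
  have "positive (norm (x + y) *\<^sub>R 1 - (x + y))" by (rule positive_norm_diff[OF positive_add[OF x y]]) simp
  from positive_add[OF this y] show "positive (norm (x + y) *\<^sub>R 1 - x)" by simp
qed simp

text \<open>
  The two parts are \<open>(\<bar>x\<bar> \<plusminus> x) / 2\<close>, where \<open>\<bar>x\<bar>\<close> is the root of \<open>x^2\<close>.  The root \<open>s\<close> of
  \<open>\<bar>x\<bar> = u + v\<close> is recorded because it turns cubes into squares: \<open>u^3 = u s^2 u = (s u)^* (s u)\<close>.
\<close>

lemma positive_part:
  fixes x :: "'a::unital_cstar"
  assumes x: "cstar x = x"
  obtains u v s where "x = u - v" "u * v = 0" "v * u = 0" "positive s"
    "u + v = s * s" "s * u = u * s" "s * v = v * s" "cstar u = u" "cstar v = v"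
    "u = (1/2) *\<^sub>R (s * s + x)"
    "(s * s) * (s * s) = x * x"
proof -
  obtain r where r: "positive r" "r * r = x * x" "\<And>z. z * (x * x) = (x * x) * z \<Longrightarrow> z * r = r * z"
    using positive_sqrt[OF positive_square[OF x]] by blast
  obtain s where s: "positive s" "s * s = r" "\<And>z. z * r = r * z \<Longrightarrow> z * s = s * z"
    using positive_sqrt[OF r(1)] by blast
  have xr: "x * r = r * x" by (rule r(3)) (simp add: mult.assoc)
  have xs: "x * s = s * x" by (rule s(3)[OF xr])
  have rs: "r * s = s * r" by (simp add: s(2)[symmetric] mult.assoc)
  define u where "u = (1/2) *\<^sub>R (r + x)"
  define v where "v = (1/2) *\<^sub>R (r - x)"
  show ?thesis
  proof (rule that[of u v s])
    have "u - v = (1/2) *\<^sub>R ((r + x) - (r - x))" unfolding u_def v_def by (simp only: scaleR_diff_right)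
    also have "(r + x) - (r - x) = 2 *\<^sub>R x" by (simp add: scaleR_2)
    finally show "x = u - v" by simp
    have "u + v = (1/2) *\<^sub>R ((r + x) + (r - x))" unfolding u_def v_def by (simp only: scaleR_add_right)
    also have "(r + x) + (r - x) = 2 *\<^sub>R r" by (simp add: scaleR_2)
    finally show "u + v = s * s" by (simp add: s(2))
    show "u * v = 0" "v * u = 0" by (simp_all add: u_def v_def algebra_simps xr r(2))
    show "s * u = u * s" "s * v = v * s" by (simp_all add: u_def v_def algebra_simps xs rs)
    show "cstar u = u" "cstar v = v"
      by (simp_all add: u_def v_def cstar_scaleR cstar_add cstar_diff x positive_cstar[OF r(1)])
  qed (simp_all add: s r u_def)
qed

text \<open>
  The remainder \<open>c\<close> collects the terms of degree at least two of the binomial expansion, a polynomial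
  in \<open>w\<close> with nonnegative coefficients.
\<close>

lemma power_one_plus_positive:
  fixes w :: "'a::unital_cstar"
  assumes w: "positive w"
  shows "\<exists>c. (1 + w) ^ m = 1 + real m *\<^sub>R w + c \<and> (\<forall>j. positive (w ^ j * c))"
proof (induction m)
  case 0 then show ?case by (intro exI[of _ 0]) (simp add: positive_zero)
next
  case (Suc m)
  then obtain c where c: "(1 + w) ^ m = 1 + real m *\<^sub>R w + c" "\<forall>j. positive (w ^ j * c)" by blast
  let ?c = "c + w * c + real m *\<^sub>R (w * w)"
  have "(1 + w) ^ Suc m = (1 + w) * (1 + real m *\<^sub>R w + c)" by (simp only: power_Suc c(1))
  also have "\<dots> = 1 + real (Suc m) *\<^sub>R w + ?c"
    by (simp add: distrib_left distrib_right scaleR_add_left scaleR_add_right)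
  finally have "(1 + w) ^ Suc m = 1 + real (Suc m) *\<^sub>R w + ?c" .
  moreover have "positive (w ^ j * ?c)" for j
  proof -
    have "w ^ j * ?c = w ^ j * c + w ^ Suc j * c + real m *\<^sub>R w ^ (j + 2)"
      by (simp only: distrib_left power_Suc2 mult.assoc power_add power2_eq_square mult_scaleR_right)
    moreover have "positive (w ^ j * c + w ^ Suc j * c + real m *\<^sub>R w ^ (j + 2))"
      by (intro positive_add positive_scaleR positive_power w c(2)[rule_format]) simp
    ultimately show ?thesis by (simp only:)
  qed
  ultimately show ?case by blast
qed

text \<open>
  From \<open>d^* (d d^*) = (d^* d) d^*\<close> one gets \<open>d^* (1 - d d^*)^m d = - (1 + w)^m w\<close>.  The left-hand side
  stays bounded as \<open>m\<close> grows, because \<open>1 - d d^*\<close> is a contraction, while the right-hand side grows at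
  least linearly unless \<open>w^2 = 0\<close>.  This replaces the comparison of the spectra of \<open>d d^*\<close> and
  \<open>d^* d\<close>.
\<close>

lemma cstar_mult_self_negative:
  fixes d :: "'a::unital_cstar"
  assumes w: "positive w" and dw: "cstar d * d = - w" and p: "positive (d * cstar d)" and n: "norm d \<le> 1"
  shows "w = 0"
proof -
  let ?p = "d * cstar d"
  have np: "norm ?p \<le> 1"
    using norm_mult_ineq[of d "cstar d"] n by (simp add: mult_le_one order_trans)
  have n1: "norm (1 - ?p) \<le> 1" using positive_norm_le[OF p np] by simp
  have swap: "cstar d * (1 - ?p) ^ m = (1 + w) ^ m * cstar d" for m
  proof (induction m)
    case (Suc m)
    have "cstar d * (1 - ?p) = (1 - cstar d * d) * cstar d" by (simp add: algebra_simps)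
    then have "cstar d * (1 - ?p) = (1 + w) * cstar d" by (simp add: dw)
    then have "cstar d * (1 - ?p) ^ Suc m = (1 + w) * (cstar d * (1 - ?p) ^ m)"
      by (simp add: mult.assoc[symmetric])
    then show ?case by (simp add: Suc mult.assoc)
  qed simp
  have bound: "real m * norm (w * w) \<le> 1" for m
  proof -
    obtain c where c: "(1 + w) ^ m = 1 + real m *\<^sub>R w + c" "\<And>j. positive (w ^ j * c)"
      using power_one_plus_positive[OF w] by blast
    define q where "q = w + w * c"
    have q: "positive q" using c(2)[of 1] unfolding q_def by (intro positive_add w) simp
    have wq: "w * (1 + w) ^ m = real m *\<^sub>R (w * w) + q"
      by (simp add: c(1) q_def distrib_left)
    have "real m * norm (w * w) = norm (real m *\<^sub>R (w * w))" by simp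
    also have "\<dots> \<le> norm (real m *\<^sub>R (w * w) + q)"
      by (intro norm_mono_positive positive_scaleR positive_square positive_cstar[OF w] q) simp
    also have "\<dots> = norm ((1 + w) ^ m * cstar d * d)"
    proof -
      have "(1 + w) ^ m * w = w * (1 + w) ^ m"
        by (rule power_commuting_commutes) (simp add: algebra_simps)
      then show ?thesis by (simp add: wq[symmetric] mult.assoc dw)
    qed
    also have "\<dots> = norm (cstar d * (1 - ?p) ^ m * d)" by (simp add: swap)
    also have "\<dots> \<le> norm (cstar d) * norm ((1 - ?p) ^ m) * norm d"
      by (meson mult_right_mono norm_ge_zero norm_mult_ineq order_trans)
    also have "\<dots> \<le> 1 * 1 * 1"
      using n norm_power_ineq[of "1 - ?p" m] power_le_one[OF norm_ge_zero n1, of m]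
      by (intro mult_mono) auto
    finally show ?thesis by simp
  qed
  have "norm (w * w) = 0"
  proof (rule ccontr)
    assume "norm (w * w) \<noteq> 0"
    then obtain m where "1 < real m * norm (w * w)"
      using reals_Archimedean3[of "norm (w * w)"] by auto
    with bound[of m] show False by simp
  qed
  then show ?thesis using square_sa_eq_0[OF positive_cstar[OF w]] by simp
qed

text \<open>
  Let \<open>v\<close> be the negative part of \<open>b^* b\<close>.  Then \<open>e = b v\<close> satisfies \<open>e^* e = - v^3 \<le> 0\<close>, and
  hence \<open>e e^* = 2 h^2 + 2 k^2 - e^* e \<ge> 0\<close>, where \<open>h\<close> and \<open>k\<close> are the real and imaginary parts of
  \<open>e\<close>.  By the previous lemma, applied to a multiple of \<open>e\<close> in the unit ball, \<open>v^3 = 0\<close>.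
\<close>

lemma positive_cstar_mult_self: "positive (cstar b * (b::'a::unital_cstar))"
proof -
  let ?x = "cstar b * b"
  have x: "cstar ?x = ?x" by (simp add: cstar_mult cstar_cstar)
  obtain u v s where uv: "?x = u - v" "u * v = 0" "v * u = 0" "positive s"
    "u + v = s * s" "s * u = u * s" "s * v = v * s" "cstar u = u" "cstar v = v"
    by (rule positive_part[OF x])
  define e where "e = b * v"
  define w where "w = (s * v) * (s * v)"
  have svs: "cstar (s * v) = s * v" by (simp add: cstar_mult uv positive_cstar)
  have "v * v * v = v * (u + v) * v" by (simp add: algebra_simps uv(2,3))
  also have "\<dots> = v * (s * s) * v" by (simp add: uv(5))
  also have "\<dots> = (v * s) * (s * v)" by (simp add: mult.assoc)
  also have "\<dots> = w" by (simp add: w_def uv(7))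
  finally have vvv: "v * v * v = w" .
  have ew: "cstar e * e = - w"
  proof -
    have "cstar e * e = v * (cstar b * b) * v" by (simp add: e_def cstar_mult uv(9) mult.assoc)
    also have "\<dots> = v * (u - v) * v" by (simp add: uv(1))
    also have "\<dots> = - (v * v * v)" by (simp add: algebra_simps uv(2,3))
    finally show ?thesis by (simp add: vvv)
  qed
  have w: "positive w" unfolding w_def by (rule positive_square[OF svs])
  have p: "positive (e * cstar e)"
  proof -
    define h where "h = (1/2) *\<^sub>R (e + cstar e)"
    define k where "k = (1/2) *\<^sub>R (\<i> *\<^sub>C (cstar e - e))"
    have "cstar h = h" by (simp add: h_def cstar_scaleR cstar_add cstar_cstar add.commute)
    moreover have "cstar k = k"
      by (simp add: k_def cstar_scaleR cstar_imaginary cstar_diff cstar_cstar complex_vector.scale_right_diff_distrib)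
    moreover have "4 *\<^sub>R (h * h) = (e + cstar e) * (e + cstar e)" by (simp add: h_def)
    moreover have "4 *\<^sub>R (k * k) = - ((cstar e - e) * (cstar e - e))"
      by (simp add: k_def mult_scaleC_left mult_scaleC_right scaleC_scaleR scaleC_scaleC scaleC_one)
    moreover have "(e + cstar e) * (e + cstar e) - (cstar e - e) * (cstar e - e)
        = 2 *\<^sub>R (e * cstar e + cstar e * e)"
      by (simp add: algebra_simps scaleR_2)
    ultimately have hk: "cstar h = h" "cstar k = k"
      "4 *\<^sub>R (h * h) + 4 *\<^sub>R (k * k) = 2 *\<^sub>R (e * cstar e - w)"
      by (simp_all add: ew)
    have "e * cstar e = (1/2) *\<^sub>R (2 *\<^sub>R (e * cstar e - w)) + w" by simp
    also have "\<dots> = 2 *\<^sub>R (h * h) + 2 *\<^sub>R (k * k) + w"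
      unfolding hk(3)[symmetric] by (simp only: scaleR_add_right scaleR_scaleR) simp
    finally show ?thesis
      by (simp only:) (intro positive_add positive_scaleR positive_square hk w; simp)
  qed
  define d where "d = (1 / (norm e + 1)) *\<^sub>R e"
  define c where "c = 1 / (norm e + 1)"
  have c: "c > 0" by (simp add: c_def add_nonneg_pos)
  have d_c: "d = c *\<^sub>R e" by (simp add: d_def c_def)
  have "(c * c) *\<^sub>R w = 0"
  proof (rule cstar_mult_self_negative)
    show "positive ((c * c) *\<^sub>R w)" using positive_scaleR[OF w, of "c * c"] by simp
    show "cstar d * d = - ((c * c) *\<^sub>R w)" by (simp add: d_c cstar_scaleR ew)
    show "positive (d * cstar d)" using positive_scaleR[OF p, of "c * c"] by (simp add: d_c cstar_scaleR)
    show "norm d \<le> 1" by (simp add: d_def add_nonneg_pos divide_le_eq)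
  qed
  then have "w = 0" using c by simp
  then have "v * v * v = 0" by (simp add: vvv)
  then have "(v * v) * (v * v) = 0" by (metis mult.assoc mult_zero_right mult_zero_left)
  then have "v * v = 0" by (rule square_sa_eq_0[rotated]) (simp add: cstar_mult uv)
  then have "v = 0" by (rule square_sa_eq_0[rotated]) (simp add: uv)
  then have "?x = s * s" using uv(1,5) by simp
  then show ?thesis using positive_square[OF positive_cstar[OF uv(4)]] by simp
qed

section \<open>Positive functionals\<close>

definition sublinear :: "('a::real_vector \<Rightarrow> real) \<Rightarrow> bool" where
  "sublinear q \<longleftrightarrow> (\<forall>x y. q (x + y) \<le> q x + q y) \<and> (\<forall>r\<ge>0. \<forall>x. q (r *\<^sub>R x) = r * q x)"

lemma sublinear_add: "sublinear q \<Longrightarrow> q (x + y) \<le> q x + q y"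
  and sublinear_scaleR: "sublinear q \<Longrightarrow> 0 \<le> r \<Longrightarrow> q (r *\<^sub>R x) = r * q x"
  by (auto simp: sublinear_def)

lemma sublinear_zero: "sublinear q \<Longrightarrow> q 0 = 0"
  using sublinear_scaleR[of q 0 0] by simp

text \<open>
  The largest sublinear functional below \<open>q\<close> whose value at \<open>- y\<close> is at most \<open>- q y\<close>.
\<close>

definition directional :: "('a::real_vector \<Rightarrow> real) \<Rightarrow> 'a \<Rightarrow> 'a \<Rightarrow> real" where
  "directional q y x = (INF t\<in>{0..}. q (x + t *\<^sub>R y) - t * q y)"

context
  fixes q :: "'a::real_vector \<Rightarrow> real" and y :: 'a
  assumes q: "sublinear q"
begin

lemma directional_bdd: "bdd_below ((\<lambda>t. q (x + t *\<^sub>R y) - t * q y) ` {0..})"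
proof (rule bdd_belowI2[where m = "- q (- x)"])
  fix t :: real assume "t \<in> {0..}"
  then have "t * q y = q ((x + t *\<^sub>R y) + - x)" by (simp add: sublinear_scaleR[OF q])
  also have "\<dots> \<le> q (x + t *\<^sub>R y) + q (- x)" by (rule sublinear_add[OF q])
  finally show "- q (- x) \<le> q (x + t *\<^sub>R y) - t * q y" by simp
qed

lemma directional_le: "0 \<le> t \<Longrightarrow> directional q y x \<le> q (x + t *\<^sub>R y) - t * q y"
  unfolding directional_def by (rule cINF_lower[OF directional_bdd]) simp

lemma directional_greatest:
  "(\<And>t. 0 \<le> t \<Longrightarrow> c \<le> q (x + t *\<^sub>R y) - t * q y) \<Longrightarrow> c \<le> directional q y x"
  unfolding directional_def by (rule cINF_greatest) auto

lemma directional_le_self: "directional q y x \<le> q x"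
  using directional_le[of 0 x] by simp

lemma directional_uminus: "directional q y (- y) \<le> - q y"
  using directional_le[of 1 "- y"] by (simp add: sublinear_zero[OF q])

lemma sublinear_directional: "sublinear (directional q y)"
  unfolding sublinear_def
proof (intro conjI allI impI)
  fix x x'
  have "directional q y (x + x') - (q (x' + t' *\<^sub>R y) - t' * q y) \<le> directional q y x" if "0 \<le> t'" for t'
  proof (rule directional_greatest)
    fix t :: real assume "0 \<le> t"
    then have "directional q y (x + x') \<le> q (x + x' + (t + t') *\<^sub>R y) - (t + t') * q y"
      using that by (intro directional_le) simp
    also have "x + x' + (t + t') *\<^sub>R y = (x + t *\<^sub>R y) + (x' + t' *\<^sub>R y)" by (simp add: scaleR_add_left)
    also have "q \<dots> \<le> q (x + t *\<^sub>R y) + q (x' + t' *\<^sub>R y)" by (rule sublinear_add[OF q])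
    finally show "directional q y (x + x') - (q (x' + t' *\<^sub>R y) - t' * q y) \<le> q (x + t *\<^sub>R y) - t * q y"
      by (simp add: algebra_simps)
  qed
  then have "directional q y (x + x') - directional q y x \<le> directional q y x'"
    by (intro directional_greatest) (simp add: algebra_simps)
  then show "directional q y (x + x') \<le> directional q y x + directional q y x'" by simp
next
  fix r :: real and x assume "0 \<le> r"
  have le: "directional q y (r *\<^sub>R x) \<le> r * directional q y x" if "0 < r" for r x
  proof -
    have "directional q y (r *\<^sub>R x) / r \<le> directional q y x"
    proof (rule directional_greatest)
      fix t :: real assume t: "0 \<le> t"
      have "directional q y (r *\<^sub>R x) \<le> q (r *\<^sub>R x + (r * t) *\<^sub>R y) - (r * t) * q y"
        using t that by (intro directional_le) simp
      also have "r *\<^sub>R x + (r * t) *\<^sub>R y = r *\<^sub>R (x + t *\<^sub>R y)" by (simp add: scaleR_add_right)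
      finally show "directional q y (r *\<^sub>R x) / r \<le> q (x + t *\<^sub>R y) - t * q y"
        using that sublinear_scaleR[OF q, of r "x + t *\<^sub>R y"] by (simp only:) (simp add: field_simps)
    qed
    then show ?thesis using that by (simp add: field_simps)
  qed
  show "directional q y (r *\<^sub>R x) = r * directional q y x"
  proof (cases "r = 0")
    case True
    have "directional q y 0 \<le> 0" using directional_le_self[of 0] by (simp add: sublinear_zero[OF q])
    moreover have "0 \<le> directional q y 0"
      by (rule directional_greatest) (simp add: sublinear_scaleR[OF q])
    ultimately show ?thesis using True by simp
  next
    case False
    then have r: "0 < r" using \<open>0 \<le> r\<close> by simp
    have "directional q y (inverse r *\<^sub>R (r *\<^sub>R x)) \<le> inverse r * directional q y (r *\<^sub>R x)"
      using r by (intro le) simp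
    then have "r * directional q y x \<le> directional q y (r *\<^sub>R x)" using r by (simp add: field_simps)
    with le[OF r, of x] show ?thesis by simp
  qed
qed

end

text \<open>
  A minimal sublinear functional \<open>m\<close> satisfies \<open>directional m y = m\<close> for all \<open>y\<close>, and this is
  additivity.  Minimal functionals exist by Zorn's lemma; starting below \<open>directional p a\<close> rather
  than \<open>p\<close> forces the value at \<open>a\<close>.
\<close>

theorem hahn_banach_sublinear:
  fixes p :: "'a::real_vector \<Rightarrow> real"
  assumes p: "sublinear p"
  obtains f where "linear f" "\<And>x. f x \<le> p x" "f a = p a"
proof -
  define p' where "p' = directional p a"
  have p': "sublinear p'" unfolding p'_def by (rule sublinear_directional[OF p])
  define S where "S = {q. sublinear q \<and> (\<forall>x. q x \<le> p' x)}"
  have "\<exists>m\<in>S. \<forall>q\<in>S. q \<le> m \<longrightarrow> q = m"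
  proof (rule predicate_Zorn)
    show "partial_order_on S (relation_of (\<lambda>q r. r \<le> q) S)"
      by (rule partial_order_on_relation_ofI) auto
    fix C assume C: "C \<in> Chains (relation_of (\<lambda>q r. r \<le> q) S)"
    have CS: "q \<in> S" if "q \<in> C" for q using C that by (auto simp: Chains_def relation_of_def)
    have ch: "q \<le> r \<or> r \<le> q" if "q \<in> C" "r \<in> C" for q r
      using C that by (auto simp: Chains_def relation_of_def)
    show "\<exists>u\<in>S. \<forall>q\<in>C. u \<le> q"
    proof (cases "C = {}")
      case True
      then show ?thesis using p' by (auto simp: S_def intro!: bexI[of _ p'])
    next
      case False
      define u where "u x = (INF q\<in>C. q x)" for x
      have bdd: "bdd_below ((\<lambda>q. q x) ` C)" for x
      proof (rule bdd_belowI2[where m = "- p' (- x)"])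
        fix q assume "q \<in> C"
        then have q: "sublinear q" "\<And>x. q x \<le> p' x" using CS by (auto simp: S_def)
        show "- p' (- x) \<le> q x" using sublinear_add[OF q(1), of x "- x"] q(2)[of "- x"]
          by (simp add: sublinear_zero[OF q(1)])
      qed
      have u_le: "u x \<le> q x" if "q \<in> C" for q x unfolding u_def by (rule cINF_lower[OF bdd that])
      have u_gr: "c \<le> u x" if "\<And>q. q \<in> C \<Longrightarrow> c \<le> q x" for c x
        unfolding u_def by (rule cINF_greatest[OF False that])
      have sl: "sublinear q" if "q \<in> C" for q using CS[OF that] by (simp add: S_def)
      have "u (x + y) \<le> u x + u y" for x y
      proof -
        have "u (x + y) - r y \<le> u x" if r: "r \<in> C" for r
        proof (rule u_gr)
          fix q assume q: "q \<in> C"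
          have "u (x + y) \<le> q x + r y"
            using ch[OF q r] u_le[OF q, of "x + y"] u_le[OF r, of "x + y"]
              sublinear_add[OF sl[OF q], of x y] sublinear_add[OF sl[OF r], of x y]
            by (auto simp: le_fun_def) (meson add_mono order_refl order_trans)+
          then show "u (x + y) - r y \<le> q x" by simp
        qed
        then have "u (x + y) - u x \<le> u y" by (intro u_gr) (simp add: algebra_simps)
        then show ?thesis by simp
      qed
      moreover have "u (r *\<^sub>R x) = r * u x" if "0 \<le> r" for r x
      proof (cases "r = 0")
        case True
        have "u 0 = (INF q\<in>C. 0)" unfolding u_def
          by (rule INF_cong) (simp_all add: sublinear_zero[OF sl])
        then show ?thesis using True False by simp
      next
        case r: False
        then have r0: "0 < r" using that by simp
        show ?thesis
        proof (rule antisym)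
          have "u (r *\<^sub>R x) / r \<le> u x"
          proof (rule u_gr)
            fix q assume "q \<in> C"
            then show "u (r *\<^sub>R x) / r \<le> q x"
              using u_le[of q "r *\<^sub>R x"] sublinear_scaleR[OF sl, of q r x] r0 by (simp add: field_simps)
          qed
          then show "u (r *\<^sub>R x) \<le> r * u x" using r0 by (simp add: field_simps)
          show "r * u x \<le> u (r *\<^sub>R x)"
          proof (rule u_gr)
            fix q assume "q \<in> C"
            then show "r * u x \<le> q (r *\<^sub>R x)"
              using u_le[of q x] sublinear_scaleR[OF sl, of q r x] r0 by simp
          qed
        qed
      qed
      moreover have "u x \<le> p' x" for x
        using False u_le CS by (fastforce simp: S_def intro: order_trans)
      ultimately have "u \<in> S" by (simp add: S_def sublinear_def)
      then show ?thesis using u_le by (auto simp: le_fun_def)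
    qed
  qed
  then obtain m where m: "m \<in> S" "\<And>q. q \<in> S \<Longrightarrow> q \<le> m \<Longrightarrow> q = m" by blast
  have ms: "sublinear m" "\<And>x. m x \<le> p' x" using m(1) by (auto simp: S_def)
  have dm: "directional m y = m" for y
  proof (rule m(2))
    show "directional m y \<le> m" by (simp add: le_fun_def directional_le_self[OF ms(1)])
    show "directional m y \<in> S"
      using sublinear_directional[OF ms(1)] order_trans[OF directional_le_self[OF ms(1)] ms(2)]
      by (simp add: S_def)
  qed
  have add: "m (x + y) = m x + m y" for x y
  proof (rule antisym)
    show "m x + m y \<le> m (x + y)" using directional_le[OF ms(1), of 1 y x] by (simp add: dm)
  qed (rule sublinear_add[OF ms(1)])
  have neg: "m (- x) = - m x" for x using add[of x "- x"] by (simp add: sublinear_zero[OF ms(1)])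
  have "linear m"
  proof (rule linearI)
    show "m (r *\<^sub>R x) = r *\<^sub>R m x" for r x
    proof (cases "0 \<le> r")
      case False
      have "m (r *\<^sub>R x) = m (- ((- r) *\<^sub>R x))" by simp
      also have "\<dots> = - ((- r) * m x)" unfolding neg using False by (subst sublinear_scaleR[OF ms(1)]) auto
      finally show ?thesis by simp
    qed (simp add: sublinear_scaleR[OF ms(1)])
  qed (rule add)
  moreover have le: "m x \<le> p x" for x
    using ms(2)[of x] directional_le_self[OF p, of a x] by (simp add: p'_def)
  moreover have "m a = p a"
    using ms(2)[of "- a"] directional_uminus[OF p, of a] le[of a] by (simp add: p'_def neg)
  ultimately show ?thesis using that by blast
qed

lemma sublinear_norm: "sublinear (norm :: 'a::real_normed_vector \<Rightarrow> real)"
  by (simp add: sublinear_def norm_triangle_ineq)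

text \<open>
  The functional \<open>directional norm 1\<close> sends \<open>y\<close> to the infimum of \<open>norm (y + t) - t\<close>, which for
  self-adjoint \<open>y\<close> is the top of the spectrum.  It is norming at positive elements and nonpositive at
  negative ones, and linear functionals below it inherit the latter.
\<close>

lemma norming_positive_functional:
  fixes x :: "'a::unital_cstar"
  assumes x: "positive x"
  shows "\<exists>\<phi>. linear \<phi> \<and> (\<forall>y. \<bar>\<phi> y\<bar> \<le> norm y) \<and> (\<forall>c. positive c \<longrightarrow> 0 \<le> \<phi> c) \<and> \<phi> x = norm x"
proof -
  define p where "p = directional norm (1::'a)"
  have p: "sublinear p" unfolding p_def by (rule sublinear_directional[OF sublinear_norm])
  have p_le: "p y \<le> norm y" for y unfolding p_def by (rule directional_le_self[OF sublinear_norm])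
  obtain \<phi> where \<phi>: "linear \<phi>" "\<And>y. \<phi> y \<le> p y" "\<phi> x = p x" using hahn_banach_sublinear[OF p] by blast
  have neg: "\<phi> (- y) = - \<phi> y" for y by (rule linear_neg[OF \<phi>(1)])
  have "norm x \<le> p x" unfolding p_def
  proof (rule directional_greatest[OF sublinear_norm])
    fix t :: real assume t: "0 \<le> t"
    let ?s = "norm (x + t *\<^sub>R 1)"
    have t1: "positive (t *\<^sub>R (1::'a))" by (rule positive_scaleR[OF positive_one t])
    have "positive (?s *\<^sub>R 1 - (x + t *\<^sub>R 1))" by (rule positive_norm_diff[OF positive_add[OF x t1]]) simp
    moreover have "?s *\<^sub>R 1 - (x + t *\<^sub>R 1) = (?s - t) *\<^sub>R 1 - x" by (simp add: scaleR_diff_left)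
    moreover have "t \<le> ?s" using norm_mono_positive[OF t1 x] t by (simp add: add.commute)
    ultimately have "norm x \<le> ?s - t" using norm_le_of_positive_diff[OF x] by simp
    then show "norm x \<le> norm (x + t *\<^sub>R 1) - t * norm (1::'a)" by simp
  qed
  then have "\<phi> x = norm x" using \<phi>(3) p_le[of x] by simp
  moreover have "0 \<le> \<phi> c" if c: "positive c" for c
  proof -
    have "\<phi> (- c) \<le> norm (- c + norm c *\<^sub>R 1) - norm c * norm (1::'a)"
      using \<phi>(2)[of "- c"] directional_le[OF sublinear_norm, of "norm c" 1 "- c"] by (simp add: p_def)
    then show ?thesis using positive_norm_le[OF c order_refl] by (simp add: neg)
  qed
  moreover have "\<bar>\<phi> y\<bar> \<le> norm y" for y
    using \<phi>(2)[of y] \<phi>(2)[of "- y"] p_le[of y] p_le[of "- y"] by (auto simp: neg)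
  ultimately show ?thesis using \<phi>(1) by blast
qed

lemma dense_sequence:
  assumes "separable_space (euclidean :: 'a::metric_space topology)"
  obtains s :: "nat \<Rightarrow> 'a::metric_space" where "\<And>x e. e > 0 \<Longrightarrow> \<exists>n. dist x (s n) < e"
proof -
  obtain C :: "'a set" where C: "countable C" "closure C = UNIV"
    using assms by (auto simp: separable_space_def)
  then have "C \<noteq> {}" by auto
  have "\<exists>n. dist x (from_nat_into C n) < e" if e: "e > 0" for x e
  proof -
    have "x \<in> closure C" using C by simp
    then obtain y where y: "y \<in> C" "dist y x < e" using e by (meson closure_approachable)
    then obtain n where "from_nat_into C n = y"
      using from_nat_into_surj[OF C(1)] by blast
    with y show ?thesis by (auto simp: dist_commute)
  qed
  then show ?thesis using that by blast
qed

definition positive_functional :: "('a::cstar_algebra \<Rightarrow> complex) \<Rightarrow> bool" where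
  "positive_functional \<Phi> \<longleftrightarrow> bounded_linear \<Phi> \<and> (\<forall>c a. \<Phi> (c *\<^sub>C a) = c * \<Phi> a) \<and>
    (\<forall>a. \<Phi> (cstar a) = cnj (\<Phi> a)) \<and> (\<forall>a. 0 \<le> Re (\<Phi> (cstar a * a)))"

text \<open>
  A complex linear functional that is real on self-adjoint elements is determined by its values there:
  the real part at \<open>a\<close> is the value at the real part \<open>R a\<close>, and the imaginary part follows by
  complex linearity.
\<close>

lemma complexify_functional:
  fixes \<phi> :: "'a::cstar_algebra unitized \<Rightarrow> real"
  assumes lin: "linear \<phi>" and bd: "\<And>y. \<bar>\<phi> y\<bar> \<le> K * norm y" and pos: "\<And>c. positive c \<Longrightarrow> 0 \<le> \<phi> c"
  shows "\<exists>\<Phi>. positive_functional \<Phi> \<and> (\<forall>a. cstar a = a \<longrightarrow> \<Phi> a = complex_of_real (\<phi> (emb a)))"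
proof -
  define R where "R a = (1/2) *\<^sub>R (a + cstar a)" for a :: 'a
  define \<Phi> where "\<Phi> a = Complex (\<phi> (emb (R a))) (- \<phi> (emb (R (\<i> *\<^sub>C a))))" for a
  have R_add: "R (a + b) = R a + R b" for a b by (simp add: R_def cstar_add algebra_simps)
  have R_scale: "R (r *\<^sub>R a) = r *\<^sub>R R a" for r a by (simp add: R_def cstar_scaleR algebra_simps)
  have R_star: "R (cstar a) = R a" for a by (simp add: R_def cstar_cstar add.commute)
  have R_sa: "R a = a" if "cstar a = a" for a
    using that by (simp add: R_def scaleR_2[symmetric])
  have R_norm: "norm (R a) \<le> norm a" for a
    using norm_triangle_ineq[of a "cstar a"] by (simp add: R_def)
  have l_add: "\<phi> (x + y) = \<phi> x + \<phi> y" and l_scale: "\<phi> (r *\<^sub>R x) = r * \<phi> x" for x y r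
    using lin by (simp_all add: linear_add linear_scale)
  have l_neg: "\<phi> (- x) = - \<phi> x" for x by (rule linear_neg[OF lin])
  have R_neg: "R (- a) = - R a" for a using R_scale[of "-1" a] by simp
  have \<Phi>_add: "\<Phi> (a + b) = \<Phi> a + \<Phi> b" for a b
    by (simp add: \<Phi>_def R_add emb_add l_add complex_eq_iff scaleC_add_right)
  have \<Phi>_scale: "\<Phi> (r *\<^sub>R a) = r *\<^sub>R \<Phi> a" for r a
    by (simp add: \<Phi>_def R_scale emb_scaleR l_scale complex_eq_iff scaleC_scaleR)
  have \<Phi>_i: "\<Phi> (\<i> *\<^sub>C a) = \<i> * \<Phi> a" for a
  proof -
    have "R (\<i> *\<^sub>C \<i> *\<^sub>C a) = - R a" by (simp add: scaleC_scaleC scaleC_one R_neg)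
    then show ?thesis
      by (simp only: \<Phi>_def) (simp add: complex_eq_iff emb_diff[of 0, simplified] l_neg)
  qed
  have \<Phi>_scaleC: "\<Phi> (c *\<^sub>C a) = c * \<Phi> a" for c a
  proof -
    have "c *\<^sub>C a = Re c *\<^sub>R a + \<i> *\<^sub>C (Im c *\<^sub>R a)"
      by (simp add: scaleR_scaleC scaleC_scaleC scaleC_add_left[symmetric] complex_eq[symmetric])
    then show ?thesis
      by (simp add: \<Phi>_add \<Phi>_scale \<Phi>_i) (simp add: complex_eq_iff)
  qed
  have "\<Phi> (cstar a) = cnj (\<Phi> a)" for a
  proof -
    have "R (\<i> *\<^sub>C cstar a) = - R (\<i> *\<^sub>C a)"
      using R_star[of "\<i> *\<^sub>C a"] by (simp add: cstar_imaginary R_neg minus_equation_iff)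
    then show ?thesis by (simp add: \<Phi>_def R_star complex_eq_iff emb_diff[of 0, simplified] l_neg)
  qed
  moreover have sa: "\<Phi> a = complex_of_real (\<phi> (emb a))" if "cstar a = a" for a
  proof -
    have "R (\<i> *\<^sub>C a) = 0" by (simp add: R_def cstar_imaginary that cstar_scaleC)
    then show ?thesis by (simp add: \<Phi>_def R_sa[OF that] complex_eq_iff linear_0[OF lin])
  qed
  moreover have "0 \<le> Re (\<Phi> (cstar a * a))" for a
    using pos[OF positive_cstar_mult_self[of "emb a"]]
    by (simp add: sa cstar_mult cstar_cstar emb_mult emb_cstar)
  moreover have "bounded_linear \<Phi>"
  proof (rule bounded_linear_intro[of _ "K + K"])
    fix a
    have "norm (\<Phi> a) \<le> \<bar>Re (\<Phi> a)\<bar> + \<bar>Im (\<Phi> a)\<bar>" by (rule cmod_le)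
    moreover have K: "0 \<le> K" using bd[of 1] by (simp add: order_trans[OF abs_ge_zero])
    have "\<bar>Re (\<Phi> a)\<bar> \<le> K * norm a" "\<bar>Im (\<Phi> a)\<bar> \<le> K * norm a"
      using bd[of "emb (R a)"] bd[of "emb (R (\<i> *\<^sub>C a))"]
        mult_left_mono[OF R_norm[of a] K] mult_left_mono[OF R_norm[of "\<i> *\<^sub>C a"] K]
      by (auto simp: \<Phi>_def norm_scaleC)
    ultimately show "norm (\<Phi> a) \<le> norm a * (K + K)" by (simp add: algebra_simps)
  qed (rule \<Phi>_add \<Phi>_scale)+
  ultimately show ?thesis using \<Phi>_scaleC unfolding positive_functional_def by blast
qed

text \<open>
  A geometric series of positive functionals, one norming \<open>s\<^sub>n^* s\<^sub>n\<close> for each member of a dense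
  sequence: at a nonzero \<open>a\<close> a functional with \<open>s\<^sub>n\<close> close to \<open>a\<close> cannot vanish on \<open>a^* a\<close>.
\<close>

theorem faithful_positive_functional:
  assumes "separable_space (euclidean :: 'a::cstar_algebra topology)"
  obtains \<Phi> :: "'a::cstar_algebra \<Rightarrow> complex" where "positive_functional \<Phi>" "\<And>a. \<Phi> (cstar a * a) = 0 \<Longrightarrow> a = 0"
proof -
  obtain s :: "nat \<Rightarrow> 'a" where s: "\<And>x e. e > 0 \<Longrightarrow> \<exists>n. dist x (s n) < e"
    using dense_sequence[OF assms] by blast
  have "\<forall>n. \<exists>\<phi>. linear \<phi> \<and> (\<forall>y. \<bar>\<phi> y\<bar> \<le> norm y) \<and> (\<forall>c. positive c \<longrightarrow> 0 \<le> \<phi> c) \<and>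
      \<phi> (cstar (emb (s n)) * emb (s n)) = norm (cstar (emb (s n)) * emb (s n))"
    using norming_positive_functional[OF positive_cstar_mult_self] by blast
  then obtain \<phi> where \<phi>: "\<And>n. linear (\<phi> n)" "\<And>n y. \<bar>\<phi> n y\<bar> \<le> norm y" "\<And>n c. positive c \<Longrightarrow> 0 \<le> \<phi> n c"
    "\<And>n. \<phi> n (cstar (emb (s n)) * emb (s n)) = norm (cstar (emb (s n)) * emb (s n))" by metis
  have sm: "summable (\<lambda>n. (1/2) ^ n * \<phi> n y)" for y
  proof (rule summable_comparison_test'[where g = "\<lambda>n. (1/2) ^ n * norm y"])
    show "summable (\<lambda>n. (1/2) ^ n * norm y)" by (intro summable_mult2 summable_geometric) simp
    show "norm ((1/2) ^ n * \<phi> n y) \<le> (1/2) ^ n * norm y" for n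
      using \<phi>(2)[of n y] by (simp add: abs_mult)
  qed
  define \<psi> where "\<psi> y = (\<Sum>n. (1/2) ^ n * \<phi> n y)" for y
  have "linear \<psi>"
  proof (rule linearI)
    show "\<psi> (x + y) = \<psi> x + \<psi> y" for x y
      unfolding \<psi>_def suminf_add[OF sm sm] by (simp add: linear_add[OF \<phi>(1)] algebra_simps)
    show "\<psi> (r *\<^sub>R x) = r *\<^sub>R \<psi> x" for r x
      unfolding \<psi>_def real_scaleR_def suminf_mult[OF sm, symmetric]
      by (simp add: linear_scale[OF \<phi>(1)] algebra_simps)
  qed
  moreover have "\<bar>\<psi> y\<bar> \<le> 2 * norm y" for y
  proof -
    have g: "(\<lambda>n. (1/2) ^ n * norm y) sums (2 * norm y)"
      using sums_mult2[OF geometric_sums[of "1/2::real"], of "norm y"] by simp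
    have sn: "summable (\<lambda>n. \<bar>(1/2) ^ n * \<phi> n y\<bar>)"
      by (rule summable_comparison_test'[OF sums_summable[OF g]])
        (use \<phi>(2)[of _ y] in \<open>simp add: abs_mult\<close>)
    have "\<bar>\<psi> y\<bar> \<le> (\<Sum>n. \<bar>(1/2) ^ n * \<phi> n y\<bar>)" unfolding \<psi>_def by (rule summable_rabs[OF sn])
    also have "\<dots> \<le> (\<Sum>n. (1/2) ^ n * norm y)"
      by (rule suminf_le[OF _ sn sums_summable[OF g]]) (use \<phi>(2)[of _ y] in \<open>simp add: abs_mult\<close>)
    also have "\<dots> = 2 * norm y" using g by (rule sums_unique[symmetric])
    finally show ?thesis .
  qed
  moreover have \<psi>_pos: "0 \<le> \<psi> c" if "positive c" for c
    unfolding \<psi>_def by (rule suminf_nonneg[OF sm]) (simp add: \<phi>(3)[OF that])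
  ultimately obtain \<Phi> where \<Phi>: "positive_functional \<Phi>"
    "\<And>a::'a. cstar a = a \<Longrightarrow> \<Phi> a = complex_of_real (\<psi> (emb a))"
    using complexify_functional by blast
  have "a = 0" if "\<Phi> (cstar a * a) = 0" for a
  proof (rule ccontr)
    assume a: "a \<noteq> 0"
    let ?y = "cstar (emb a) * emb a"
    have "\<psi> ?y = 0"
      using that \<Phi>(2)[of "cstar a * a"] by (simp add: cstar_mult cstar_cstar emb_mult emb_cstar)
    then have "(\<Sum>n. (1/2) ^ n * \<phi> n ?y) = 0" by (simp add: \<psi>_def)
    then have z: "(1/2) ^ n * \<phi> n ?y = 0" for n
      by (subst (asm) suminf_eq_zero_iff[OF sm]) (simp_all add: \<phi>(3) positive_cstar_mult_self)
    then have z: "\<phi> n ?y = 0" for n using z[of n] by simp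
    have na: "norm a > 0" using a by simp
    \<comment> \<open>With this constant \<open>norm (s n)^2\<close> would be at least \<open>49/64\<close> and at most \<open>17/64\<close> of \<open>norm a^2\<close>.\<close>
    define e where "e = norm a / 8"
    have e: "e > 0" using na by (simp add: e_def)
    obtain n where n: "norm (a - s n) < e" using s[OF e, of a] by (auto simp: dist_norm)
    let ?z = "cstar (emb (s n)) * emb (s n)"
    have sn: "norm a - e \<le> norm (s n)" "norm (s n) \<le> norm a + e"
      using n norm_triangle_ineq2[of a "s n"] norm_triangle_ineq2[of "s n" a] by (simp_all add: norm_minus_commute)
    have "norm (s n) * norm (s n) = \<phi> n ?z"
      using \<phi>(4)[of n] by (simp add: cstar_identity power2_eq_square)
    also have "\<dots> = \<phi> n (?z - ?y)" using z[of n] by (simp add: linear_diff[OF \<phi>(1)])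
    also have "\<dots> \<le> norm (?z - ?y)" using \<phi>(2)[of n "?z - ?y"] by simp
    also have "?z - ?y = cstar (emb (s n)) * emb (s n - a) + cstar (emb (s n - a)) * emb a"
      by (simp add: emb_diff cstar_diff algebra_simps)
    also have "norm \<dots> \<le> norm (s n) * norm (s n - a) + norm (s n - a) * norm a"
      by (rule order_trans[OF norm_triangle_ineq add_mono]; rule order_trans[OF norm_mult_ineq]) simp_all
    also have "\<dots> \<le> (norm a + e) * e + e * norm a"
      using n sn na e by (intro add_mono mult_mono) (simp_all add: norm_minus_commute)
    finally have "64 * (norm (s n) * norm (s n)) \<le> 17 * (norm a * norm a)" by (simp add: e_def)
    moreover have "49 * (norm a * norm a) \<le> 64 * (norm (s n) * norm (s n))"
      using mult_mono[OF sn(1) sn(1)] na by (simp add: e_def)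
    ultimately show False using mult_pos_pos[OF na na] by linarith
  qed
  then show ?thesis using that \<Phi>(1) by blast
qed

text \<open>
  The inequality \<open>a^* a \<le> norm a^2\<close> in the form of an algebraic identity, which survives under
  asymptotic homomorphisms.
\<close>

lemma contractive_identity:
  fixes a :: "'a::cstar_algebra"
  obtains m where "cstar m = m" "(norm a)\<^sup>2 *\<^sub>R 1 - emb (cstar a * a) = m * m"
proof -
  have "positive ((norm a)\<^sup>2 *\<^sub>R 1 - emb (cstar a * a))"
    by (rule positive_norm_diff) (simp_all add: emb_mult emb_cstar positive_cstar_mult_self cstar_identity)
  then show ?thesis using that by (auto simp: positive_def)
qed

text \<open>
  Placed between \<open>b^*\<close> and \<open>b\<close>, the previous identity takes place in \<open>A\<close> itself.
\<close>

lemma contractive_identity_conj: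
  fixes a b :: "'a::cstar_algebra"
  obtains c where "cstar c * c = (norm a)\<^sup>2 *\<^sub>R (cstar b * b) - cstar (a * b) * (a * b)"
proof -
  obtain m where m: "cstar m = m" "(norm a)\<^sup>2 *\<^sub>R 1 - emb (cstar a * a) = m * m"
    using contractive_identity by blast
  define c where "c = base (m * emb b)"
  have c: "emb c = m * emb b" unfolding c_def by (rule emb_base) simp
  have "emb (cstar c * c) = cstar (emb b) * (m * m) * emb b"
    by (simp add: emb_mult emb_cstar c cstar_mult m mult.assoc)
  also have "\<dots> = emb ((norm a)\<^sup>2 *\<^sub>R (cstar b * b) - cstar (a * b) * (a * b))"
    unfolding m(2)[symmetric] by (simp add: emb_diff emb_mult emb_cstar emb_scaleR cstar_mult algebra_simps)
  finally show ?thesis using that by simp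
qed

text \<open>
  With \<open>u\<close> the positive part of \<open>x - \<delta>\<close> and \<open>s^2 = \<bar>x - \<delta>\<bar>\<close>, put \<open>y = s u\<close>; then
  \<open>y^* y = u^3 = u (x - \<delta>) u\<close>.  As \<open>\<bar>x - \<delta>\<bar>\<close> has scalar part \<open>\<delta>\<close> (this uses \<open>\<delta> > 0\<close>), the
  scalar part of \<open>u\<close> is \<open>0\<close>, so \<open>u\<close> and \<open>y\<close> lie in \<open>A\<close>.
\<close>

lemma truncation:
  fixes x :: "'a::cstar_algebra"
  assumes x: "cstar x = x" and \<delta>: "\<delta> > 0"
  obtains u y where "cstar u = u" "cstar y * y = u * x * u - \<delta> *\<^sub>R (u * u)"
    "y = 0 \<Longrightarrow> \<exists>m. cstar m = m \<and> \<delta> *\<^sub>R 1 - emb x = m * m"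
proof -
  let ?X = "emb x - \<delta> *\<^sub>R 1"
  have X: "cstar ?X = ?X" by (simp add: cstar_diff cstar_scaleR emb_cstar[symmetric] x)
  obtain u v s where uv: "?X = u - v" "u * v = 0" "v * u = 0" "positive s"
    "u + v = s * s" "s * u = u * s" "s * v = v * s" "cstar u = u" "cstar v = v"
    "u = (1/2) *\<^sub>R (s * s + ?X)" "(s * s) * (s * s) = ?X * ?X"
    by (rule positive_part[OF X])
  have "cnj (scal s) = scal s" using arg_cong[OF positive_cstar[OF uv(4)], of scal] by simp
  then have ss: "scal s = of_real (Re (scal s))" by (simp add: complex_eq_iff)
  have "scal s * scal s * (scal s * scal s) = of_real (\<delta> * \<delta>)"
    using arg_cong[OF uv(11), of scal] by (simp add: of_real_def)
  then have "of_real ((Re (scal s) * Re (scal s))\<^sup>2) = (of_real (\<delta>\<^sup>2) :: complex)"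
    by (subst (asm) (1 2 3 4) ss) (simp add: power2_eq_square)
  then have "(Re (scal s) * Re (scal s))\<^sup>2 = \<delta>\<^sup>2" by (simp only: of_real_eq_iff)
  then have "Re (scal s) * Re (scal s) = \<delta>" using \<delta> by (simp add: power2_eq_iff_nonneg)
  then have "scal s * scal s = of_real \<delta>" by (subst (1 2) ss) (simp flip: of_real_mult)
  then have scu: "scal u = 0" by (subst uv(10)) (simp add: of_real_def)
  define b where "b = base u"
  define y where "y = base (s * u)"
  have b: "emb b = u" unfolding b_def by (rule emb_base[OF scu])
  have y: "emb y = s * u" unfolding y_def by (rule emb_base) (simp add: scu)
  have uuu: "u * (s * s) * u = u * ?X * u" unfolding uv(5)[symmetric] uv(1)
    by (simp add: algebra_simps uv(2,3))
  show ?thesis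
  proof (rule that[of b y])
    show "cstar b = b" using uv(8) by (simp add: b[symmetric] emb_cstar[symmetric])
    have "emb (cstar y * y) = u * ?X * u" unfolding uuu[symmetric]
      by (simp add: emb_mult emb_cstar y cstar_mult uv(8) positive_cstar[OF uv(4)] mult.assoc)
    also have "\<dots> = emb (b * x * b - \<delta> *\<^sub>R (b * b))"
      by (simp add: emb_diff emb_mult emb_scaleR b algebra_simps)
    finally show "cstar y * y = b * x * b - \<delta> *\<^sub>R (b * b)" by simp
    assume "y = 0"
    then have su: "s * u = 0" using y by simp
    have "u * u = (u + v) * u" by (simp add: algebra_simps uv(3))
    also have "\<dots> = s * (s * u)" by (simp add: uv(5) mult.assoc)
    also have "\<dots> = 0" by (simp add: su)
    finally have "u = 0" using square_sa_eq_0[OF uv(8)] by simp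
    then have "\<delta> *\<^sub>R 1 - emb x = s * s" using uv(1,5) by (simp add: algebra_simps)
    then show "\<exists>m. cstar m = m \<and> \<delta> *\<^sub>R 1 - emb x = m * m" using positive_cstar[OF uv(4)] by blast
  qed
qed

section \<open>Operators on Hilbert space\<close>

lemma cinner_sum_right: "cinner x (\<Sum>i\<in>F. f i) = (\<Sum>i\<in>F. cinner x (f i :: 'h::chilbert_space))"
  by (induction F rule: infinite_finite_induct) (simp_all add: cinner_zero_right cinner_add_right)

lemma cinner_zero_left: "cinner (0::'h::chilbert_space) x = 0"
  using cinner_add_left[of 0 0 x] by simp

lemma cinner_sum_left: "cinner (\<Sum>i\<in>F. f i) x = (\<Sum>i\<in>F. cinner (f i) (x :: 'h::chilbert_space))"
  by (induction F rule: infinite_finite_induct) (simp_all add: cinner_zero_left cinner_add_left)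

lemma cinner_scaleR_right: "cinner x (r *\<^sub>R y) = r *\<^sub>R cinner x (y::'h::chilbert_space)"
  by (simp add: scaleR_scaleC[of r y] cinner_scaleC_right scaleR_conv_of_real)

lemma cinner_scaleR_left: "cinner (r *\<^sub>R x) y = r *\<^sub>R cinner x (y::'h::chilbert_space)"
  by (simp add: scaleR_scaleC[of r x] cinner_scaleC_left scaleR_conv_of_real)

lemma bounded_bilinear_cinner: "bounded_bilinear (cinner :: 'h::chilbert_space \<Rightarrow> 'h \<Rightarrow> complex)"
  by standard (use cauchy_schwarz in \<open>auto intro!: exI[of _ 1] simp: cinner_add_left cinner_add_right
      cinner_scaleR_left cinner_scaleR_right\<close>)

lemmas tendsto_cinner = bounded_bilinear.tendsto[OF bounded_bilinear_cinner]

lemma bounded_opsD: "T \<in> bounded_ops \<Longrightarrow> blinfun_apply T (c *\<^sub>C x) = c *\<^sub>C T x"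
  by (simp add: bounded_ops_def)

definition scale_op :: "complex \<Rightarrow> ('h::chilbert_space \<Rightarrow>\<^sub>L 'h) \<Rightarrow> 'h \<Rightarrow>\<^sub>L 'h" where
  "scale_op c T = Blinfun (\<lambda>x. c *\<^sub>C T x)"

lemma bounded_linear_scaleC: "bounded_linear (\<lambda>x::'h::complex_normed_vector. c *\<^sub>C x)"
  by (rule bounded_linear_intro[of _ "cmod c"])
    (simp_all add: scaleC_add_right scaleC_scaleR norm_scaleC)

lemma scale_op_apply [simp]: "blinfun_apply (scale_op c T) x = c *\<^sub>C T x"
  unfolding scale_op_def
  by (subst bounded_linear_Blinfun_apply)
    (auto intro: bounded_linear_compose[OF bounded_linear_scaleC blinfun.bounded_linear_right])

lemma bounded_ops_simps [simp, intro]: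
  "0 \<in> bounded_ops" "id_blinfun \<in> bounded_ops"
  "S \<in> bounded_ops \<Longrightarrow> T \<in> bounded_ops \<Longrightarrow> S + T \<in> bounded_ops"
  "S \<in> bounded_ops \<Longrightarrow> T \<in> bounded_ops \<Longrightarrow> S - T \<in> bounded_ops"
  "S \<in> bounded_ops \<Longrightarrow> T \<in> bounded_ops \<Longrightarrow> S o\<^sub>L T \<in> bounded_ops"
  "S \<in> bounded_ops \<Longrightarrow> scale_op c S \<in> bounded_ops"
  by (simp_all add: bounded_ops_def blinfun.add_left blinfun.diff_left scaleC_add_right
      complex_vector.scale_right_diff_distrib scaleC_scaleC mult.commute)

lemma cadjoint_eqI:
  assumes "T \<in> bounded_ops" "\<And>x y. cinner (blinfun_apply S x) y = cinner x (T y)"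
  shows "cadjoint T = S"
  by (intro blinfun_eqI cinner_eqI) (simp add: cinner_cadjoint[OF assms(1)] assms(2))

lemma cinner_cadjoint_right:
  assumes "T \<in> bounded_ops" shows "cinner x (cadjoint T y) = cinner (T x) y"
  by (metis assms cinner_cadjoint cinner_commute)

lemma cadjoint_cadjoint [simp]: "T \<in> bounded_ops \<Longrightarrow> cadjoint (cadjoint T) = T"
  by (rule cadjoint_eqI) (simp_all add: cadjoint_bounded_ops cinner_cadjoint_right)

lemma cadjoint_add: "S \<in> bounded_ops \<Longrightarrow> T \<in> bounded_ops \<Longrightarrow> cadjoint (S + T) = cadjoint S + cadjoint T"
  by (rule cadjoint_eqI) (simp_all add: blinfun.add_left cinner_add_left cinner_add_right cinner_cadjoint)

lemma cadjoint_diff: "S \<in> bounded_ops \<Longrightarrow> T \<in> bounded_ops \<Longrightarrow> cadjoint (S - T) = cadjoint S - cadjoint T"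
  by (rule cadjoint_eqI) (simp_all add: blinfun.diff_left cinner_diff_left cinner_diff_right cinner_cadjoint)

lemma cadjoint_compose: "S \<in> bounded_ops \<Longrightarrow> T \<in> bounded_ops \<Longrightarrow> cadjoint (S o\<^sub>L T) = cadjoint T o\<^sub>L cadjoint S"
  by (rule cadjoint_eqI) (simp_all add: cinner_cadjoint)

lemma cadjoint_scale: "S \<in> bounded_ops \<Longrightarrow> cadjoint (scale_op c S) = scale_op (cnj c) (cadjoint S)"
  by (rule cadjoint_eqI) (simp_all add: cinner_cadjoint cinner_scaleC_left cinner_scaleC_right)

lemma cadjoint_zero [simp]: "cadjoint 0 = 0"
  by (rule cadjoint_eqI) (simp_all add: cinner_zero_left cinner_zero_right)

lemma cadjoint_id [simp]: "cadjoint id_blinfun = id_blinfun"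
  by (rule cadjoint_eqI) simp_all

lemma norm_cadjoint:
  assumes T: "T \<in> bounded_ops" shows "norm (cadjoint T) = norm T"
proof -
  have le: "norm (cadjoint T) \<le> norm T" if T: "T \<in> bounded_ops" for T :: "'a \<Rightarrow>\<^sub>L 'a"
  proof (rule norm_blinfun_bound)
    fix x
    show "norm (cadjoint T x) \<le> norm T * norm x"
    proof (cases "cadjoint T x = 0")
      case False
      have "(norm (cadjoint T x))\<^sup>2 = cmod (cinner x (T (cadjoint T x)))"
        by (simp add: cinner_cadjoint[OF T, symmetric] cinner_self norm_power)
      also have "\<dots> \<le> norm x * norm (T (cadjoint T x))" by (rule cauchy_schwarz)
      also have "\<dots> \<le> norm x * (norm T * norm (cadjoint T x))" by (intro mult_left_mono norm_blinfun) simp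
      finally show ?thesis using False by (simp add: power2_eq_square algebra_simps)
    qed simp
  qed simp
  show ?thesis using le[OF T] le[OF cadjoint_bounded_ops[OF T]] T by simp
qed

lemma norm_scale_op: "norm (scale_op c T) = cmod c * norm T"
proof -
  have le: "norm (scale_op c T) \<le> cmod c * norm T" for c and T :: "'a \<Rightarrow>\<^sub>L 'a"
    by (rule norm_blinfun_bound) (simp_all add: norm_scaleC mult.assoc mult_left_mono norm_blinfun)
  show ?thesis
  proof (cases "c = 0")
    case True then show ?thesis using le[of 0 T] by simp
  next
    case False
    have "scale_op (inverse c) (scale_op c T) = T"
      using False by (intro blinfun_eqI) (simp add: scaleC_scaleC scaleC_one)
    then have "norm T \<le> cmod (inverse c) * norm (scale_op c T)" using le[of "inverse c" "scale_op c T"] by simp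
    then show ?thesis using le[of c T] False by (simp add: norm_inverse norm_divide field_simps)
  qed
qed

lemma bounded_op_alg_simps:
  "elems bounded_op_alg = bounded_ops" "add_sa bounded_op_alg = (+)" "mult_sa bounded_op_alg = (o\<^sub>L)"
  "scale_sa bounded_op_alg = scale_op" "star_sa bounded_op_alg = cadjoint" "norm_sa bounded_op_alg = norm"
  by (auto simp: bounded_op_alg_def scale_op_def fun_eq_iff)

lemma star_homD:
  assumes "star_hom bounded_op_alg f"
  shows "f a \<in> bounded_ops" "f (a + b) = f a + f b" "f (c *\<^sub>C a) = scale_op c (f a)"
    "f (a * b) = f a o\<^sub>L f b" "f (cstar a) = cadjoint (f a)"
  using assms by (simp_all add: star_hom_def bounded_op_alg_simps)

section \<open>Orthonormal bases\<close>

locale orthonormal_basis =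
  fixes e :: "nat \<Rightarrow> 'h::chilbert_space"
  assumes ortho: "cinner (e i) (e j) = (if i = j then 1 else 0)"
    and complete: "(\<lambda>n. \<Sum>i<n. cinner (e i) v *\<^sub>C e i) \<longlonglongrightarrow> v"
begin

definition proj :: "nat \<Rightarrow> 'h \<Rightarrow>\<^sub>L 'h" where
  "proj n = Blinfun (\<lambda>v. \<Sum>i<n. cinner (e i) v *\<^sub>C e i)"

lemma norm_e [simp]: "norm (e i) = 1"
  using ortho[of i i] by (simp add: norm_eq_sqrt_cinner)

lemma cinner_e_sum: "finite F \<Longrightarrow> cinner (e j) (\<Sum>i\<in>F. c i *\<^sub>C e i) = (if j \<in> F then c j else 0)"
  by (simp add: cinner_sum_right cinner_scaleC_right ortho if_distrib cong: if_cong)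

lemma norm_sum_e: "finite F \<Longrightarrow> (norm (\<Sum>i\<in>F. c i *\<^sub>C e i))\<^sup>2 = (\<Sum>i\<in>F. (cmod (c i))\<^sup>2)"
proof -
  assume F: "finite F"
  have "cinner (\<Sum>i\<in>F. c i *\<^sub>C e i) (\<Sum>i\<in>F. c i *\<^sub>C e i) = (\<Sum>i\<in>F. cnj (c i) * c i)"
    by (simp add: cinner_sum_left cinner_scaleC_left cinner_e_sum[OF F])
  also have "\<dots> = complex_of_real (\<Sum>i\<in>F. (cmod (c i))\<^sup>2)"
    unfolding of_real_sum
    by (rule sum.cong) (simp_all add: complex_norm_square[symmetric] mult.commute)
  finally show ?thesis by (simp add: norm_sq_cinner)
qed

lemma bounded_linear_proj: "bounded_linear (\<lambda>v. \<Sum>i<n. cinner (e i) v *\<^sub>C e i)"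
proof (rule bounded_linear_sum)
  show "bounded_linear (\<lambda>v. cinner (e i) v *\<^sub>C e i)" for i
    by (rule bounded_linear_intro[of _ 1])
      (use cauchy_schwarz[of "e i"] in \<open>simp_all add: cinner_add_right scaleC_add_left norm_scaleC
        scaleR_scaleC scaleC_scaleC cinner_scaleC_right\<close>)
qed

lemma proj_apply: "proj n v = (\<Sum>i<n. cinner (e i) v *\<^sub>C e i)"
  unfolding proj_def by (rule bounded_linear_Blinfun_apply[OF bounded_linear_proj, THEN fun_cong])

lemma proj_bounded_ops [simp]: "proj n \<in> bounded_ops"
  by (simp add: bounded_ops_def proj_apply cinner_scaleC_right complex_vector.scale_sum_right scaleC_scaleC)

lemma cinner_e_proj: "cinner (e j) (proj n v) = (if j < n then cinner (e j) v else 0)"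
  by (simp add: proj_apply cinner_e_sum)

lemma proj_proj: "proj m (proj n v) = proj (min m n) v"
proof -
  have "proj m (proj n v) = (\<Sum>i<m. (if i < n then cinner (e i) v else 0) *\<^sub>C e i)"
    by (simp add: proj_apply[of m] cinner_e_proj)
  also have "\<dots> = (\<Sum>i<min m n. cinner (e i) v *\<^sub>C e i)"
    by (rule sum.mono_neutral_cong_right) auto
  finally show ?thesis by (simp add: proj_apply)
qed

lemma cinner_proj: "cinner (proj n v) w = cinner v (proj n w)"
  by (simp add: proj_apply cinner_sum_left cinner_sum_right cinner_scaleC_left cinner_scaleC_right
      cinner_commute[of v "e _"] mult.commute)

lemma norm_proj_sq: "(norm (proj n v))\<^sup>2 = (\<Sum>i<n. (cmod (cinner (e i) v))\<^sup>2)"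
  by (simp add: proj_apply norm_sum_e)

lemma norm_proj_pythagoras: "(norm v)\<^sup>2 = (norm (proj n v))\<^sup>2 + (norm (v - proj n v))\<^sup>2"
proof -
  have "cinner (proj n v) (proj n v) = cinner (proj n v) v" "cinner (proj n v) (proj n v) = cinner v (proj n v)"
    by (simp_all add: cinner_proj proj_proj)
  then show ?thesis unfolding norm_sq_cinner
    by (simp add: cinner_diff_left cinner_diff_right)
qed

lemma norm_proj_le: "norm (proj n v) \<le> norm v"
  by (rule power2_le_imp_le) (use norm_proj_pythagoras[of v n] in simp_all)

lemma proj_tendsto: "(\<lambda>n. proj n v) \<longlonglongrightarrow> v"
  using complete[of v] by (simp add: proj_apply)

lemma proj_e: "proj n (e i) = (if i < n then e i else 0)"
proof -
  have "proj n (e i) = (\<Sum>j<n. (if j = i then e j else 0))"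
    by (simp add: proj_apply ortho if_distrib[of "\<lambda>c. c *\<^sub>C _"] scaleC_one cong: if_cong)
  then show ?thesis by simp
qed

lemma e_eqI: "(\<And>i. cinner (e i) v = cinner (e i) w) \<Longrightarrow> v = w"
  by (rule LIMSEQ_unique[OF proj_tendsto[of v]]) (use proj_tendsto[of w] in \<open>simp add: proj_apply\<close>)

lemma summable_l2:
  assumes "summable (\<lambda>n. (cmod (c n))\<^sup>2)"
  shows "summable (\<lambda>n. c n *\<^sub>C e n)"
proof (rule summable_Cauchy[THEN iffD2], intro allI impI)
  fix r :: real assume r: "0 < r"
  then obtain N where N: "\<And>m n. m \<ge> N \<Longrightarrow> norm (\<Sum>i\<in>{m..<n}. (cmod (c i))\<^sup>2) < r\<^sup>2"
    using assms unfolding summable_Cauchy by (meson zero_less_power)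
  have "norm (\<Sum>i\<in>{m..<n}. c i *\<^sub>C e i) < r" if "m \<ge> N" for m n
  proof (rule power2_less_imp_less)
    show "(norm (\<Sum>i\<in>{m..<n}. c i *\<^sub>C e i))\<^sup>2 < r\<^sup>2"
      using N[OF that, of n] by (simp add: norm_sum_e) 
  qed (use r in simp)
  then show "\<exists>N. \<forall>m\<ge>N. \<forall>n. norm (\<Sum>i = m..<n. c i *\<^sub>C e i) < r" by blast
qed

lemma cinner_e_suminf:
  assumes "summable (\<lambda>n. (cmod (c n))\<^sup>2)"
  shows "cinner (e j) (\<Sum>n. c n *\<^sub>C e n) = c j"
proof -
  have "(\<lambda>N. cinner (e j) (\<Sum>n<N. c n *\<^sub>C e n)) \<longlonglongrightarrow> cinner (e j) (\<Sum>n. c n *\<^sub>C e n)"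
    by (intro tendsto_cinner tendsto_const summable_LIMSEQ[OF summable_l2[OF assms]])
  moreover have "(\<lambda>N. cinner (e j) (\<Sum>n<N. c n *\<^sub>C e n)) \<longlonglongrightarrow> c j"
    by (rule tendsto_eventually) (rule eventually_sequentiallyI[of "Suc j"], simp add: cinner_e_sum)
  ultimately show ?thesis by (rule LIMSEQ_unique)
qed

end

text \<open>
  The dimension grows by one, so the range of \<open>P (Suc n)\<close> contains a unit vector \<open>e n\<close> orthogonal to
  the range of \<open>P n\<close>, and a count of dimensions shows that \<open>P (Suc n) - P n\<close> is the projection onto
  its span.
\<close>

lemma projection_filtration_basis:
  fixes P :: "nat \<Rightarrow> 'h::chilbert_space \<Rightarrow>\<^sub>L 'h"
  assumes P: "projection_filtration P"
  shows "\<exists>e. orthonormal_basis e \<and> (\<forall>n. P n = orthonormal_basis.proj e n)"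
proof -
  have pr: "P n \<in> bounded_ops" "P n (P n x) = P n x" "cinner (P n x) y = cinner x (P n y)" for n x y
  proof -
    have o: "orthogonal_projection (P n)" using P by (simp add: projection_filtration_def)
    then show b: "P n \<in> bounded_ops" by (simp add: orthogonal_projection_def)
    have "P n o\<^sub>L P n = P n" using o by (simp add: orthogonal_projection_def)
    then show "P n (P n x) = P n x" by (metis blinfun_apply_blinfun_compose)
    show "cinner (P n x) y = cinner x (P n y)"
      using cinner_cadjoint[OF b, of x y] o by (simp add: orthogonal_projection_def)
  qed
  have fix_iff: "v \<in> range (P n) \<longleftrightarrow> P n v = v" for n v
    using pr(2) by (metis rangeE rangeI)
  have nest: "P n (P m x) = P m x" if "m \<le> n" for m n x
  proof -
    have "range (P m) \<subseteq> range (P n)" using P that by (simp add: projection_filtration_def)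
    then show ?thesis using fix_iff[of "P m x" n] by blast
  qed
  have nest': "P m (P n x) = P m x" if "m \<le> n" for m n x
    by (rule cinner_eqI) (simp add: pr(3) nest[OF that])
  have sub: "complex_vector.subspace (range (P n))" for n
    unfolding complex_vector.subspace_def fix_iff
    by (auto simp: blinfun.add_right blinfun.zero_right bounded_opsD[OF pr(1)] pr(2))
  have bas: "\<exists>B. finite B \<and> complex_vector.independent B \<and> complex_vector.span B = range (P n) \<and> card B = n" for n
  proof -
    obtain S where S: "finite S" "complex_vector.span S = range (P n)" and d: "complex_vector.dim (range (P n)) = n"
      using P unfolding projection_filtration_def by blast
    obtain B where B: "B \<subseteq> range (P n)" "complex_vector.independent B" "range (P n) \<subseteq> complex_vector.span B"
      "card B = complex_vector.dim (range (P n))"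
      by (rule complex_vector.basis_exists)
    have "finite B" using complex_vector.independent_span_bound[OF S(1) B(2)] B(1) S(2) by auto
    moreover have "complex_vector.span B = range (P n)"
      using complex_vector.span_minimal[OF B(1) sub] B(3) by auto
    ultimately show ?thesis using B d by auto
  qed
  have "\<exists>v. P (Suc n) v = v \<and> P n v \<noteq> v" for n
  proof (rule ccontr)
    assume "\<not> ?thesis"
    then have le: "range (P (Suc n)) \<subseteq> range (P n)" using fix_iff by blast
    obtain B where B: "finite B" "complex_vector.span B = range (P n)" "card B = n" using bas[of n] by blast
    obtain C where C: "complex_vector.independent C" "complex_vector.span C = range (P (Suc n))" "card C = Suc n"
      using bas[of "Suc n"] by blast
    have "C \<subseteq> complex_vector.span B" using le B(2) C(2) complex_vector.span_superset[of C] by auto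
    then show False using complex_vector.independent_span_bound[OF B(1) C(1)] B(3) C(3) by auto
  qed
  then obtain v where v: "\<And>n. P (Suc n) (v n) = v n" "\<And>n. P n (v n) \<noteq> v n" by metis
  define w where "w n = v n - P n (v n)" for n
  define e where "e n = (1 / norm (w n)) *\<^sub>R w n" for n
  have w: "w n \<noteq> 0" "P (Suc n) (w n) = w n" "P n (w n) = 0" for n
    using v[of n] by (auto simp: w_def blinfun.diff_right nest pr(2))
  have e: "norm (e n) = 1" "P (Suc n) (e n) = e n" "P n (e n) = 0" for n
    using w[of n] by (simp_all add: e_def blinfun.scaleR_right)
  have lt: "cinner (e i) (e j) = 0" if "i < j" for i j
  proof -
    have "P j (e i) = e i" using nest[of "Suc i" j "e i"] that by (simp add: e)
    then show ?thesis using pr(3)[of j "e i" "e j"] by (simp add: e cinner_zero_right)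
  qed
  have ortho: "cinner (e i) (e j) = (if i = j then 1 else 0)" for i j
  proof (cases i j rule: linorder_cases)
    case less then show ?thesis by (simp add: lt)
  next
    case equal then show ?thesis by (simp add: cinner_self e)
  next
    case greater
    have "cinner (e i) (e j) = cnj (cinner (e j) (e i))" by (rule cinner_commute)
    then show ?thesis using greater by (simp add: lt)
  qed
  have step: "P (Suc n) x = P n x + cinner (e n) x *\<^sub>C e n" for n x
  proof -
    obtain B where B: "finite B" "complex_vector.independent B" "complex_vector.span B = range (P n)" "card B = n"
      using bas[of n] by blast
    obtain C where C: "finite C" "complex_vector.span C = range (P (Suc n))" "card C = Suc n"
      using bas[of "Suc n"] by blast
    have en: "e n \<notin> complex_vector.span B" 
    proof
      assume "e n \<in> complex_vector.span B"
      then have "P n (e n) = e n" by (simp only: B(3) fix_iff)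
      then show False using e(1)[of n] e(3)[of n] by simp
    qed
    have enB: "e n \<notin> B" by (rule contra_subsetD[OF complex_vector.span_superset en])
    have ind: "complex_vector.independent (insert (e n) B)"
      using B(2) en by (simp add: complex_vector.independent_insert)
    let ?y = "P (Suc n) x"
    have "?y \<in> complex_vector.span (insert (e n) B)"
    proof (rule ccontr)
      assume y: "?y \<notin> complex_vector.span (insert (e n) B)"
      have yB: "?y \<notin> insert (e n) B" by (rule contra_subsetD[OF complex_vector.span_superset y])
      have "complex_vector.independent (insert ?y (insert (e n) B))"
        using ind y by (simp add: complex_vector.independent_insert)
      moreover have "insert ?y (insert (e n) B) \<subseteq> complex_vector.span C"
      proof -
        have "b \<in> range (P (Suc n))" if "b \<in> B" for b
        proof -
          have "b \<in> range (P n)" using that complex_vector.span_base B(3) by blast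
          then have "P n b = b" by (simp only: fix_iff)
          then have "P (Suc n) b = b" using nest[of n "Suc n" b] by simp
          then show ?thesis by (simp only: fix_iff)
        qed
        then show ?thesis unfolding C(2) using e(2)[of n] fix_iff[of "e n" "Suc n"] by blast
      qed
      ultimately have "card (insert ?y (insert (e n) B)) \<le> card C"
        using complex_vector.independent_span_bound[OF C(1)] by blast
      moreover have "card (insert ?y (insert (e n) B)) = Suc (Suc n)" using B enB yB by simp
      ultimately show False using C(3) by simp
    qed
    then obtain c where "?y - c *\<^sub>C e n \<in> complex_vector.span B"
      unfolding complex_vector.span_insert by blast
    then have z: "P n (?y - c *\<^sub>C e n) = ?y - c *\<^sub>C e n" unfolding B(3) fix_iff .
    then have y: "?y = P n x + c *\<^sub>C e n"
      by (simp add: blinfun.diff_right nest' bounded_opsD[OF pr(1)] e algebra_simps)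
    have "cinner (e n) (P n x) = 0" using pr(3)[of n "e n" x] by (simp add: e cinner_zero_left)
    moreover have "cinner (e n) ?y = cinner (e n) x" using pr(3)[of "Suc n" "e n" x] by (simp add: e)
    ultimately have "c = cinner (e n) x"
      using arg_cong[OF y, of "cinner (e n)"] by (simp add: cinner_add_right cinner_scaleC_right ortho)
    with y show ?thesis by simp
  qed
  have zero: "P 0 x = 0" for x
  proof -
    obtain B where "finite B" "complex_vector.span B = range (P 0)" "card B = 0" using bas[of 0] by blast
    then have "range (P 0) = {0}" by (auto simp: complex_vector.span_empty)
    then show ?thesis by (metis rangeI singletonD)
  qed
  have expand: "P n x = (\<Sum>i<n. cinner (e i) x *\<^sub>C e i)" for n x
    by (induction n) (simp_all add: zero step add.commute)
  have onb: "orthonormal_basis e"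
  proof
    show "(\<lambda>n. \<Sum>i<n. cinner (e i) v *\<^sub>C e i) \<longlonglongrightarrow> v" for v
      using P by (simp add: projection_filtration_def star_strong_limit_def expand)
  qed (rule ortho)
  have "P n = orthonormal_basis.proj e n" for n
    by (rule blinfun_eqI) (simp add: orthonormal_basis.proj_apply[OF onb] expand)
  with onb show ?thesis by blast
qed

section \<open>The representation of a faithful functional\<close>

text \<open>
  An element that depends linearly on its predecessors is sent to \<open>0\<close>, since \<open>1 / sqrt 0 = 0\<close>.
  The resulting sequence is orthonormal apart from such zeros.
\<close>

function gram_schmidt :: "('a \<Rightarrow> 'a::cstar_algebra \<Rightarrow> complex) \<Rightarrow> (nat \<Rightarrow> 'a) \<Rightarrow> nat \<Rightarrow> 'a" where
  "gram_schmidt ip s n =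
     (let g = s n - (\<Sum>i<n. ip (gram_schmidt ip s i) (s n) *\<^sub>C gram_schmidt ip s i)
      in (1 / sqrt (Re (ip g g))) *\<^sub>R g)"
  by pat_completeness auto
termination by (relation "Wellfounded.measure (\<lambda>(ip, s, n). n)") auto

declare gram_schmidt.simps [simp del]

text \<open>
  The dense sequence is orthonormalized for \<open>\<Phi> (a^* b)\<close>, so that no abstract completion is needed:
  the pre-Hilbert space embeds in any Hilbert space with an orthonormal basis.
\<close>

locale faithful_functional =
  fixes \<Phi> :: "'a::cstar_algebra \<Rightarrow> complex" and s :: "nat \<Rightarrow> 'a"
  assumes positive_functional: "positive_functional \<Phi>"
    and faithful: "\<Phi> (cstar a * a) = 0 \<Longrightarrow> a = 0"
    and dense: "r > 0 \<Longrightarrow> \<exists>n. dist x (s n) < r"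
begin

definition ip :: "'a \<Rightarrow> 'a \<Rightarrow> complex" where "ip a b = \<Phi> (cstar a * b)"

lemma \<Phi>_bounded_linear: "bounded_linear \<Phi>"
  and \<Phi>_scaleC: "\<Phi> (c *\<^sub>C a) = c * \<Phi> a"
  and \<Phi>_cstar: "\<Phi> (cstar a) = cnj (\<Phi> a)"
  and \<Phi>_nonneg: "0 \<le> Re (\<Phi> (cstar a * a))"
  using positive_functional by (simp_all add: positive_functional_def)

lemma \<Phi>_add: "\<Phi> (a + b) = \<Phi> a + \<Phi> b" and \<Phi>_diff: "\<Phi> (a - b) = \<Phi> a - \<Phi> b"
  and \<Phi>_zero: "\<Phi> 0 = 0" and \<Phi>_scaleR: "\<Phi> (r *\<^sub>R a) = r *\<^sub>R \<Phi> a"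
  using \<Phi>_bounded_linear by (simp_all add: linear_simps)

lemma ip_add_right: "ip a (b + c) = ip a b + ip a c"
  and ip_diff_right: "ip a (b - c) = ip a b - ip a c"
  and ip_scaleC_right: "ip a (z *\<^sub>C b) = z * ip a b"
  and ip_scaleR_right: "ip a (r *\<^sub>R b) = r * ip a b"
  and ip_zero_right [simp]: "ip a 0 = 0"
  by (simp_all add: ip_def distrib_left right_diff_distrib \<Phi>_add \<Phi>_diff \<Phi>_scaleC \<Phi>_scaleR \<Phi>_zero
      mult_scaleC_right scaleR_conv_of_real)

lemma ip_commute: "ip a b = cnj (ip b a)"
  by (simp add: ip_def \<Phi>_cstar[symmetric] cstar_mult cstar_cstar)

lemma ip_add_left: "ip (a + b) c = ip a c + ip b c"
  and ip_diff_left: "ip (a - b) c = ip a c - ip b c"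
  and ip_scaleC_left: "ip (z *\<^sub>C a) c = cnj z * ip a c"
  and ip_scaleR_left: "ip (r *\<^sub>R a) c = r * ip a c"
  and ip_zero_left [simp]: "ip 0 a = 0"
  by (simp_all add: ip_def cstar_add cstar_diff cstar_scaleC cstar_scaleR distrib_right left_diff_distrib
      \<Phi>_add \<Phi>_diff \<Phi>_scaleC \<Phi>_scaleR \<Phi>_zero mult_scaleC_left scaleR_conv_of_real)

lemma ip_sum_right: "ip a (\<Sum>i\<in>F. f i) = (\<Sum>i\<in>F. ip a (f i))"
  by (induction F rule: infinite_finite_induct) (simp_all add: ip_add_right)

lemma ip_sum_left: "ip (\<Sum>i\<in>F. f i) a = (\<Sum>i\<in>F. ip (f i) a)"
  by (induction F rule: infinite_finite_induct) (simp_all add: ip_add_left)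

lemma ip_nonneg: "0 \<le> Re (ip a a)" and ip_real: "Im (ip a a) = 0"
  using \<Phi>_nonneg[of a] arg_cong[OF ip_commute[of a a], of Im] by (simp_all add: ip_def)

lemma ip_self: "ip a a = complex_of_real (Re (ip a a))"
  by (simp add: complex_eq_iff ip_real)

lemma ip_eq_0: "Re (ip a a) = 0 \<Longrightarrow> a = 0"
  using faithful[of a] ip_self[of a] by (simp add: ip_def)

lemma ip_bound: "\<exists>K. \<forall>a. Re (ip a a) \<le> K * (norm a)\<^sup>2"
proof -
  obtain K where K: "\<And>a. norm (\<Phi> a) \<le> norm a * K" using bounded_linear.bounded[OF \<Phi>_bounded_linear] by blast
  have "Re (ip a a) \<le> K * (norm a)\<^sup>2" for a
    using complex_Re_le_cmod[of "ip a a"] K[of "cstar a * a"] by (simp add: ip_def cstar_identity mult.commute)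
  then show ?thesis by blast
qed

lemma ip_amgm: "cmod (ip a b) \<le> Re (ip a a) + Re (ip b b)"
proof -
  have R: "2 * \<bar>Re (ip a b)\<bar> \<le> Re (ip a a) + Re (ip b b)" for a b
  proof -
    have "Re (ip b a) = Re (ip a b)" using arg_cong[OF ip_commute[of b a], of Re] by simp
    then show ?thesis using ip_nonneg[of "a + b"] ip_nonneg[of "a - b"]
      by (auto simp: ip_add_left ip_add_right ip_diff_left ip_diff_right)
  qed
  have "2 * \<bar>Im (ip a b)\<bar> \<le> Re (ip a a) + Re (ip b b)"
    using R[of a "\<i> *\<^sub>C b"] by (simp add: ip_scaleC_right ip_scaleC_left)
  with R[of a b] cmod_le[of "ip a b"] show ?thesis by linarith
qed

text \<open>
  Positivity of \<open>\<Phi>\<close> on \<open>norm a^2 b^* b - (a b)^* (a b)\<close>, which has the form \<open>c^* c\<close>; it makes left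
  multiplication by \<open>a\<close> bounded.
\<close>

lemma ip_mult_le: "Re (ip (a * b) (a * b)) \<le> (norm a)\<^sup>2 * Re (ip b b)"
proof -
  obtain c where c: "cstar c * c = (norm a)\<^sup>2 *\<^sub>R (cstar b * b) - cstar (a * b) * (a * b)"
    by (rule contractive_identity_conj)
  have "0 \<le> Re (\<Phi> (cstar c * c))" by (rule \<Phi>_nonneg)
  then show ?thesis unfolding c by (simp add: \<Phi>_diff \<Phi>_scaleR ip_def)
qed

definition g :: "nat \<Rightarrow> 'a" where "g = gram_schmidt ip s"

definition g' :: "nat \<Rightarrow> 'a" where "g' n = s n - (\<Sum>i<n. ip (g i) (s n) *\<^sub>C g i)"

lemma g_eq: "g n = (1 / sqrt (Re (ip (g' n) (g' n)))) *\<^sub>R g' n"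
  unfolding g_def g'_def by (subst gram_schmidt.simps) (simp add: Let_def)

lemma g_norm: "g n = 0 \<or> ip (g n) (g n) = 1"
proof (cases "Re (ip (g' n) (g' n)) = 0")
  case False
  then have "ip (g n) (g n) = of_real (1 / sqrt (Re (ip (g' n) (g' n))) * (1 / sqrt (Re (ip (g' n) (g' n)))) * Re (ip (g' n) (g' n)))"
    by (subst (1 2) g_eq) (subst ip_self, simp add: ip_scaleR_left ip_scaleR_right)
  also have "\<dots> = 1" using False ip_nonneg[of "g' n"] by (simp add: real_div_sqrt)
  finally show ?thesis ..
qed (simp add: g_eq)

lemma ip_g_lt: "\<forall>i<n. ip (g i) (g n) = 0"
proof (induction n rule: less_induct)
  case (less n)
  have orth: "ip (g i) (g j) = 0" if "i < n" "j < n" "i \<noteq> j" for i j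
    using less that ip_commute[of "g i" "g j"] by (cases i j rule: linorder_cases) auto
  have "ip (g i) (g' n) = 0" if i: "i < n" for i
  proof -
    have "(\<Sum>j<n. ip (g j) (s n) * ip (g i) (g j)) = (\<Sum>j<n. if j = i then ip (g i) (s n) else 0)"
    proof (rule sum.cong)
      fix j assume "j \<in> {..<n}"
      then show "ip (g j) (s n) * ip (g i) (g j) = (if j = i then ip (g i) (s n) else 0)"
        using orth[OF i] g_norm[of i] by (cases "g i = 0") auto
    qed simp
    then show ?thesis using i by (simp add: g'_def ip_diff_right ip_sum_right ip_scaleC_right)
  qed
  then show ?case by (simp add: g_eq ip_scaleR_right)
qed

lemma ip_g: "ip (g i) (g j) = (if i = j \<and> g i \<noteq> 0 then 1 else 0)"
proof (cases i j rule: linorder_cases)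
  case less then show ?thesis using ip_g_lt by simp
next
  case equal then show ?thesis using g_norm[of j] by auto
next
  case greater
  have "ip (g i) (g j) = cnj (ip (g j) (g i))" by (rule ip_commute)
  then show ?thesis using greater ip_g_lt by simp
qed

definition partial :: "nat \<Rightarrow> 'a \<Rightarrow> 'a" where
  "partial N a = (\<Sum>n<N. ip (g n) a *\<^sub>C g n)"

lemma ip_g_partial: "ip (g j) (partial N a) = (if j < N then ip (g j) a else 0)"
proof -
  have "ip (g j) (partial N a) = (\<Sum>n<N. if n = j then ip (g j) a else 0)"
    unfolding partial_def ip_sum_right
    by (rule sum.cong) (auto simp: ip_scaleC_right ip_g)
  then show ?thesis by simp
qed

lemma ip_partial_partial: "ip (partial N a) (partial N b) = (\<Sum>n<N. cnj (ip (g n) a) * ip (g n) b)"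
proof -
  have "ip (partial N a) (partial N b) = (\<Sum>n<N. cnj (ip (g n) a) * ip (g n) (partial N b))"
    unfolding partial_def[of N a] by (simp add: ip_sum_left ip_scaleC_left)
  then show ?thesis by (simp add: ip_g_partial)
qed

lemma ip_partial: "ip (partial N a) b = ip (partial N a) (partial N b)"
  "ip a (partial N b) = ip (partial N a) (partial N b)"
proof -
  have l: "ip (partial N a) b = (\<Sum>n<N. cnj (ip (g n) a) * ip (g n) b)" for a b
    unfolding partial_def[of N a] by (simp add: ip_sum_left ip_scaleC_left)
  show "ip (partial N a) b = ip (partial N a) (partial N b)" by (simp add: l ip_partial_partial)
  have "ip a (partial N b) = cnj (ip (partial N b) a)" by (rule ip_commute)
  then show "ip a (partial N b) = ip (partial N a) (partial N b)"
    by (simp add: l ip_partial_partial mult.commute)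
qed

lemma ip_residual: "ip (a - partial N a) (b - partial N b) = ip a b - ip (partial N a) (partial N b)"
  by (simp add: ip_diff_left ip_diff_right ip_partial(1)[of N a b] ip_partial(2)[of a N b])

lemma partial_s:
  assumes "k < N" shows "partial N (s k) = s k"
proof -
  have gs: "g' k = ip (g k) (s k) *\<^sub>C g k"
  proof (cases "g' k = 0")
    case True then show ?thesis by (simp add: g_eq)
  next
    case False
    define r where "r = sqrt (Re (ip (g' k) (g' k)))"
    have "Re (ip (g' k) (g' k)) \<noteq> 0" using ip_eq_0 False by blast
    then have r: "r \<noteq> 0" "g k = (1 / r) *\<^sub>R g' k" by (simp_all add: r_def g_eq)
    then have g'g: "g' k = r *\<^sub>R g k" by simp
    have "ip (g k) (g' k) = ip (g k) (s k)"
    proof -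
      have "(\<Sum>i<k. ip (g i) (s k) * ip (g k) (g i)) = 0" by (rule sum.neutral) (simp add: ip_g)
      then show ?thesis by (simp add: g'_def ip_diff_right ip_sum_right ip_scaleC_right)
    qed
    moreover have "g k \<noteq> 0" using False g'g by auto
    ultimately have "ip (g k) (s k) = r" using g'g g_norm[of k] by (simp add: ip_scaleR_right)
    then show ?thesis using g'g by (simp add: scaleR_scaleC)
  qed
  have "s k = g' k + (\<Sum>i<k. ip (g i) (s k) *\<^sub>C g i)" by (simp add: g'_def)
  also have "\<dots> = (\<Sum>i<Suc k. ip (g i) (s k) *\<^sub>C g i)" using gs by (simp add: add.commute)
  finally have sk: "s k = partial (Suc k) (s k)" by (simp add: partial_def)
  have "ip (g n) (s k) = 0" if "n \<ge> Suc k" for n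
    using arg_cong[OF sk, of "ip (g n)"] that by (simp add: ip_g_partial)
  then have "partial N (s k) = partial (Suc k) (s k)"
    unfolding partial_def by (intro sum.mono_neutral_right) (use assms in auto)
  with sk show ?thesis by simp
qed

lemma partial_diff: "partial N (a - b) = partial N a - partial N b"
  by (simp add: partial_def ip_diff_right complex_vector.scale_left_diff_distrib sum_subtractf)

text \<open>
  The residual does not change when \<open>s k\<close> is subtracted from \<open>a\<close>, as soon as \<open>N > k\<close>, and Bessel's
  inequality bounds the residual of the small element \<open>a - s k\<close>.
\<close>

lemma residual_tendsto: "(\<lambda>N. Re (ip (a - partial N a) (a - partial N a))) \<longlonglongrightarrow> 0"
proof -
  obtain K where K: "\<And>a. Re (ip a a) \<le> K * (norm a)\<^sup>2" using ip_bound by blast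
  have K1: "0 \<le> \<bar>K\<bar> + 1" by simp
  show ?thesis
  proof (rule LIMSEQ_I)
    fix r :: real assume r: "0 < r"
    define d where "d = sqrt (r / (\<bar>K\<bar> + 1))"
    have d: "0 < d" using r by (simp add: d_def add_nonneg_pos)
    obtain k where k: "norm (a - s k) < d" using dense[OF d, of a] by (auto simp: dist_norm)
    have "Re (ip (a - partial N a) (a - partial N a)) < r" if "N \<ge> Suc k" for N
    proof -
      have "a - partial N a = (a - s k) - partial N (a - s k)"
        using partial_s[of k N] that by (simp add: partial_diff)
      then have "Re (ip (a - partial N a) (a - partial N a))
          = Re (ip (a - s k) (a - s k)) - Re (ip (partial N (a - s k)) (partial N (a - s k)))"
        by (simp only: ip_residual) simp
      also have "\<dots> \<le> K * (norm (a - s k))\<^sup>2" using K[of "a - s k"] ip_nonneg[of "partial N (a - s k)"] by linarith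
      also have "\<dots> \<le> \<bar>K\<bar> * (norm (a - s k))\<^sup>2" by (intro mult_right_mono) auto
      also have "\<dots> \<le> \<bar>K\<bar> * d\<^sup>2" using k by (intro mult_left_mono power_mono) auto
      also have "\<dots> < (\<bar>K\<bar> + 1) * d\<^sup>2" using d by simp
      also have "\<dots> = r" using r by (simp add: d_def)
      finally show ?thesis .
    qed
    then show "\<exists>no. \<forall>n\<ge>no. norm (Re (ip (a - partial n a) (a - partial n a)) - 0) < r"
      using ip_nonneg by (intro exI[of _ "Suc k"]) simp
  qed
qed

lemma parseval_ip: "(\<lambda>n. cnj (ip (g n) a) * ip (g n) b) sums ip a b"
proof -
  have "(\<lambda>N. Re (ip (a - partial N a) (a - partial N a)) + Re (ip (b - partial N b) (b - partial N b))) \<longlonglongrightarrow> 0 + 0"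
    by (intro tendsto_add residual_tendsto)
  then have lim: "(\<lambda>N. Re (ip (a - partial N a) (a - partial N a)) + Re (ip (b - partial N b) (b - partial N b))) \<longlonglongrightarrow> 0"
    by simp
  have "(\<lambda>N. ip a b - ip (partial N a) (partial N b)) \<longlonglongrightarrow> 0"
    unfolding ip_residual[symmetric]
    by (rule Lim_null_comparison[OF always_eventually lim]) (simp add: ip_amgm)
  then have "(\<lambda>N. ip a b - (ip a b - ip (partial N a) (partial N b))) \<longlonglongrightarrow> ip a b - 0"
    by (intro tendsto_diff tendsto_const)
  then show ?thesis by (simp add: sums_def ip_partial_partial)
qed

end

locale gns = faithful_functional \<Phi> s + orthonormal_basis e
  for \<Phi> :: "'a::cstar_algebra \<Rightarrow> complex" and s and e :: "nat \<Rightarrow> 'h::chilbert_space"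
begin

lemma summable_coeffs: "summable (\<lambda>n. (cmod (ip (g n) a))\<^sup>2)"
proof -
  have "summable (\<lambda>n. Re (cnj (ip (g n) a) * ip (g n) a))"
    using sums_summable[OF parseval_ip[of a a]] by (rule summable_Re)
  moreover have "Re (cnj z * z) = (cmod z)\<^sup>2" for z using cmod_power2[of z] by (simp add: power2_eq_square)
  ultimately show ?thesis by simp
qed

text \<open>
  The isometry from \<open>A\<close> with the inner product \<open>ip\<close> into \<open>H\<close> that sends \<open>g n\<close> to \<open>e n\<close>; if
  \<open>g n = 0\<close>, its range is orthogonal to \<open>e n\<close>.
\<close>

definition vec :: "'a \<Rightarrow> 'h" where "vec a = (\<Sum>n. ip (g n) a *\<^sub>C e n)"

lemma cinner_e_vec: "cinner (e n) (vec a) = ip (g n) a"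
  unfolding vec_def by (rule cinner_e_suminf[OF summable_coeffs])

lemma vec_add: "vec (a + b) = vec a + vec b"
  and vec_scaleC: "vec (c *\<^sub>C a) = c *\<^sub>C vec a"
  and vec_diff: "vec (a - b) = vec a - vec b"
  by (rule e_eqI; simp add: cinner_e_vec cinner_add_right cinner_diff_right cinner_scaleC_right
      ip_add_right ip_scaleC_right ip_diff_right)+

lemma cinner_vec: "(\<lambda>n. cnj (ip (g n) a) * cinner (e n) x) sums cinner (vec a) x"
proof -
  have "(\<lambda>N. cinner (\<Sum>n<N. ip (g n) a *\<^sub>C e n) x) \<longlonglongrightarrow> cinner (vec a) x"
    unfolding vec_def
    by (intro tendsto_cinner tendsto_const summable_LIMSEQ[OF summable_l2[OF summable_coeffs]])
  then show ?thesis by (simp add: sums_def cinner_sum_left cinner_scaleC_left)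
qed

lemma cinner_vec_vec: "cinner (vec a) (vec b) = ip a b"
  using sums_unique2[OF cinner_vec[of a "vec b"]] parseval_ip[of a b] by (simp add: cinner_e_vec)

lemma norm_vec: "(norm (vec a))\<^sup>2 = Re (ip a a)"
  by (simp add: norm_sq_cinner cinner_vec_vec)

lemma norm_vec_mult: "norm (vec (a * b)) \<le> norm a * norm (vec b)"
  by (rule power2_le_imp_le) (simp_all add: norm_vec power_mult_distrib ip_mult_le)

text \<open>
  Elements of \<open>A\<close> whose images under \<open>vec\<close> converge to the projection of \<open>x\<close> onto the closure of the
  range of \<open>vec\<close>.
\<close>

definition approx :: "nat \<Rightarrow> 'h \<Rightarrow> 'a" where
  "approx N x = (\<Sum>n<N. cinner (e n) x *\<^sub>C g n)"

lemma approx_add: "approx N (x + y) = approx N x + approx N y"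
  and approx_scaleC: "approx N (c *\<^sub>C x) = c *\<^sub>C approx N x"
  by (simp_all add: approx_def cinner_add_right cinner_scaleC_right scaleC_add_left sum.distrib
      complex_vector.scale_sum_right scaleC_scaleC)

lemma norm_vec_approx_diff:
  assumes "M \<le> N" shows "norm (vec (approx N x - approx M x)) \<le> norm (proj N x - proj M x)"
proof (rule power2_le_imp_le)
  have split: "{..<N} = {..<M} \<union> {M..<N}" using assms by auto
  have "approx N x - approx M x = (\<Sum>n\<in>{M..<N}. cinner (e n) x *\<^sub>C g n)"
    unfolding approx_def split by (subst sum.union_disjoint) auto
  moreover have "vec (\<Sum>n\<in>F. c n *\<^sub>C g n) = (\<Sum>n\<in>F. (if g n = 0 then 0 else c n) *\<^sub>C e n)" if "finite F" for F and c :: "nat \<Rightarrow> complex"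
  proof (rule e_eqI)
    fix i
    have "ip (g i) (\<Sum>n\<in>F. c n *\<^sub>C g n) = (\<Sum>n\<in>F. if n = i then (if g i = 0 then 0 else c i) else 0)"
      unfolding ip_sum_right by (rule sum.cong) (auto simp: ip_scaleC_right ip_g)
    then show "cinner (e i) (vec (\<Sum>n\<in>F. c n *\<^sub>C g n)) = cinner (e i) (\<Sum>n\<in>F. (if g n = 0 then 0 else c n) *\<^sub>C e n)"
      using that by (simp add: cinner_e_vec cinner_e_sum)
  qed
  ultimately have "vec (approx N x - approx M x) = (\<Sum>n\<in>{M..<N}. (if g n = 0 then 0 else cinner (e n) x) *\<^sub>C e n)"
    by simp
  then have "(norm (vec (approx N x - approx M x)))\<^sup>2 = (\<Sum>n\<in>{M..<N}. (cmod (if g n = 0 then 0 else cinner (e n) x))\<^sup>2)"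
    by (simp add: norm_sum_e)
  also have "\<dots> \<le> (\<Sum>n\<in>{M..<N}. (cmod (cinner (e n) x))\<^sup>2)" by (rule sum_mono) simp
  also have "\<dots> = (norm (\<Sum>n\<in>{M..<N}. cinner (e n) x *\<^sub>C e n))\<^sup>2" by (simp add: norm_sum_e)
  also have "(\<Sum>n\<in>{M..<N}. cinner (e n) x *\<^sub>C e n) = proj N x - proj M x"
    unfolding proj_apply split by (subst sum.union_disjoint) auto
  finally show "(norm (vec (approx N x - approx M x)))\<^sup>2 \<le> (norm (proj N x - proj M x))\<^sup>2" .
qed simp

lemma norm_vec_approx: "norm (vec (approx N x)) \<le> norm x"
proof -
  have "approx 0 x = 0" "proj 0 x = 0" by (simp_all add: approx_def proj_apply)
  then show ?thesis using norm_vec_approx_diff[of 0 N x] norm_proj_le[of N x] by simp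
qed

lemma Cauchy_vec_approx: "Cauchy (\<lambda>N. vec (a * approx N x))"
proof (rule CauchyI)
  fix r :: real assume r: "0 < r"
  have "Cauchy (\<lambda>N. proj N x)" by (rule LIMSEQ_imp_Cauchy[OF proj_tendsto])
  then obtain K where K: "\<And>m n. m \<ge> K \<Longrightarrow> n \<ge> K \<Longrightarrow> norm (proj m x - proj n x) < r / (norm a + 1)"
    using CauchyD[of "\<lambda>N. proj N x" "r / (norm a + 1)"] r by (auto simp: add_nonneg_pos)
  have le: "norm (vec (a * approx m x) - vec (a * approx n x)) < r" if "n \<ge> K" "n \<le> m" for m n
  proof -
    have "norm (vec (a * approx m x) - vec (a * approx n x)) = norm (vec (a * (approx m x - approx n x)))"
      by (simp add: vec_diff right_diff_distrib)
    also have "\<dots> \<le> norm a * norm (proj m x - proj n x)"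
      using norm_vec_mult[of a "approx m x - approx n x"] norm_vec_approx_diff[OF that(2), of x]
      by (meson mult_left_mono norm_ge_zero order_trans)
    also have "\<dots> \<le> norm a * (r / (norm a + 1))" using K[of m n] that by (intro mult_left_mono) auto
    also have "\<dots> < r"
    proof -
      have "0 < norm a + 1" by (simp add: add_nonneg_pos)
      then show ?thesis using r
        by (simp only: times_divide_eq_right pos_divide_less_eq) (simp add: algebra_simps)
    qed
    finally show ?thesis .
  qed
  then show "\<exists>M. \<forall>m\<ge>M. \<forall>n\<ge>M. norm (vec (a * approx m x) - vec (a * approx n x)) < r"
  proof (intro exI[of _ K] allI impI)
    fix m n assume "K \<le> m" "K \<le> n"
    then show "norm (vec (a * approx m x) - vec (a * approx n x)) < r"
      using le[of n m] le[of m n] by (cases "n \<le> m") (auto simp: norm_minus_commute)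
  qed
qed

definition rep_fun :: "'a \<Rightarrow> 'h \<Rightarrow> 'h" where
  "rep_fun a x = lim (\<lambda>N. vec (a * approx N x))"

lemma rep_fun_lim: "(\<lambda>N. vec (a * approx N x)) \<longlonglongrightarrow> rep_fun a x"
  unfolding rep_fun_def using Cauchy_vec_approx Cauchy_convergent_iff convergent_LIMSEQ_iff by blast

lemma rep_fun_eqI: "(\<lambda>N. vec (a * approx N x)) \<longlonglongrightarrow> y \<Longrightarrow> rep_fun a x = y"
  using rep_fun_lim LIMSEQ_unique by blast

lemma rep_fun_scaleC: "rep_fun a (c *\<^sub>C x) = c *\<^sub>C rep_fun a x"
proof (rule rep_fun_eqI)
  show "(\<lambda>N. vec (a * approx N (c *\<^sub>C x))) \<longlonglongrightarrow> c *\<^sub>C rep_fun a x"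
    unfolding approx_scaleC mult_scaleC_right vec_scaleC
    by (rule bounded_linear.tendsto[OF bounded_linear_scaleC rep_fun_lim])
qed

lemma bounded_linear_rep_fun: "bounded_linear (rep_fun a)"
proof (rule bounded_linear_intro)
  show add: "rep_fun a (x + y) = rep_fun a x + rep_fun a y" for x y
    by (rule rep_fun_eqI) (simp add: approx_add distrib_left vec_add tendsto_add rep_fun_lim)
  show "rep_fun a (r *\<^sub>R x) = r *\<^sub>R rep_fun a x" for r x
    by (simp add: scaleR_scaleC rep_fun_scaleC)
  show "norm (rep_fun a x) \<le> norm x * norm a" for x
  proof (rule LIMSEQ_le_const2[OF tendsto_norm[OF rep_fun_lim]], intro exI allI impI)
    show "norm (vec (a * approx n x)) \<le> norm x * norm a" for n
      using norm_vec_mult[of a "approx n x"] mult_left_mono[OF norm_vec_approx[of n x], of "norm a"]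
      by (simp add: mult.commute)
  qed
qed

text \<open>
  Left multiplication on the closure of the range of \<open>vec\<close>, and zero on its orthogonal complement.
\<close>

definition rep :: "'a \<Rightarrow> 'h \<Rightarrow>\<^sub>L 'h" where "rep a = Blinfun (rep_fun a)"

lemma rep_apply: "rep a x = rep_fun a x"
  by (simp add: rep_def bounded_linear_Blinfun_apply[OF bounded_linear_rep_fun])

lemma approx_vec: "approx N (vec b) = partial N b"
  by (simp add: approx_def partial_def cinner_e_vec)

lemma norm_vec_residual: "(\<lambda>N. norm (vec (b - partial N b))) \<longlonglongrightarrow> 0"
proof -
  have "(\<lambda>N. sqrt (Re (ip (b - partial N b) (b - partial N b)))) \<longlonglongrightarrow> sqrt 0"
    by (intro tendsto_real_sqrt residual_tendsto)
  then show ?thesis by (simp add: norm_vec[symmetric])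
qed

lemma rep_vec: "rep a (vec b) = vec (a * b)"
  unfolding rep_apply
proof (rule rep_fun_eqI)
  have "(\<lambda>N. vec (a * b) - vec (a * approx N (vec b))) \<longlonglongrightarrow> 0"
  proof (rule Lim_null_comparison[OF always_eventually])
    show "\<forall>N. norm (vec (a * b) - vec (a * approx N (vec b))) \<le> norm a * norm (vec (b - partial N b))"
      using norm_vec_mult[of a "b - partial _ b"] by (simp add: approx_vec vec_diff right_diff_distrib)
    show "(\<lambda>N. norm a * norm (vec (b - partial N b))) \<longlonglongrightarrow> 0"
      using tendsto_mult[OF tendsto_const norm_vec_residual[of b], of "norm a"] by simp
  qed
  from tendsto_diff[OF tendsto_const this, of "vec (a * b)"]
  show "(\<lambda>N. vec (a * approx N (vec b))) \<longlonglongrightarrow> vec (a * b)" by simp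
qed

lemma cinner_vec_approx: "(\<lambda>N. cinner (vec c) (vec (approx N x))) \<longlonglongrightarrow> cinner (vec c) x"
proof -
  have "cinner (vec c) (vec (approx N x)) = (\<Sum>n<N. cnj (ip (g n) c) * cinner (e n) x)" for N
  proof -
    have "ip c (g n) = cnj (ip (g n) c)" for n by (rule ip_commute)
    then show ?thesis by (simp add: cinner_vec_vec approx_def ip_sum_right ip_scaleC_right mult.commute)
  qed
  then show ?thesis using cinner_vec[of c x] by (simp add: sums_def)
qed

text \<open>
  The values of \<open>rep a\<close> lie in the closure of the range of \<open>vec\<close>, where replacing \<open>x\<close> by its
  projection makes no difference.
\<close>

lemma cinner_rep_approx: "(\<lambda>N. cinner (rep a y) (vec (approx N x))) \<longlonglongrightarrow> cinner (rep a y) x"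
proof (rule LIMSEQ_I)
  fix r :: real assume r: "0 < r"
  define d where "d = r / (4 * (norm x + 1))"
  have d: "d > 0" using r by (simp add: d_def add_nonneg_pos)
  obtain M where M: "norm (vec (a * approx M y) - rep a y) < d"
    using LIMSEQ_D[OF rep_fun_lim[of a y] d] by (auto simp: rep_apply)
  define c where "c = a * approx M y"
  obtain N0 where N0: "\<And>N. N \<ge> N0 \<Longrightarrow> norm (cinner (vec c) (vec (approx N x)) - cinner (vec c) x) < r / 2"
    using LIMSEQ_D[OF cinner_vec_approx[of c x], of "r / 2"] r by auto
  have "norm (cinner (rep a y) (vec (approx N x)) - cinner (rep a y) x) < r" if "N \<ge> N0" for N
  proof -
    let ?v = "vec (approx N x)"
    have b: "norm (cinner (vec c - rep a y) z) \<le> d * norm x" if "norm z \<le> norm x" for z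
    proof (rule order_trans[OF cauchy_schwarz mult_mono[OF _ that]])
      show "norm (vec c - rep a y) \<le> d" using M by (simp add: c_def)
    qed (use d in simp_all)
    define A B C where "A = cinner (vec c) ?v - cinner (vec c) x"
      and "B = cinner (vec c - rep a y) ?v" and "C = cinner (vec c - rep a y) x"
    have "cinner (rep a y) ?v - cinner (rep a y) x = A - B + C"
      unfolding A_def B_def C_def cinner_diff_left by (simp add: algebra_simps)
    moreover have "norm (A - B + C) \<le> norm A + norm B + norm C"
      using norm_triangle_ineq[of "A - B" C] norm_triangle_ineq4[of A B] by linarith
    moreover have "norm A < r / 2" unfolding A_def by (rule N0[OF that])
    moreover have "norm B \<le> d * norm x" unfolding B_def by (rule b[OF norm_vec_approx])
    moreover have "norm C \<le> d * norm x" unfolding C_def by (rule b[OF order_refl])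
    moreover have "d * norm x + d * norm x \<le> r / 2"
    proof -
      have "r / (4 * K) * K = r / 4" if "K \<noteq> 0" for K by (simp add: that)
      moreover have "norm x + 1 \<noteq> 0" using norm_ge_zero[of x] by linarith
      ultimately have eq: "d * (norm x + 1) = r / 4" unfolding d_def by blast
      have "2 * (d * norm x) \<le> 2 * (d * (norm x + 1))" using d by simp
      also have "\<dots> = r / 2" unfolding eq by simp
      finally show ?thesis by simp
    qed
    ultimately show ?thesis by simp
  qed
  then show "\<exists>no. \<forall>n\<ge>no. norm (cinner (rep a y) (vec (approx n x)) - cinner (rep a y) x) < r" by blast
qed

text \<open>
  Injectivity is tested on the vector of \<open>(a - b)^*\<close>, which \<open>rep a - rep b\<close> sends to the vector of
  \<open>(a - b) (a - b)^*\<close>.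
\<close>

lemma embedding_rep: "embedding bounded_op_alg rep"
  unfolding embedding_def star_hom_def bounded_op_alg_simps
proof (intro conjI allI)
  show bo: "rep a \<in> bounded_ops" for a by (simp add: bounded_ops_def rep_apply rep_fun_scaleC)
  show "rep (a + b) = rep a + rep b" for a b
    by (rule blinfun_eqI, simp add: rep_apply blinfun.add_left, rule rep_fun_eqI)
      (simp add: distrib_right vec_add tendsto_add rep_fun_lim)
  show "rep (c *\<^sub>C a) = scale_op c (rep a)" for c a
    by (rule blinfun_eqI, simp add: rep_apply, rule rep_fun_eqI)
      (simp add: mult_scaleC_left vec_scaleC bounded_linear.tendsto[OF bounded_linear_scaleC rep_fun_lim])
  show "rep (a * b) = rep a o\<^sub>L rep b" for a b
  proof (rule blinfun_eqI)
    fix x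
    have "(\<lambda>N. rep a (vec (b * approx N x))) \<longlonglongrightarrow> rep a (rep_fun b x)"
      by (intro blinfun.tendsto tendsto_const rep_fun_lim)
    then have "(\<lambda>N. vec (a * b * approx N x)) \<longlonglongrightarrow> rep a (rep_fun b x)" by (simp add: rep_vec mult.assoc)
    then have "rep_fun (a * b) x = rep a (rep_fun b x)" by (rule rep_fun_eqI)
    then show "rep (a * b) x = (rep a o\<^sub>L rep b) x" by (simp add: rep_apply)
  qed
  show "rep (cstar a) = cadjoint (rep a)" for a
  proof (rule cadjoint_eqI[OF bo, symmetric])
    fix x y
    have m: "cinner (vec (cstar a * b)) (vec c) = cinner (vec b) (vec (a * c))" for b c
      by (simp add: cinner_vec_vec ip_def cstar_mult cstar_cstar mult.assoc)
    have 1: "cinner (vec (cstar a * b)) y = cinner (vec b) (rep a y)" for b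
    proof (rule LIMSEQ_unique[OF cinner_vec_approx])
      show "(\<lambda>N. cinner (vec (cstar a * b)) (vec (approx N y))) \<longlonglongrightarrow> cinner (vec b) (rep a y)"
        unfolding m rep_apply by (intro tendsto_cinner tendsto_const rep_fun_lim)
    qed
    have "(\<lambda>N. cinner (vec (cstar a * approx N x)) y) \<longlonglongrightarrow> cinner (rep (cstar a) x) y"
      unfolding rep_apply by (intro tendsto_cinner tendsto_const rep_fun_lim)
    then have "(\<lambda>N. cinner (vec (approx N x)) (rep a y)) \<longlonglongrightarrow> cinner (rep (cstar a) x) y" by (simp add: 1)
    then have "(\<lambda>N. cnj (cinner (vec (approx N x)) (rep a y))) \<longlonglongrightarrow> cnj (cinner (rep (cstar a) x) y)"
      by (rule tendsto_cnj)
    then have "(\<lambda>N. cinner (rep a y) (vec (approx N x))) \<longlonglongrightarrow> cinner y (rep (cstar a) x)"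
      by (simp only: cinner_commute[symmetric])
    then have "cinner y (rep (cstar a) x) = cinner (rep a y) x"
      using cinner_rep_approx LIMSEQ_unique by blast
    then show "cinner (rep (cstar a) x) y = cinner x (rep a y)" 
      using cinner_commute[of "rep (cstar a) x" y] cinner_commute[of x "rep a y"] by simp
  qed
  show "inj rep"
  proof (rule injI)
    fix a b assume ab: "rep a = rep b"
    define d where "d = cstar (a - b)"
    have "vec ((a - b) * d) = rep a (vec d) - rep b (vec d)"
      by (simp add: rep_vec left_diff_distrib vec_diff)
    then have "vec ((a - b) * d) = 0" using ab by simp
    then have "Re (ip ((a - b) * d) ((a - b) * d)) = 0" by (simp add: norm_vec[symmetric])
    then have "(a - b) * d = 0" by (rule ip_eq_0)
    then have "cstar d * d = 0" by (simp add: d_def cstar_cstar)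
    then have "d = 0" using cstar_identity[of d] by simp
    then have "norm (a - b) = 0" using norm_cstar[of "a - b"] by (simp add: d_def)
    then show "a = b" by simp
  qed
qed

end

theorem gelfand_naimark_separable:
  assumes sep: "separable_space (euclidean :: 'a::cstar_algebra topology)"
    and e: "orthonormal_basis (e :: nat \<Rightarrow> 'h::chilbert_space)"
  shows "\<exists>f :: 'a \<Rightarrow> 'h \<Rightarrow>\<^sub>L 'h. embedding bounded_op_alg f"
proof -
  obtain s :: "nat \<Rightarrow> 'a" where s: "\<And>x r. r > 0 \<Longrightarrow> \<exists>n. dist x (s n) < r"
    using dense_sequence[OF sep] by blast
  obtain \<Phi> :: "'a \<Rightarrow> complex" where \<Phi>: "positive_functional \<Phi>" "\<And>a. \<Phi> (cstar a * a) = 0 \<Longrightarrow> a = 0"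
    using faithful_positive_functional[OF sep] by blast
  interpret orthonormal_basis e by (rule e)
  interpret gns \<Phi> s e by unfold_locales (use \<Phi> s in auto)
  show ?thesis using embedding_rep by blast
qed

section \<open>Asymptotic representations on Hilbert space\<close>

definition close :: "(nat \<Rightarrow> 'h::chilbert_space \<Rightarrow>\<^sub>L 'h) \<Rightarrow> (nat \<Rightarrow> 'h \<Rightarrow>\<^sub>L 'h) \<Rightarrow> bool" where
  "close X Y \<longleftrightarrow> (\<lambda>n. norm (X n - Y n)) \<longlonglongrightarrow> 0"

definition bounded_seq :: "(nat \<Rightarrow> 'a::real_normed_vector) \<Rightarrow> bool" where
  "bounded_seq X \<longleftrightarrow> (\<exists>K. \<forall>n. norm (X n) \<le> K)"

lemma bounded_seqI: "(\<And>n. norm (X n) \<le> K) \<Longrightarrow> bounded_seq X"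
  by (auto simp: bounded_seq_def)

lemma bounded_seqE:
  assumes "bounded_seq X" obtains K where "K > 0" "\<And>n. norm (X n) \<le> K"
proof -
  obtain K where K: "\<And>n. norm (X n) \<le> K" using assms by (auto simp: bounded_seq_def)
  show ?thesis by (rule that[of "max K 1"]) (use K in \<open>auto simp: max_def intro: order_trans\<close>)
qed

lemma bounded_seq_const [simp]: "bounded_seq (\<lambda>n. x)"
  by (auto simp: bounded_seq_def)

lemma bounded_seq_bdd_above: "bounded_seq X \<longleftrightarrow> bdd_above (range (\<lambda>n. norm (X n)))"
  by (auto simp: bounded_seq_def bdd_above_def)

lemma close_le:
  assumes "g \<longlonglongrightarrow> 0" "\<And>n. norm (X n - Y n) \<le> g n" shows "close X Y"
  unfolding close_def by (rule tendsto_sandwich[OF _ _ tendsto_const assms(1)]) (simp_all add: assms(2))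

lemma close_refl [simp]: "close X X" by (simp add: close_def)

lemma close_sym: "close X Y \<Longrightarrow> close Y X" by (simp add: close_def norm_minus_commute)

lemma close_add: "close X X' \<Longrightarrow> close Y Y' \<Longrightarrow> close (\<lambda>n. X n + Y n) (\<lambda>n. X' n + Y' n)"
  by (rule close_le[of "\<lambda>n. norm (X n - X' n) + norm (Y n - Y' n)"])
    (auto simp: close_def add_diff_add norm_triangle_ineq intro: tendsto_add_zero)

lemma close_scale: "close X Y \<Longrightarrow> close (\<lambda>n. scale_op c (X n)) (\<lambda>n. scale_op c (Y n))"
proof (rule close_le[of "\<lambda>n. cmod c * norm (X n - Y n)"])
  have "scale_op c (X n) - scale_op c (Y n) = scale_op c (X n - Y n)" for n
    by (rule blinfun_eqI) (simp add: blinfun.diff_left complex_vector.scale_right_diff_distrib)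
  then show "norm (scale_op c (X n) - scale_op c (Y n)) \<le> cmod c * norm (X n - Y n)" for n
    by (simp add: norm_scale_op)
qed (auto simp: close_def intro: tendsto_mult_right_zero)

lemma close_scaleR: "close X Y \<Longrightarrow> close (\<lambda>n. r *\<^sub>R X n) (\<lambda>n. r *\<^sub>R Y n)"
  by (rule close_le[of "\<lambda>n. \<bar>r\<bar> * norm (X n - Y n)"])
    (auto simp: close_def scaleR_diff_right[symmetric] intro: tendsto_mult_right_zero)

lemma close_diff: "close X X' \<Longrightarrow> close Y Y' \<Longrightarrow> close (\<lambda>n. X n - Y n) (\<lambda>n. X' n - Y' n)"
  using close_add[of X X' "\<lambda>n. (-1) *\<^sub>R Y n" "\<lambda>n. (-1) *\<^sub>R Y' n"] close_scaleR[of Y Y' "-1"] by simp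

lemma close_trans: "close X Y \<Longrightarrow> close Y Z \<Longrightarrow> close X Z"
proof (rule close_le[of "\<lambda>n. norm (X n - Y n) + norm (Y n - Z n)"])
  show "norm (X n - Z n) \<le> norm (X n - Y n) + norm (Y n - Z n)" for n
    using norm_triangle_ineq[of "X n - Y n" "Y n - Z n"] by simp
qed (auto simp: close_def intro: tendsto_add_zero)

lemma close_compose:
  assumes "close X X'" "close Y Y'" "bounded_seq X" "bounded_seq Y'"
  shows "close (\<lambda>n. X n o\<^sub>L Y n) (\<lambda>n. X' n o\<^sub>L Y' n)"
proof -
  obtain K L where K: "\<And>n. norm (X n) \<le> K" and L: "\<And>n. norm (Y' n) \<le> L"
    using assms(3,4) by (auto simp: bounded_seq_def)
  show ?thesis
  proof (rule close_le[of "\<lambda>n. K * norm (Y n - Y' n) + norm (X n - X' n) * L"])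
    have "(\<lambda>n. K * norm (Y n - Y' n)) \<longlonglongrightarrow> 0" "(\<lambda>n. norm (X n - X' n) * L) \<longlonglongrightarrow> 0"
      using assms(1,2) by (auto simp: close_def intro: tendsto_mult_right_zero tendsto_mult_left_zero)
    then show "(\<lambda>n. K * norm (Y n - Y' n) + norm (X n - X' n) * L) \<longlonglongrightarrow> 0" by (rule tendsto_add_zero)
    fix n
    have "(X n o\<^sub>L Y n) - (X' n o\<^sub>L Y' n) = (X n o\<^sub>L (Y n - Y' n)) + ((X n - X' n) o\<^sub>L Y' n)"
      by (rule blinfun_eqI) (simp add: blinfun.diff_left blinfun.diff_right blinfun.add_left)
    also have "norm \<dots> \<le> norm (X n o\<^sub>L (Y n - Y' n)) + norm ((X n - X' n) o\<^sub>L Y' n)"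
      by (rule norm_triangle_ineq)
    also have "\<dots> \<le> K * norm (Y n - Y' n) + norm (X n - X' n) * L"
      by (intro add_mono order_trans[OF norm_blinfun_compose] mult_mono K L order_trans[OF norm_ge_zero K]) auto
    finally show "norm ((X n o\<^sub>L Y n) - (X' n o\<^sub>L Y' n)) \<le> K * norm (Y n - Y' n) + norm (X n - X' n) * L" .
  qed
qed

lemma close_bounded_seq: "close X Y \<Longrightarrow> bounded_seq Y \<Longrightarrow> bounded_seq X"
proof -
  assume "close X Y" and Y: "bounded_seq Y"
  then have "Bseq (\<lambda>n. norm (X n - Y n))" unfolding close_def by (intro convergent_imp_Bseq convergentI)
  then obtain L where L: "\<And>n. norm (X n - Y n) \<le> L" by (auto simp: Bseq_def)
  obtain K where K: "\<And>n. norm (Y n) \<le> K" using Y by (auto simp: bounded_seq_def)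
  show ?thesis
  proof (rule bounded_seqI)
    show "norm (X n) \<le> L + K" for n
      using norm_triangle_ineq[of "X n - Y n" "Y n"] L[of n] K[of n] by simp
  qed
qed

lemma norm_cinner_op: "cmod (cinner v (blinfun_apply T w)) \<le> norm T * norm v * norm w"
proof -
  have "cmod (cinner v (T w)) \<le> norm v * norm (T w)" by (rule cauchy_schwarz)
  also have "\<dots> \<le> norm v * (norm T * norm w)" by (intro mult_left_mono norm_blinfun) simp
  finally show ?thesis by (simp add: algebra_simps)
qed

lemma close_quadratic:
  assumes "close X Y" "\<epsilon> > 0"
  shows "\<forall>\<^sub>F n in sequentially. \<forall>v. Re (cinner v (X n v)) \<le> Re (cinner v (Y n v)) + \<epsilon> * (norm v)\<^sup>2"
proof -
  have "\<forall>\<^sub>F n in sequentially. norm (X n - Y n) < \<epsilon>"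
    using order_tendstoD(2)[OF assms(1)[unfolded close_def] assms(2)] .
  then show ?thesis
  proof eventually_elim
    case (elim n)
    show ?case
    proof
      fix v
      have "Re (cinner v (X n v)) - Re (cinner v (Y n v)) = Re (cinner v ((X n - Y n) v))"
        by (simp add: blinfun.diff_left cinner_diff_right)
      also have "\<dots> \<le> norm (X n - Y n) * norm v * norm v"
        by (rule order_trans[OF complex_Re_le_cmod norm_cinner_op])
      also have "\<dots> \<le> \<epsilon> * (norm v)\<^sup>2" using elim by (simp add: power2_eq_square mult.assoc mult_right_mono)
      finally show "Re (cinner v (X n v)) \<le> Re (cinner v (Y n v)) + \<epsilon> * (norm v)\<^sup>2" by simp
    qed
  qed
qed

lemma diff_sa_op: "diff_sa bounded_op_alg S T = S - T"
  by (rule blinfun_eqI) (simp add: diff_sa_def bounded_op_alg_simps blinfun.add_left blinfun.diff_left)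

abbreviation asymptotic_rep :: "(nat \<Rightarrow> 'a::cstar_algebra \<Rightarrow> 'h::chilbert_space \<Rightarrow>\<^sub>L 'h) \<Rightarrow> bool" where
  "asymptotic_rep \<equiv> discrete_asymptotic_hom bounded_op_alg"

lemma asymptotic_rep_iff:
  "asymptotic_rep \<psi> \<longleftrightarrow> (\<forall>n a. \<psi> n a \<in> bounded_ops) \<and> (\<forall>a. bounded_seq (\<lambda>n. \<psi> n a)) \<and>
    (\<forall>a. close (\<lambda>n. \<psi> n (cstar a)) (\<lambda>n. cadjoint (\<psi> n a))) \<and>
    (\<forall>a b c d. close (\<lambda>n. \<psi> n (c *\<^sub>C a + d *\<^sub>C b)) (\<lambda>n. scale_op c (\<psi> n a) + scale_op d (\<psi> n b))) \<and>
    (\<forall>a b. close (\<lambda>n. \<psi> n (a * b)) (\<lambda>n. \<psi> n a o\<^sub>L \<psi> n b))"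
  by (simp add: discrete_asymptotic_hom_def diff_sa_op bounded_seq_bdd_above close_def) (simp add: bounded_op_alg_simps)

lemma asymptotic_rep_star_hom:
  assumes "star_hom bounded_op_alg f" shows "asymptotic_rep (\<lambda>n. f)"
  unfolding asymptotic_rep_iff using star_homD[OF assms] by simp

lemma scale_op_1 [simp]: "scale_op 1 T = T" and scale_op_0 [simp]: "scale_op 0 T = 0"
  and scale_op_of_real: "scale_op (complex_of_real r) T = r *\<^sub>R T"
  by (rule blinfun_eqI, simp add: scaleC_one scaleR_scaleC[symmetric] blinfun.scaleR_left)+

context
  fixes \<psi> :: "nat \<Rightarrow> 'a::cstar_algebra \<Rightarrow> 'h::chilbert_space \<Rightarrow>\<^sub>L 'h"
  assumes \<psi>: "asymptotic_rep \<psi>"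
begin

lemma rep_bounded_ops: "\<psi> n a \<in> bounded_ops"
  and rep_bounded: "bounded_seq (\<lambda>n. \<psi> n a)"
  and rep_cstar: "close (\<lambda>n. \<psi> n (cstar a)) (\<lambda>n. cadjoint (\<psi> n a))"
  and rep_linear: "close (\<lambda>n. \<psi> n (c *\<^sub>C a + d *\<^sub>C b)) (\<lambda>n. scale_op c (\<psi> n a) + scale_op d (\<psi> n b))"
  and rep_mult: "close (\<lambda>n. \<psi> n (a * b)) (\<lambda>n. \<psi> n a o\<^sub>L \<psi> n b)"
  using \<psi> unfolding asymptotic_rep_iff by blast+

lemma rep_add: "close (\<lambda>n. \<psi> n (a + b)) (\<lambda>n. \<psi> n a + \<psi> n b)"
  using rep_linear[of 1 a 1 b] by (simp add: scaleC_one)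

lemma rep_scaleC: "close (\<lambda>n. \<psi> n (c *\<^sub>C a)) (\<lambda>n. scale_op c (\<psi> n a))"
  using rep_linear[of c a 0 a] by simp

lemma rep_zero: "close (\<lambda>n. \<psi> n 0) (\<lambda>n. 0)"
  using rep_scaleC[of 0 0] by simp

lemma rep_scaleR: "close (\<lambda>n. \<psi> n (r *\<^sub>R a)) (\<lambda>n. r *\<^sub>R \<psi> n a)"
  using rep_scaleC[of "of_real r" a] by (simp add: scaleR_scaleC scale_op_of_real)

lemma rep_diff: "close (\<lambda>n. \<psi> n (a - b)) (\<lambda>n. \<psi> n a - \<psi> n b)"
  using close_trans[OF rep_add[of a "(-1) *\<^sub>R b"] close_add[OF close_refl rep_scaleR]] by simp

lemma rep_sum: "finite I \<Longrightarrow> close (\<lambda>n. \<psi> n (\<Sum>i\<in>I. r i *\<^sub>R a i)) (\<lambda>n. \<Sum>i\<in>I. r i *\<^sub>R \<psi> n (a i))"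
proof (induction I rule: finite_induct)
  case empty then show ?case by (simp add: rep_zero)
next
  case (insert j I)
  then show ?case using close_trans[OF rep_add close_add[OF rep_scaleR insert.IH]] by simp
qed

lemma rep_square: "close (\<lambda>n. \<psi> n (cstar a * a)) (\<lambda>n. cadjoint (\<psi> n a) o\<^sub>L \<psi> n a)"
  by (rule close_trans[OF rep_mult close_compose[OF rep_cstar close_refl rep_bounded rep_bounded]])

end

text \<open>
  Passing to the unitization preserves asymptotic homomorphisms.  Thus identities in the unitization,
  such as those of \<open>contractive_identity\<close> and \<open>truncation\<close>, can be used even if \<open>A\<close> has no unit.
\<close>

definition ext :: "('a::cstar_algebra \<Rightarrow> 'h::chilbert_space \<Rightarrow>\<^sub>L 'h) \<Rightarrow> 'a unitized \<Rightarrow> 'h \<Rightarrow>\<^sub>L 'h" where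
  "ext T x = T (base x) + scale_op (scal x) id_blinfun"

lemma ext_emb [simp]: "ext T (emb a) = T a"
  by (simp add: ext_def)

lemma bounded_seq_add: "bounded_seq X \<Longrightarrow> bounded_seq Y \<Longrightarrow> bounded_seq (\<lambda>n. X n + Y n)"
proof -
  assume "bounded_seq X" "bounded_seq Y"
  then obtain K L where "\<And>n. norm (X n) \<le> K" "\<And>n. norm (Y n) \<le> L" by (auto simp: bounded_seq_def)
  then show ?thesis by (intro bounded_seqI[of _ "K + L"]) (meson add_mono norm_triangle_ineq order_trans)
qed

lemma asymptotic_rep_ext:
  assumes \<psi>: "asymptotic_rep \<psi>" shows "asymptotic_rep (\<lambda>n. ext (\<psi> n))"
  unfolding asymptotic_rep_iff
proof (intro conjI allI)
  note bo = rep_bounded_ops[OF \<psi>]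
  show "ext (\<psi> n) x \<in> bounded_ops" for n x by (simp add: ext_def bo)
  show "bounded_seq (\<lambda>n. ext (\<psi> n) x)" for x
    unfolding ext_def by (intro bounded_seq_add rep_bounded[OF \<psi>] bounded_seq_const)
  show "close (\<lambda>n. ext (\<psi> n) (cstar x)) (\<lambda>n. cadjoint (ext (\<psi> n) x))" for x
    using close_add[OF rep_cstar[OF \<psi>] close_refl[of "\<lambda>_. scale_op (cnj (scal x)) id_blinfun"], of "base x"]
    by (simp add: ext_def cadjoint_add bo cadjoint_scale)
  show "close (\<lambda>n. ext (\<psi> n) (c *\<^sub>C x + d *\<^sub>C y)) (\<lambda>n. scale_op c (ext (\<psi> n) x) + scale_op d (ext (\<psi> n) y))" for x y c d
  proof -
    have "scale_op c (ext (\<psi> n) x) + scale_op d (ext (\<psi> n) y)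
        = (scale_op c (\<psi> n (base x)) + scale_op d (\<psi> n (base y))) + scale_op (c * scal x + d * scal y) id_blinfun" for n
      by (rule blinfun_eqI) (simp add: ext_def blinfun.add_left scaleC_add_left scaleC_add_right scaleC_scaleC)
    then show ?thesis using close_add[OF rep_linear[OF \<psi>] close_refl] by (simp add: ext_def)
  qed
  show "close (\<lambda>n. ext (\<psi> n) (x * y)) (\<lambda>n. ext (\<psi> n) x o\<^sub>L ext (\<psi> n) y)" for x y
  proof -
    have "close (\<lambda>n. \<psi> n (base (x * y)))
      (\<lambda>n. (\<psi> n (base x) o\<^sub>L \<psi> n (base y)) + (scale_op (scal x) (\<psi> n (base y)) + scale_op (scal y) (\<psi> n (base x))))"
      unfolding base_mult add.assoc
      by (rule close_trans[OF rep_add[OF \<psi>] close_add[OF rep_mult[OF \<psi>] rep_linear[OF \<psi>]]])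
    moreover have "ext (\<psi> n) x o\<^sub>L ext (\<psi> n) y = ((\<psi> n (base x) o\<^sub>L \<psi> n (base y)) +
        (scale_op (scal x) (\<psi> n (base y)) + scale_op (scal y) (\<psi> n (base x)))) + scale_op (scal (x * y)) id_blinfun" for n
      by (rule blinfun_eqI) (simp add: ext_def blinfun.add_left blinfun.add_right scaleC_add_right scaleC_scaleC
          bounded_opsD[OF bo] algebra_simps)
    ultimately show ?thesis using close_add[OF _ close_refl] by (simp add: ext_def[of _ "x * y"])
  qed
qed

lemma norm_apply_sq: "T \<in> bounded_ops \<Longrightarrow> (norm (blinfun_apply T v))\<^sup>2 = Re (cinner v ((cadjoint T o\<^sub>L T) v))"
  by (simp add: cinner_cadjoint_right norm_sq_cinner)

lemma ext_one: "asymptotic_rep \<psi> \<Longrightarrow> close (\<lambda>n. ext (\<psi> n) 1) (\<lambda>n. id_blinfun)"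
  using close_add[OF rep_zero close_refl[of "\<lambda>n. id_blinfun"]] by (simp add: ext_def)

text \<open>
  Apply the maps to \<open>norm a^2 - a^* a = m^* m\<close>: up to small errors, \<open>norm (\<psi> n a v)^2\<close> is
  \<open>norm a^2 norm v^2\<close> minus a square.
\<close>

lemma asymptotically_contractive:
  fixes a :: "'a::cstar_algebra"
  assumes \<psi>: "asymptotic_rep \<psi>" and \<epsilon>: "\<epsilon> > 0"
  shows "\<forall>\<^sub>F n in sequentially. norm (\<psi> n a) \<le> norm a + \<epsilon>"
proof -
  obtain m where m: "cstar m = m" "(norm a)\<^sup>2 *\<^sub>R 1 - emb (cstar a * a) = m * m"
    using contractive_identity by blast
  note \<psi>' = asymptotic_rep_ext[OF \<psi>]
  have eq: "emb (cstar a * a) = (norm a)\<^sup>2 *\<^sub>R 1 - cstar m * m" using m by (simp add: algebra_simps)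
  have "close (\<lambda>n. cadjoint (\<psi> n a) o\<^sub>L \<psi> n a) (\<lambda>n. ext (\<psi> n) (emb (cstar a * a)))"
    using close_sym[OF rep_square[OF \<psi>]] by simp
  moreover have "close (\<lambda>n. ext (\<psi> n) (emb (cstar a * a)))
      (\<lambda>n. (norm a)\<^sup>2 *\<^sub>R id_blinfun - (cadjoint (ext (\<psi> n) m) o\<^sub>L ext (\<psi> n) m))"
    unfolding eq
    by (rule close_trans[OF rep_diff[OF \<psi>'] close_diff[OF close_trans[OF rep_scaleR[OF \<psi>'] close_scaleR[OF ext_one[OF \<psi>]]] rep_square[OF \<psi>']]])
  ultimately have "close (\<lambda>n. cadjoint (\<psi> n a) o\<^sub>L \<psi> n a)
      (\<lambda>n. (norm a)\<^sup>2 *\<^sub>R id_blinfun - (cadjoint (ext (\<psi> n) m) o\<^sub>L ext (\<psi> n) m))" by (rule close_trans)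
  from close_quadratic[OF this, of "\<epsilon>\<^sup>2"] \<epsilon>
  have "\<forall>\<^sub>F n in sequentially. \<forall>v. Re (cinner v ((cadjoint (\<psi> n a) o\<^sub>L \<psi> n a) v))
      \<le> Re (cinner v (((norm a)\<^sup>2 *\<^sub>R id_blinfun - (cadjoint (ext (\<psi> n) m) o\<^sub>L ext (\<psi> n) m)) v)) + \<epsilon>\<^sup>2 * (norm v)\<^sup>2"
    by simp
  then show ?thesis
  proof eventually_elim
    case (elim n)
    show ?case
    proof (rule norm_blinfun_bound)
      fix v
      have "(norm (\<psi> n a v))\<^sup>2 \<le> (norm a)\<^sup>2 * (norm v)\<^sup>2 - (norm (ext (\<psi> n) m v))\<^sup>2 + \<epsilon>\<^sup>2 * (norm v)\<^sup>2"
        using elim[rule_format, of v]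
        unfolding norm_apply_sq[OF rep_bounded_ops[OF \<psi>]] norm_apply_sq[OF rep_bounded_ops[OF \<psi>']]
        by (simp add: blinfun.diff_left blinfun.scaleR_left cinner_diff_right cinner_scaleR_right norm_sq_cinner)
      also have "\<dots> \<le> (norm a)\<^sup>2 * (norm v)\<^sup>2 + \<epsilon>\<^sup>2 * (norm v)\<^sup>2" by simp
      also have "\<dots> \<le> ((norm a + \<epsilon>) * norm v)\<^sup>2"
        using \<epsilon> by (simp add: power_mult_distrib distrib_right[symmetric] power2_sum mult_right_mono)
      finally show "norm (\<psi> n a v) \<le> (norm a + \<epsilon>) * norm v" by (rule power2_le_imp_le) (use \<epsilon> in simp)
    qed (use \<epsilon> in simp)
  qed
qed

text \<open>
  Let \<open>u\<close> and \<open>y\<close> be as in \<open>truncation\<close>.  The hypothesis on \<open>x\<close> bounds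
  \<open>\<psi> n (y^* y) \<approx> \<psi> n u (\<psi> n x - \<delta>) \<psi> n u\<close> asymptotically by \<open>0\<close>, so \<open>y = 0\<close> by
  faithfulness.  Hence \<open>\<delta> - x\<close> is a square in the unitization, and this is preserved by \<open>f\<close>.
\<close>

lemma upper_bound_transfer:
  fixes x :: "'a::cstar_algebra" and f :: "'a \<Rightarrow> 'k::chilbert_space \<Rightarrow>\<^sub>L 'k"
  assumes \<psi>: "asymptotic_rep \<psi>" and faithful: "\<And>a. (\<lambda>n. norm (\<psi> n a)) \<longlonglongrightarrow> 0 \<Longrightarrow> a = 0"
    and x: "cstar x = x" and \<delta>: "\<delta> > 0"
    and le: "\<And>\<epsilon>. \<epsilon> > 0 \<Longrightarrow> \<forall>\<^sub>F n in sequentially. \<forall>v. Re (cinner v (\<psi> n x v)) \<le> (\<delta> + \<epsilon>) * (norm v)\<^sup>2"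
    and f: "star_hom bounded_op_alg f"
  shows "Re (cinner \<xi> (f x \<xi>)) \<le> \<delta> * (norm \<xi>)\<^sup>2"
proof -
  note bo = rep_bounded_ops[OF \<psi>]
  obtain u y where uy: "cstar u = u" "cstar y * y = u * x * u - \<delta> *\<^sub>R (u * u)"
    "y = 0 \<Longrightarrow> \<exists>m. cstar m = m \<and> \<delta> *\<^sub>R 1 - emb x = m * m"
    by (rule truncation[OF x \<delta>]) (rule that; blast)
  have "y = 0"
  proof (rule faithful, rule LIMSEQ_I)
    fix r :: real assume r: "r > 0"
    obtain K where K: "K > 0" "\<And>n. norm (\<psi> n u) \<le> K" using bounded_seqE[OF rep_bounded[OF \<psi>]] by blast
    have su: "close (\<lambda>n. \<psi> n u) (\<lambda>n. cadjoint (\<psi> n u))" using rep_cstar[OF \<psi>, of u] uy(1) by simp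
    have "close (\<lambda>n. \<psi> n (u * x * u)) (\<lambda>n. (cadjoint (\<psi> n u) o\<^sub>L \<psi> n x) o\<^sub>L \<psi> n u)"
    proof (rule close_trans[OF rep_mult[OF \<psi>] close_compose[OF _ close_refl rep_bounded[OF \<psi>] rep_bounded[OF \<psi>]]])
      show "close (\<lambda>n. \<psi> n (u * x)) (\<lambda>n. cadjoint (\<psi> n u) o\<^sub>L \<psi> n x)"
        by (rule close_trans[OF rep_mult[OF \<psi>] close_compose[OF su close_refl rep_bounded[OF \<psi>] rep_bounded[OF \<psi>]]])
    qed
    moreover have "close (\<lambda>n. \<psi> n (\<delta> *\<^sub>R (u * u))) (\<lambda>n. \<delta> *\<^sub>R (cadjoint (\<psi> n u) o\<^sub>L \<psi> n u))"
      using close_trans[OF rep_scaleR[OF \<psi>] close_scaleR[OF rep_square[OF \<psi>]], of \<delta> u] uy(1) by simp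
    ultimately have "close (\<lambda>n. \<psi> n (cstar y * y))
        (\<lambda>n. ((cadjoint (\<psi> n u) o\<^sub>L \<psi> n x) o\<^sub>L \<psi> n u) - \<delta> *\<^sub>R (cadjoint (\<psi> n u) o\<^sub>L \<psi> n u))"
      unfolding uy(2) by (intro close_trans[OF rep_diff[OF \<psi>] close_diff])
    then have cl: "close (\<lambda>n. cadjoint (\<psi> n y) o\<^sub>L \<psi> n y)
        (\<lambda>n. ((cadjoint (\<psi> n u) o\<^sub>L \<psi> n x) o\<^sub>L \<psi> n u) - \<delta> *\<^sub>R (cadjoint (\<psi> n u) o\<^sub>L \<psi> n u))"
      by (rule close_trans[OF close_sym[OF rep_square[OF \<psi>]]])
    define \<epsilon> where "\<epsilon> = r\<^sup>2 / 8"
    have \<epsilon>: "\<epsilon> > 0" using r by (simp add: \<epsilon>_def)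
    have "\<epsilon> / K\<^sup>2 > 0" using \<epsilon> K(1) by simp
    from close_quadratic[OF cl \<epsilon>] le[OF this]
    have "\<forall>\<^sub>F n in sequentially. norm (\<psi> n y) < r"
    proof eventually_elim
      case (elim n)
      have "norm (\<psi> n y) \<le> r / 2"
      proof (rule norm_blinfun_bound)
        fix v
        let ?w = "\<psi> n u v"
        have "(norm (\<psi> n y v))\<^sup>2 \<le> Re (cinner ?w (\<psi> n x ?w)) - \<delta> * (norm ?w)\<^sup>2 + \<epsilon> * (norm v)\<^sup>2"
          using elim(1)[rule_format, of v] unfolding norm_apply_sq[OF bo]
          by (simp add: blinfun.diff_left blinfun.scaleR_left cinner_diff_right cinner_scaleR_right
              cinner_cadjoint_right[OF bo] norm_sq_cinner)
        also have "\<dots> \<le> \<epsilon> / K\<^sup>2 * (norm ?w)\<^sup>2 + \<epsilon> * (norm v)\<^sup>2"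
          using elim(2)[rule_format, of ?w] by (simp add: algebra_simps)
        also have "\<dots> \<le> \<epsilon> / K\<^sup>2 * (K * norm v)\<^sup>2 + \<epsilon> * (norm v)\<^sup>2"
          using norm_blinfun[of "\<psi> n u" v] K \<epsilon>
          by (intro add_right_mono mult_left_mono power_mono)
            (auto intro: order_trans[OF norm_blinfun mult_right_mono])
        also have "\<dots> = (r / 2 * norm v)\<^sup>2"
          using K(1) by (simp add: \<epsilon>_def power_mult_distrib power_divide field_simps)
        finally show "norm (\<psi> n y v) \<le> r / 2 * norm v" by (rule power2_le_imp_le) (use r in simp)
      qed (use r in simp)
      then show "norm (\<psi> n y) < r" using r by simp
    qed
    then show "\<exists>no. \<forall>n\<ge>no. norm (norm (\<psi> n y) - 0) < r" by (simp add: eventually_sequentially)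
  qed
  then obtain m where m: "cstar m = m" "\<delta> *\<^sub>R 1 - emb x = m * m" using uy(3) by blast
  have mm: "scal m * scal m = of_real \<delta>" using arg_cong[OF m(2), of scal] by (simp add: of_real_def)
  have scm: "cnj (scal m) = scal m" "cstar (base m) = base m"
    using arg_cong[OF m(1), of scal] arg_cong[OF m(1), of base] by simp_all
  have bm: "- x = base m * base m + scal m *\<^sub>C base m + scal m *\<^sub>C base m"
    using arg_cong[OF m(2), of base] by (simp add: base_mult)
  note fD = star_homD[OF f]
  have "ext f m \<in> bounded_ops" by (simp add: ext_def fD(1))
  have "(norm (ext f m \<xi>))\<^sup>2 = Re (cinner (ext f m \<xi>) (ext f m \<xi>))" by (rule norm_sq_cinner)
  also have "cinner (ext f m \<xi>) (ext f m \<xi>) = cinner \<xi> (ext f m (ext f m \<xi>))"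
    using cinner_cadjoint[OF fD(1), of "base m" \<xi>] fD(5)[of "base m"] scm
    by (simp add: ext_def blinfun.add_left cinner_add_left cinner_add_right cinner_scaleC_left
        cinner_scaleC_right blinfun.add_right bounded_opsD[OF fD(1)] algebra_simps)
  also have "ext f m (ext f m \<xi>) = f (base m * base m + scal m *\<^sub>C base m + scal m *\<^sub>C base m) \<xi> + (scal m * scal m) *\<^sub>C \<xi>"
    by (simp add: ext_def fD blinfun.add_left blinfun.add_right bounded_opsD[OF fD(1)] scaleC_add_right scaleC_scaleC)
  also have "\<dots> = f (- x) \<xi> + of_real \<delta> *\<^sub>C \<xi>" by (simp add: bm[symmetric] mm)
  also have "f (- x) = - f x"
    using fD(2)[of "- x" x] fD(2)[of 0 0] by (simp add: add_eq_0_iff2)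
  also have "Re (cinner \<xi> ((- f x) \<xi> + of_real \<delta> *\<^sub>C \<xi>)) = \<delta> * (norm \<xi>)\<^sup>2 - Re (cinner \<xi> (f x \<xi>))"
    by (simp add: blinfun.minus_left cinner_diff_right cinner_scaleC_right cinner_self)
  finally show ?thesis using zero_le_power2[of "norm (ext f m \<xi>)"] by linarith
qed

section \<open>Block sums of almost multiplicative maps\<close>

text \<open>
  The expressions that an asymptotic homomorphism sends to null sequences.  They are collected in a set
  because the constructions below -- block sums and unitary conjugation -- commute with all of them.
\<close>

definition vanishing_tests :: "(('a::cstar_algebra \<Rightarrow> 'h::chilbert_space \<Rightarrow>\<^sub>L 'h) \<Rightarrow> 'h \<Rightarrow>\<^sub>L 'h) set" where
  "vanishing_tests = range (\<lambda>a \<Theta>. \<Theta> (cstar a) - cadjoint (\<Theta> a))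
    \<union> range (\<lambda>(a, b, c, d) \<Theta>. \<Theta> (c *\<^sub>C a + d *\<^sub>C b) - (scale_op c (\<Theta> a) + scale_op d (\<Theta> b)))
    \<union> range (\<lambda>(a, b) \<Theta>. \<Theta> (a * b) - (\<Theta> a o\<^sub>L \<Theta> b))"

definition tests :: "(('a::cstar_algebra \<Rightarrow> 'h::chilbert_space \<Rightarrow>\<^sub>L 'h) \<Rightarrow> 'h \<Rightarrow>\<^sub>L 'h) set" where
  "tests = vanishing_tests \<union> range (\<lambda>a \<Theta>. \<Theta> a)"

lemma tests_cases:
  assumes "E \<in> tests"
  obtains a where "E = (\<lambda>\<Theta>. \<Theta> a)" | a where "E = (\<lambda>\<Theta>. \<Theta> (cstar a) - cadjoint (\<Theta> a))"
    | a b c d where "E = (\<lambda>\<Theta>. \<Theta> (c *\<^sub>C a + d *\<^sub>C b) - (scale_op c (\<Theta> a) + scale_op d (\<Theta> b)))"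
    | a b where "E = (\<lambda>\<Theta>. \<Theta> (a * b) - (\<Theta> a o\<^sub>L \<Theta> b))"
  using assms unfolding tests_def vanishing_tests_def by auto

lemma asymptotic_rep_tests:
  "asymptotic_rep \<psi> \<longleftrightarrow> (\<forall>n a. \<psi> n a \<in> bounded_ops) \<and> (\<forall>a. bounded_seq (\<lambda>n. \<psi> n a)) \<and>
    (\<forall>E\<in>vanishing_tests. (\<lambda>n. norm (E (\<psi> n))) \<longlonglongrightarrow> 0)"
  unfolding asymptotic_rep_iff vanishing_tests_def ball_Un close_def by (auto simp: image_iff)

context orthonormal_basis
begin

text \<open>
  The operators that live on the first \<open>D\<close> basis vectors, identified below with \<open>D \<times> D\<close> matrices.
\<close>

definition corner :: "nat \<Rightarrow> ('h \<Rightarrow>\<^sub>L 'h) set" where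
  "corner D = {T \<in> bounded_ops. \<forall>v. proj D (T v) = T v \<and> T (proj D v) = T v}"

lemma cornerD: "T \<in> corner D \<Longrightarrow> T \<in> bounded_ops" "T \<in> corner D \<Longrightarrow> proj D (T v) = T v"
  "T \<in> corner D \<Longrightarrow> T (proj D v) = T v"
  by (auto simp: corner_def)

lemma cornerI: "T \<in> bounded_ops \<Longrightarrow> proj D o\<^sub>L T o\<^sub>L proj D = T \<Longrightarrow> T \<in> corner D"
proof -
  assume T: "T \<in> bounded_ops" and eq: "proj D o\<^sub>L T o\<^sub>L proj D = T"
  have v: "T v = proj D (T (proj D v))" for v using arg_cong[OF eq, of "\<lambda>S. blinfun_apply S v"] by simp
  have "proj D (T v) = T v \<and> T (proj D v) = T v" for v
    by (subst (1 2 3 4) v) (simp add: proj_proj)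
  with T show ?thesis by (simp add: corner_def)
qed

lemma corner_compress: "T \<in> corner D \<Longrightarrow> proj D o\<^sub>L T o\<^sub>L proj D = T"
  by (rule blinfun_eqI) (simp add: cornerD)

lemma corner_mono: "D \<le> D' \<Longrightarrow> corner D \<subseteq> corner D'"
proof
  fix T assume D: "D \<le> D'" and T: "T \<in> corner D"
  have "proj D' (T v) = T v" for v
    using cornerD(2)[OF T, of v] D proj_proj[of D' D "T v"] by (simp add: min_absorb2)
  moreover have "T (proj D' v) = T v" for v
    using cornerD(3)[OF T, of "proj D' v"] cornerD(3)[OF T, of v] D proj_proj[of D D' v] by (simp add: min_absorb1)
  ultimately show "T \<in> corner D'" using cornerD(1)[OF T] by (simp add: corner_def)
qed

lemma corner_cadjoint: "T \<in> corner D \<Longrightarrow> cadjoint T \<in> corner D"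
proof -
  assume T: "T \<in> corner D"
  note b = cornerD(1)[OF T]
  have "proj D (cadjoint T v) = cadjoint T v" "cadjoint T (proj D v) = cadjoint T v" for v
    by (rule cinner_eqI; simp add: cinner_proj cinner_cadjoint[OF b] cornerD[OF T])+
  then show ?thesis using cadjoint_bounded_ops[OF b] by (simp add: corner_def)
qed

lemma corner_simps:
  "S \<in> corner D \<Longrightarrow> T \<in> corner D \<Longrightarrow> S + T \<in> corner D"
  "S \<in> corner D \<Longrightarrow> T \<in> corner D \<Longrightarrow> S - T \<in> corner D"
  "S \<in> corner D \<Longrightarrow> T \<in> corner D \<Longrightarrow> S o\<^sub>L T \<in> corner D"
  "S \<in> corner D \<Longrightarrow> scale_op c S \<in> corner D"
  by (simp_all add: corner_def blinfun.add_left blinfun.diff_left blinfun.add_right blinfun.diff_right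
      bounded_opsD[OF proj_bounded_ops])

lemma corner_tests:
  assumes "\<And>a. \<Theta> a \<in> corner D" "E \<in> tests" shows "E \<Theta> \<in> corner D"
  using assms(2) by (cases rule: tests_cases) (simp_all add: assms(1) corner_simps corner_cadjoint)

definition transfer :: "nat \<Rightarrow> (nat \<Rightarrow> nat) \<Rightarrow> (nat \<Rightarrow> nat) \<Rightarrow> 'h \<Rightarrow>\<^sub>L 'h" where
  "transfer n a b = Blinfun (\<lambda>v. \<Sum>i<n. cinner (e (a i)) v *\<^sub>C e (b i))"

lemma transfer_apply: "transfer n a b v = (\<Sum>i<n. cinner (e (a i)) v *\<^sub>C e (b i))"
proof -
  have "bounded_linear (\<lambda>v. \<Sum>i<n. cinner (e (a i)) v *\<^sub>C e (b i))"
  proof (rule bounded_linear_sum)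
    show "bounded_linear (\<lambda>v. cinner (e (a i)) v *\<^sub>C e (b i))" for i
      by (rule bounded_linear_intro[of _ 1])
        (use cauchy_schwarz[of "e (a i)"] in \<open>simp_all add: cinner_add_right scaleC_add_left norm_scaleC
          scaleR_scaleC scaleC_scaleC cinner_scaleC_right\<close>)
  qed
  then show ?thesis unfolding transfer_def by (simp add: bounded_linear_Blinfun_apply)
qed

lemma transfer_bounded_ops: "transfer n a b \<in> bounded_ops"
  by (simp add: bounded_ops_def transfer_apply cinner_scaleC_right complex_vector.scale_sum_right scaleC_scaleC)

lemma cinner_transfer: "cinner (transfer n b a v) w = cinner v (transfer n a b w)"
proof -
  have "cnj (cinner (e i) v) = cinner v (e i)" for i by (rule cinner_commute[symmetric])
  then show ?thesis
    by (simp add: transfer_apply cinner_sum_left cinner_sum_right cinner_scaleC_left cinner_scaleC_right mult.commute)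
qed

lemma cadjoint_transfer: "cadjoint (transfer n a b) = transfer n b a"
  by (rule cadjoint_eqI[OF transfer_bounded_ops]) (rule cinner_transfer)

definition shift :: "nat \<Rightarrow> nat \<Rightarrow> 'h \<Rightarrow>\<^sub>L 'h" where "shift D D' = transfer D' (\<lambda>i. i) (\<lambda>i. D + i)"

definition unshift :: "nat \<Rightarrow> nat \<Rightarrow> 'h \<Rightarrow>\<^sub>L 'h" where "unshift D D' = transfer D' (\<lambda>i. D + i) (\<lambda>i. i)"

lemma shift_bounded_ops [simp]: "shift D D' \<in> bounded_ops" "unshift D D' \<in> bounded_ops"
  by (simp_all add: shift_def unshift_def transfer_bounded_ops)

lemma cadjoint_shift: "cadjoint (shift D D') = unshift D D'" "cadjoint (unshift D D') = shift D D'"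
  by (simp_all add: shift_def unshift_def cadjoint_transfer)

lemma cinner_shift: "cinner (shift D D' v) w = cinner v (unshift D D' w)"
  and cinner_unshift: "cinner (unshift D D' v) w = cinner v (shift D D' w)"
  by (simp_all add: shift_def unshift_def cinner_transfer)

lemma cinner_e_unshift: "cinner (e j) (unshift D D' v) = (if j < D' then cinner (e (D + j)) v else 0)"
  by (simp add: unshift_def transfer_apply cinner_e_sum)

lemma cinner_e_shift: "cinner (e j) (shift D D' v) = (if D \<le> j \<and> j < D + D' then cinner (e (j - D)) v else 0)"
proof -
  have "cinner (e j) (shift D D' v) = (\<Sum>i<D'. if i = j - D then (if D \<le> j then cinner (e (j - D)) v else 0) else 0)"
    unfolding shift_def transfer_apply cinner_sum_right
    by (rule sum.cong) (auto simp: cinner_scaleC_right ortho)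
  then show ?thesis by (simp add: less_diff_conv2)
qed

lemma shift_simps:
  "unshift D D' (shift D D' v) = proj D' v" "proj D (shift D D' v) = 0" "unshift D D' (proj D v) = 0"
  "proj (D + D') (shift D D' v) = shift D D' v" "unshift D D' (proj (D + D') v) = unshift D D' v"
  "proj D' (unshift D D' v) = unshift D D' v" "shift D D' (proj D' v) = shift D D' v"
  by (rule e_eqI; auto simp: cinner_e_unshift cinner_e_shift cinner_e_proj cinner_zero_right)+

lemma norm_proj_unshift: "(norm (proj D v))\<^sup>2 + (norm (unshift D D' v))\<^sup>2 \<le> (norm v)\<^sup>2"
proof -
  have "(norm (unshift D D' v))\<^sup>2 = (\<Sum>i<D'. (cmod (cinner (e (D + i)) v))\<^sup>2)"
    by (simp add: unshift_def transfer_apply norm_sum_e)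
  also have "\<dots> = (\<Sum>i\<in>{D..<D + D'}. (cmod (cinner (e i) v))\<^sup>2)"
    by (rule sum.reindex_bij_witness[of _ "\<lambda>i. i - D" "\<lambda>i. D + i"]) auto
  finally have "(norm (proj D v))\<^sup>2 + (norm (unshift D D' v))\<^sup>2
      = (\<Sum>i\<in>{..<D} \<union> {D..<D + D'}. (cmod (cinner (e i) v))\<^sup>2)"
    by (subst sum.union_disjoint) (auto simp: norm_proj_sq)
  also have "{..<D} \<union> {D..<D + D'} = {..<D + D'}" by auto
  also have "(\<Sum>i<D + D'. (cmod (cinner (e i) v))\<^sup>2) = (norm (proj (D + D') v))\<^sup>2" by (simp add: norm_proj_sq)
  also have "\<dots> \<le> (norm v)\<^sup>2" by (rule power_mono[OF norm_proj_le]) simp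
  finally show ?thesis .
qed

text \<open>
  The block sum of \<open>S\<close> on the first \<open>D\<close> basis vectors and of \<open>T\<close>, moved to the next \<open>D'\<close> ones.
\<close>

definition bsum :: "nat \<Rightarrow> nat \<Rightarrow> ('h \<Rightarrow>\<^sub>L 'h) \<Rightarrow> ('h \<Rightarrow>\<^sub>L 'h) \<Rightarrow> 'h \<Rightarrow>\<^sub>L 'h" where
  "bsum D D' S T = S + (shift D D' o\<^sub>L T o\<^sub>L unshift D D')"

lemma bsum_apply: "bsum D D' S T v = S v + shift D D' (T (unshift D D' v))"
  by (simp add: bsum_def blinfun.add_left)

lemma corner_shift:
  assumes "S \<in> corner D" shows "S (shift D D' v) = 0" "unshift D D' (S v) = 0"
  using cornerD(3)[OF assms, of "shift D D' v"] cornerD(2)[OF assms, of v]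
    shift_simps(3)[of D D' "S v"] by (simp_all add: shift_simps blinfun.zero_right)

lemma bsum_add: "bsum D D' S T + bsum D D' S' T' = bsum D D' (S + S') (T + T')"
  and bsum_diff: "bsum D D' S T - bsum D D' S' T' = bsum D D' (S - S') (T - T')"
  and bsum_scale: "scale_op c (bsum D D' S T) = bsum D D' (scale_op c S) (scale_op c T)"
  by (rule blinfun_eqI; simp add: bsum_apply blinfun.add_left blinfun.add_right blinfun.diff_left blinfun.diff_right
      scaleC_add_right bounded_opsD[OF shift_bounded_ops(1)])+

lemma bsum_compose:
  assumes S: "S \<in> corner D" "S' \<in> corner D" and T: "T \<in> corner D'" "T' \<in> corner D'"
  shows "bsum D D' S T o\<^sub>L bsum D D' S' T' = bsum D D' (S o\<^sub>L S') (T o\<^sub>L T')"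
  by (rule blinfun_eqI) (simp add: bsum_apply blinfun.add_right corner_shift[OF S(1)] corner_shift[OF S(2)]
      shift_simps cornerD(2)[OF T(2)] blinfun.zero_right)

lemma bsum_cadjoint:
  assumes S: "S \<in> corner D" and T: "T \<in> corner D'"
  shows "cadjoint (bsum D D' S T) = bsum D D' (cadjoint S) (cadjoint T)"
  by (rule blinfun_eqI)
    (simp add: bsum_def blinfun.add_left cadjoint_add cornerD(1)[OF S] cornerD(1)[OF T] cadjoint_compose cadjoint_shift)

lemma bsum_corner:
  assumes S: "S \<in> corner D" and T: "T \<in> corner D'"
  shows "bsum D D' S T \<in> corner (D + D')"
proof -
  have "S \<in> corner (D + D')" using corner_mono[of D "D + D'"] S by auto
  moreover have "shift D D' o\<^sub>L T o\<^sub>L unshift D D' \<in> corner (D + D')"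
    by (simp add: corner_def cornerD(1)[OF T] shift_simps)
  ultimately show ?thesis unfolding bsum_def by (rule corner_simps)
qed

lemmas bsum_simps = bsum_add bsum_diff bsum_scale bsum_compose bsum_cadjoint

lemma norm_bsum_le:
  assumes S: "S \<in> corner D" and T: "T \<in> corner D'" and K: "norm S \<le> K" "norm T \<le> K"
  shows "norm (bsum D D' S T) \<le> K"
proof (rule norm_blinfun_bound)
  have K0: "0 \<le> K" by (rule order_trans[OF norm_ge_zero K(1)])
  then show "0 \<le> K" .
  fix v
  let ?u = "unshift D D' v"
  have z: "cinner (S v) (shift D D' (T ?u)) = 0"
    using cinner_unshift[of D D' "S v" "T ?u"] by (simp add: corner_shift[OF S] cinner_zero_left)
  then have z': "cinner (shift D D' (T ?u)) (S v) = 0" using cinner_commute[of "shift D D' (T ?u)" "S v"] by simp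
  have "(norm (bsum D D' S T v))\<^sup>2 = (norm (S v))\<^sup>2 + (norm (shift D D' (T ?u)))\<^sup>2"
    unfolding bsum_apply norm_sq_cinner by (simp add: cinner_add_left cinner_add_right z z')
  also have "(norm (shift D D' (T ?u)))\<^sup>2 = (norm (T ?u))\<^sup>2"
    unfolding norm_sq_cinner cinner_shift by (simp add: shift_simps cornerD[OF T])
  also have "(norm (S v))\<^sup>2 \<le> (K * norm (proj D v))\<^sup>2"
    using norm_blinfun[of S "proj D v"] mult_right_mono[OF K(1), of "norm (proj D v)"]
    by (intro power_mono) (simp_all add: cornerD[OF S])
  also have "(norm (T ?u))\<^sup>2 \<le> (K * norm ?u)\<^sup>2"
    using norm_blinfun[of T ?u] mult_right_mono[OF K(2), of "norm ?u"] by (intro power_mono) simp_all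
  finally have "(norm (bsum D D' S T v))\<^sup>2 \<le> K\<^sup>2 * ((norm (proj D v))\<^sup>2 + (norm ?u)\<^sup>2)"
    by (simp add: power_mult_distrib algebra_simps)
  also have "\<dots> \<le> K\<^sup>2 * (norm v)\<^sup>2" by (intro mult_left_mono norm_proj_unshift) simp
  finally have "(norm (bsum D D' S T v))\<^sup>2 \<le> (K * norm v)\<^sup>2" by (simp only: power_mult_distrib)
  then show "norm (bsum D D' S T v) \<le> K * norm v" by (rule power2_le_imp_le) (simp add: K0)
qed

lemma bsum_tests:
  assumes "\<And>a. \<Theta> a \<in> corner D" "\<And>a. \<Theta>' a \<in> corner D'" "E \<in> tests"
  shows "E (\<lambda>a. bsum D D' (\<Theta> a) (\<Theta>' a)) = bsum D D' (E \<Theta>) (E \<Theta>')"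
  using assms(3)
proof (cases rule: tests_cases)
  case (2 a)
  then show ?thesis by (simp add: bsum_simps assms corner_cadjoint)
next
  case (3 a b c d)
  then show ?thesis by (simp add: bsum_simps assms corner_simps)
next
  case (4 a b)
  then show ?thesis by (simp add: bsum_simps assms corner_simps)
qed simp

definition conj_op :: "('h \<Rightarrow>\<^sub>L 'h) \<Rightarrow> ('h \<Rightarrow>\<^sub>L 'h) \<Rightarrow> 'h \<Rightarrow>\<^sub>L 'h" where
  "conj_op U T = U o\<^sub>L T o\<^sub>L cadjoint U"

definition unitary_on :: "nat \<Rightarrow> ('h \<Rightarrow>\<^sub>L 'h) \<Rightarrow> bool" where
  "unitary_on D U \<longleftrightarrow> U \<in> bounded_ops \<and> (\<forall>v. cadjoint U (U v) = v) \<and> (\<forall>v. U (cadjoint U v) = v)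
    \<and> (\<forall>v. proj D (U v) = U (proj D v))"

lemma unitary_onD:
  assumes "unitary_on D U"
  shows "U \<in> bounded_ops" "cadjoint U (U v) = v" "U (cadjoint U v) = v" "proj D (U v) = U (proj D v)"
    "proj D (cadjoint U v) = cadjoint U (proj D v)" "norm (U v) = norm v" "norm (cadjoint U v) = norm v"
proof -
  show U: "U \<in> bounded_ops" "\<And>v. cadjoint U (U v) = v" "\<And>v. U (cadjoint U v) = v" "\<And>v. proj D (U v) = U (proj D v)"
    using assms by (auto simp: unitary_on_def)
  show "proj D (cadjoint U v) = cadjoint U (proj D v)"
    using U(4)[of "cadjoint U v"] U(2)[of "proj D (cadjoint U v)"] by (simp add: U(3))
  have "(norm (U v))\<^sup>2 = (norm v)\<^sup>2" for v unfolding norm_sq_cinner by (simp add: cinner_cadjoint_right[OF U(1), symmetric] U(2))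
  then show n: "norm (U v) = norm v" for v by simp
  show "norm (cadjoint U v) = norm v" using n[of "cadjoint U v"] by (simp add: U(3))
qed

lemma conj_op_simps:
  assumes U: "unitary_on D U"
  shows "conj_op U S + conj_op U T = conj_op U (S + T)" "conj_op U S - conj_op U T = conj_op U (S - T)"
    "scale_op c (conj_op U S) = conj_op U (scale_op c S)" "conj_op U S o\<^sub>L conj_op U T = conj_op U (S o\<^sub>L T)"
    "T \<in> bounded_ops \<Longrightarrow> cadjoint (conj_op U T) = conj_op U (cadjoint T)"
proof -
  note u = unitary_onD[OF U]
  show "conj_op U S + conj_op U T = conj_op U (S + T)" "conj_op U S - conj_op U T = conj_op U (S - T)"
    "scale_op c (conj_op U S) = conj_op U (scale_op c S)" "conj_op U S o\<^sub>L conj_op U T = conj_op U (S o\<^sub>L T)"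
    by (rule blinfun_eqI; simp add: conj_op_def blinfun.add_left blinfun.add_right blinfun.diff_left blinfun.diff_right
        bounded_opsD[OF u(1)] u(2))+
  show "cadjoint (conj_op U T) = conj_op U (cadjoint T)" if "T \<in> bounded_ops"
    by (rule blinfun_eqI) (simp add: conj_op_def cadjoint_compose that u(1) cadjoint_bounded_ops)
qed

lemma conj_op_tests:
  assumes U: "unitary_on D U" and b: "\<And>a. \<Theta> a \<in> bounded_ops" and E: "E \<in> tests"
  shows "E (\<lambda>a. conj_op U (\<Theta> a)) = conj_op U (E \<Theta>)"
  using E
proof (cases rule: tests_cases)
  case (2 a)
  then show ?thesis by (simp add: conj_op_simps[OF U] b)
next
  case (3 a b c d)
  then show ?thesis by (simp add: conj_op_simps[OF U] b)
next
  case (4 a b)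
  then show ?thesis by (simp add: conj_op_simps[OF U] b)
qed simp

lemma norm_conj_op_le: "unitary_on D U \<Longrightarrow> norm (conj_op U T) \<le> norm T"
proof (rule norm_blinfun_bound)
  fix v assume U: "unitary_on D U"
  show "norm (conj_op U T v) \<le> norm T * norm v"
    using norm_blinfun[of T "cadjoint U v"] by (simp add: conj_op_def unitary_onD[OF U])
qed simp

lemma conj_op_corner: "unitary_on D U \<Longrightarrow> T \<in> corner D \<Longrightarrow> conj_op U T \<in> corner D"
proof -
  assume U: "unitary_on D U" and T: "T \<in> corner D"
  have "T (cadjoint U (proj D v)) = T (cadjoint U v)" for v
    using cornerD(3)[OF T, of "cadjoint U v"] by (simp add: unitary_onD(5)[OF U])
  then show ?thesis
    by (simp add: corner_def conj_op_def unitary_onD(1,4)[OF U] cornerD[OF T] cadjoint_bounded_ops)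
qed

end

locale faithful_asymptotic_rep = orthonormal_basis e
  for e :: "nat \<Rightarrow> 'h::chilbert_space" +
  fixes \<psi> :: "nat \<Rightarrow> 'a::cstar_algebra \<Rightarrow> 'h \<Rightarrow>\<^sub>L 'h" and k :: "nat \<Rightarrow> nat"
  assumes \<psi>: "asymptotic_rep \<psi>" and \<psi>_corner: "\<psi> n a \<in> corner (k n)"
    and faithful: "(\<lambda>n. norm (\<psi> n a)) \<longlonglongrightarrow> 0 \<Longrightarrow> a = 0"
begin

text \<open>
  Every expression evaluated at \<open>\<Theta>\<close> obeys all bounds that hold along the tail
  \<open>\<psi> N, \<psi> (N + 1), \<dots>\<close>.  This property is stable under block sums and unitary conjugation and needs no
  choice of an error or of a finite subset of \<open>A\<close>, so any sequence of maps that are controlled by later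
  and later tails is an asymptotic representation (\<open>approximants_asymptotic_rep\<close>).
\<close>

definition controlled :: "nat \<Rightarrow> nat \<Rightarrow> ('a \<Rightarrow> 'h \<Rightarrow>\<^sub>L 'h) \<Rightarrow> bool" where
  "controlled N D \<Theta> \<longleftrightarrow> (\<forall>a. \<Theta> a \<in> corner D) \<and>
    (\<forall>E\<in>tests. \<forall>K. (\<forall>n\<ge>N. norm (E (\<psi> n)) \<le> K) \<longrightarrow> norm (E \<Theta>) \<le> K)"

lemma controlled_corner: "controlled N D \<Theta> \<Longrightarrow> \<Theta> a \<in> corner D"
  by (simp add: controlled_def)

lemma controlled_bound: "controlled N D \<Theta> \<Longrightarrow> E \<in> tests \<Longrightarrow> (\<And>n. n \<ge> N \<Longrightarrow> norm (E (\<psi> n)) \<le> K) \<Longrightarrow> norm (E \<Theta>) \<le> K"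
  by (simp add: controlled_def)

lemma controlled_mono: "controlled N D \<Theta> \<Longrightarrow> M \<le> N \<Longrightarrow> D \<le> D' \<Longrightarrow> controlled M D' \<Theta>"
  using corner_mono[of D D'] unfolding controlled_def by (meson le_trans subsetD)

lemma controlled_\<psi>: "N \<le> n \<Longrightarrow> controlled N (k n) (\<psi> n)"
  by (simp add: controlled_def \<psi>_corner)

lemma controlled_bsum:
  assumes "controlled N D \<Theta>" "controlled N D' \<Theta>'"
  shows "controlled N (D + D') (\<lambda>a. bsum D D' (\<Theta> a) (\<Theta>' a))"
proof -
  note c = controlled_corner[OF assms(1)] controlled_corner[OF assms(2)]
  show ?thesis unfolding controlled_def
  proof (intro conjI allI ballI impI)
    show "bsum D D' (\<Theta> a) (\<Theta>' a) \<in> corner (D + D')" for a by (rule bsum_corner[OF c])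
    fix E :: "('a \<Rightarrow> 'h \<Rightarrow>\<^sub>L 'h) \<Rightarrow> 'h \<Rightarrow>\<^sub>L 'h" and K
    assume E: "E \<in> tests" "\<forall>n\<ge>N. norm (E (\<psi> n)) \<le> K"
    have "norm (E \<Theta>) \<le> K" "norm (E \<Theta>') \<le> K"
      using controlled_bound[OF assms(1) E(1)] controlled_bound[OF assms(2) E(1)] E(2) by blast+
    then show "norm (E (\<lambda>a. bsum D D' (\<Theta> a) (\<Theta>' a))) \<le> K"
      unfolding bsum_tests[OF c E(1)]
      by (rule norm_bsum_le[OF corner_tests[OF c(1) E(1)] corner_tests[OF c(2) E(1)]])
  qed
qed

lemma controlled_conj:
  assumes "controlled N D \<Theta>" "unitary_on D U"
  shows "controlled N D (\<lambda>a. conj_op U (\<Theta> a))"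
  unfolding controlled_def
proof (intro conjI allI ballI impI)
  note c = controlled_corner[OF assms(1)]
  show "conj_op U (\<Theta> a) \<in> corner D" for a by (rule conj_op_corner[OF assms(2) c])
  fix E :: "('a \<Rightarrow> 'h \<Rightarrow>\<^sub>L 'h) \<Rightarrow> 'h \<Rightarrow>\<^sub>L 'h" and K
  assume E: "E \<in> tests" "\<forall>n\<ge>N. norm (E (\<psi> n)) \<le> K"
  have "norm (E \<Theta>) \<le> K" by (rule controlled_bound[OF assms(1) E(1)]) (use E(2) in blast)
  then show "norm (E (\<lambda>a. conj_op U (\<Theta> a))) \<le> K"
    unfolding conj_op_tests[OF assms(2) cornerD(1)[OF c] E(1)]
    by (rule order_trans[OF norm_conj_op_le[OF assms(2)]])
qed

definition approximants :: "(nat \<Rightarrow> nat) \<Rightarrow> (nat \<Rightarrow> 'a \<Rightarrow> 'h \<Rightarrow>\<^sub>L 'h) \<Rightarrow> bool" where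
  "approximants D \<Theta> \<longleftrightarrow> (\<forall>j. controlled j (D j) (\<Theta> j))"

lemma approximants_asymptotic_rep:
  assumes "approximants D \<Theta>" shows "asymptotic_rep \<Theta>"
  unfolding asymptotic_rep_tests
proof (intro conjI allI ballI)
  have c: "controlled j (D j) (\<Theta> j)" for j using assms by (simp add: approximants_def)
  show "\<Theta> j a \<in> bounded_ops" for j a by (rule cornerD(1)[OF controlled_corner[OF c]])
  show "bounded_seq (\<lambda>j. \<Theta> j a)" for a
  proof -
    obtain K where K: "\<And>n. norm (\<psi> n a) \<le> K" using bounded_seqE[OF rep_bounded[OF \<psi>]] by blast
    have "(\<lambda>\<Theta>. \<Theta> a) \<in> tests" by (simp add: tests_def)
    from controlled_bound[OF c this, of _ K] K have "norm (\<Theta> j a) \<le> K" for j by blast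
    then show ?thesis by (rule bounded_seqI)
  qed
  fix E :: "('a \<Rightarrow> 'h \<Rightarrow>\<^sub>L 'h) \<Rightarrow> 'h \<Rightarrow>\<^sub>L 'h" assume E: "E \<in> vanishing_tests"
  then have lim: "(\<lambda>n. norm (E (\<psi> n))) \<longlonglongrightarrow> 0" using \<psi> by (simp add: asymptotic_rep_tests)
  show "(\<lambda>j. norm (E (\<Theta> j))) \<longlonglongrightarrow> 0"
  proof (rule LIMSEQ_I)
    fix r :: real assume "r > 0"
    then obtain N where N: "\<And>n. n \<ge> N \<Longrightarrow> norm (E (\<psi> n)) < r / 2" using LIMSEQ_D[OF lim, of "r / 2"] by auto
    have Et: "E \<in> tests" using E by (simp add: tests_def)
    have "norm (E (\<Theta> j)) \<le> r / 2" if "j \<ge> N" for j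
      by (rule controlled_bound[OF c Et]) (use N that in \<open>meson less_imp_le order_trans\<close>)
    then show "\<exists>no. \<forall>j\<ge>no. norm (norm (E (\<Theta> j)) - 0) < r" using \<open>r > 0\<close> by (intro exI[of _ N]) fastforce
  qed
qed

end

section \<open>Approximation of vectors in a representation\<close>

text \<open>
  Separation of the first \<open>r\<close> coordinates of a point from a bounded convex set that need not be
  closed.  The functional points from a point \<open>d\<close> of almost minimal distance to \<open>t\<close>: if it were larger
  at some \<open>d'\<close>, a short step from \<open>d\<close> towards \<open>d'\<close> would bring the squared distance below its
  infimum.
\<close>

lemma nearest_point_separation:
  fixes S :: "(nat \<Rightarrow> real) set" and t :: "nat \<Rightarrow> real"
  assumes ne: "S \<noteq> {}" and bd: "\<And>d i. d \<in> S \<Longrightarrow> i < r \<Longrightarrow> \<bar>d i\<bar> \<le> B i"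
    and conv: "\<And>d d' \<tau>. d \<in> S \<Longrightarrow> d' \<in> S \<Longrightarrow> 0 \<le> \<tau> \<Longrightarrow> \<tau> \<le> 1 \<Longrightarrow> \<exists>d''\<in>S. \<forall>i<r. d'' i = (1 - \<tau>) * d i + \<tau> * d' i"
    and \<epsilon>: "\<epsilon> > 0" and far: "\<And>d. d \<in> S \<Longrightarrow> \<epsilon> \<le> (\<Sum>i<r. (d i - t i)\<^sup>2)"
  shows "\<exists>l c. (\<forall>d\<in>S. (\<Sum>i<r. l i * d i) \<le> c) \<and> c < (\<Sum>i<r. l i * t i)"
proof -
  define g where "g d = (\<Sum>i<r. (d i - t i)\<^sup>2)" for d
  define m where "m = Inf (g ` S)"
  have bdd: "bdd_below (g ` S)" by (rule bdd_belowI2[where m = 0]) (simp add: g_def sum_nonneg)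
  have m_le: "m \<le> g d" if "d \<in> S" for d unfolding m_def by (rule cINF_lower[OF bdd that])
  have m_ge: "\<epsilon> \<le> m" unfolding m_def by (rule cINF_greatest[OF ne]) (use far in \<open>simp add: g_def\<close>)
  then have m0: "m > 0" using \<epsilon> by linarith
  define R where "R = (\<Sum>i<r. (2 * B i)\<^sup>2) + 1"
  have R1: "R \<ge> 1" by (simp add: R_def sum_nonneg)
  \<comment> \<open>The step \<open>\<tau>\<close> is so short that the quadratic term \<open>\<tau>\<^sup>2 * R\<close> is dominated by the linear gain.\<close>
  define \<tau> where "\<tau> = min 1 (m / (4 * R))"
  have \<tau>: "0 < \<tau>" "\<tau> \<le> 1" "\<tau> * R \<le> m / 4"
  proof -
    show "0 < \<tau>" "\<tau> \<le> 1" using m0 R1 by (simp_all add: \<tau>_def)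
    have "\<tau> * R \<le> m / (4 * R) * R" unfolding \<tau>_def using R1 by (intro mult_right_mono) auto
    then show "\<tau> * R \<le> m / 4" using R1 by simp
  qed
  have "\<exists>d\<in>S. g d < m + \<tau>\<^sup>2 * R"
  proof -
    have "Inf (g ` S) < m + \<tau>\<^sup>2 * R" using \<tau> R1 by (simp add: m_def)
    then show ?thesis using cInf_less_iff[of "g ` S"] ne bdd by auto
  qed
  then obtain d where d: "d \<in> S" "g d < m + \<tau>\<^sup>2 * R" by blast
  define l where "l i = t i - d i" for i
  define c where "c = (\<Sum>i<r. l i * d i) + m / 4"
  have "(\<Sum>i<r. l i * d' i) \<le> c" if d': "d' \<in> S" for d'
  proof -
    obtain d'' where d'': "d'' \<in> S" "\<And>i. i < r \<Longrightarrow> d'' i = (1 - \<tau>) * d i + \<tau> * d' i"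
      using conv[OF d(1) d', of \<tau>] \<tau> by auto
    define q where "q = (\<Sum>i<r. (d' i - d i)\<^sup>2)"
    define p where "p = (\<Sum>i<r. l i * (d' i - d i))"
    have "q \<le> (\<Sum>i<r. (2 * B i)\<^sup>2)" unfolding q_def
    proof (rule sum_mono)
      fix i assume "i \<in> {..<r}"
      then have "\<bar>d' i - d i\<bar> \<le> \<bar>2 * B i\<bar>" using bd[OF d(1), of i] bd[OF d', of i] by auto
      then show "(d' i - d i)\<^sup>2 \<le> (2 * B i)\<^sup>2" by (simp only: abs_le_square_iff)
    qed
    then have q: "q \<le> R" by (simp add: R_def)
    have "g d'' = (\<Sum>i<r. (d i - t i)\<^sup>2 - 2 * \<tau> * (l i * (d' i - d i)) + \<tau>\<^sup>2 * (d' i - d i)\<^sup>2)"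
      unfolding g_def by (rule sum.cong) (auto simp: d'' l_def power2_eq_square algebra_simps)
    also have "\<dots> = g d - 2 * \<tau> * p + \<tau>\<^sup>2 * q"
      by (simp add: g_def p_def q_def sum.distrib sum_subtractf sum_distrib_left)
    finally have "m \<le> g d - 2 * \<tau> * p + \<tau>\<^sup>2 * q" using m_le[OF d''(1)] by simp
    moreover have "\<tau>\<^sup>2 * q \<le> \<tau>\<^sup>2 * R" by (rule mult_left_mono[OF q]) simp
    ultimately have "2 * \<tau> * p \<le> 2 * \<tau> * (\<tau> * R)" using d(2) by (simp add: power2_eq_square)
    then have "p \<le> \<tau> * R" using \<tau>(1) by simp
    then have "p \<le> m / 4" using \<tau>(3) by linarith
    moreover have "p = (\<Sum>i<r. l i * d' i) - (\<Sum>i<r. l i * d i)"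
      by (simp add: p_def right_diff_distrib sum_subtractf)
    ultimately show ?thesis by (simp add: c_def)
  qed
  moreover have "c < (\<Sum>i<r. l i * t i)"
  proof -
    have "(\<Sum>i<r. l i * t i) - (\<Sum>i<r. l i * d i) = g d"
      by (simp add: g_def l_def sum_subtractf[symmetric] power2_eq_square algebra_simps)
    then show ?thesis using m_le[OF d(1)] m0 by (simp add: c_def)
  qed
  ultimately show ?thesis by blast
qed

lemma close_cinner:
  assumes "close X Y" "bounded_seq x" "bounded_seq y"
  shows "(\<lambda>j. cinner (x j) (blinfun_apply (X j) (y j)) - cinner (x j) (Y j (y j))) \<longlonglongrightarrow> 0"
proof -
  obtain K L where K: "\<And>j. norm (x j) \<le> K" and L: "\<And>j. norm (y j) \<le> L" using assms(2,3) by (auto simp: bounded_seq_def)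
  have "(\<lambda>j. norm (X j - Y j) * (K * L)) \<longlonglongrightarrow> 0"
    using assms(1) unfolding close_def by (rule tendsto_mult_left_zero)
  then show ?thesis
  proof (rule Lim_null_comparison[rotated], intro always_eventually allI)
    fix j
    have "cinner (x j) (X j (y j)) - cinner (x j) (Y j (y j)) = cinner (x j) ((X j - Y j) (y j))"
      by (simp add: blinfun.diff_left cinner_diff_right)
    also have "norm \<dots> \<le> norm (X j - Y j) * norm (x j) * norm (y j)" by (rule norm_cinner_op)
    also have "\<dots> \<le> norm (X j - Y j) * (K * L)"
      unfolding mult.assoc using order_trans[OF norm_ge_zero K] by (intro mult_left_mono mult_mono K L) auto
    finally show "norm (cinner (x j) (X j (y j)) - cinner (x j) (Y j (y j))) \<le> norm (X j - Y j) * (K * L)" .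
  qed
qed

lemma perturb_cinner:
  fixes T :: "nat \<Rightarrow> 'h::chilbert_space \<Rightarrow>\<^sub>L 'h"
  assumes "(\<lambda>j. x j - x' j) \<longlonglongrightarrow> 0" "(\<lambda>j. y j - y' j) \<longlonglongrightarrow> 0" "bounded_seq x'" "bounded_seq y" "bounded_seq T"
  shows "(\<lambda>j. cinner (x j) (T j (y j)) - cinner (x' j) (T j (y' j))) \<longlonglongrightarrow> 0"
proof -
  obtain K where K: "\<And>j. norm (x' j) \<le> K" using assms(3) by (auto simp: bounded_seq_def)
  obtain L where L: "\<And>j. norm (y j) \<le> L" using assms(4) by (auto simp: bounded_seq_def)
  obtain M where M: "\<And>j. norm (T j) \<le> M" using assms(5) by (auto simp: bounded_seq_def)
  have nn: "0 \<le> K" "0 \<le> L" "0 \<le> M"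
    using order_trans[OF norm_ge_zero K[of 0]] order_trans[OF norm_ge_zero L[of 0]] order_trans[OF norm_ge_zero M[of 0]] by auto
  have "(\<lambda>j. norm (x j - x' j) * (M * L)) \<longlonglongrightarrow> 0" "(\<lambda>j. norm (y j - y' j) * (M * K)) \<longlonglongrightarrow> 0"
    using assms(1,2) by (auto intro!: tendsto_mult_left_zero tendsto_norm_zero)
  then have "(\<lambda>j. norm (x j - x' j) * (M * L) + norm (y j - y' j) * (M * K)) \<longlonglongrightarrow> 0" by (rule tendsto_add_zero)
  then show ?thesis
  proof (rule Lim_null_comparison[rotated], intro always_eventually allI)
    fix j
    have "cinner (x j) (T j (y j)) - cinner (x' j) (T j (y' j))
        = cinner (x j - x' j) (T j (y j)) + cinner (x' j) (T j (y j - y' j))"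
      by (simp add: cinner_diff_left blinfun.diff_right cinner_diff_right)
    also have "norm \<dots> \<le> norm (cinner (x j - x' j) (T j (y j))) + norm (cinner (x' j) (T j (y j - y' j)))"
      by (rule norm_triangle_ineq)
    also have "norm (cinner (x j - x' j) (T j (y j))) \<le> norm (T j) * norm (x j - x' j) * norm (y j)" by (rule norm_cinner_op)
    also have "\<dots> = norm (x j - x' j) * (norm (T j) * norm (y j))" by simp
    also have "\<dots> \<le> norm (x j - x' j) * (M * L)" by (intro mult_left_mono mult_mono M L nn) auto
    also have "norm (cinner (x' j) (T j (y j - y' j))) \<le> norm (T j) * norm (x' j) * norm (y j - y' j)" by (rule norm_cinner_op)
    also have "\<dots> = norm (y j - y' j) * (norm (T j) * norm (x' j))" by simp
    also have "\<dots> \<le> norm (y j - y' j) * (M * K)" by (intro mult_left_mono mult_mono M K nn) auto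
    finally show "norm (cinner (x j) (T j (y j)) - cinner (x' j) (T j (y' j)))
        \<le> norm (x j - x' j) * (M * L) + norm (y j - y' j) * (M * K)" by simp
  qed
qed

lemma star_hom_zero: "star_hom bounded_op_alg f \<Longrightarrow> f 0 = 0"
  using star_homD(2)[of f 0 0] by simp

lemma star_hom_diff: "star_hom bounded_op_alg f \<Longrightarrow> f (a - b) = f a - f b"
  using star_homD(2)[of f "a - b" b] by simp

lemma star_hom_ext:
  fixes f :: "'a::cstar_algebra \<Rightarrow> 'k::chilbert_space \<Rightarrow>\<^sub>L 'k"
  assumes f: "star_hom bounded_op_alg f" shows "star_hom bounded_op_alg (ext f)"
proof -
  note E = asymptotic_rep_ext[OF asymptotic_rep_star_hom[OF f]]
  have eq: "S = T" if "close (\<lambda>n. S) (\<lambda>n. T)" for S T :: "'k \<Rightarrow>\<^sub>L 'k"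
    using that by (simp add: close_def LIMSEQ_const_iff)
  show ?thesis unfolding star_hom_def bounded_op_alg_simps
    using rep_bounded_ops[OF E] eq[OF rep_add[OF E]] eq[OF rep_scaleC[OF E]] eq[OF rep_mult[OF E]] eq[OF rep_cstar[OF E]]
    by blast
qed

text \<open>
  By asymptotic contractivity, coefficients at \<open>a\<close> and at a nearby \<open>b\<close> differ uniformly little, so
  convergence passes to limits in \<open>A\<close>.
\<close>

lemma coefficient_limit_closed:
  fixes \<Theta> :: "nat \<Rightarrow> 'a::cstar_algebra \<Rightarrow> 'h::chilbert_space \<Rightarrow>\<^sub>L 'h" and f :: "'a \<Rightarrow> 'k::chilbert_space \<Rightarrow>\<^sub>L 'k"
  assumes \<Theta>: "asymptotic_rep \<Theta>" and f: "star_hom bounded_op_alg f" and x: "bounded_seq x" and y: "bounded_seq y"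
    and C: "\<And>\<epsilon>. \<epsilon> > 0 \<Longrightarrow> \<exists>b. norm (a - b) < \<epsilon> \<and> (\<lambda>j. cinner (x j) (\<Theta> j b (y j))) \<longlonglongrightarrow> cinner x' (f b y')"
  shows "(\<lambda>j. cinner (x j) (\<Theta> j a (y j))) \<longlonglongrightarrow> cinner x' (f a y')"
proof (rule LIMSEQ_I)
  fix r :: real assume r: "r > 0"
  obtain K where K: "K > 0" "\<And>j. norm (x j) \<le> K" by (rule bounded_seqE[OF x]) blast
  obtain L where L: "L > 0" "\<And>j. norm (y j) \<le> L" by (rule bounded_seqE[OF y]) blast
  define M where "M = max (K * L) (norm x' * norm y')"
  have M: "M > 0" "norm (x j) * norm (y j) \<le> M" "norm x' * norm y' \<le> M" for j
  proof -
    have "norm (x j) * norm (y j) \<le> K * L" using K L by (intro mult_mono) auto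
    then show "norm (x j) * norm (y j) \<le> M" by (simp add: M_def)
    show "M > 0" using K(1) L(1) by (simp add: M_def less_max_iff_disj)
  qed (simp add: M_def)
  define \<delta> where "\<delta> = r / (8 * M)"
  have \<delta>: "\<delta> > 0" "2 * \<delta> * M = r / 4" using r M(1) by (simp_all add: \<delta>_def)
  obtain b where b: "norm (a - b) < \<delta>" "(\<lambda>j. cinner (x j) (\<Theta> j b (y j))) \<longlonglongrightarrow> cinner x' (f b y')"
    using C[OF \<delta>(1)] by blast
  have coef: "cmod (cinner u (blinfun_apply T v)) \<le> r / 4"
    if "norm T \<le> norm (a - b) + \<delta>" "norm u * norm v \<le> M" for T :: "'z::chilbert_space \<Rightarrow>\<^sub>L 'z" and u v
  proof -
    have "cmod (cinner u (T v)) \<le> norm T * (norm u * norm v)" using norm_cinner_op[of u T v] by (simp add: mult.assoc)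
    also have "\<dots> \<le> (2 * \<delta>) * M" using that b(1) \<delta>(1) by (intro mult_mono) auto
    finally show ?thesis by (simp add: \<delta>)
  qed
  have 1: "\<forall>\<^sub>F j in sequentially. cmod (cinner (x j) (\<Theta> j b (y j)) - cinner x' (f b y')) < r / 4"
    using tendstoD[OF b(2), of "r / 4"] r by (simp add: dist_norm)
  have 2: "\<forall>\<^sub>F j in sequentially. cmod (cinner (x j) (\<Theta> j (a - b) (y j)) - cinner (x j) ((\<Theta> j a - \<Theta> j b) (y j))) < r / 4"
    using tendstoD[OF close_cinner[OF rep_diff[OF \<Theta>] x y], of "r / 4"] r by (simp add: dist_norm)
  have 3: "\<forall>\<^sub>F j in sequentially. norm (\<Theta> j (a - b)) \<le> norm (a - b) + \<delta>"
    by (rule asymptotically_contractive[OF \<Theta> \<delta>(1)])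
  have 4: "norm (f (a - b)) \<le> norm (a - b) + \<delta>"
    using asymptotically_contractive[OF asymptotic_rep_star_hom[OF f] \<delta>(1), of "a - b"] by simp
  have "\<forall>\<^sub>F j in sequentially. cmod (cinner (x j) (\<Theta> j a (y j)) - cinner x' (f a y')) < r"
    using 1 2 3
  proof eventually_elim
    case (elim j)
    define A where "A = cinner (x j) (\<Theta> j b (y j)) - cinner x' (f b y')"
    define B where "B = cinner (x j) (\<Theta> j (a - b) (y j)) - cinner (x j) ((\<Theta> j a - \<Theta> j b) (y j))"
    define C where "C = cinner (x j) (\<Theta> j (a - b) (y j))"
    define D where "D = cinner x' (f (a - b) y')"
    have "cinner (x j) (\<Theta> j a (y j)) - cinner x' (f a y') = A - B + C - D"
      by (simp add: A_def B_def C_def D_def star_hom_diff[OF f] blinfun.diff_left cinner_diff_right)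
    moreover have "cmod (A - B + C - D) \<le> cmod A + cmod B + cmod C + cmod D"
      using norm_triangle_ineq4[of "A - B + C" D] norm_triangle_ineq[of "A - B" C] norm_triangle_ineq4[of A B] by linarith
    moreover have "cmod C \<le> r / 4" unfolding C_def by (rule coef[OF elim(3) M(2)])
    moreover have "cmod D \<le> r / 4" unfolding D_def by (rule coef[OF 4 M(3)])
    moreover have "cmod A < r / 4" "cmod B < r / 4" using elim(1,2) by (simp_all add: A_def B_def)
    ultimately show ?case by simp
  qed
  then show "\<exists>no. \<forall>j\<ge>no. norm (cinner (x j) (\<Theta> j a (y j)) - cinner x' (f a y')) < r"
    by (simp add: eventually_sequentially)
qed

lemma coefficient_limit_add:
  assumes \<Theta>: "asymptotic_rep \<Theta>" and f: "star_hom bounded_op_alg f" and x: "bounded_seq x" and y: "bounded_seq y"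
    and a: "(\<lambda>j. cinner (x j) (\<Theta> j a (y j))) \<longlonglongrightarrow> cinner x' (f a y')"
    and b: "(\<lambda>j. cinner (x j) (\<Theta> j b (y j))) \<longlonglongrightarrow> cinner x' (f b y')"
  shows "(\<lambda>j. cinner (x j) (\<Theta> j (a + b) (y j))) \<longlonglongrightarrow> cinner x' (f (a + b) y')"
proof -
  have "(\<lambda>j. cinner (x j) (\<Theta> j (a + b) (y j)) - cinner (x j) ((\<Theta> j a + \<Theta> j b) (y j))
      + (cinner (x j) (\<Theta> j a (y j)) + cinner (x j) (\<Theta> j b (y j)))) \<longlonglongrightarrow> 0 + (cinner x' (f a y') + cinner x' (f b y'))"
    by (intro tendsto_add close_cinner[OF rep_add[OF \<Theta>] x y] a b)
  then show ?thesis by (simp add: blinfun.add_left cinner_add_right star_homD(2)[OF f])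
qed

lemma coefficient_limit_scaleC:
  assumes \<Theta>: "asymptotic_rep \<Theta>" and f: "star_hom bounded_op_alg f" and x: "bounded_seq x" and y: "bounded_seq y"
    and a: "(\<lambda>j. cinner (x j) (\<Theta> j a (y j))) \<longlonglongrightarrow> cinner x' (f a y')"
  shows "(\<lambda>j. cinner (x j) (\<Theta> j (c *\<^sub>C a) (y j))) \<longlonglongrightarrow> cinner x' (f (c *\<^sub>C a) y')"
proof -
  have "(\<lambda>j. cinner (x j) (\<Theta> j (c *\<^sub>C a) (y j)) - cinner (x j) (scale_op c (\<Theta> j a) (y j))
      + c * cinner (x j) (\<Theta> j a (y j))) \<longlonglongrightarrow> 0 + c * cinner x' (f a y')"
    by (intro tendsto_add tendsto_mult tendsto_const close_cinner[OF rep_scaleC[OF \<Theta>] x y] a)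
  then show ?thesis by (simp add: cinner_scaleC_right star_homD(3)[OF f])
qed

lemma (in orthonormal_basis) bsum_cinner:
  assumes S: "S \<in> corner D" and T: "T \<in> corner D'" and "proj D \<zeta> = \<zeta>" "proj D' \<zeta>' = \<zeta>'" "proj D \<eta> = \<eta>" "proj D' \<eta>' = \<eta>'"
  shows "cinner (\<zeta> + shift D D' \<zeta>') (bsum D D' S T (\<eta> + shift D D' \<eta>')) = cinner \<zeta> (S \<eta>) + cinner \<zeta>' (T \<eta>')"
    and "cinner (\<zeta> + shift D D' \<zeta>') (\<eta> + shift D D' \<eta>') = cinner \<zeta> \<eta> + cinner \<zeta>' \<eta>'"
    and "proj (D + D') (\<eta> + shift D D' \<eta>') = \<eta> + shift D D' \<eta>'"
proof -
  have u: "unshift D D' \<zeta> = 0" "unshift D D' \<eta> = 0"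
    using shift_simps(3)[of D D' \<zeta>] shift_simps(3)[of D D' \<eta>] assms by simp_all
  have o: "cinner w (shift D D' z) = 0" if "unshift D D' w = 0" for w z
    using cinner_unshift[of D D' w z] that by (simp add: cinner_zero_left)
  show "cinner (\<zeta> + shift D D' \<zeta>') (bsum D D' S T (\<eta> + shift D D' \<eta>')) = cinner \<zeta> (S \<eta>) + cinner \<zeta>' (T \<eta>')"
    by (simp add: bsum_apply blinfun.add_right corner_shift[OF S] u shift_simps assms cinner_add_left cinner_add_right
        cinner_shift o cornerD(2)[OF T] cinner_zero_right)
  show "cinner (\<zeta> + shift D D' \<zeta>') (\<eta> + shift D D' \<eta>') = cinner \<zeta> \<eta> + cinner \<zeta>' \<eta>'"
    by (simp add: cinner_add_left cinner_add_right cinner_shift u o shift_simps assms cinner_zero_right)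
  have "proj (D + D') \<eta> = \<eta>" using proj_proj[of "D + D'" D \<eta>] assms by simp
  then show "proj (D + D') (\<eta> + shift D D' \<eta>') = \<eta> + shift D D' \<eta>'" by (simp add: blinfun.add_right shift_simps)
qed

locale lifting_problem = faithful_asymptotic_rep e \<psi> k
  for e :: "nat \<Rightarrow> 'h::chilbert_space" and \<psi> :: "nat \<Rightarrow> 'a::cstar_algebra \<Rightarrow> 'h \<Rightarrow>\<^sub>L 'h" and k +
  fixes f :: "'a \<Rightarrow> 'h \<Rightarrow>\<^sub>L 'h" and s :: "nat \<Rightarrow> 'a"
  assumes f: "star_hom bounded_op_alg f" and dense: "r > 0 \<Longrightarrow> \<exists>n. dist a (s n) < r"
begin

text \<open>
  Otherwise the vector state of \<open>\<xi>\<close>, evaluated at the \<open>h i\<close>, is separated from the convex set \<open>S\<close> of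
  the values of all vector states of controlled maps: at some real combination \<open>x\<close> of the \<open>h i\<close> those
  vector states are at most \<open>c\<close>, while the one of \<open>\<xi>\<close> is larger than \<open>c\<close>.  As the late \<open>\<psi> n\<close> are controlled,
  \<open>\<psi> n x \<le> c\<close> asymptotically, which contradicts \<open>upper_bound_transfer\<close>.  That result needs a positive
  bound, and \<open>c \<ge> 0\<close> because \<open>0\<close> belongs to \<open>S\<close>.
\<close>

lemma vector_state_approx:
  fixes h :: "nat \<Rightarrow> 'a"
  assumes h: "\<And>i. cstar (h i) = h i" and \<xi>: "norm \<xi> = 1" and \<epsilon>: "\<epsilon> > 0"
  shows "\<exists>D \<Theta> \<eta>. controlled N D \<Theta> \<and> proj D \<eta> = \<eta> \<and> norm \<eta> = 1 \<and>
    (\<Sum>i<r. (Re (cinner \<eta> (\<Theta> (h i) \<eta>)) - Re (cinner \<xi> (f (h i) \<xi>)))\<^sup>2) < \<epsilon>"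
proof (rule ccontr)
  assume contra: "\<not> ?thesis"
  define S where "S = {d. \<exists>D \<Theta> \<eta>. controlled N D \<Theta> \<and> proj D \<eta> = \<eta> \<and> norm \<eta> = 1 \<and> d = (\<lambda>i. Re (cinner \<eta> (\<Theta> (h i) \<eta>)))}"
  define t where "t i = Re (cinner \<xi> (f (h i) \<xi>))" for i
  have S_I: "(\<lambda>i. Re (cinner \<eta> (\<Theta> (h i) \<eta>))) \<in> S" if "controlled N D \<Theta>" "proj D \<eta> = \<eta>" "norm \<eta> = 1" for D \<Theta> \<eta>
    unfolding S_def using that by blast
  \<comment> \<open>Enlarging the corner by one dimension makes room for a unit vector that \<open>\<psi> n\<close> annihilates.\<close>
  have zero: "(\<lambda>i. 0) \<in> S" if n: "n \<ge> N" for n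
  proof -
    have "controlled N (Suc (k n)) (\<psi> n)" by (rule controlled_mono[OF controlled_\<psi>[OF n]]) auto
    moreover have "\<psi> n a (e (k n)) = 0" for a
      using cornerD(3)[OF \<psi>_corner, of n a "e (k n)"] by (simp add: proj_e blinfun.zero_right)
    ultimately show ?thesis using S_I[of "Suc (k n)" "\<psi> n" "e (k n)"] by (simp add: proj_e cinner_zero_right)
  qed
  have "\<exists>l c. (\<forall>d\<in>S. (\<Sum>i<r. l i * d i) \<le> c) \<and> c < (\<Sum>i<r. l i * t i)"
  proof (rule nearest_point_separation[OF _ _ _ \<epsilon>])
    show "S \<noteq> {}" using zero[of N] by auto
    show "\<epsilon> \<le> (\<Sum>i<r. (d i - t i)\<^sup>2)" if "d \<in> S" for d
      using contra that unfolding S_def t_def by (force simp: not_less)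
    define B where "B i = (SOME K. \<forall>n. norm (\<psi> n (h i)) \<le> K)" for i
    have B: "norm (\<psi> n (h i)) \<le> B i" for n i
    proof -
      have "\<exists>K. \<forall>n. norm (\<psi> n (h i)) \<le> K" using rep_bounded[OF \<psi>, of "h i"] by (simp add: bounded_seq_def)
      then have "\<forall>n. norm (\<psi> n (h i)) \<le> B i" unfolding B_def by (rule someI_ex)
      then show ?thesis by blast
    qed
    show "\<bar>d i\<bar> \<le> B i" if dS: "d \<in> S" and "i < r" for d i
    proof -
      obtain D \<Theta> \<eta> where d: "controlled N D \<Theta>" "norm \<eta> = 1" "d = (\<lambda>i. Re (cinner \<eta> (\<Theta> (h i) \<eta>)))"
        using dS unfolding S_def by blast
      have "(\<lambda>\<Theta>. \<Theta> (h i)) \<in> tests" by (simp add: tests_def)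
      from controlled_bound[OF d(1) this, of "B i"] B have "norm (\<Theta> (h i)) \<le> B i" by blast
      moreover have "\<bar>d i\<bar> \<le> norm (\<Theta> (h i))"
        using order_trans[OF abs_Re_le_cmod norm_cinner_op[of \<eta> "\<Theta> (h i)" \<eta>]] by (simp add: d)
      ultimately show ?thesis by linarith
    qed
    fix d d' :: "nat \<Rightarrow> real" and \<tau> :: real
    assume "d \<in> S" "d' \<in> S" and \<tau>: "0 \<le> \<tau>" "\<tau> \<le> 1"
    then obtain D \<Theta> \<eta> D' \<Theta>' \<eta>' where
      d: "controlled N D \<Theta>" "proj D \<eta> = \<eta>" "norm \<eta> = 1" "d = (\<lambda>i. Re (cinner \<eta> (\<Theta> (h i) \<eta>)))" and
      d': "controlled N D' \<Theta>'" "proj D' \<eta>' = \<eta>'" "norm \<eta>' = 1" "d' = (\<lambda>i. Re (cinner \<eta>' (\<Theta>' (h i) \<eta>')))"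
      unfolding S_def by blast
    define u where "u = sqrt (1 - \<tau>) *\<^sub>R \<eta>"
    define u' where "u' = sqrt \<tau> *\<^sub>R \<eta>'"
    \<comment> \<open>A convex combination of vector states is a vector state of the block sum.\<close>
    define w where "w = u + shift D D' u'"
    have pu: "proj D u = u" "proj D' u' = u'" by (simp_all add: u_def u'_def blinfun.scaleR_right d d')
    note b = bsum_cinner[OF controlled_corner[OF d(1)] controlled_corner[OF d'(1)] pu pu, folded w_def]
    have "(norm w)\<^sup>2 = (1 - \<tau>) * (norm \<eta>)\<^sup>2 + \<tau> * (norm \<eta>')\<^sup>2"
      using \<tau> unfolding norm_sq_cinner b(2) by (simp add: u_def u'_def cinner_scaleR_left cinner_scaleR_right)
    then have "(norm w)\<^sup>2 = 1\<^sup>2" using d(3) d'(3) by simp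
    then have nw: "norm w = 1" by (simp only: power2_eq_iff_nonneg norm_ge_zero zero_le_one)
    have "(\<lambda>i. Re (cinner w (bsum D D' (\<Theta> (h i)) (\<Theta>' (h i)) w))) \<in> S"
      by (rule S_I[OF controlled_bsum[OF d(1) d'(1)] b(3) nw])
    moreover have "Re (cinner w (bsum D D' (\<Theta> (h i)) (\<Theta>' (h i)) w)) = (1 - \<tau>) * d i + \<tau> * d' i" for i
      using \<tau> unfolding b(1) by (simp add: u_def u'_def cinner_scaleR_left cinner_scaleR_right blinfun.scaleR_right d(4) d'(4))
    ultimately show "\<exists>d''\<in>S. \<forall>i<r. d'' i = (1 - \<tau>) * d i + \<tau> * d' i"
      by (intro bexI[of _ "\<lambda>i. Re (cinner w (bsum D D' (\<Theta> (h i)) (\<Theta>' (h i)) w))"]) simp_all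
  qed
  then obtain l c where lc: "\<And>d. d \<in> S \<Longrightarrow> (\<Sum>i<r. l i * d i) \<le> c" "c < (\<Sum>i<r. l i * t i)" by blast
  have c0: "0 \<le> c" using lc(1)[OF zero[OF order_refl]] by simp
  define x where "x = (\<Sum>i<r. l i *\<^sub>R h i)"
  have cx: "cstar x = x"
    unfolding x_def linear_sum[OF bounded_linear.linear[OF bounded_linear_cstar]]
    by (simp add: cstar_scaleR h)
  have fx: "Re (cinner \<xi> (f x \<xi>)) = (\<Sum>i<r. l i * t i)"
  proof -
    have "f (\<Sum>i\<in>I. l i *\<^sub>R h i) = (\<Sum>i\<in>I. l i *\<^sub>R f (h i))" if "finite I" for I
      using that by (induction I rule: finite_induct)
        (simp_all add: star_hom_zero[OF f] star_homD(2,3)[OF f] scaleR_scaleC[of _ "h _"] scale_op_of_real)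
    then show ?thesis
      by (simp add: x_def t_def blinfun.sum_left blinfun.scaleR_left cinner_sum_right cinner_scaleR_right)
  qed
  have bound: "Re (cinner v ((\<Sum>i<r. l i *\<^sub>R \<psi> n (h i)) v)) \<le> c * (norm v)\<^sup>2" if n: "n \<ge> N" for n v
  proof -
    define w where "w = proj (k n) v"
    have vw: "cinner v (\<psi> n a v) = cinner w (\<psi> n a w)" for a
      using cinner_proj[of "k n" v "\<psi> n a w"] cornerD(2)[OF \<psi>_corner, of n a w] cornerD(3)[OF \<psi>_corner, of n a v]
      by (simp add: w_def)
    have "(\<Sum>i<r. l i * Re (cinner w (\<psi> n (h i) w))) \<le> c * (norm w)\<^sup>2"
    proof (cases "w = 0")
      case False
      define \<eta> where "\<eta> = (1 / norm w) *\<^sub>R w"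
      have "proj (k n) \<eta> = \<eta>" "norm \<eta> = 1" using False by (simp_all add: \<eta>_def w_def blinfun.scaleR_right proj_proj)
      from lc(1)[OF S_I[OF controlled_\<psi>[OF n] this]]
      have "(norm w)\<^sup>2 * (\<Sum>i<r. l i * Re (cinner \<eta> (\<psi> n (h i) \<eta>))) \<le> (norm w)\<^sup>2 * c"
        by (rule mult_left_mono) simp
      moreover have "Re (cinner w (\<psi> n a w)) = (norm w)\<^sup>2 * Re (cinner \<eta> (\<psi> n a \<eta>))" for a
        using False by (simp add: \<eta>_def blinfun.scaleR_right cinner_scaleR_left cinner_scaleR_right power2_eq_square)
      then have "(\<Sum>i<r. l i * Re (cinner w (\<psi> n (h i) w))) = (norm w)\<^sup>2 * (\<Sum>i<r. l i * Re (cinner \<eta> (\<psi> n (h i) \<eta>)))"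
        by (simp add: sum_distrib_left algebra_simps)
      ultimately show ?thesis by (simp only: mult.commute[of c])
    qed (simp add: cinner_zero_left)
    also have "\<dots> \<le> c * (norm v)\<^sup>2" unfolding w_def by (intro mult_left_mono power_mono norm_proj_le c0) simp
    finally show ?thesis by (simp add: blinfun.sum_left blinfun.scaleR_left cinner_sum_right cinner_scaleR_right vw)
  qed
  define \<delta> where "\<delta> = (c + (\<Sum>i<r. l i * t i)) / 2"
  have \<delta>: "c < \<delta>" "\<delta> < (\<Sum>i<r. l i * t i)" using lc(2) by (simp_all add: \<delta>_def)
  have "Re (cinner \<xi> (f x \<xi>)) \<le> \<delta> * (norm \<xi>)\<^sup>2"
  proof (rule upper_bound_transfer[OF \<psi> faithful cx _ _ f])
    show "\<delta> > 0" using c0 \<delta>(1) by linarith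
    fix \<epsilon>' :: real assume \<epsilon>': "\<epsilon>' > 0"
    have "close (\<lambda>n. \<psi> n x) (\<lambda>n. \<Sum>i<r. l i *\<^sub>R \<psi> n (h i))" unfolding x_def by (rule rep_sum[OF \<psi>]) simp
    from close_quadratic[OF this \<epsilon>'] eventually_ge_at_top[of N]
    show "\<forall>\<^sub>F n in sequentially. \<forall>v. Re (cinner v (\<psi> n x v)) \<le> (\<delta> + \<epsilon>') * (norm v)\<^sup>2"
    proof eventually_elim
      case (elim n)
      show ?case
      proof
        fix v :: 'h
        have "c * (norm v)\<^sup>2 \<le> \<delta> * (norm v)\<^sup>2" using \<delta>(1) by (intro mult_right_mono) auto
        then show "Re (cinner v (\<psi> n x v)) \<le> (\<delta> + \<epsilon>') * (norm v)\<^sup>2"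
          using elim(1)[rule_format, of v] bound[OF elim(2), of v] by (simp add: distrib_right)
      qed
    qed
  qed
  then show False using fx \<delta>(2) \<xi> by simp
qed

text \<open>
  At self-adjoint elements the imaginary parts of the coefficients tend to \<open>0\<close> anyway.
\<close>

lemma hermitian_coefficients:
  fixes \<Theta> :: "nat \<Rightarrow> 'a \<Rightarrow> 'h \<Rightarrow>\<^sub>L 'h"
  assumes \<Theta>: "asymptotic_rep \<Theta>" and \<eta>: "\<And>j. norm (\<eta> j) = 1" and a: "cstar a = a"
    and lim: "(\<lambda>j. Re (cinner (\<eta> j) (\<Theta> j a (\<eta> j)))) \<longlonglongrightarrow> Re (cinner \<xi> (f a \<xi>))"
  shows "(\<lambda>j. cinner (\<eta> j) (\<Theta> j a (\<eta> j))) \<longlonglongrightarrow> cinner \<xi> (f a \<xi>)"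
proof -
  have b: "bounded_seq \<eta>" by (rule bounded_seqI[of _ 1]) (simp add: \<eta>)
  have Im2: "Im (cinner v (T v)) * 2 = Im (cinner v (T v) - cinner v (cadjoint T v))" if "T \<in> bounded_ops" for T :: "'h \<Rightarrow>\<^sub>L 'h" and v
    using arg_cong[OF cinner_commute[of v "cadjoint T v"], of Im] by (simp add: cinner_cadjoint[OF that])
  have "(\<lambda>j. cinner (\<eta> j) (\<Theta> j a (\<eta> j)) - cinner (\<eta> j) (cadjoint (\<Theta> j a) (\<eta> j))) \<longlonglongrightarrow> 0"
    using close_cinner[OF rep_cstar[OF \<Theta>, of a] b b] a by simp
  then have "(\<lambda>j. Im (cinner (\<eta> j) (\<Theta> j a (\<eta> j)) - cinner (\<eta> j) (cadjoint (\<Theta> j a) (\<eta> j))) / 2) \<longlonglongrightarrow> Im 0 / 2"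
    by (intro tendsto_intros) simp_all
  then have "(\<lambda>j. Im (cinner (\<eta> j) (\<Theta> j a (\<eta> j)))) \<longlonglongrightarrow> 0"
    unfolding Im2[OF rep_bounded_ops[OF \<Theta>], symmetric] by simp
  moreover have "Im (cinner \<xi> (f a \<xi>)) = 0"
    using Im2[OF star_homD(1)[OF f, of a], of \<xi>] star_homD(5)[OF f, of a] a by simp
  ultimately show ?thesis using lim by (simp add: tendsto_complex_iff)
qed

text \<open>
  The Gram matrix of the vectors and the coefficients of \<open>f\<close> between them are limits of the
  corresponding data of vectors \<open>\<eta> j p\<close> in corners, under one sequence of approximating maps.
\<close>

definition realized :: "nat \<Rightarrow> (nat \<Rightarrow> 'h) \<Rightarrow> bool" where
  "realized m v \<longleftrightarrow> (\<exists>D \<Theta> \<eta>. approximants D \<Theta> \<and> (\<forall>j. \<forall>p<m. proj (D j) (\<eta> j p) = \<eta> j p) \<and>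
    (\<forall>p<m. \<forall>q<m. (\<lambda>j. cinner (\<eta> j p) (\<eta> j q)) \<longlonglongrightarrow> cinner (v p) (v q)) \<and>
    (\<forall>a. \<forall>p<m. \<forall>q<m. (\<lambda>j. cinner (\<eta> j p) (\<Theta> j a (\<eta> j q))) \<longlonglongrightarrow> cinner (v p) (f a (v q))))"

lemma realized_cong: "realized m v \<Longrightarrow> (\<And>p. p < m \<Longrightarrow> v p = w p) \<Longrightarrow> realized m w"
proof -
  assume "realized m v" and eq: "\<And>p. p < m \<Longrightarrow> v p = w p"
  then obtain D \<Theta> \<eta> where "approximants D \<Theta>" "\<forall>j. \<forall>p<m. proj (D j) (\<eta> j p) = \<eta> j p"
    "\<forall>p<m. \<forall>q<m. (\<lambda>j. cinner (\<eta> j p) (\<eta> j q)) \<longlonglongrightarrow> cinner (v p) (v q)"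
    "\<forall>a. \<forall>p<m. \<forall>q<m. (\<lambda>j. cinner (\<eta> j p) (\<Theta> j a (\<eta> j q))) \<longlonglongrightarrow> cinner (v p) (f a (v q))"
    unfolding realized_def by blast
  then show ?thesis unfolding realized_def
    by (intro exI[of _ D] exI[of _ \<Theta>] exI[of _ \<eta>]) (simp add: eq[symmetric])
qed

lemma gram_bounded:
  fixes \<eta> :: "nat \<Rightarrow> 'h"
  assumes "(\<lambda>j. cinner (\<eta> j) (\<eta> j)) \<longlonglongrightarrow> c" shows "bounded_seq \<eta>"
proof -
  have "Bseq (\<lambda>j. cinner (\<eta> j) (\<eta> j))" by (intro convergent_imp_Bseq convergentI[OF assms])
  then obtain K where K: "\<And>j. norm (cinner (\<eta> j) (\<eta> j)) \<le> K" by (auto simp: Bseq_def)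
  show ?thesis
  proof (rule bounded_seqI[of _ "sqrt K"])
    show "norm (\<eta> j) \<le> sqrt K" for j
      using K[of j] by (intro real_le_rsqrt) (simp add: cinner_self norm_power)
  qed
qed

lemma dense_coefficients:
  fixes \<Theta> :: "nat \<Rightarrow> 'a \<Rightarrow> 'h \<Rightarrow>\<^sub>L 'h"
  assumes \<Theta>: "asymptotic_rep \<Theta>" and x: "bounded_seq x" and y: "bounded_seq y"
    and lim: "\<And>i. (\<lambda>j. cinner (x j) (\<Theta> j (s i) (y j))) \<longlonglongrightarrow> cinner x' (f (s i) y')"
  shows "(\<lambda>j. cinner (x j) (\<Theta> j a (y j))) \<longlonglongrightarrow> cinner x' (f a y')"
proof (rule coefficient_limit_closed[OF \<Theta> f x y])
  fix \<epsilon> :: real assume "\<epsilon> > 0"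
  then obtain n where "norm (a - s n) < \<epsilon>" using dense[of \<epsilon> a] by (auto simp: dist_norm)
  with lim show "\<exists>b. norm (a - b) < \<epsilon> \<and> (\<lambda>j. cinner (x j) (\<Theta> j b (y j))) \<longlonglongrightarrow> cinner x' (f b y')" by blast
qed

text \<open>
  The approximation of vector states is used with the first \<open>j\<close> members of a sequence that is dense in the
  self-adjoint part of \<open>A\<close>, with tail \<open>j\<close> and error \<open>1 / (j + 1)\<close>.
\<close>

lemma realized_unit_vector:
  assumes \<xi>: "norm \<xi> = 1" shows "realized 1 (\<lambda>_. \<xi>)"
proof -
  define h where "h i = (1/2) *\<^sub>R (s i + cstar (s i))" for i
  have h: "cstar (h i) = h i" for i by (simp add: h_def cstar_scaleR cstar_add cstar_cstar add.commute)
  have "\<exists>D \<Theta> \<eta>. controlled j D \<Theta> \<and> proj D \<eta> = \<eta> \<and> norm \<eta> = 1 \<and>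
    (\<Sum>i<j. (Re (cinner \<eta> (\<Theta> (h i) \<eta>)) - Re (cinner \<xi> (f (h i) \<xi>)))\<^sup>2) < 1 / real (Suc j)" for j
    by (rule vector_state_approx[OF h \<xi>]) simp
  then have "\<forall>j. \<exists>z. controlled j (fst z) (fst (snd z)) \<and> proj (fst z) (snd (snd z)) = snd (snd z) \<and> norm (snd (snd z)) = 1 \<and>
    (\<Sum>i<j. (Re (cinner (snd (snd z)) (fst (snd z) (h i) (snd (snd z)))) - Re (cinner \<xi> (f (h i) \<xi>)))\<^sup>2) < 1 / real (Suc j)"
    by simp
  from choice[OF this] obtain z where z: "\<And>j. controlled j (fst (z j)) (fst (snd (z j)))"
    "\<And>j. proj (fst (z j)) (snd (snd (z j))) = snd (snd (z j))" "\<And>j. norm (snd (snd (z j))) = 1"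
    "\<And>j. (\<Sum>i<j. (Re (cinner (snd (snd (z j))) (fst (snd (z j)) (h i) (snd (snd (z j))))) - Re (cinner \<xi> (f (h i) \<xi>)))\<^sup>2) < 1 / real (Suc j)"
    by blast
  define D \<Theta> \<eta> where "D j = fst (z j)" and "\<Theta> j = fst (snd (z j))" and "\<eta> j = snd (snd (z j))" for j
  note T = z(1)[folded D_def \<Theta>_def] and \<eta> = z(2,3)[folded D_def \<eta>_def]
    and sm = z(4)[folded \<Theta>_def \<eta>_def]
  have app: "approximants D \<Theta>" using T by (simp add: approximants_def)
  note R = approximants_asymptotic_rep[OF app]
  have b: "bounded_seq \<eta>" by (rule bounded_seqI[of _ 1]) (simp add: \<eta>)
  have hlim: "(\<lambda>j. cinner (\<eta> j) (\<Theta> j (h i) (\<eta> j))) \<longlonglongrightarrow> cinner \<xi> (f (h i) \<xi>)" for i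
  proof (rule hermitian_coefficients[OF R \<eta>(2) h])
    define g where "g j = Re (cinner (\<eta> j) (\<Theta> j (h i) (\<eta> j))) - Re (cinner \<xi> (f (h i) \<xi>))" for j
    have "(\<lambda>j. (g j)\<^sup>2) \<longlonglongrightarrow> 0"
    proof (rule tendsto_sandwich[OF _ _ tendsto_const LIMSEQ_inverse_real_of_nat])
      have "(g j)\<^sup>2 \<le> inverse (real (Suc j))" if "j \<ge> Suc i" for j
      proof -
        have "(g j)\<^sup>2 \<le> (\<Sum>i<j. (Re (cinner (\<eta> j) (\<Theta> j (h i) (\<eta> j))) - Re (cinner \<xi> (f (h i) \<xi>)))\<^sup>2)"
          unfolding g_def by (rule member_le_sum) (use that in auto)
        with sm[of j] show ?thesis by (simp add: inverse_eq_divide)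
      qed
      then show "\<forall>\<^sub>F j in sequentially. (g j)\<^sup>2 \<le> inverse (real (Suc j))"
        by (rule eventually_sequentiallyI)
    qed simp
    then have "(\<lambda>j. sqrt ((g j)\<^sup>2)) \<longlonglongrightarrow> sqrt 0" by (rule tendsto_real_sqrt)
    then have "g \<longlonglongrightarrow> 0" by (simp add: tendsto_rabs_zero_iff)
    then show "(\<lambda>j. Re (cinner (\<eta> j) (\<Theta> j (h i) (\<eta> j)))) \<longlonglongrightarrow> Re (cinner \<xi> (f (h i) \<xi>))"
      unfolding g_def by (rule LIM_zero_cancel)
  qed
  have sa: "(\<lambda>j. cinner (\<eta> j) (\<Theta> j a (\<eta> j))) \<longlonglongrightarrow> cinner \<xi> (f a \<xi>)" if a: "cstar a = a" for a
  proof (rule coefficient_limit_closed[OF R f b b])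
    fix \<epsilon> :: real assume "\<epsilon> > 0"
    then obtain n where n: "norm (a - s n) < \<epsilon>" using dense[of \<epsilon> a] by (auto simp: dist_norm)
    have "a - h n = (1/2) *\<^sub>R ((a - s n) + cstar (a - s n))"
    proof -
      have "(a - s n) + cstar (a - s n) = 2 *\<^sub>R a - (s n + cstar (s n))"
        by (simp add: cstar_diff a scaleR_2)
      then show ?thesis by (simp only: h_def scaleR_diff_right) simp
    qed
    then have "norm (a - h n) \<le> norm (a - s n)"
      using norm_triangle_ineq[of "a - s n" "cstar (a - s n)"] by simp
    then show "\<exists>b. norm (a - b) < \<epsilon> \<and> (\<lambda>j. cinner (\<eta> j) (\<Theta> j b (\<eta> j))) \<longlonglongrightarrow> cinner \<xi> (f b \<xi>)"
      using n hlim by (intro exI[of _ "h n"]) auto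
  qed
  have all: "(\<lambda>j. cinner (\<eta> j) (\<Theta> j a (\<eta> j))) \<longlonglongrightarrow> cinner \<xi> (f a \<xi>)" for a
  proof -
    define x where "x = (1/2) *\<^sub>R (a + cstar a)"
    define y where "y = (1/2) *\<^sub>R (\<i> *\<^sub>C (cstar a - a))"
    have "cstar x = x" by (simp add: x_def cstar_scaleR cstar_add cstar_cstar add.commute)
    moreover have "cstar y = y"
      by (simp add: y_def cstar_scaleR cstar_imaginary cstar_diff cstar_cstar complex_vector.scale_right_diff_distrib)
    moreover have "a = x + \<i> *\<^sub>C y"
    proof -
      have "\<i> *\<^sub>C y = (1/2) *\<^sub>R (a - cstar a)"
        by (simp add: y_def scaleC_scaleR scaleC_scaleC scaleC_one)
      then have "x + \<i> *\<^sub>C y = (1/2) *\<^sub>R ((a + cstar a) + (a - cstar a))" by (simp only: x_def scaleR_add_right)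
      also have "(a + cstar a) + (a - cstar a) = 2 *\<^sub>R a" by (simp add: scaleR_2)
      finally show ?thesis by simp
    qed
    ultimately show ?thesis
      using coefficient_limit_add[OF R f b b sa[of x] coefficient_limit_scaleC[OF R f b b sa[of y]], of \<i>] by simp
  qed
  have "cinner (\<eta> j) (\<eta> j) = cinner \<xi> \<xi>" for j by (simp add: cinner_self \<eta> \<xi>)
  then show ?thesis unfolding realized_def
    using app \<eta>(1) all by (intro exI[of _ D] exI[of _ \<Theta>] exI[of _ "\<lambda>j _. \<eta> j"]) simp
qed

lemma ext_limits:
  fixes \<Theta> :: "nat \<Rightarrow> 'a \<Rightarrow> 'h \<Rightarrow>\<^sub>L 'h"
  assumes R: "asymptotic_rep \<Theta>" and gr: "(\<lambda>j. cinner (\<eta> j) (\<eta> j)) \<longlonglongrightarrow> cinner \<xi> \<xi>"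
    and co: "\<And>a. (\<lambda>j. cinner (\<eta> j) (\<Theta> j a (\<eta> j))) \<longlonglongrightarrow> cinner \<xi> (f a \<xi>)"
  shows "(\<lambda>j. cinner (ext (\<Theta> j) x (\<eta> j)) (ext (\<Theta> j) y (\<eta> j))) \<longlonglongrightarrow> cinner (ext f x \<xi>) (ext f y \<xi>)"
    and "(\<lambda>j. cinner (ext (\<Theta> j) x (\<eta> j)) (ext (\<Theta> j) z (ext (\<Theta> j) y (\<eta> j)))) \<longlonglongrightarrow> cinner (ext f x \<xi>) (ext f z (ext f y \<xi>))"
proof -
  note E = asymptotic_rep_ext[OF R]
  note F = star_hom_ext[OF f]
  have b: "bounded_seq \<eta>" by (rule gram_bounded[OF gr])
  have co': "(\<lambda>j. cinner (\<eta> j) (ext (\<Theta> j) w (\<eta> j))) \<longlonglongrightarrow> cinner \<xi> (ext f w \<xi>)" for w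
    unfolding ext_def blinfun.add_left cinner_add_right
    using co gr by (intro tendsto_add) (auto simp: cinner_scaleC_right intro: tendsto_mult_left)
  have "(\<lambda>j. cinner (\<eta> j) (ext (\<Theta> j) (cstar x * y) (\<eta> j)) - cinner (\<eta> j) ((cadjoint (ext (\<Theta> j) x) o\<^sub>L ext (\<Theta> j) y) (\<eta> j))) \<longlonglongrightarrow> 0"
    by (rule close_cinner[OF close_trans[OF rep_mult[OF E] close_compose[OF rep_cstar[OF E] close_refl rep_bounded[OF E] rep_bounded[OF E]]] b b])
  from tendsto_diff[OF co'[of "cstar x * y"] this]
  show "(\<lambda>j. cinner (ext (\<Theta> j) x (\<eta> j)) (ext (\<Theta> j) y (\<eta> j))) \<longlonglongrightarrow> cinner (ext f x \<xi>) (ext f y \<xi>)"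
    by (simp add: cinner_cadjoint_right[OF rep_bounded_ops[OF E]] star_homD(4,5)[OF F] cinner_cadjoint_right[OF star_homD(1)[OF F]])
  have "close (\<lambda>j. ext (\<Theta> j) (cstar x * (z * y))) (\<lambda>j. cadjoint (ext (\<Theta> j) x) o\<^sub>L (ext (\<Theta> j) z o\<^sub>L ext (\<Theta> j) y))"
  proof (rule close_trans[OF rep_mult[OF E] close_compose[OF rep_cstar[OF E] rep_mult[OF E] rep_bounded[OF E]]])
    show "bounded_seq (\<lambda>j. ext (\<Theta> j) z o\<^sub>L ext (\<Theta> j) y)"
      by (rule close_bounded_seq[OF close_sym[OF rep_mult[OF E]] rep_bounded[OF E]])
  qed
  from tendsto_diff[OF co'[of "cstar x * (z * y)"] close_cinner[OF this b b]]
  show "(\<lambda>j. cinner (ext (\<Theta> j) x (\<eta> j)) (ext (\<Theta> j) z (ext (\<Theta> j) y (\<eta> j)))) \<longlonglongrightarrow> cinner (ext f x \<xi>) (ext f z (ext f y \<xi>))"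
    by (simp add: cinner_cadjoint_right[OF rep_bounded_ops[OF E]] star_homD(4,5)[OF F] cinner_cadjoint_right[OF star_homD(1)[OF F]])
qed

text \<open>
  If \<open>\<eta> j\<close> realizes \<open>\<xi>\<close>, then \<open>ext (\<Theta> j) x (\<eta> j)\<close> realizes \<open>ext f x \<xi>\<close>, as the coefficients between
  such vectors are vector states at products.  Using the unitization places \<open>\<xi>\<close> itself in its cyclic
  subspace even if \<open>f\<close> is degenerate.
\<close>

lemma realized_cyclic: "realized m (\<lambda>q. ext f (x q) \<xi>)"
proof -
  have unit: "realized m (\<lambda>q. ext f (x q) \<xi>)" if \<xi>: "norm \<xi> = 1" for \<xi> x
  proof -
    obtain D \<Theta> \<eta> where R: "approximants D \<Theta>" "\<And>j. proj (D j) (\<eta> j (0::nat)) = \<eta> j 0"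
      "(\<lambda>j. cinner (\<eta> j 0) (\<eta> j 0)) \<longlonglongrightarrow> cinner \<xi> \<xi>"
      "\<And>a. (\<lambda>j. cinner (\<eta> j 0) (\<Theta> j a (\<eta> j 0))) \<longlonglongrightarrow> cinner \<xi> (f a \<xi>)"
      using realized_unit_vector[OF \<xi>] unfolding realized_def by auto
    note A = approximants_asymptotic_rep[OF R(1)]
    note L = ext_limits[OF A R(3,4)]
    have c: "\<Theta> j a \<in> corner (D j)" for j a
      by (rule controlled_corner[of j]) (use R(1) in \<open>simp add: approximants_def\<close>)
    have "proj (D j) (ext (\<Theta> j) (x q) (\<eta> j 0)) = ext (\<Theta> j) (x q) (\<eta> j 0)" for j q
      by (simp add: ext_def blinfun.add_left blinfun.add_right bounded_opsD[OF proj_bounded_ops] cornerD(2)[OF c] R(2))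
    moreover have "(\<lambda>j. cinner (ext (\<Theta> j) (x p) (\<eta> j 0)) (\<Theta> j a (ext (\<Theta> j) (x q) (\<eta> j 0))))
        \<longlonglongrightarrow> cinner (ext f (x p) \<xi>) (f a (ext f (x q) \<xi>))" for p q a
      using L(2)[of "x p" "emb a" "x q"] by simp
    ultimately show ?thesis unfolding realized_def using R(1) L(1)
      by (intro exI[of _ D] exI[of _ \<Theta>] exI[of _ "\<lambda>j q. ext (\<Theta> j) (x q) (\<eta> j 0)"] conjI allI impI)
  qed
  show ?thesis
  proof (cases "\<xi> = 0")
    case True
    have "realized m (\<lambda>q. ext f 0 (e 0))" by (rule unit) simp
    then show ?thesis by (rule realized_cong) (simp add: True blinfun.zero_right star_hom_zero[OF star_hom_ext[OF f]])
  next
    case False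
    have "realized m (\<lambda>q. ext f (norm \<xi> *\<^sub>R x q) ((1 / norm \<xi>) *\<^sub>R \<xi>))" by (rule unit) (use False in simp)
    then show ?thesis
    proof (rule realized_cong)
      fix p
      have "ext f (norm \<xi> *\<^sub>R x p) = norm \<xi> *\<^sub>R ext f (x p)"
        using star_homD(3)[OF star_hom_ext[OF f], of "of_real (norm \<xi>)" "x p"] by (simp add: scaleR_scaleC[symmetric] scale_op_of_real)
      then show "ext f (norm \<xi> *\<^sub>R x p) ((1 / norm \<xi>) *\<^sub>R \<xi>) = ext f (x p) \<xi>"
        using False by (simp add: blinfun.scaleR_left blinfun.scaleR_right)
    qed
  qed
qed

text \<open>
  Block sums imitate two families of vectors whose mixed coefficients vanish.
\<close>

lemma realized_add:
  assumes v: "realized m v" and w: "realized m w"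
    and orth: "\<And>p q. p < m \<Longrightarrow> q < m \<Longrightarrow> cinner (v p) (w q) = 0" "\<And>a p q. p < m \<Longrightarrow> q < m \<Longrightarrow> cinner (v p) (f a (w q)) = 0"
  shows "realized m (\<lambda>p. v p + w p)"
proof -
  obtain D \<Theta> \<eta> where V: "approximants D \<Theta>" "\<And>j p. p < m \<Longrightarrow> proj (D j) (\<eta> j p) = \<eta> j p"
    "\<And>p q. p < m \<Longrightarrow> q < m \<Longrightarrow> (\<lambda>j. cinner (\<eta> j p) (\<eta> j q)) \<longlonglongrightarrow> cinner (v p) (v q)"
    "\<And>a p q. p < m \<Longrightarrow> q < m \<Longrightarrow> (\<lambda>j. cinner (\<eta> j p) (\<Theta> j a (\<eta> j q))) \<longlonglongrightarrow> cinner (v p) (f a (v q))"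
    using v unfolding realized_def by blast
  obtain D' \<Theta>' \<eta>' where W: "approximants D' \<Theta>'" "\<And>j p. p < m \<Longrightarrow> proj (D' j) (\<eta>' j p) = \<eta>' j p"
    "\<And>p q. p < m \<Longrightarrow> q < m \<Longrightarrow> (\<lambda>j. cinner (\<eta>' j p) (\<eta>' j q)) \<longlonglongrightarrow> cinner (w p) (w q)"
    "\<And>a p q. p < m \<Longrightarrow> q < m \<Longrightarrow> (\<lambda>j. cinner (\<eta>' j p) (\<Theta>' j a (\<eta>' j q))) \<longlonglongrightarrow> cinner (w p) (f a (w q))"
    using w unfolding realized_def by blast
  have c: "controlled j (D j) (\<Theta> j)" "controlled j (D' j) (\<Theta>' j)" for j using V(1) W(1) by (auto simp: approximants_def)
  have o1: "cinner (w p) (v q) = 0" if "p < m" "q < m" for p q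
    using orth(1)[OF that(2,1)] cinner_commute[of "w p" "v q"] by simp
  have o2: "cinner (w p) (f a (v q)) = 0" if "p < m" "q < m" for a p q
    using orth(2)[OF that(2,1), of "cstar a"] cinner_commute[of "w p" "f a (v q)"]
      cinner_cadjoint_right[OF star_homD(1)[OF f], of "v q" a "w p"] by (simp add: star_homD(5)[OF f])
  define Z where "Z j p = \<eta> j p + shift (D j) (D' j) (\<eta>' j p)" for j p
  show ?thesis unfolding realized_def
  proof (intro exI conjI allI impI)
    show "approximants (\<lambda>j. D j + D' j) (\<lambda>j a. bsum (D j) (D' j) (\<Theta> j a) (\<Theta>' j a))"
      unfolding approximants_def by (intro allI controlled_bsum c)
    note b = bsum_cinner[OF controlled_corner[OF c(1)] controlled_corner[OF c(2)]]
    show "proj (D j + D' j) (Z j p) = Z j p" if "p < m" for j p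
      unfolding Z_def by (rule b(3)) (use that V(2) W(2) in auto)
    fix p q assume pq: "p < m" "q < m"
    have "cinner (Z j p) (Z j q) = cinner (\<eta> j p) (\<eta> j q) + cinner (\<eta>' j p) (\<eta>' j q)" for j
      unfolding Z_def by (rule b(2)) (use pq V(2) W(2) in auto)
    moreover have "cinner (v p + w p) (v q + w q) = cinner (v p) (v q) + cinner (w p) (w q)"
      by (simp add: cinner_add_left cinner_add_right orth(1)[OF pq] o1[OF pq])
    ultimately show "(\<lambda>j. cinner (Z j p) (Z j q)) \<longlonglongrightarrow> cinner (v p + w p) (v q + w q)"
      using tendsto_add[OF V(3)[OF pq] W(3)[OF pq]] by simp
    fix a
    have "cinner (Z j p) (bsum (D j) (D' j) (\<Theta> j a) (\<Theta>' j a) (Z j q)) = cinner (\<eta> j p) (\<Theta> j a (\<eta> j q)) + cinner (\<eta>' j p) (\<Theta>' j a (\<eta>' j q))" for j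
      unfolding Z_def by (rule b(1)) (use pq V(2) W(2) in auto)
    moreover have "cinner (v p + w p) (f a (v q + w q)) = cinner (v p) (f a (v q)) + cinner (w p) (f a (w q))"
      by (simp add: blinfun.add_right cinner_add_left cinner_add_right orth(2)[OF pq] o2[OF pq])
    ultimately show "(\<lambda>j. cinner (Z j p) (bsum (D j) (D' j) (\<Theta> j a) (\<Theta>' j a) (Z j q))) \<longlonglongrightarrow> cinner (v p + w p) (f a (v q + w q))"
      using tendsto_add[OF V(4)[OF pq] W(4)[OF pq]] by simp
  qed
qed

end

section \<open>Orthogonal projections and reflections\<close>

lemma projection_exists:
  fixes E :: "'h::chilbert_space set"
  assumes cl: "closed E" and zero: "0 \<in> E" and add: "\<And>x y. x \<in> E \<Longrightarrow> y \<in> E \<Longrightarrow> x + y \<in> E"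
    and scale: "\<And>c x. x \<in> E \<Longrightarrow> c *\<^sub>C x \<in> E"
  shows "\<exists>p\<in>bounded_ops. \<forall>v. blinfun_apply p v \<in> E \<and> (\<forall>w\<in>E. cinner w (v - p v) = 0)"
proof -
  have scaleR: "r *\<^sub>R x \<in> E" if "x \<in> E" for r x using scale[OF that, of "of_real r"] by (simp add: scaleR_scaleC)
  have diff: "x - y \<in> E" if "x \<in> E" "y \<in> E" for x y using add[OF that(1) scaleR[OF that(2), of "-1"]] by simp
  have near: "\<exists>z. z \<in> E \<and> (\<forall>w\<in>E. cinner w (v - z) = 0)" for v
  proof -
    define d where "d = Inf ((\<lambda>x. norm (v - x)) ` E)"
    have ne: "(\<lambda>x. norm (v - x)) ` E \<noteq> {}" using zero by auto
    have bdd: "bdd_below ((\<lambda>x. norm (v - x)) ` E)" by (rule bdd_belowI[of _ 0]) auto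
    have d_le: "d \<le> norm (v - x)" if "x \<in> E" for x unfolding d_def by (rule cInf_lower) (use that bdd in auto)
    have d0: "0 \<le> d" unfolding d_def by (rule cInf_greatest) (use ne in auto)
    have "\<exists>x\<in>E. norm (v - x) < d + 1 / real (Suc n)" for n
    proof -
      have "Inf ((\<lambda>x. norm (v - x)) ` E) < d + 1 / real (Suc n)" by (simp add: d_def)
      then show ?thesis using cInf_less_iff[OF ne bdd] by auto
    qed
    then obtain X where X: "\<And>n. X n \<in> E" "\<And>n. norm (v - X n) < d + 1 / real (Suc n)" by metis
    have gap: "(norm (x - y))\<^sup>2 \<le> 2 * (norm (v - x))\<^sup>2 + 2 * (norm (v - y))\<^sup>2 - 4 * d\<^sup>2" if "x \<in> E" "y \<in> E" for x y
    proof -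
      have "d \<le> norm (v - (1/2) *\<^sub>R (x + y))" by (intro d_le scaleR add that)
      also have "v - (1/2) *\<^sub>R (x + y) = (1/2) *\<^sub>R ((v - x) + (v - y))"
      proof -
        have "(1/2) *\<^sub>R ((v - x) + (v - y)) = (1/2) *\<^sub>R (2 *\<^sub>R v - (x + y))" by (simp add: scaleR_2)
        then show ?thesis by (simp add: scaleR_diff_right)
      qed
      finally have "2 * d \<le> norm ((v - x) + (v - y))" by simp
      then have "(2 * d)\<^sup>2 \<le> (norm ((v - x) + (v - y)))\<^sup>2" using d0 by (intro power_mono) auto
      moreover have "(v - x) - (v - y) = - (x - y)" by simp
      ultimately show ?thesis using parallelogram[of "v - x" "v - y"]
        by (simp only: norm_minus_cancel power_mult_distrib) simp
    qed
    have lim: "(\<lambda>n. norm (v - X n)) \<longlonglongrightarrow> d"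
    proof (rule real_tendsto_sandwich[of "\<lambda>_. d" _ _ "\<lambda>n. d + 1 / real (Suc n)"])
      show "(\<lambda>n. d + 1 / real (Suc n)) \<longlonglongrightarrow> d"
        using tendsto_add[OF tendsto_const[of d] LIMSEQ_inverse_real_of_nat] by (simp add: inverse_eq_divide)
      show "\<forall>\<^sub>F n in sequentially. norm (v - X n) \<le> d + 1 / real (Suc n)" using X(2) by (simp add: less_imp_le)
    qed (use d_le X(1) in auto)
    have "Cauchy X"
    proof (rule metric_CauchyI)
      fix r :: real assume r: "r > 0"
      have "(\<lambda>n. 2 * (norm (v - X n))\<^sup>2 - 2 * d\<^sup>2) \<longlonglongrightarrow> 2 * d\<^sup>2 - 2 * d\<^sup>2" by (intro tendsto_intros lim)
      then have "(\<lambda>n. 2 * (norm (v - X n))\<^sup>2 - 2 * d\<^sup>2) \<longlonglongrightarrow> 0" by simp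
      then have "\<forall>\<^sub>F n in sequentially. 2 * (norm (v - X n))\<^sup>2 - 2 * d\<^sup>2 < r\<^sup>2 / 2"
        by (rule order_tendstoD) (use r in simp)
      then obtain N where N: "\<And>n. n \<ge> N \<Longrightarrow> 2 * (norm (v - X n))\<^sup>2 - 2 * d\<^sup>2 < r\<^sup>2 / 2"
        by (auto simp: eventually_sequentially)
      have "dist (X m) (X n) < r" if "m \<ge> N" "n \<ge> N" for m n
      proof -
        have "(norm (X m - X n))\<^sup>2 < r\<^sup>2" using gap[OF X(1) X(1), of m n] N[OF that(1)] N[OF that(2)] by linarith
        then show ?thesis using r by (simp add: dist_norm power2_less_imp_less)
      qed
      then show "\<exists>M. \<forall>m\<ge>M. \<forall>n\<ge>M. dist (X m) (X n) < r" by blast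
    qed
    then obtain z where z: "X \<longlonglongrightarrow> z" using Cauchy_convergent convergent_def by blast
    have zE: "z \<in> E" using closed_sequentially[OF cl] X(1) z by blast
    have nz: "norm (v - z) = d" by (rule LIMSEQ_unique[OF tendsto_norm[OF tendsto_diff[OF tendsto_const z]] lim])
    have "cinner w (v - z) = 0" if w: "w \<in> E" for w
    proof -
      have "cinner (v - z) w = 0"
      proof (rule minimal_orthogonal)
        fix c
        have "d \<le> norm (v - (z + c *\<^sub>C w))" by (intro d_le add zE scale w)
        then show "norm (v - z) \<le> norm (v - z - c *\<^sub>C w)" by (simp add: nz diff_diff_eq)
      qed
      then show ?thesis using cinner_commute[of w "v - z"] by simp
    qed
    with zE show ?thesis by blast
  qed
  then obtain p where p: "\<And>v. p v \<in> E" "\<And>v w. w \<in> E \<Longrightarrow> cinner w (v - p v) = 0" by metis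
  have uniq: "z = p v" if z: "z \<in> E" and o: "\<And>w. w \<in> E \<Longrightarrow> cinner w (v - z) = 0" for z v
  proof -
    have d: "z - p v \<in> E" by (rule diff[OF z p(1)])
    have "cinner (z - p v) (z - p v) = cinner (z - p v) (v - p v) - cinner (z - p v) (v - z)"
      by (simp add: cinner_diff_right)
    also have "\<dots> = 0" by (simp add: p(2)[OF d] o[OF d])
    finally show ?thesis by (simp add: cinner_self)
  qed
  have add': "p (v + v') = p v + p v'" for v v'
  proof (rule uniq[symmetric])
    fix w assume w: "w \<in> E"
    have "(v + v') - (p v + p v') = (v - p v) + (v' - p v')" by simp
    then show "cinner w ((v + v') - (p v + p v')) = 0" using p(2)[OF w, of v] p(2)[OF w, of v'] by (simp only: cinner_add_right add_0_left)
  qed (intro add p)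
  have scale': "p (c *\<^sub>C v) = c *\<^sub>C p v" for c v
  proof (rule uniq[symmetric])
    fix w assume w: "w \<in> E"
    have "c *\<^sub>C v - c *\<^sub>C p v = c *\<^sub>C (v - p v)" by (simp add: complex_vector.scale_right_diff_distrib)
    then show "cinner w (c *\<^sub>C v - c *\<^sub>C p v) = 0" using p(2)[OF w, of v] by (simp add: cinner_scaleC_right)
  qed (intro scale p)
  have bl: "bounded_linear p"
  proof (rule bounded_linear_intro[of _ 1])
    show "p (r *\<^sub>R v) = r *\<^sub>R p v" for r v by (simp add: scaleR_scaleC scale')
    show "norm (p v) \<le> norm v * 1" for v
    proof (cases "p v = 0")
      case False
      have "cinner (p v) v = cinner (p v) (p v)" using p(2)[OF p(1), of v v] by (simp add: cinner_diff_right)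
      then have "(norm (p v))\<^sup>2 \<le> norm (p v) * norm v" using cauchy_schwarz[of "p v" v] by (simp add: cinner_self norm_power)
      then show ?thesis using False by (simp add: power2_eq_square)
    qed simp
  qed (rule add')
  have ap: "blinfun_apply (Blinfun p) v = p v" for v by (simp add: bounded_linear_Blinfun_apply[OF bl])
  have "Blinfun p \<in> bounded_ops" by (simp add: bounded_ops_def ap scale')
  then show ?thesis using p by (intro bexI[of _ "Blinfun p"]) (simp_all add: ap)
qed

context orthonormal_basis
begin

lemma unitary_id: "unitary_on D id_blinfun"
  by (simp add: unitary_on_def)

lemma unitary_compose: "unitary_on D U \<Longrightarrow> unitary_on D V \<Longrightarrow> unitary_on D (V o\<^sub>L U)"
  by (simp add: unitary_on_def cadjoint_compose)

text \<open>
  A complex Householder reflection \<open>v - (\<langle>z, v\<rangle> / \<langle>z, a\<rangle>) z\<close> with \<open>z = a - b\<close>.  It is unitary because equality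
  of norms gives \<open>\<langle>z, a\<rangle> + \<langle>a, z\<rangle> = \<langle>z, z\<rangle>\<close>.
\<close>

lemma reflection_exists:
  assumes ab: "proj D a = a" "proj D b = b" "norm a = norm b"
  shows "\<exists>V. unitary_on D V \<and> V a = b \<and> (\<forall>v. cinner a v = 0 \<longrightarrow> cinner b v = 0 \<longrightarrow> blinfun_apply V v = v)"
proof (cases "a = b")
  case True then show ?thesis using unitary_id by (intro exI[of _ id_blinfun]) simp
next
  case False
  define z where "z = a - b"
  define w where "w = cinner z a"
  have z: "proj D z = z" "z \<noteq> 0" using False by (simp_all add: z_def blinfun.diff_right ab)
  have ww: "w + cnj w = cinner z z"
  proof -
    have "cinner z z = cinner z a - cinner z b" by (simp add: z_def cinner_diff_right)
    moreover have "- cinner z b = cinner a z"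
      using ab(3) by (simp add: z_def cinner_diff_left cinner_diff_right cinner_self)
    moreover have "cinner a z = cnj w" unfolding w_def by (rule cinner_commute)
    ultimately show ?thesis by (simp add: w_def)
  qed
  have w0: "w \<noteq> 0" using ww z(2) by (auto simp: cinner_self)
  define H where "H c v = v - (c * cinner z v) *\<^sub>C z" for c v
  have bl: "bounded_linear (H c)" for c
  proof (rule bounded_linear_intro[of _ "1 + cmod c * norm z * norm z"])
    show "norm (H c v) \<le> norm v * (1 + cmod c * norm z * norm z)" for v
    proof -
      have "norm (H c v) \<le> norm v + norm ((c * cinner z v) *\<^sub>C z)" unfolding H_def by (rule norm_triangle_ineq4)
      also have "norm ((c * cinner z v) *\<^sub>C z) = cmod c * cmod (cinner z v) * norm z" by (simp add: norm_scaleC norm_mult)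
      also have "\<dots> \<le> cmod c * (norm z * norm v) * norm z" by (intro mult_right_mono mult_left_mono cauchy_schwarz) auto
      finally show ?thesis by (simp add: algebra_simps)
    qed
  qed (simp_all add: H_def cinner_add_right scaleC_add_left cinner_scaleC_right distrib_left
        scaleR_scaleC scaleC_scaleC algebra_simps)
  define R where "R c = Blinfun (H c)" for c
  have R: "blinfun_apply (R c) v = v - (c * cinner z v) *\<^sub>C z" for c v
    by (simp add: R_def bounded_linear_Blinfun_apply[OF bl] H_def)
  have Rb: "R c \<in> bounded_ops" for c
    by (simp add: bounded_ops_def R cinner_scaleC_right complex_vector.scale_right_diff_distrib scaleC_scaleC mult.left_commute)
  have adj: "cadjoint (R c) = R (cnj c)" for c
  proof (rule cadjoint_eqI[OF Rb])
    fix x y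
    have "cnj (cinner z x) = cinner x z" by (rule cinner_commute[symmetric])
    then show "cinner (R (cnj c) x) y = cinner x (R c y)"
      by (simp add: R cinner_diff_left cinner_diff_right cinner_scaleC_left cinner_scaleC_right mult.assoc mult.commute)
  qed
  have inv: "R c (R d v) = v" if "c + d = c * d * (w + cnj w)" for c d v
  proof -
    have "R c (R d v) = v - (d * cinner z v) *\<^sub>C z - (c * (cinner z v - d * cinner z v * (w + cnj w))) *\<^sub>C z"
      by (simp add: R cinner_diff_right cinner_scaleC_right ww)
    also have "\<dots> = v - ((c + d - c * d * (w + cnj w)) * cinner z v) *\<^sub>C z"
      unfolding diff_diff_eq scaleC_add_left[symmetric] by (simp add: algebra_simps)
    finally show ?thesis using that by simp
  qed
  have c: "1 / w + cnj (1 / w) = 1 / w * cnj (1 / w) * (w + cnj w)" using w0 by (simp add: field_simps)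
  have "unitary_on D (R (1 / w))"
    unfolding unitary_on_def adj
  proof (intro conjI allI)
    show "R (1 / w) \<in> bounded_ops" by (rule Rb)
    show "R (cnj (1 / w)) (R (1 / w) v) = v" for v by (rule inv) (use c in \<open>simp add: add.commute mult.commute\<close>)
    show "R (1 / w) (R (cnj (1 / w)) v) = v" for v by (rule inv) (use c in simp)
    show "proj D (R (1 / w) v) = R (1 / w) (proj D v)" for v
      using cinner_proj[of D z v] z(1) by (simp add: R blinfun.diff_right bounded_opsD[OF proj_bounded_ops])
  qed
  moreover have "R (1 / w) a = b" using w0 by (simp add: R w_def[symmetric] scaleC_one) (simp add: z_def)
  moreover have "R (1 / w) v = v" if "cinner a v = 0" "cinner b v = 0" for v
    using that by (simp add: R z_def cinner_diff_left)
  ultimately show ?thesis by blast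
qed

text \<open>
  One vector is aligned at a time.  After the first \<open>m\<close> vectors have been moved close to
  \<open>e 0, \<dots>, e (m - 1)\<close>, the next one is asymptotically a unit vector orthogonal to these, and a reflection
  that fixes them sends the normalized orthogonal component of the next one to \<open>e m\<close>.  The reflection
  stays in the corner, which is large enough because \<open>d \<le> D j\<close>.
\<close>

lemma align_orthonormal:
  assumes D: "\<And>j. d \<le> D j" and \<eta>: "\<And>j p. p < d \<Longrightarrow> proj (D j) (\<eta> j p) = \<eta> j p"
    and gram: "\<And>p q. p < d \<Longrightarrow> q < d \<Longrightarrow> (\<lambda>j. cinner (\<eta> j p) (\<eta> j q)) \<longlonglongrightarrow> (if p = q then 1 else 0)"
  shows "\<exists>U. (\<forall>j. unitary_on (D j) (U j)) \<and> (\<forall>p<d. (\<lambda>j. blinfun_apply (U j) (\<eta> j p)) \<longlonglongrightarrow> e p)"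
proof -
  have "\<exists>U. (\<forall>j. unitary_on (D j) (U j)) \<and> (\<forall>p<d'. (\<lambda>j. blinfun_apply (U j) (\<eta> j p)) \<longlonglongrightarrow> e p)" if "d' \<le> d" for d'
    using that
  proof (induction d')
    case 0 show ?case using unitary_id by (intro exI[of _ "\<lambda>j. id_blinfun"]) simp
  next
    case (Suc m)
    then obtain U where U: "\<And>j. unitary_on (D j) (U j)" "\<And>p. p < m \<Longrightarrow> (\<lambda>j. blinfun_apply (U j) (\<eta> j p)) \<longlonglongrightarrow> e p" by auto
    have md: "m < d" using Suc.prems by simp
    define y where "y j = U j (\<eta> j m)" for j
    define z where "z j = y j - proj m (y j)" for j
    have yD: "proj (D j) (y j) = y j" for j by (simp add: y_def unitary_onD(4)[OF U(1)] \<eta>[OF md])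
    have Uinner: "cinner (U j v) (U j w) = cinner v w" for j v w
      using cinner_cadjoint_right[OF unitary_onD(1)[OF U(1)], of v j "U j w"] by (simp add: unitary_onD(2)[OF U(1)])
    have ny: "(\<lambda>j. norm (y j)) \<longlonglongrightarrow> 1"
    proof -
      have "(\<lambda>j. sqrt (Re (cinner (\<eta> j m) (\<eta> j m)))) \<longlonglongrightarrow> sqrt (Re 1)"
        using gram[OF md md] by (intro tendsto_real_sqrt tendsto_Re) simp
      then show ?thesis by (simp add: norm_eq_sqrt_cinner y_def Uinner)
    qed
    have ey: "(\<lambda>j. cinner (e p) (y j)) \<longlonglongrightarrow> 0" if p: "p < m" for p
    proof -
      have "(\<lambda>j. cinner (e p - U j (\<eta> j p)) (y j)) \<longlonglongrightarrow> 0"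
      proof (rule Lim_null_comparison[OF always_eventually])
        show "\<forall>j. norm (cinner (e p - U j (\<eta> j p)) (y j)) \<le> norm (e p - U j (\<eta> j p)) * norm (y j)"
          by (simp add: cauchy_schwarz)
        have "(\<lambda>j. norm (e p - U j (\<eta> j p)) * norm (y j)) \<longlonglongrightarrow> norm (e p - e p) * 1"
          by (intro tendsto_intros U(2) p ny)
        then show "(\<lambda>j. norm (e p - U j (\<eta> j p)) * norm (y j)) \<longlonglongrightarrow> 0" by simp
      qed
      moreover have "(\<lambda>j. cinner (U j (\<eta> j p)) (y j)) \<longlonglongrightarrow> 0"
        using gram[of p m] p md by (simp add: y_def Uinner)
      ultimately have "(\<lambda>j. cinner (e p - U j (\<eta> j p)) (y j) + cinner (U j (\<eta> j p)) (y j)) \<longlonglongrightarrow> 0 + 0" by (rule tendsto_add)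
      then show ?thesis by (simp add: cinner_diff_left)
    qed
    have py: "(\<lambda>j. proj m (y j)) \<longlonglongrightarrow> 0"
    proof -
      have "(\<lambda>j. (\<Sum>i<m. (cmod (cinner (e i) (y j)))\<^sup>2)) \<longlonglongrightarrow> (\<Sum>i<m. (cmod 0)\<^sup>2)"
        by (intro tendsto_sum tendsto_power tendsto_norm ey) simp
      then have "(\<lambda>j. (norm (proj m (y j)))\<^sup>2) \<longlonglongrightarrow> 0" by (simp add: norm_proj_sq)
      then have "(\<lambda>j. sqrt ((norm (proj m (y j)))\<^sup>2)) \<longlonglongrightarrow> sqrt 0" by (rule tendsto_real_sqrt)
      then show ?thesis by (simp add: tendsto_norm_zero_iff)
    qed
    have nz: "(\<lambda>j. norm (z j)) \<longlonglongrightarrow> 1"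
    proof -
      have "(\<lambda>j. norm (z j) - norm (y j)) \<longlonglongrightarrow> 0"
      proof (rule Lim_null_comparison[OF always_eventually tendsto_norm_zero[OF py]])
        have "\<bar>norm (z j) - norm (y j)\<bar> \<le> norm (proj m (y j))" for j
          using norm_triangle_ineq3[of "z j" "y j"] by (simp add: z_def)
        then show "\<forall>j. norm (norm (z j) - norm (y j)) \<le> norm (proj m (y j))" by simp
      qed
      from tendsto_add[OF this ny] show ?thesis by simp
    qed
    define z' where "z' j = (1 / norm (z j)) *\<^sub>R z j" for j
    have "\<exists>V. unitary_on (D j) V \<and> (z j \<noteq> 0 \<longrightarrow> V (z' j) = e m) \<and> (\<forall>p<m. blinfun_apply V (e p) = e p)" for j
    proof (cases "z j = 0")
      case True then show ?thesis using unitary_id by (intro exI[of _ id_blinfun]) simp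
    next
      case False
      have "proj (D j) (z j) = z j" using D[of j] md
        by (simp add: z_def blinfun.diff_right yD proj_proj)
      then have 1: "proj (D j) (z' j) = z' j" by (simp add: z'_def blinfun.scaleR_right)
      have 2: "proj (D j) (e m) = e m" using D[of j] md by (simp add: proj_e)
      have 3: "norm (z' j) = norm (e m)" using False by (simp add: z'_def)
      obtain V where V: "unitary_on (D j) V" "V (z' j) = e m" "\<And>v. cinner (z' j) v = 0 \<Longrightarrow> cinner (e m) v = 0 \<Longrightarrow> V v = v"
        using reflection_exists[OF 1 2 3] by blast
      have "V (e p) = e p" if p: "p < m" for p
      proof (rule V(3))
        have "cinner (e p) (z j) = 0" using p by (simp add: z_def cinner_diff_right cinner_e_proj)
        then have "cinner (z j) (e p) = 0" using cinner_commute[of "z j" "e p"] by simp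
        then show "cinner (z' j) (e p) = 0" by (simp add: z'_def cinner_scaleR_left)
      qed (use p in \<open>simp add: ortho\<close>)
      with V show ?thesis by blast
    qed
    then obtain V where V: "\<And>j. unitary_on (D j) (V j)" "\<And>j. z j \<noteq> 0 \<Longrightarrow> V j (z' j) = e m" "\<And>j p. p < m \<Longrightarrow> V j (e p) = e p"
      by metis
    have "(\<lambda>j. (V j o\<^sub>L U j) (\<eta> j p)) \<longlonglongrightarrow> e p" if "p < Suc m" for p
    proof (cases "p = m")
      case False
      then have p: "p < m" using that by simp
      have "norm (V j (U j (\<eta> j p)) - e p) = norm (U j (\<eta> j p) - e p)" for j
        using unitary_onD(6)[OF V(1), of j "U j (\<eta> j p) - e p"] V(3)[OF p] by (simp add: blinfun.diff_right)
      moreover have "(\<lambda>j. norm (U j (\<eta> j p) - e p)) \<longlonglongrightarrow> 0" using U(2)[OF p] by (simp add: LIM_zero tendsto_norm_zero)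
      ultimately have "(\<lambda>j. norm (V j (U j (\<eta> j p)) - e p)) \<longlonglongrightarrow> 0" by simp
      then have "(\<lambda>j. V j (U j (\<eta> j p))) \<longlonglongrightarrow> e p" unfolding tendsto_norm_zero_iff by (rule LIM_zero_cancel)
      then show ?thesis by simp
    next
      case True
      have "\<forall>\<^sub>F j in sequentially. norm (z j) > 0" using order_tendstoD(1)[OF nz, of 0] by simp
      then have "\<forall>\<^sub>F j in sequentially. norm (V j (y j) - e m) \<le> norm (proj m (y j)) + \<bar>norm (z j) - 1\<bar>"
      proof eventually_elim
        case (elim j)
        then have "V j (y j) - e m = V j (y j - z' j)" using V(2)[of j] by (simp add: blinfun.diff_right)
        then have "norm (V j (y j) - e m) = norm (y j - z' j)" by (simp add: unitary_onD(6)[OF V(1)])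
        also have "y j - z' j = proj m (y j) + (z j - z' j)" by (simp add: z_def)
        also have "z j - z' j = (norm (z j) - 1) *\<^sub>R z' j"
          using elim by (simp add: z'_def diff_divide_distrib scaleR_diff_left)
        also have "norm (proj m (y j) + (norm (z j) - 1) *\<^sub>R z' j)
            \<le> norm (proj m (y j)) + norm ((norm (z j) - 1) *\<^sub>R z' j)" by (rule norm_triangle_ineq)
        also have "norm ((norm (z j) - 1) *\<^sub>R z' j) = \<bar>norm (z j) - 1\<bar>" using elim by (simp add: z'_def)
        finally show ?case .
      qed
      moreover have "(\<lambda>j. norm (proj m (y j)) + \<bar>norm (z j) - 1\<bar>) \<longlonglongrightarrow> 0"
        using tendsto_add[OF tendsto_norm_zero[OF py] tendsto_rabs_zero[OF LIM_zero[OF nz]]] by simp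
      ultimately have "(\<lambda>j. V j (y j) - e m) \<longlonglongrightarrow> 0" by (rule Lim_null_comparison)
      then show ?thesis using True by (simp add: LIM_zero_iff y_def)
    qed
    moreover have "unitary_on (D j) (V j o\<^sub>L U j)" for j by (rule unitary_compose[OF U(1) V(1)])
    ultimately show ?case by (intro exI[of _ "\<lambda>j. V j o\<^sub>L U j"]) blast
  qed
  then show ?thesis by blast
qed

end

section \<open>Decomposition into cyclic subspaces\<close>

context lifting_problem
begin

text \<open>
  A diagonal choice: it suffices to control finitely many coefficients at a time, since
  asymptotic representations are asymptotically contractive and \<open>s\<close> is dense.
\<close>

lemma realized_closure:
  assumes near: "\<And>\<epsilon>. \<epsilon> > 0 \<Longrightarrow> \<exists>v'. realized m v' \<and> (\<forall>p<m. norm (v' p - v p) < \<epsilon>)"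
  shows "realized m v"
proof -
  have "\<exists>v'. realized m v' \<and> (\<forall>p<m. norm (v' p - v p) < inverse (real (Suc i)))" for i by (rule near) simp
  then obtain V where V: "\<And>i. realized m (V i)" "\<And>i p. p < m \<Longrightarrow> norm (V i p - v p) < inverse (real (Suc i))" by metis
  have Vlim: "(\<lambda>i. V i p) \<longlonglongrightarrow> v p" if "p < m" for p
  proof -
    have "(\<lambda>i. V i p - v p) \<longlonglongrightarrow> 0"
      by (rule Lim_null_comparison[OF always_eventually LIMSEQ_inverse_real_of_nat])
        (use V(2)[OF that] in \<open>auto intro: less_imp_le\<close>)
    then show ?thesis by (rule LIM_zero_cancel)
  qed
  define Q where "Q i D \<Theta> \<eta> \<longleftrightarrow> controlled i D \<Theta> \<and> (\<forall>p<m. proj D (\<eta> p) = \<eta> p) \<and>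
      (\<forall>p<m. \<forall>q<m. cmod (cinner (\<eta> p) (\<eta> q) - cinner (V i p) (V i q)) < inverse (real (Suc i))) \<and>
      (\<forall>p<m. \<forall>q<m. \<forall>l<i. cmod (cinner (\<eta> p) (blinfun_apply (\<Theta> (s l)) (\<eta> q)) - cinner (V i p) (f (s l) (V i q))) < inverse (real (Suc i)))"
    for i D \<Theta> \<eta>
  have "\<exists>D \<Theta> \<eta>. Q i D \<Theta> \<eta>" for i
  proof -
    obtain D \<Theta> \<eta> where R: "approximants D \<Theta>" "\<And>j p. p < m \<Longrightarrow> proj (D j) (\<eta> j p) = \<eta> j p"
      "\<And>p q. p < m \<Longrightarrow> q < m \<Longrightarrow> (\<lambda>j. cinner (\<eta> j p) (\<eta> j q)) \<longlonglongrightarrow> cinner (V i p) (V i q)"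
      "\<And>a p q. p < m \<Longrightarrow> q < m \<Longrightarrow> (\<lambda>j. cinner (\<eta> j p) (\<Theta> j a (\<eta> j q))) \<longlonglongrightarrow> cinner (V i p) (f a (V i q))"
      using V(1)[of i] unfolding realized_def by blast
    have pos: "0 < inverse (real (Suc i))" by simp
    have "\<forall>\<^sub>F j in sequentially. \<forall>p\<in>{..<m}. \<forall>q\<in>{..<m}. cmod (cinner (\<eta> j p) (\<eta> j q) - cinner (V i p) (V i q)) < inverse (real (Suc i))"
      using tendstoD[OF R(3) pos] by (intro eventually_ball_finite ballI finite_lessThan) (simp add: dist_norm)
    moreover have "\<forall>\<^sub>F j in sequentially. \<forall>p\<in>{..<m}. \<forall>q\<in>{..<m}. \<forall>l\<in>{..<i}.
        cmod (cinner (\<eta> j p) (\<Theta> j (s l) (\<eta> j q)) - cinner (V i p) (f (s l) (V i q))) < inverse (real (Suc i))"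
      using tendstoD[OF R(4) pos] by (intro eventually_ball_finite ballI finite_lessThan) (simp add: dist_norm)
    ultimately have "\<forall>\<^sub>F j in sequentially. i \<le> j \<and>
        (\<forall>p\<in>{..<m}. \<forall>q\<in>{..<m}. cmod (cinner (\<eta> j p) (\<eta> j q) - cinner (V i p) (V i q)) < inverse (real (Suc i))) \<and>
        (\<forall>p\<in>{..<m}. \<forall>q\<in>{..<m}. \<forall>l\<in>{..<i}. cmod (cinner (\<eta> j p) (\<Theta> j (s l) (\<eta> j q)) - cinner (V i p) (f (s l) (V i q))) < inverse (real (Suc i)))"
      by (intro eventually_conj eventually_ge_at_top)
    then obtain j where j: "i \<le> j"
        "\<forall>p\<in>{..<m}. \<forall>q\<in>{..<m}. cmod (cinner (\<eta> j p) (\<eta> j q) - cinner (V i p) (V i q)) < inverse (real (Suc i))"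
        "\<forall>p\<in>{..<m}. \<forall>q\<in>{..<m}. \<forall>l\<in>{..<i}. cmod (cinner (\<eta> j p) (\<Theta> j (s l) (\<eta> j q)) - cinner (V i p) (f (s l) (V i q))) < inverse (real (Suc i))"
      using eventually_happens'[OF sequentially_bot] by blast
    have "controlled i (D j) (\<Theta> j)" using R(1) j(1) controlled_mono[of j "D j" "\<Theta> j" i "D j"] by (simp add: approximants_def)
    then show ?thesis unfolding Q_def using j(2,3) R(2) by (intro exI[of _ "D j"] exI[of _ "\<Theta> j"] exI[of _ "\<eta> j"]) simp
  qed
  then obtain D \<Theta> \<eta> where Q: "\<And>i. Q i (D i) (\<Theta> i) (\<eta> i)" by metis
  have z': "\<And>i. controlled i (D i) (\<Theta> i)" "\<And>i p. p < m \<Longrightarrow> proj (D i) (\<eta> i p) = \<eta> i p"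
    "\<And>i p q. p < m \<Longrightarrow> q < m \<Longrightarrow> cmod (cinner (\<eta> i p) (\<eta> i q) - cinner (V i p) (V i q)) < inverse (real (Suc i))"
    "\<And>i p q l. p < m \<Longrightarrow> q < m \<Longrightarrow> l < i \<Longrightarrow> cmod (cinner (\<eta> i p) (\<Theta> i (s l) (\<eta> i q)) - cinner (V i p) (f (s l) (V i q))) < inverse (real (Suc i))"
    using Q unfolding Q_def by blast+
  have app: "approximants D \<Theta>" using z'(1) by (simp add: approximants_def)
  note R = approximants_asymptotic_rep[OF app]
  have gram: "(\<lambda>i. cinner (\<eta> i p) (\<eta> i q)) \<longlonglongrightarrow> cinner (v p) (v q)" if pq: "p < m" "q < m" for p q
  proof -
    have "(\<lambda>i. cinner (\<eta> i p) (\<eta> i q) - cinner (V i p) (V i q)) \<longlonglongrightarrow> 0"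
      by (rule Lim_null_comparison[OF always_eventually LIMSEQ_inverse_real_of_nat])
        (use z'(3)[OF pq] in \<open>auto intro: less_imp_le\<close>)
    from tendsto_add[OF this tendsto_cinner[OF Vlim[OF pq(1)] Vlim[OF pq(2)]]] show ?thesis by simp
  qed
  have bd: "bounded_seq (\<lambda>i. \<eta> i p)" if "p < m" for p by (rule gram_bounded[OF gram[OF that that]])
  have "(\<lambda>i. cinner (\<eta> i p) (\<Theta> i a (\<eta> i q))) \<longlonglongrightarrow> cinner (v p) (f a (v q))" if pq: "p < m" "q < m" for a p q
  proof (rule dense_coefficients[OF R bd[OF pq(1)] bd[OF pq(2)]])
    fix l
    have "(\<lambda>i. cinner (\<eta> i p) (\<Theta> i (s l) (\<eta> i q)) - cinner (V i p) (f (s l) (V i q))) \<longlonglongrightarrow> 0"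
    proof (rule Lim_null_comparison[OF _ LIMSEQ_inverse_real_of_nat])
      show "\<forall>\<^sub>F i in sequentially. norm (cinner (\<eta> i p) (\<Theta> i (s l) (\<eta> i q)) - cinner (V i p) (f (s l) (V i q))) \<le> inverse (real (Suc i))"
        by (rule eventually_sequentiallyI[of "Suc l"]) (use z'(4)[OF pq] in \<open>auto intro: less_imp_le\<close>)
    qed
    moreover have "(\<lambda>i. cinner (V i p) (f (s l) (V i q))) \<longlonglongrightarrow> cinner (v p) (f (s l) (v q))"
      by (intro tendsto_cinner Vlim pq blinfun.tendsto tendsto_const)
    ultimately have "(\<lambda>i. (cinner (\<eta> i p) (\<Theta> i (s l) (\<eta> i q)) - cinner (V i p) (f (s l) (V i q))) + cinner (V i p) (f (s l) (V i q)))
        \<longlonglongrightarrow> 0 + cinner (v p) (f (s l) (v q))" by (rule tendsto_add)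
    then show "(\<lambda>i. cinner (\<eta> i p) (\<Theta> i (s l) (\<eta> i q))) \<longlonglongrightarrow> cinner (v p) (f (s l) (v q))" by simp
  qed
  then show ?thesis unfolding realized_def using app z'(2) gram
    by (intro exI[of _ D] exI[of _ \<Theta>] exI[of _ \<eta>] conjI allI impI)
qed

text \<open>
  Closed invariant subspaces in which every finite family of vectors is realized; they exhaust \<open>H\<close> by
  successively splitting off cyclic subspaces.
\<close>

definition tame :: "'h set \<Rightarrow> bool" where
  "tame E \<longleftrightarrow> closed E \<and> 0 \<in> E \<and> (\<forall>x\<in>E. \<forall>y\<in>E. x + y \<in> E) \<and> (\<forall>c. \<forall>x\<in>E. c *\<^sub>C x \<in> E) \<and>
    (\<forall>a. \<forall>x\<in>E. blinfun_apply (f a) x \<in> E) \<and> (\<forall>m v. (\<forall>p<m. v p \<in> E) \<longrightarrow> realized m v)"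

lemma tame_zero: "tame {0}"
proof -
  have "realized m v" if "\<forall>p<m. v p = 0" for m and v :: "nat \<Rightarrow> 'h"
  proof (rule realized_cong[OF realized_cyclic[of m "\<lambda>_. 0" 0]])
    show "ext f 0 0 = v p" if "p < m" for p using that \<open>\<forall>p<m. v p = 0\<close> by (simp add: blinfun.zero_right)
  qed
  then show ?thesis by (simp add: tame_def blinfun.zero_right)
qed

text \<open>
  The new subspace is the orthogonal sum of \<open>E\<close> and the closed cyclic subspace generated by the
  component \<open>\<xi>\<close> of \<open>w\<close> orthogonal to \<open>E\<close>.
\<close>

lemma tame_extend:
  assumes E: "tame E" shows "\<exists>E'. tame E' \<and> E \<subseteq> E' \<and> w \<in> E'"
proof -
  have clE: "closed E" and zE: "0 \<in> E" and aE: "\<And>x y. x \<in> E \<Longrightarrow> y \<in> E \<Longrightarrow> x + y \<in> E"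
    and sE: "\<And>c x. x \<in> E \<Longrightarrow> c *\<^sub>C x \<in> E" and fE: "\<And>a x. x \<in> E \<Longrightarrow> f a x \<in> E"
    and rE: "\<And>m v. (\<And>p. p < m \<Longrightarrow> v p \<in> E) \<Longrightarrow> realized m v"
    using E unfolding tame_def by blast+
  obtain p where p: "p \<in> bounded_ops" "\<And>v. blinfun_apply p v \<in> E" "\<And>v u. u \<in> E \<Longrightarrow> cinner u (v - p v) = 0"
    using projection_exists[OF clE zE aE sE] by blast
  note F = star_homD[OF star_hom_ext[OF f]]
  define \<xi> where "\<xi> = w - p w"
  define C where "C = range (\<lambda>x. ext f x \<xi>)"
  have extE: "ext f x u \<in> E" if "u \<in> E" for x u
    using that by (simp add: ext_def blinfun.add_left aE fE sE)
  have p_id: "p u = u" if u: "u \<in> E" for u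
  proof -
    have "u - p u \<in> E" using aE[OF u sE[OF p(2), of "-1" u]] by simp
    then have "cinner (u - p u) (u - p u) = 0" by (rule p(3))
    then show ?thesis by (simp add: cinner_self)
  qed
  have orth: "cinner u z = 0" if u: "u \<in> E" and z: "z \<in> closure C" for u z
  proof -
    obtain X where X: "\<And>n. X n \<in> C" "X \<longlonglongrightarrow> z" using z unfolding closure_sequential by blast
    have "cinner u (X n) = 0" for n
    proof -
      obtain x where "X n = ext f x \<xi>" using X(1)[of n] by (auto simp: C_def)
      then have "cinner u (X n) = cinner (ext f (cstar x) u) \<xi>"
        using cinner_cadjoint[OF F(1), of x u \<xi>] by (simp add: F(5))
      then show ?thesis unfolding \<xi>_def using p(3)[OF extE[OF u]] by simp
    qed
    then have "(\<lambda>n. 0) \<longlonglongrightarrow> cinner u z" using tendsto_cinner[OF tendsto_const X(2), of u] by simp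
    then show ?thesis by (simp add: LIMSEQ_const_iff)
  qed
  have p_zero: "p z = 0" if z: "z \<in> closure C" for z
  proof -
    have "cinner (p z) (p z) = cinner (p z) z - cinner (p z) (z - p z)" by (simp add: cinner_diff_right)
    also have "\<dots> = 0" by (simp add: orth[OF p(2) z] p(3)[OF p(2)])
    finally show ?thesis by (simp add: cinner_self)
  qed
  have C_add: "x + y \<in> closure C" if "x \<in> closure C" "y \<in> closure C" for x y
  proof -
    obtain X Y where X: "\<And>n. X n \<in> C" "X \<longlonglongrightarrow> x" and Y: "\<And>n. Y n \<in> C" "Y \<longlonglongrightarrow> y"
      using \<open>x \<in> closure C\<close> \<open>y \<in> closure C\<close> unfolding closure_sequential by blast
    have "X n + Y n \<in> C" for n
    proof -
      obtain a b where "X n = ext f a \<xi>" "Y n = ext f b \<xi>" using X(1)[of n] Y(1)[of n] by (auto simp: C_def)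
      then have "X n + Y n = ext f (a + b) \<xi>" by (simp add: F(2) blinfun.add_left)
      then show ?thesis by (simp add: C_def)
    qed
    then show ?thesis unfolding closure_sequential using tendsto_add[OF X(2) Y(2)] by (intro exI[of _ "\<lambda>n. X n + Y n"]) simp
  qed
  have C_op: "T x \<in> closure C" if T: "bounded_linear T" "\<And>y. y \<in> C \<Longrightarrow> T y \<in> C" and x: "x \<in> closure C" for T :: "'h \<Rightarrow> 'h" and x
  proof -
    obtain X where X: "\<And>n. X n \<in> C" "X \<longlonglongrightarrow> x" using x unfolding closure_sequential by blast
    show ?thesis unfolding closure_sequential
      using bounded_linear.tendsto[OF T(1) X(2)] T(2)[OF X(1)] by (intro exI[of _ "\<lambda>n. T (X n)"]) simp
  qed
  have C_scale: "c *\<^sub>C x \<in> closure C" if "x \<in> closure C" for c x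
  proof (rule C_op[OF bounded_linear_scaleC _ that])
    fix y assume "y \<in> C"
    then obtain a where "y = ext f a \<xi>" by (auto simp: C_def)
    then have "c *\<^sub>C y = ext f (c *\<^sub>C a) \<xi>" by (simp add: F(3))
    then show "c *\<^sub>C y \<in> C" by (simp add: C_def)
  qed
  have C_f: "f a x \<in> closure C" if "x \<in> closure C" for a x
  proof (rule C_op[OF blinfun.bounded_linear_right _ that])
    fix y assume "y \<in> C"
    then obtain b where "y = ext f b \<xi>" by (auto simp: C_def)
    then have "f a y = ext f (emb a * b) \<xi>" by (simp add: F(4))
    then show "f a y \<in> C" by (simp add: C_def)
  qed
  have C_zero: "0 \<in> closure C"
  proof -
    have "ext f 0 \<xi> \<in> C" by (simp add: C_def)
    then show ?thesis using closure_subset[of C] star_hom_zero[OF star_hom_ext[OF f]] by auto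
  qed
  define E' where "E' = {v. v - p v \<in> closure C}"
  have "tame E'" unfolding tame_def
  proof (intro conjI ballI allI impI)
    have "E' = (\<lambda>v. v - p v) -` closure C" by (auto simp: E'_def)
    moreover have "continuous_on UNIV (\<lambda>v. v - blinfun_apply p v)" by (intro continuous_intros)
    ultimately show "closed E'" by (simp add: closed_vimage continuous_on_closed_vimage)
    show "0 \<in> E'" by (simp add: E'_def blinfun.zero_right C_zero)
    fix x assume x: "x \<in> E'"
    then have x': "x - p x \<in> closure C" by (simp add: E'_def)
    show "x + y \<in> E'" if "y \<in> E'" for y
    proof -
      have eq: "(x + y) - p (x + y) = (x - p x) + (y - p y)" by (simp add: blinfun.add_right)
      show ?thesis unfolding E'_def mem_Collect_eq eq
        by (rule C_add[OF x']) (use that in \<open>simp add: E'_def\<close>)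
    qed
    show "c *\<^sub>C x \<in> E'" for c
      using C_scale[OF x', of c] by (simp add: E'_def bounded_opsD[OF p(1)] complex_vector.scale_right_diff_distrib)
    show "f a x \<in> E'" for a
    proof -
      have "f a x = f a (p x) + f a (x - p x)" by (simp add: blinfun.diff_right)
      then have "p (f a x) = p (f a (p x)) + p (f a (x - p x))" by (simp only: blinfun.add_right)
      then have "p (f a x) = f a (p x)" by (simp add: p_id[OF fE[OF p(2)]] p_zero[OF C_f[OF x']])
      then have "f a x - p (f a x) = f a (x - p x)" by (simp add: blinfun.diff_right)
      then show ?thesis using C_f[OF x'] by (simp add: E'_def)
    qed
  next
    fix m and v :: "nat \<Rightarrow> 'h" assume v: "\<forall>q<m. v q \<in> E'"
    define z where "z q = v q - p (v q)" for q
    have z: "z q \<in> closure C" if "q < m" for q using v that by (simp add: z_def E'_def)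
    have "realized m z"
    proof (rule realized_closure)
      fix \<epsilon> :: real assume \<epsilon>: "\<epsilon> > 0"
      have "\<exists>x. q < m \<longrightarrow> norm (ext f x \<xi> - z q) < \<epsilon>" for q
      proof (cases "q < m")
        case True
        obtain y where "y \<in> C" "dist y (z q) < \<epsilon>" using z[OF True] \<epsilon> unfolding closure_approachable by blast
        then show ?thesis by (auto simp: C_def dist_norm)
      qed simp
      then obtain x where "\<And>q. q < m \<longrightarrow> norm (ext f (x q) \<xi> - z q) < \<epsilon>" by metis
      then show "\<exists>v'. realized m v' \<and> (\<forall>q<m. norm (v' q - z q) < \<epsilon>)"
        using realized_cyclic[of m x \<xi>] by blast
    qed
    moreover have "realized m (\<lambda>q. p (v q))" by (rule rE) (rule p(2))
    ultimately have "realized m (\<lambda>q. p (v q) + z q)"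
      by (intro realized_add) (auto intro: orth p(2) z C_f)
    then show "realized m v" by (rule realized_cong) (simp add: z_def)
  qed
  moreover have "E \<subseteq> E'" by (auto simp: E'_def p_id C_zero)
  moreover have "w \<in> E'"
  proof -
    have "ext f 1 \<xi> = \<xi>" by (simp add: ext_def blinfun.add_left star_hom_zero[OF f] scaleC_one)
    then have "\<xi> \<in> C" unfolding C_def by (metis rangeI)
    then show ?thesis using closure_subset[of C] by (auto simp: E'_def \<xi>_def)
  qed
  ultimately show ?thesis by blast
qed

lemma realized_basis: "realized d e"
proof -
  have "\<exists>E. tame E \<and> (\<forall>p<d. e p \<in> E)"
  proof (induction d)
    case 0 show ?case using tame_zero by blast
  next
    case (Suc d)
    then obtain E where E: "tame E" "\<forall>p<d. e p \<in> E" by blast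
    obtain E' where E': "tame E'" "E \<subseteq> E'" "e d \<in> E'" using tame_extend[OF E(1)] by blast
    then show ?case using E(2) by (intro exI[of _ E']) (auto simp: less_Suc_eq)
  qed
  then show ?thesis unfolding tame_def by blast
qed

end

section \<open>Lifting a representation\<close>

context lifting_problem
begin

text \<open>
  Conjugating by the unitaries of \<open>align_orthonormal\<close> replaces the vectors that realize
  \<open>e 0, \<dots>, e (d - 1)\<close> by these basis vectors themselves.
\<close>

lemma coefficient_approximants:
  "\<exists>D \<Theta>. approximants D \<Theta> \<and> (\<forall>a. \<forall>p<d. \<forall>q<d. (\<lambda>j. cinner (e p) (blinfun_apply (\<Theta> j a) (e q))) \<longlonglongrightarrow> cinner (e p) (f a (e q)))"
proof -
  obtain D \<Theta> \<eta> where R: "approximants D \<Theta>" "\<And>j p. p < d \<Longrightarrow> proj (D j) (\<eta> j p) = \<eta> j p"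
    "\<And>p q. p < d \<Longrightarrow> q < d \<Longrightarrow> (\<lambda>j. cinner (\<eta> j p) (\<eta> j q)) \<longlonglongrightarrow> cinner (e p) (e q)"
    "\<And>a p q. p < d \<Longrightarrow> q < d \<Longrightarrow> (\<lambda>j. cinner (\<eta> j p) (\<Theta> j a (\<eta> j q))) \<longlonglongrightarrow> cinner (e p) (f a (e q))"
    using realized_basis[of d] unfolding realized_def by blast
  note A = approximants_asymptotic_rep[OF R(1)]
  define D' where "D' j = max (D j) d" for j
  have c: "controlled j (D' j) (\<Theta> j)" for j
    using R(1) controlled_mono[of j "D j" "\<Theta> j" j "D' j"] by (simp add: approximants_def D'_def)
  have "proj (D' j) (\<eta> j p) = \<eta> j p" if "p < d" for j p
    using proj_proj[of "D' j" "D j" "\<eta> j p"] R(2)[OF that, of j] by (simp add: D'_def)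
  moreover have "d \<le> D' j" for j by (simp add: D'_def)
  moreover have gram: "(\<lambda>j. cinner (\<eta> j p) (\<eta> j q)) \<longlonglongrightarrow> (if p = q then 1 else 0)" if "p < d" "q < d" for p q
    using R(3)[OF that] by (simp add: ortho)
  ultimately obtain U where U: "\<And>j. unitary_on (D' j) (U j)" "\<And>p. p < d \<Longrightarrow> (\<lambda>j. blinfun_apply (U j) (\<eta> j p)) \<longlonglongrightarrow> e p"
    using align_orthonormal[of d D' \<eta>] by blast
  have near: "(\<lambda>j. cadjoint (U j) (e p) - \<eta> j p) \<longlonglongrightarrow> 0" if p: "p < d" for p
  proof -
    have "norm (cadjoint (U j) (e p) - \<eta> j p) = norm (U j (\<eta> j p) - e p)" for j
    proof -
      have "U j (\<eta> j p) - e p = U j (\<eta> j p - cadjoint (U j) (e p))"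
        by (simp add: blinfun.diff_right unitary_onD(3)[OF U(1)])
      then show ?thesis by (simp add: unitary_onD(6)[OF U(1)] norm_minus_commute)
    qed
    moreover have "(\<lambda>j. norm (U j (\<eta> j p) - e p)) \<longlonglongrightarrow> 0" using U(2)[OF p] by (simp add: LIM_zero tendsto_norm_zero)
    ultimately have "(\<lambda>j. norm (cadjoint (U j) (e p) - \<eta> j p)) \<longlonglongrightarrow> 0" by simp
    then show ?thesis by (simp only: tendsto_norm_zero_iff)
  qed
  show ?thesis
  proof (intro exI conjI allI impI)
    show "approximants D' (\<lambda>j a. conj_op (U j) (\<Theta> j a))"
      unfolding approximants_def by (intro allI controlled_conj c U(1))
    fix a p q assume pq: "p < d" "q < d"
    have b1: "bounded_seq (\<lambda>j. \<eta> j p)" by (rule gram_bounded[OF gram[OF pq(1) pq(1)]])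
    have b2: "bounded_seq (\<lambda>j. cadjoint (U j) (e q))"
      by (rule bounded_seqI[of _ 1]) (simp add: unitary_onD(7)[OF U(1)])
    have "(\<lambda>j. cinner (cadjoint (U j) (e p)) (\<Theta> j a (cadjoint (U j) (e q))) - cinner (\<eta> j p) (\<Theta> j a (\<eta> j q))) \<longlonglongrightarrow> 0"
      by (rule perturb_cinner[OF near[OF pq(1)] near[OF pq(2)] b1 b2 rep_bounded[OF A]])
    from tendsto_add[OF this R(4)[OF pq, of a]]
    have "(\<lambda>j. cinner (cadjoint (U j) (e p)) (\<Theta> j a (cadjoint (U j) (e q)))) \<longlonglongrightarrow> cinner (e p) (f a (e q))" by simp
    then show "(\<lambda>j. cinner (e p) (conj_op (U j) (\<Theta> j a) (e q))) \<longlonglongrightarrow> cinner (e p) (f a (e q))"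
      by (simp add: conj_op_def cinner_cadjoint[OF unitary_onD(1)[OF U(1)]])
  qed
qed

lemma weak_approximants:
  "\<exists>D \<Theta>. approximants D \<Theta> \<and> (\<forall>a p q. (\<lambda>j. cinner (e p) (blinfun_apply (\<Theta> j a) (e q))) \<longlonglongrightarrow> cinner (e p) (f a (e q)))"
proof -
  define Q where "Q d D \<Theta> \<longleftrightarrow> controlled d D \<Theta> \<and> (\<forall>p<d. \<forall>q<d. \<forall>l<d.
      cmod (cinner (e p) (blinfun_apply (\<Theta> (s l)) (e q)) - cinner (e p) (f (s l) (e q))) < inverse (real (Suc d)))" for d D \<Theta>
  have "\<exists>D \<Theta>. Q d D \<Theta>" for d
  proof -
    obtain D \<Theta> where R: "approximants D \<Theta>"
      "\<And>a p q. p < d \<Longrightarrow> q < d \<Longrightarrow> (\<lambda>j. cinner (e p) (blinfun_apply (\<Theta> j a) (e q))) \<longlonglongrightarrow> cinner (e p) (f a (e q))"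
      using coefficient_approximants[of d] by blast
    have "\<forall>\<^sub>F j in sequentially. \<forall>p\<in>{..<d}. \<forall>q\<in>{..<d}. \<forall>l\<in>{..<d}.
        cmod (cinner (e p) (\<Theta> j (s l) (e q)) - cinner (e p) (f (s l) (e q))) < inverse (real (Suc d))"
      using tendstoD[OF R(2), of _ _ "inverse (real (Suc d))"]
      by (intro eventually_ball_finite ballI finite_lessThan) (simp add: dist_norm)
    then have "\<forall>\<^sub>F j in sequentially. d \<le> j \<and> (\<forall>p\<in>{..<d}. \<forall>q\<in>{..<d}. \<forall>l\<in>{..<d}.
        cmod (cinner (e p) (\<Theta> j (s l) (e q)) - cinner (e p) (f (s l) (e q))) < inverse (real (Suc d)))"
      by (intro eventually_conj eventually_ge_at_top)
    then obtain j where j: "d \<le> j" "\<forall>p\<in>{..<d}. \<forall>q\<in>{..<d}. \<forall>l\<in>{..<d}.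
        cmod (cinner (e p) (\<Theta> j (s l) (e q)) - cinner (e p) (f (s l) (e q))) < inverse (real (Suc d))"
      using eventually_happens'[OF sequentially_bot] by blast
    have "controlled d (D j) (\<Theta> j)" using R(1) j(1) controlled_mono[of j "D j" "\<Theta> j" d "D j"] by (simp add: approximants_def)
    then show ?thesis unfolding Q_def using j(2) by (intro exI[of _ "D j"] exI[of _ "\<Theta> j"]) simp
  qed
  then obtain D \<Theta> where Q: "\<And>d. Q d (D d) (\<Theta> d)" by metis
  have app: "approximants D \<Theta>" using Q unfolding Q_def approximants_def by blast
  note A = approximants_asymptotic_rep[OF app]
  have "(\<lambda>j. cinner (e p) (\<Theta> j a (e q))) \<longlonglongrightarrow> cinner (e p) (f a (e q))" for a p q
  proof (rule dense_coefficients[OF A bounded_seq_const bounded_seq_const])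
    fix l
    have "(\<lambda>j. cinner (e p) (\<Theta> j (s l) (e q)) - cinner (e p) (f (s l) (e q))) \<longlonglongrightarrow> 0"
    proof (rule Lim_null_comparison[OF _ LIMSEQ_inverse_real_of_nat])
      show "\<forall>\<^sub>F j in sequentially. norm (cinner (e p) (\<Theta> j (s l) (e q)) - cinner (e p) (f (s l) (e q))) \<le> inverse (real (Suc j))"
      proof (rule eventually_sequentiallyI[of "Suc (max p (max q l))"])
        fix j assume "Suc (max p (max q l)) \<le> j"
        then have "p < j" "q < j" "l < j" by auto
        then show "norm (cinner (e p) (\<Theta> j (s l) (e q)) - cinner (e p) (f (s l) (e q))) \<le> inverse (real (Suc j))"
          using Q[of j] unfolding Q_def by (meson less_imp_le)
      qed
    qed
    then show "(\<lambda>j. cinner (e p) (\<Theta> j (s l) (e q))) \<longlonglongrightarrow> cinner (e p) (f (s l) (e q))" by (rule LIM_zero_cancel)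
  qed
  with app show ?thesis by blast
qed

end

context orthonormal_basis
begin

text \<open>
  Convergence of the norms rules out that mass escapes to the basis vectors of large index.
\<close>

lemma strong_limit_of_weak:
  fixes w :: "nat \<Rightarrow> 'h"
  assumes weak: "\<And>p. (\<lambda>j. cinner (e p) (w j)) \<longlonglongrightarrow> cinner (e p) v"
    and nrm: "(\<lambda>j. (norm (w j))\<^sup>2) \<longlonglongrightarrow> (norm v)\<^sup>2"
  shows "w \<longlonglongrightarrow> v"
proof -
  have bound: "(norm (x - y))\<^sup>2 \<le> (norm (proj N (x - y)))\<^sup>2 + 2 * ((norm x)\<^sup>2 - (norm (proj N x))\<^sup>2) + 2 * ((norm y)\<^sup>2 - (norm (proj N y))\<^sup>2)" for x y :: 'h and N
  proof -
    have "(norm (x - y))\<^sup>2 = (norm (proj N (x - y)))\<^sup>2 + (norm ((x - proj N x) - (y - proj N y)))\<^sup>2"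
      using norm_proj_pythagoras[of "x - y" N] by (simp add: blinfun.diff_right algebra_simps)
    moreover have "(norm ((x - proj N x) - (y - proj N y)))\<^sup>2 \<le> 2 * (norm (x - proj N x))\<^sup>2 + 2 * (norm (y - proj N y))\<^sup>2"
      using parallelogram[of "x - proj N x" "y - proj N y"] zero_le_power2[of "norm ((x - proj N x) + (y - proj N y))"] by linarith
    ultimately show ?thesis using norm_proj_pythagoras[of x N] norm_proj_pythagoras[of y N] by (simp add: right_diff_distrib)
  qed
  have "(\<lambda>j. (norm (w j - v))\<^sup>2) \<longlonglongrightarrow> 0"
  proof (rule LIMSEQ_I)
    fix r :: real assume r: "r > 0"
    have "(\<lambda>N. (norm v)\<^sup>2 - (norm (proj N v))\<^sup>2) \<longlonglongrightarrow> (norm v)\<^sup>2 - (norm v)\<^sup>2" by (intro tendsto_intros proj_tendsto)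
    then have "\<forall>\<^sub>F N in sequentially. (norm v)\<^sup>2 - (norm (proj N v))\<^sup>2 < r / 8"
      by (intro order_tendstoD(2)[of _ 0]) (use r in simp_all)
    then obtain N where N: "(norm v)\<^sup>2 - (norm (proj N v))\<^sup>2 < r / 8" using eventually_happens'[OF sequentially_bot] by blast
    have pw: "(\<lambda>j. (norm (proj N (w j - v)))\<^sup>2) \<longlonglongrightarrow> (\<Sum>i<N. (cmod (cinner (e i) v - cinner (e i) v))\<^sup>2)"
      unfolding norm_proj_sq cinner_diff_right by (intro tendsto_intros weak)
    have pw': "(\<lambda>j. (norm (proj N (w j)))\<^sup>2) \<longlonglongrightarrow> (norm (proj N v))\<^sup>2"
      unfolding norm_proj_sq by (intro tendsto_intros weak)
    have lim: "(\<lambda>j. (norm (proj N (w j - v)))\<^sup>2 + 2 * ((norm (w j))\<^sup>2 - (norm (proj N (w j)))\<^sup>2) + 2 * ((norm v)\<^sup>2 - (norm (proj N v))\<^sup>2))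
        \<longlonglongrightarrow> 0 + 2 * ((norm v)\<^sup>2 - (norm (proj N v))\<^sup>2) + 2 * ((norm v)\<^sup>2 - (norm (proj N v))\<^sup>2)"
      using pw by (intro tendsto_intros pw' nrm) simp
    have "\<forall>\<^sub>F j in sequentially. (norm (proj N (w j - v)))\<^sup>2 + 2 * ((norm (w j))\<^sup>2 - (norm (proj N (w j)))\<^sup>2) + 2 * ((norm v)\<^sup>2 - (norm (proj N v))\<^sup>2) < r"
      by (rule order_tendstoD(2)[OF lim]) (use N r in simp)
    then have "\<forall>\<^sub>F j in sequentially. (norm (w j - v))\<^sup>2 < r"
      by eventually_elim (use bound[of _ v N] in \<open>rule le_less_trans\<close>)
    then show "\<exists>no. \<forall>j\<ge>no. norm ((norm (w j - v))\<^sup>2 - 0) < r" by (simp add: eventually_sequentially)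
  qed
  then have "(\<lambda>j. sqrt ((norm (w j - v))\<^sup>2)) \<longlonglongrightarrow> sqrt 0" by (rule tendsto_real_sqrt)
  then have "(\<lambda>j. w j - v) \<longlonglongrightarrow> 0" by (simp add: tendsto_norm_zero_iff)
  then show ?thesis by (rule LIM_zero_cancel)
qed

lemma strong_limit_of_basis:
  fixes T :: "nat \<Rightarrow> 'h \<Rightarrow>\<^sub>L 'h" and S :: "'h \<Rightarrow>\<^sub>L 'h"
  assumes T: "bounded_seq T" and lim: "\<And>q. (\<lambda>j. blinfun_apply (T j) (e q)) \<longlonglongrightarrow> S (e q)"
    and b: "\<And>j. T j \<in> bounded_ops" "S \<in> bounded_ops"
  shows "(\<lambda>j. blinfun_apply (T j) v) \<longlonglongrightarrow> blinfun_apply S v"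
proof (rule LIMSEQ_I)
  fix r :: real assume r: "r > 0"
  obtain K where K: "K > 0" "\<And>j. norm (T j) \<le> K" by (rule bounded_seqE[OF T]) blast
  define L where "L = max K (norm S)"
  have L: "L > 0" "\<And>j. norm (T j) \<le> L" "norm S \<le> L" using K by (auto simp: L_def less_max_iff_disj le_max_iff_disj)
  have "\<forall>\<^sub>F N in sequentially. dist (proj N v) v < r / (4 * L)" by (rule tendstoD[OF proj_tendsto]) (use r L in simp)
  then obtain N where N: "norm (proj N v - v) < r / (4 * L)"
    using eventually_happens'[OF sequentially_bot] by (auto simp: dist_norm)
  have "(\<lambda>j. \<Sum>i<N. cinner (e i) v *\<^sub>C T j (e i)) \<longlonglongrightarrow> (\<Sum>i<N. cinner (e i) v *\<^sub>C S (e i))"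
    by (intro tendsto_sum bounded_linear.tendsto[OF bounded_linear_scaleC] lim)
  then have "(\<lambda>j. T j (proj N v)) \<longlonglongrightarrow> S (proj N v)"
    by (simp add: proj_apply blinfun.sum_right bounded_opsD[OF b(1)] bounded_opsD[OF b(2)])
  then obtain j0 where j0: "\<And>j. j \<ge> j0 \<Longrightarrow> norm (T j (proj N v) - S (proj N v)) < r / 2"
    using LIMSEQ_D[of _ _ "r / 2"] r by (metis half_gt_zero)
  have small: "norm (blinfun_apply X (v - proj N v)) \<le> r / 4" if "norm X \<le> L" for X :: "'h \<Rightarrow>\<^sub>L 'h"
  proof -
    have "norm (X (v - proj N v)) \<le> norm X * norm (v - proj N v)" by (rule norm_blinfun)
    also have "\<dots> \<le> L * (r / (4 * L))" using that N L by (intro mult_mono) (auto simp: norm_minus_commute)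
    also have "\<dots> = r / 4" using L(1) by simp
    finally show ?thesis .
  qed
  have "norm (T j v - S v) < r" if "j \<ge> j0" for j
  proof -
    define A B C where "A = T j (v - proj N v)" and "B = T j (proj N v) - S (proj N v)" and "C = blinfun_apply S (v - proj N v)"
    have eq: "T j v - S v = A + B - C" by (simp add: A_def B_def C_def blinfun.diff_right)
    have "norm (A + B - C) \<le> norm A + norm B + norm C"
      using norm_triangle_ineq4[of "A + B" C] norm_triangle_ineq[of A B] by linarith
    moreover have "norm A \<le> r / 4" "norm C \<le> r / 4" "norm B < r / 2"
      using small[OF L(2)] small[OF L(3)] j0[OF that] by (simp_all add: A_def B_def C_def)
    ultimately have "norm (A + B - C) < r" by linarith
    then show ?thesis using eq by simp
  qed
  then show "\<exists>no. \<forall>j\<ge>no. norm (T j v - S v) < r" by blast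
qed

lemma corner_alg_simps:
  "elems (corner_alg (proj n)) = corner n" "add_sa (corner_alg p) = (+)" "mult_sa (corner_alg p) = (o\<^sub>L)"
  "scale_sa (corner_alg p) = scale_op" "star_sa (corner_alg p) = cadjoint" "norm_sa (corner_alg p) = norm"
proof -
  have "T \<in> corner n \<longleftrightarrow> (\<exists>S. T = proj n o\<^sub>L S o\<^sub>L proj n \<and> S \<in> bounded_ops)" for T
  proof
    assume "T \<in> corner n"
    then show "\<exists>S. T = proj n o\<^sub>L S o\<^sub>L proj n \<and> S \<in> bounded_ops"
      using corner_compress[of T n] cornerD(1)[of T n] by metis
  next
    assume "\<exists>S. T = proj n o\<^sub>L S o\<^sub>L proj n \<and> S \<in> bounded_ops"
    then show "T \<in> corner n" by (auto intro!: cornerI blinfun_eqI simp: proj_proj)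
  qed
  then show "elems (corner_alg (proj n)) = corner n" by (auto simp: corner_alg_def)
qed (use bounded_op_alg_simps in \<open>simp_all add: corner_alg_def\<close>)

lemma convergent_alg_simps:
  "elems (convergent_matrix_alg proj) = {X. (\<forall>n. X n \<in> corner n) \<and> bounded_seq X \<and> (\<exists>T. star_strong_limit X T)}"
  "add_sa (convergent_matrix_alg proj) = (\<lambda>X Y n. X n + Y n)" "mult_sa (convergent_matrix_alg proj) = (\<lambda>X Y n. X n o\<^sub>L Y n)"
  "scale_sa (convergent_matrix_alg proj) = (\<lambda>c X n. scale_op c (X n))" "star_sa (convergent_matrix_alg proj) = (\<lambda>X n. cadjoint (X n))"
  "norm_sa (convergent_matrix_alg proj) = (\<lambda>X. SUP n. norm (X n))" "diff_sa (convergent_matrix_alg proj) = (\<lambda>X Y n. X n - Y n)"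
proof -
  have "X n + scale_op (- 1) (Y n) = X n - Y n" for X Y :: "nat \<Rightarrow> 'h \<Rightarrow>\<^sub>L 'h" and n
    by (rule blinfun_eqI) (simp add: blinfun.add_left blinfun.diff_left)
  then show "diff_sa (convergent_matrix_alg proj) = (\<lambda>X Y n. X n - Y n)"
    by (simp add: fun_eq_iff diff_sa_def convergent_matrix_alg_def bounded_prod_def corner_alg_simps)
qed (auto simp: convergent_matrix_alg_def bounded_prod_def corner_alg_simps bounded_seq_bdd_above)

lemma cadjoint_strong_limit:
  fixes \<Theta> :: "nat \<Rightarrow> 'a::cstar_algebra \<Rightarrow> 'h \<Rightarrow>\<^sub>L 'h" and f :: "'a \<Rightarrow> 'h \<Rightarrow>\<^sub>L 'h"
  assumes \<Theta>: "asymptotic_rep \<Theta>" and f: "star_hom bounded_op_alg f"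
    and lim: "\<And>a v. (\<lambda>j. blinfun_apply (\<Theta> j a) v) \<longlonglongrightarrow> blinfun_apply (f a) v"
  shows "star_strong_limit (\<lambda>j. \<Theta> j a) (f a)"
  unfolding star_strong_limit_def
proof (intro conjI allI)
  show "f a \<in> bounded_ops" by (rule star_homD(1)[OF f])
  show "(\<lambda>j. \<Theta> j a v) \<longlonglongrightarrow> f a v" for v by (rule lim)
  fix v :: 'h
  have "(\<lambda>j. norm (\<Theta> j (cstar a) - cadjoint (\<Theta> j a)) * norm v) \<longlonglongrightarrow> 0"
    using rep_cstar[OF \<Theta>, of a] unfolding close_def by (rule tendsto_mult_left_zero)
  then have "(\<lambda>j. (\<Theta> j (cstar a) - cadjoint (\<Theta> j a)) v) \<longlonglongrightarrow> 0"
    by (rule Lim_null_comparison[OF always_eventually[rule_format], rotated]) (rule norm_blinfun)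
  from tendsto_diff[OF lim[of "cstar a" v] this]
  show "(\<lambda>j. cadjoint (\<Theta> j a) v) \<longlonglongrightarrow> cadjoint (f a) v"
    by (simp add: blinfun.diff_left star_homD(5)[OF f])
qed

end

context lifting_problem
begin

text \<open>
  Asymptotic multiplicativity turns weak into strong convergence: \<open>norm (\<Theta> j a v)^2\<close> is
  asymptotically the coefficient of \<open>\<Theta> j (a^* a)\<close> at \<open>v\<close>, which converges.
\<close>

lemma strong_approximants:
  "\<exists>D \<Theta>. approximants D \<Theta> \<and> (\<forall>a v. (\<lambda>j. blinfun_apply (\<Theta> j a) v) \<longlonglongrightarrow> f a v)"
proof -
  obtain D \<Theta> where app: "approximants D \<Theta>"
    and weak: "\<And>a p q. (\<lambda>j. cinner (e p) (blinfun_apply (\<Theta> j a) (e q))) \<longlonglongrightarrow> cinner (e p) (f a (e q))"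
    using weak_approximants by blast
  note A = approximants_asymptotic_rep[OF app]
  have "(\<lambda>j. \<Theta> j a v) \<longlonglongrightarrow> f a v" for a v
  proof (rule strong_limit_of_basis[OF rep_bounded[OF A] _ rep_bounded_ops[OF A] star_homD(1)[OF f]])
    fix q
    show "(\<lambda>j. \<Theta> j a (e q)) \<longlonglongrightarrow> f a (e q)"
    proof (rule strong_limit_of_weak[OF weak])
      have "(\<lambda>j. cinner (e q) (\<Theta> j (cstar a * a) (e q)) - cinner (e q) ((cadjoint (\<Theta> j a) o\<^sub>L \<Theta> j a) (e q))) \<longlonglongrightarrow> 0"
        by (rule close_cinner[OF rep_square[OF A] bounded_seq_const bounded_seq_const])
      from tendsto_Re[OF tendsto_diff[OF weak[of q "cstar a * a" q] this]]
      show "(\<lambda>j. (norm (\<Theta> j a (e q)))\<^sup>2) \<longlonglongrightarrow> (norm (f a (e q)))\<^sup>2"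
        unfolding norm_apply_sq[OF rep_bounded_ops[OF A]] norm_apply_sq[OF star_homD(1)[OF f]]
        by (simp add: star_homD(4,5)[OF f])
    qed
  qed
  with app show ?thesis by blast
qed

text \<open>
  The asymptotic representation \<open>\<Theta>\<close> is slowed down until its \<open>m\<close>-th member \<open>X a m\<close> fits in the
  corner of size \<open>m\<close>.  The \<open>n\<close>-th map of the lift sends \<open>a\<close> to \<open>X a\<close> with the first \<open>n\<close> entries
  replaced by \<open>0\<close>; all its defects are then suprema over \<open>m \<ge> n\<close>.
\<close>

theorem lifts_proj: "lifts proj f"
proof -
  obtain D \<Theta> where app: "approximants D \<Theta>" and lim: "\<And>a v. (\<lambda>j. blinfun_apply (\<Theta> j a) v) \<longlonglongrightarrow> f a v"
    using strong_approximants by blast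
  note A = approximants_asymptotic_rep[OF app]
  have cor: "\<Theta> j a \<in> corner (D j)" for j a
    by (rule controlled_corner[of j]) (use app in \<open>simp add: approximants_def\<close>)
  \<comment> \<open>A strictly increasing sequence of matrix sizes with \<open>D j \<le> M j\<close>.\<close>
  define M where "M j = j + (\<Sum>i\<le>j. D i)" for j
  have M_mono: "M i \<le> M j" if "i \<le> j" for i j
    unfolding M_def by (intro add_mono that sum_mono2) (use that in auto)
  have D_le: "D j \<le> M j" for j unfolding M_def by (rule trans_le_add2, rule member_le_sum) auto
  \<comment> \<open>The number of maps \<open>\<Theta> j\<close> with \<open>M j \<le> m\<close>; if it is not \<open>0\<close>, then \<open>J m\<close> is the last of these.\<close>
  define c where "c m = (LEAST j. m < M j)" for m
  have c_less: "m < M (c m)" for m unfolding c_def by (rule LeastI[of _ "Suc m"]) (simp add: M_def)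
  have c_pred: "M j \<le> m" if "j < c m" for j m using not_less_Least[OF that[unfolded c_def]] by simp
  have c_ge: "j < c m" if "M j \<le> m" for j m using M_mono[of "c m" j] c_less[of m] that by (meson leI le_trans not_less)
  define J where "J m = c m - 1" for m
  define X where "X a m = (if c m = 0 then 0 else \<Theta> (J m) a)" for a m
  have J_top: "filterlim J at_top sequentially"
    unfolding filterlim_at_top eventually_sequentially
  proof (intro allI exI impI)
    fix z m assume "M z \<le> m"
    then show "z \<le> J m" using c_ge[of z m] by (simp add: J_def)
  qed
  have ev: "\<forall>\<^sub>F m in sequentially. c m \<noteq> 0"
    by (rule eventually_sequentiallyI[of "M 0"]) (use c_ge[of 0] in auto)
  have XJ: "\<forall>\<^sub>F m in sequentially. X a m = \<Theta> (J m) a" for a using ev by eventually_elim (simp add: X_def)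
  have X_corner: "X a m \<in> corner m" for a m
  proof (cases "c m = 0")
    case True then show ?thesis by (simp add: X_def corner_def blinfun.zero_right)
  next
    case False
    then have "D (J m) \<le> m" using D_le[of "J m"] c_pred[of "J m" m] by (simp add: J_def)
    then show ?thesis using cor[of "J m" a] corner_mono[of "D (J m)" m] False by (auto simp: X_def)
  qed
  have X_rep: "asymptotic_rep (\<lambda>m a. X a m)"
    unfolding asymptotic_rep_tests
  proof (intro conjI allI ballI)
    show "X a m \<in> bounded_ops" for m a by (rule cornerD(1)[OF X_corner])
    show "bounded_seq (\<lambda>m. X a m)" for a
    proof -
      obtain K where "K > 0" "\<And>j. norm (\<Theta> j a) \<le> K" using bounded_seqE[OF rep_bounded[OF A]] by blast
      then show ?thesis by (intro bounded_seqI[of _ K]) (simp add: X_def)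
    qed
    fix E :: "('a \<Rightarrow> 'h \<Rightarrow>\<^sub>L 'h) \<Rightarrow> 'h \<Rightarrow>\<^sub>L 'h" assume "E \<in> vanishing_tests"
    then have "(\<lambda>j. norm (E (\<Theta> j))) \<longlonglongrightarrow> 0" using A by (simp add: asymptotic_rep_tests)
    then have "(\<lambda>m. norm (E (\<Theta> (J m)))) \<longlonglongrightarrow> 0" by (rule filterlim_compose[OF _ J_top])
    moreover have "\<forall>\<^sub>F m in sequentially. norm (E (\<Theta> (J m))) = norm (E (\<lambda>a. X a m))"
      using ev by eventually_elim (simp add: X_def)
    ultimately show "(\<lambda>m. norm (E (\<lambda>a. X a m))) \<longlonglongrightarrow> 0" by (rule Lim_transform_eventually)
  qed
  have X_lim: "(\<lambda>m. X a m v) \<longlonglongrightarrow> f a v" for a v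
  proof (rule Lim_transform_eventually)
    show "(\<lambda>m. \<Theta> (J m) a v) \<longlonglongrightarrow> f a v" by (rule filterlim_compose[OF lim J_top])
    show "\<forall>\<^sub>F m in sequentially. \<Theta> (J m) a v = X a m v" using XJ[of a] by eventually_elim simp
  qed
  define \<phi> where "\<phi> n a m = (if m < n then 0 else X a m)" for n a m
  have \<phi>_lim: "star_strong_limit (\<phi> n a) (f a)" for n a
  proof -
    have S: "star_strong_limit (\<lambda>m. X a m) (f a)" by (rule cadjoint_strong_limit[OF X_rep f X_lim])
    have ev: "\<forall>\<^sub>F m in sequentially. X a m = \<phi> n a m"
      by (rule eventually_sequentiallyI[of n]) (simp add: \<phi>_def)
    show ?thesis unfolding star_strong_limit_def
    proof (intro conjI allI)
      show "f a \<in> bounded_ops" by (rule star_homD(1)[OF f])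
      show "(\<lambda>m. \<phi> n a m v) \<longlonglongrightarrow> f a v" "(\<lambda>m. cadjoint (\<phi> n a m) v) \<longlonglongrightarrow> cadjoint (f a) v" for v
        using S unfolding star_strong_limit_def
        by (auto intro: Lim_transform_eventually[OF _ eventually_mono[OF ev]])
    qed
  qed
  have sup0: "(\<lambda>n. SUP m. norm (if m < n then 0 else Y m)) \<longlonglongrightarrow> 0" if Y0: "(\<lambda>m. norm (Y m)) \<longlonglongrightarrow> 0" for Y :: "nat \<Rightarrow> 'h \<Rightarrow>\<^sub>L 'h"
  proof (rule LIMSEQ_I)
    fix r :: real assume r: "r > 0"
    obtain N where N: "\<And>m. m \<ge> N \<Longrightarrow> norm (Y m) < r / 2" using LIMSEQ_D[OF Y0, of "r / 2"] r by auto
    have "norm ((SUP m. norm (if m < n then 0 else Y m)) - 0) < r" if n: "n \<ge> N" for n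
    proof -
      have b: "norm (if m < n then 0 else Y m) \<le> r / 2" for m using N[of m] n r by (auto intro: less_imp_le)
      have "(SUP m. norm (if m < n then 0 else Y m)) \<le> r / 2" by (rule cSUP_least) (use b in auto)
      moreover have "0 \<le> (SUP m. norm (if m < n then 0 else Y m))"
        by (rule order_trans[OF norm_ge_zero cSUP_upper[of 0]]) (use b in \<open>auto intro!: bdd_aboveI2[of _ _ "r / 2"]\<close>)
      ultimately show ?thesis using r by simp
    qed
    then show "\<exists>no. \<forall>n\<ge>no. norm ((SUP m. norm (if m < n then 0 else Y m)) - 0) < r" by blast
  qed
  have X_bd: "bounded_seq (\<phi> n a)" and X_sup: "(SUP m. norm (\<phi> n a m)) \<le> (SUP m. norm (X a m))" for n a
  proof -
    obtain K where K: "K > 0" "\<And>m. norm (X a m) \<le> K" using bounded_seqE[OF rep_bounded[OF X_rep]] by blast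
    then show "bounded_seq (\<phi> n a)" by (intro bounded_seqI[of _ K]) (simp add: \<phi>_def)
    show "(SUP m. norm (\<phi> n a m)) \<le> (SUP m. norm (X a m))"
    proof (rule cSUP_mono)
      show "bdd_above (range (\<lambda>m. norm (X a m)))" using K by (intro bdd_aboveI2[of _ _ K]) auto
      show "\<exists>m'\<in>UNIV. norm (\<phi> n a m) \<le> norm (X a m')" for m by (rule bexI[of _ m]) (simp_all add: \<phi>_def)
    qed simp
  qed
  have "discrete_asymptotic_hom (convergent_matrix_alg proj) \<phi>"
    unfolding discrete_asymptotic_hom_def convergent_alg_simps
  proof (intro conjI allI)
    have "\<phi> n a m \<in> corner m" for n a m using X_corner[of a m] by (simp add: \<phi>_def corner_def blinfun.zero_right)
    then show "\<phi> n a \<in> {X. (\<forall>n. X n \<in> corner n) \<and> bounded_seq X \<and> (\<exists>T. star_strong_limit X T)}" for n a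
      using X_bd \<phi>_lim by blast
    show "bdd_above (range (\<lambda>n. SUP m. norm (\<phi> n a m)))" for a
      by (rule bdd_aboveI2[of _ _ "SUP m. norm (X a m)"]) (rule X_sup)
    have "(\<lambda>m. \<phi> n (cstar a) m - cadjoint (\<phi> n a m)) = (\<lambda>m. if m < n then 0 else X (cstar a) m - cadjoint (X a m))" for n a
      by (auto simp: \<phi>_def)
    then show "(\<lambda>n. SUP m. norm (\<phi> n (cstar a) m - cadjoint (\<phi> n a m))) \<longlonglongrightarrow> 0" for a
      using sup0[OF rep_cstar[OF X_rep, unfolded close_def]] by (simp add: fun_eq_iff)
    have "(\<lambda>m. \<phi> n (c *\<^sub>C a + d *\<^sub>C b) m - (scale_op c (\<phi> n a m) + scale_op d (\<phi> n b m)))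
        = (\<lambda>m. if m < n then 0 else X (c *\<^sub>C a + d *\<^sub>C b) m - (scale_op c (X a m) + scale_op d (X b m)))" for n a b c d
      by (rule ext) (auto simp: \<phi>_def blinfun.minus_left intro!: blinfun_eqI)
    then show "(\<lambda>n. SUP m. norm (\<phi> n (c *\<^sub>C a + d *\<^sub>C b) m - (scale_op c (\<phi> n a m) + scale_op d (\<phi> n b m)))) \<longlonglongrightarrow> 0" for a b c d
      using sup0[OF rep_linear[OF X_rep, unfolded close_def]] by (simp add: fun_eq_iff)
    have "(\<lambda>m. \<phi> n (a * b) m - (\<phi> n a m o\<^sub>L \<phi> n b m)) = (\<lambda>m. if m < n then 0 else X (a * b) m - (X a m o\<^sub>L X b m))" for n a b
      by (auto simp: \<phi>_def intro!: blinfun_eqI)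
    then show "(\<lambda>n. SUP m. norm (\<phi> n (a * b) m - (\<phi> n a m o\<^sub>L \<phi> n b m))) \<longlonglongrightarrow> 0" for a b
      using sup0[OF rep_mult[OF X_rep, unfolded close_def]] by (simp add: fun_eq_iff)
  qed
  then show ?thesis unfolding lifts_def using limit_map_eq[OF \<phi>_lim] by blast
qed

end

section \<open>Extracting matrix models from an asymptotic lift\<close>

text \<open>
  Lower semicontinuity of the norm for strong convergence.
\<close>

lemma strong_limit_norm:
  assumes "star_strong_limit X T" "\<epsilon> > 0"
  shows "\<forall>\<^sub>F m in sequentially. norm T \<le> norm (X m) + \<epsilon>"
proof (cases "norm T - \<epsilon> < 0")
  case True
  then have "norm T \<le> norm (X m) + \<epsilon>" for m using norm_ge_zero[of "X m"] by linarith
  then show ?thesis by simp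
next
  case False
  have "\<exists>v. norm (T v) > (norm T - \<epsilon>) * norm v"
  proof (rule ccontr)
    assume "\<nexists>v. norm (T v) > (norm T - \<epsilon>) * norm v"
    then have "norm T \<le> norm T - \<epsilon>" by (intro norm_blinfun_bound) (use False in \<open>auto simp: not_less\<close>)
    with assms(2) show False by simp
  qed
  then obtain v where v: "norm (T v) > (norm T - \<epsilon>) * norm v" by blast
  have "(\<lambda>m. norm (X m v)) \<longlonglongrightarrow> norm (T v)"
    by (intro tendsto_norm) (use assms(1) in \<open>simp add: star_strong_limit_def\<close>)
  then have "\<forall>\<^sub>F m in sequentially. norm (X m v) > (norm T - \<epsilon>) * norm v" using v by (rule order_tendstoD)
  then show ?thesis
  proof eventually_elim
    case (elim m)
    then have "(norm T - \<epsilon>) * norm v < norm (X m) * norm v" using norm_blinfun[of "X m" v] by linarith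
    then show ?case using mult_less_cancel_right[of _ "norm v"] by (simp add: not_less)
  qed
qed

lemma star_hom_contractive:
  fixes f :: "'a::cstar_algebra \<Rightarrow> 'h::chilbert_space \<Rightarrow>\<^sub>L 'h"
  assumes "star_hom bounded_op_alg f" shows "norm (f a) \<le> norm a"
proof (rule field_le_epsilon)
  fix \<epsilon> :: real assume "\<epsilon> > 0"
  from asymptotically_contractive[OF asymptotic_rep_star_hom[OF assms] this, of a]
  show "norm (f a) \<le> norm a + \<epsilon>" by simp
qed

context orthonormal_basis
begin

text \<open>
  From \<open>\<phi> n a\<close> the entry with index \<open>k n\<close> is chosen so late that its norm is almost that of the limit
  for the first \<open>n\<close> elements of the dense sequence.  Norms of defects in \<open>\<D>\<close> are suprema over all
  entries, so they bound the defects of the chosen entries.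
\<close>

lemma diagonal_rep:
  fixes f :: "'a::cstar_algebra \<Rightarrow> 'h \<Rightarrow>\<^sub>L 'h" and s :: "nat \<Rightarrow> 'a"
  assumes lift: "asymptotically_lifts proj f" and emb: "embedding bounded_op_alg f"
    and dense: "\<And>a r. r > 0 \<Longrightarrow> \<exists>n. dist a (s n) < r"
  shows "\<exists>k \<psi>. (\<forall>n. 0 < k n) \<and> faithful_asymptotic_rep e (\<psi> :: nat \<Rightarrow> 'a \<Rightarrow> 'h \<Rightarrow>\<^sub>L 'h) k"
proof -
  have hom: "star_hom bounded_op_alg f" and inj: "inj f" using emb by (simp_all add: embedding_def)
  obtain \<phi> where \<phi>: "discrete_asymptotic_hom (convergent_matrix_alg proj) \<phi>"
    and lim: "\<And>a. (\<lambda>n. norm (limit_map (\<phi> n a) - f a)) \<longlonglongrightarrow> 0"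
    using lift by (auto simp: asymptotically_lifts_def)
  have mem: "\<phi> n a \<in> {X. (\<forall>n. X n \<in> corner n) \<and> bounded_seq X \<and> (\<exists>T. star_strong_limit X T)}"
    and bdd: "bdd_above (range (\<lambda>n. SUP m. norm (\<phi> n a m)))"
    and star: "(\<lambda>n. SUP m. norm (\<phi> n (cstar a) m - cadjoint (\<phi> n a m))) \<longlonglongrightarrow> 0"
    and linear: "(\<lambda>n. SUP m. norm (\<phi> n (c *\<^sub>C a + d *\<^sub>C b) m - (scale_op c (\<phi> n a m) + scale_op d (\<phi> n b m)))) \<longlonglongrightarrow> 0"
    and mult: "(\<lambda>n. SUP m. norm (\<phi> n (a * b) m - (\<phi> n a m o\<^sub>L \<phi> n b m))) \<longlonglongrightarrow> 0" for n a b c d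
    using \<phi>[unfolded discrete_asymptotic_hom_def convergent_alg_simps] by simp_all
  have cor: "\<phi> n a m \<in> corner m" and bs: "bounded_seq (\<phi> n a)" for n a m using mem[of n a] by auto
  note bo = cornerD(1)[OF cor]
  define T where "T n a = limit_map (\<phi> n a)" for n a
  have ssl: "star_strong_limit (\<phi> n a) (T n a)" for n a
    using mem[of n a] limit_map_eq unfolding T_def by fastforce
  have "\<exists>m\<ge>Suc n. \<forall>l\<in>{..n}. norm (T n (s l)) \<le> norm (\<phi> n (s l) m) + inverse (real (Suc n))" for n
  proof -
    have "\<forall>\<^sub>F m in sequentially. m \<ge> Suc n \<and> (\<forall>l\<in>{..n}. norm (T n (s l)) \<le> norm (\<phi> n (s l) m) + inverse (real (Suc n)))"
      by (intro eventually_conj eventually_ge_at_top eventually_ball_finite ballI finite_atMost strong_limit_norm[OF ssl]) simp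
    then show ?thesis using eventually_happens'[OF sequentially_bot] by blast
  qed
  then obtain k where k: "\<And>n. k n \<ge> Suc n"
    "\<And>n l. l \<le> n \<Longrightarrow> norm (T n (s l)) \<le> norm (\<phi> n (s l) (k n)) + inverse (real (Suc n))"
    by (metis atMost_iff)
  define \<psi> where "\<psi> n a = \<phi> n a (k n)" for n a
  have sup: "norm (Z (k n)) \<le> (SUP m. norm (Z m))" if "bounded_seq Z" for Z :: "nat \<Rightarrow> 'h \<Rightarrow>\<^sub>L 'h" and n
    by (rule cSUP_upper) (use that in \<open>simp_all add: bounded_seq_bdd_above\<close>)
  have diag: "close (\<lambda>n. X n (k n)) (\<lambda>n. Y n (k n))"
    if "(\<lambda>n. SUP m. norm (X n m - Y n m)) \<longlonglongrightarrow> 0" and "\<And>n. bounded_seq (\<lambda>m. X n m - Y n m)"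
    for X Y :: "nat \<Rightarrow> nat \<Rightarrow> 'h \<Rightarrow>\<^sub>L 'h"
    by (rule close_le[OF that(1) sup[OF that(2)]])
  obtain K where K: "\<And>n a m. norm (\<phi> n a m) \<le> K n a"
  proof -
    have "\<exists>K. \<forall>m. norm (\<phi> n a m) \<le> K" for n a using bs[of n a] by (simp add: bounded_seq_def)
    then show thesis using that by metis
  qed
  have rep: "asymptotic_rep \<psi>"
    unfolding asymptotic_rep_iff
  proof (intro conjI allI)
    show "\<psi> n a \<in> bounded_ops" for n a using bo by (simp add: \<psi>_def)
    show "bounded_seq (\<lambda>n. \<psi> n a)" for a
    proof -
      obtain L where "\<And>n. (SUP m. norm (\<phi> n a m)) \<le> L" using bdd[of a] by (auto simp: bdd_above_def)
      then have "norm (\<psi> n a) \<le> L" for n unfolding \<psi>_def by (rule order_trans[OF sup[OF bs[of n a], of n]])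
      then show ?thesis by (rule bounded_seqI)
    qed
    show "close (\<lambda>n. \<psi> n (cstar a)) (\<lambda>n. cadjoint (\<psi> n a))" for a
      unfolding \<psi>_def
    proof (rule diag[OF star])
      have "norm (\<phi> n (cstar a) m - cadjoint (\<phi> n a m)) \<le> K n (cstar a) + K n a" for n m
        using norm_triangle_ineq4[of "\<phi> n (cstar a) m" "cadjoint (\<phi> n a m)"] K[of n a m] K[of n "cstar a" m]
        by (simp add: norm_cadjoint[OF bo])
      then show "bounded_seq (\<lambda>m. \<phi> n (cstar a) m - cadjoint (\<phi> n a m))" for n by (rule bounded_seqI)
    qed
    show "close (\<lambda>n. \<psi> n (c *\<^sub>C a + d *\<^sub>C b)) (\<lambda>n. scale_op c (\<psi> n a) + scale_op d (\<psi> n b))" for a b c d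
      unfolding \<psi>_def
    proof (rule diag[OF linear])
      have "norm (\<phi> n (c *\<^sub>C a + d *\<^sub>C b) m - (scale_op c (\<phi> n a m) + scale_op d (\<phi> n b m)))
          \<le> K n (c *\<^sub>C a + d *\<^sub>C b) + (cmod c * K n a + cmod d * K n b)" for n m
      proof (rule order_trans[OF norm_triangle_ineq4], rule add_mono[OF K], rule order_trans[OF norm_triangle_ineq])
        show "norm (scale_op c (\<phi> n a m)) + norm (scale_op d (\<phi> n b m)) \<le> cmod c * K n a + cmod d * K n b"
          unfolding norm_scale_op by (intro add_mono mult_left_mono K norm_ge_zero)
      qed
      then show "bounded_seq (\<lambda>m. \<phi> n (c *\<^sub>C a + d *\<^sub>C b) m - (scale_op c (\<phi> n a m) + scale_op d (\<phi> n b m)))" for n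
        by (rule bounded_seqI)
    qed
    show "close (\<lambda>n. \<psi> n (a * b)) (\<lambda>n. \<psi> n a o\<^sub>L \<psi> n b)" for a b
      unfolding \<psi>_def
    proof (rule diag[OF mult])
      have "norm (\<phi> n (a * b) m - (\<phi> n a m o\<^sub>L \<phi> n b m)) \<le> K n (a * b) + K n a * K n b" for n m
      proof (rule order_trans[OF norm_triangle_ineq4], rule add_mono[OF K], rule order_trans[OF norm_blinfun_compose])
        show "norm (\<phi> n a m) * norm (\<phi> n b m) \<le> K n a * K n b"
          by (intro mult_mono K norm_ge_zero order_trans[OF norm_ge_zero K])
      qed
      then show "bounded_seq (\<lambda>m. \<phi> n (a * b) m - (\<phi> n a m o\<^sub>L \<phi> n b m))" for n by (rule bounded_seqI)
    qed
  qed
  have "a = 0" if a: "(\<lambda>n. norm (\<psi> n a)) \<longlonglongrightarrow> 0" for a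
  proof -
    have "norm (f a) \<le> 0 + \<epsilon>" if \<epsilon>: "\<epsilon> > 0" for \<epsilon> :: real
    proof -
      \<comment> \<open>The estimates below add up to less than \<open>7 * r\<close>.\<close>
      define r where "r = \<epsilon> / 8"
      have r: "r > 0" using \<epsilon> by (simp add: r_def)
      have sum: "w \<le> \<epsilon>"
        if "p \<le> q + t + u" "x \<le> y + z" "w \<le> x + o'" "y \<le> p + i" "o' < r" "q \<le> o' + r" "t < r" "u < r" "i < r" "z < r"
        for p q t u w x y z i o' :: real
        using that r unfolding r_def by linarith
      obtain l where l: "dist a (s l) < r" using dense r by blast
      have "\<forall>\<^sub>F n in sequentially. norm (\<psi> n (s l - a)) \<le> norm (s l - a) + r"
        by (rule asymptotically_contractive[OF rep r])
      moreover have "\<forall>\<^sub>F n in sequentially. norm (\<psi> n (s l - a) - (\<psi> n (s l) - \<psi> n a)) < r"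
        using order_tendstoD(2)[OF rep_diff[OF rep, of "s l" a, unfolded close_def] r] .
      moreover have "\<forall>\<^sub>F n in sequentially. norm (\<psi> n a) < r" by (rule order_tendstoD(2)[OF a r])
      moreover have "\<forall>\<^sub>F n in sequentially. inverse (real (Suc n)) < r"
        by (rule order_tendstoD(2)[OF LIMSEQ_inverse_real_of_nat r])
      moreover have "\<forall>\<^sub>F n in sequentially. norm (T n (s l) - f (s l)) < r"
        using order_tendstoD(2)[OF lim[of "s l"] r] by (simp add: T_def)
      ultimately have "\<forall>\<^sub>F n in sequentially. norm (f a) \<le> \<epsilon>"
        using eventually_ge_at_top[of l]
      proof eventually_elim
        case (elim n)
        have 1: "norm (\<psi> n (s l)) \<le> norm (\<psi> n (s l - a)) + norm (\<psi> n (s l - a) - (\<psi> n (s l) - \<psi> n a)) + norm (\<psi> n a)"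
          using norm_triangle_ineq[of "\<psi> n (s l) - \<psi> n a" "\<psi> n a"]
            norm_triangle_sub[of "\<psi> n (s l) - \<psi> n a" "\<psi> n (s l - a)"]
          by (simp add: norm_minus_commute)
        have 2: "norm (f (s l)) \<le> norm (T n (s l)) + norm (T n (s l) - f (s l))"
          using norm_triangle_sub[of "f (s l)" "T n (s l)"] by (simp add: norm_minus_commute)
        have 3: "norm (f a) \<le> norm (f (s l)) + norm (s l - a)"
          using norm_triangle_ineq[of "f (s l)" "f (a - s l)"] star_hom_contractive[OF hom, of "a - s l"]
          by (simp add: star_homD(2)[OF hom, symmetric] norm_minus_commute)
        have 4: "norm (T n (s l)) \<le> norm (\<psi> n (s l)) + inverse (real (Suc n))"
          using k(2)[of l n] elim by (simp add: \<psi>_def)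
        have 5: "norm (s l - a) < r" using l by (simp add: dist_norm norm_minus_commute)
        show ?case by (rule sum[OF 1 2 3 4 5 elim(1) elim(2) elim(3) elim(4) elim(5)])
      qed
      then show ?thesis by simp
    qed
    then have "norm (f a) \<le> 0" by (rule field_le_epsilon)
    then have "f a = f 0" using star_hom_zero[OF hom] by simp
    then show "a = 0" using inj by (simp add: inj_eq)
  qed
  then have "faithful_asymptotic_rep e \<psi> k"
    by unfold_locales (use rep cor in \<open>auto simp: \<psi>_def\<close>)
  moreover have "0 < k n" for n using k(1)[of n] by simp
  ultimately show ?thesis by blast
qed

end

section \<open>Corners as matrix algebras\<close>

context orthonormal_basis
begin

definition matrix_of :: "nat \<Rightarrow> ('h \<Rightarrow>\<^sub>L 'h) \<Rightarrow> complex Matrix.mat" where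
  "matrix_of k T = Matrix.mat k k (\<lambda>(i, j). cinner (e i) (T (e j)))"

definition coords :: "nat \<Rightarrow> 'h \<Rightarrow> complex Matrix.vec" where
  "coords k v = Matrix.vec k (\<lambda>i. cinner (e i) v)"

lemma matrix_of_carrier [simp]: "matrix_of k T \<in> carrier_mat k k"
  by (simp add: matrix_of_def)

lemma cinner_corner:
  assumes "T \<in> corner k"
  shows "cinner (e i) (T v) = (\<Sum>j<k. cinner (e i) (T (e j)) * cinner (e j) v)"
proof -
  have "T v = T (proj k v)" by (simp add: cornerD(3)[OF assms])
  also have "\<dots> = (\<Sum>j<k. cinner (e j) v *\<^sub>C T (e j))"
    by (simp add: proj_apply blinfun.sum_right bounded_opsD[OF cornerD(1)[OF assms]])
  finally show ?thesis by (simp add: cinner_sum_right cinner_scaleC_right mult.commute)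
qed

lemma matrix_of_add: "matrix_of k (S + T) = matrix_of k S + matrix_of k T"
  by (rule eq_matI) (simp_all add: matrix_of_def blinfun.add_left cinner_add_right)

lemma matrix_of_scale: "matrix_of k (scale_op c T) = c \<cdot>\<^sub>m matrix_of k T"
  by (rule eq_matI) (simp_all add: matrix_of_def cinner_scaleC_right)

lemma matrix_of_compose:
  assumes "S \<in> corner k" shows "matrix_of k (S o\<^sub>L T) = matrix_of k S * matrix_of k T"
  by (rule eq_matI)
    (simp_all add: matrix_of_def scalar_prod_def cinner_corner[OF assms, of _ "blinfun_apply T _"] lessThan_atLeast0)

lemma matrix_of_cadjoint:
  assumes "T \<in> bounded_ops" shows "matrix_of k (cadjoint T) = mat_adjoint (matrix_of k T)"
  by (rule eq_matI)
    (simp_all add: matrix_of_def mat_adjoint_def mat_of_rows_def cinner_cadjoint_right[OF assms] cinner_commute[of "blinfun_apply T _"])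

lemma matrix_of_coords:
  assumes "T \<in> corner k" shows "matrix_of k T *\<^sub>v coords k v = coords k (T v)"
  by (rule eq_vecI)
    (simp_all add: matrix_of_def coords_def scalar_prod_def cinner_corner[OF assms, of _ v] lessThan_atLeast0)

lemma vec_l2norm_coords: "vec_l2norm (coords k v) = norm (proj k v)"
proof -
  have "vec_l2norm (coords k v) = sqrt ((norm (proj k v))\<^sup>2)"
    unfolding vec_l2norm_def L2_set_def norm_proj_sq by (simp add: coords_def)
  then show ?thesis by simp
qed

lemma coords_surj:
  assumes "w \<in> carrier_vec k" obtains v where "w = coords k v"
proof
  show "w = coords k (\<Sum>i<k. vec_index w i *\<^sub>C e i)"
    by (rule eq_vecI) (use assms in \<open>simp_all add: coords_def cinner_e_sum\<close>)
qed

text \<open>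
  Every vector with \<open>k\<close> entries has the form \<open>coords k v\<close>, so the two suprema are over the same set.
\<close>

lemma mat_opnorm_matrix_of:
  assumes T: "T \<in> corner k" shows "mat_opnorm (matrix_of k T) = norm T"
proof -
  have eq: "{vec_l2norm (matrix_of k T *\<^sub>v w) | w. w \<in> carrier_vec (dim_col (matrix_of k T)) \<and> vec_l2norm w \<le> 1}
      = {norm (T v) | v. norm (proj k v) \<le> 1}" (is "?L = ?R")
  proof (intro equalityI subsetI)
    fix x assume "x \<in> ?L"
    then obtain w where w: "x = vec_l2norm (matrix_of k T *\<^sub>v w)" "w \<in> carrier_vec k" "vec_l2norm w \<le> 1"
      by (auto simp: matrix_of_def)
    obtain v where "w = coords k v" using coords_surj[OF w(2)] .
    with w show "x \<in> ?R" by (auto simp: matrix_of_coords[OF T] vec_l2norm_coords cornerD[OF T])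
  next
    fix x assume "x \<in> ?R"
    then obtain v where "x = norm (T v)" "norm (proj k v) \<le> 1" by blast
    then show "x \<in> ?L"
      by (intro CollectI exI[of _ "coords k v"])
        (simp add: matrix_of_coords[OF T] vec_l2norm_coords cornerD[OF T], simp add: coords_def matrix_of_def)
  qed
  have ub: "x \<le> norm T" if x: "x \<in> ?R" for x
  proof -
    obtain v where v: "x = norm (T v)" "norm (proj k v) \<le> 1" using x by blast
    have "x \<le> norm T * norm (proj k v)" using norm_blinfun[of T "proj k v"] by (simp add: v(1) cornerD[OF T])
    also have "\<dots> \<le> norm T * 1" using v(2) by (intro mult_left_mono) simp_all
    finally show ?thesis by simp
  qed
  have bdd: "bdd_above ?R" by (rule bdd_aboveI) (rule ub)
  have zero: "0 \<in> ?R" by (rule CollectI, rule exI[of _ 0]) (simp add: blinfun.zero_right)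
  have "Sup ?R = norm T"
  proof (rule antisym)
    show "Sup ?R \<le> norm T" by (rule cSup_least) (use zero ub in auto)
    show "norm T \<le> Sup ?R"
    proof (rule norm_blinfun_bound)
      show "0 \<le> Sup ?R" by (rule cSup_upper[OF zero bdd])
      fix v :: 'h
      show "norm (T v) \<le> Sup ?R * norm v"
      proof (cases "v = 0")
        case True then show ?thesis by (simp add: blinfun.zero_right)
      next
        case False
        define u where "u = (1 / norm v) *\<^sub>R v"
        have "norm (proj k u) \<le> norm u" by (rule norm_proj_le)
        also have "norm u = 1" using False by (simp add: u_def)
        finally have "norm (T u) \<le> Sup ?R" by (intro cSup_upper bdd) blast
        moreover have "norm (T v) = norm (T u) * norm v" using False by (simp add: u_def blinfun.scaleR_right)
        ultimately show ?thesis by (simp add: mult_right_mono)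
      qed
    qed
  qed
  then show ?thesis unfolding mat_opnorm_def eq .
qed

lemma matrix_of_surj:
  assumes A: "A \<in> carrier_mat k k" obtains T where "T \<in> corner k" "matrix_of k T = A"
proof -
  define T where "T = Blinfun (\<lambda>v. \<Sum>i<k. \<Sum>j<k. (A $$ (i, j) * cinner (e j) v) *\<^sub>C e i)"
  have "bounded_linear (\<lambda>v. \<Sum>i<k. \<Sum>j<k. (A $$ (i, j) * cinner (e j) v) *\<^sub>C e i)"
  proof (intro bounded_linear_sum)
    fix i j
    show "bounded_linear (\<lambda>v. (A $$ (i, j) * cinner (e j) v) *\<^sub>C e i)"
    proof (rule bounded_linear_intro[of _ "cmod (A $$ (i, j))"])
      show "norm ((A $$ (i, j) * cinner (e j) v) *\<^sub>C e i) \<le> norm v * cmod (A $$ (i, j))" for v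
        using cauchy_schwarz[of "e j" v] by (simp add: norm_scaleC norm_mult mult.commute mult_right_mono)
    qed (simp_all add: cinner_add_right scaleC_add_left ring_distribs scaleR_scaleC scaleC_scaleC cinner_scaleC_right mult_ac)
  qed
  then have T: "T v = (\<Sum>i<k. \<Sum>j<k. (A $$ (i, j) * cinner (e j) v) *\<^sub>C e i)" for v
    unfolding T_def by (simp add: bounded_linear_Blinfun_apply)
  have c: "cinner (e i) (T v) = (if i < k then \<Sum>j<k. A $$ (i, j) * cinner (e j) v else 0)" for i v
  proof -
    have "T v = (\<Sum>i<k. (\<Sum>j<k. A $$ (i, j) * cinner (e j) v) *\<^sub>C e i)"
      unfolding T by (simp add: complex_vector.scale_sum_left)
    then show ?thesis by (simp add: cinner_e_sum)
  qed
  show ?thesis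
  proof (rule that)
    have "T \<in> bounded_ops"
      by (simp add: bounded_ops_def T cinner_scaleC_right complex_vector.scale_sum_right scaleC_scaleC mult_ac)
    moreover have "proj k (T v) = T v" "T (proj k v) = T v" for v
      by (rule e_eqI; simp add: cinner_e_proj c)+
    ultimately show "T \<in> corner k" by (simp add: corner_def)
    have "cinner (e i) (T (e j)) = A $$ (i, j)" if "i < k" "j < k" for i j
      using that by (simp add: c ortho if_distrib[of "(*) _"] cong: if_cong)
    then show "matrix_of k T = A" using A by (intro eq_matI) (simp_all add: matrix_of_def)
  qed
qed

definition corner_seqs :: "(nat \<Rightarrow> nat) \<Rightarrow> (nat \<Rightarrow> 'h \<Rightarrow>\<^sub>L 'h) set" where
  "corner_seqs k = {X. (\<forall>n. X n \<in> corner (k n)) \<and> bounded_seq X}"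

definition matrices_of :: "(nat \<Rightarrow> nat) \<Rightarrow> (nat \<Rightarrow> 'h \<Rightarrow>\<^sub>L 'h) \<Rightarrow> nat \<Rightarrow> complex Matrix.mat" where
  "matrices_of k X n = matrix_of (k n) (X n)"

abbreviation matrix_prod :: "(nat \<Rightarrow> nat) \<Rightarrow> (nat \<Rightarrow> complex Matrix.mat) star_algebra" where
  "matrix_prod k \<equiv> bounded_prod (\<lambda>n. matrix_alg (k n))"

abbreviation null_seqs :: "(nat \<Rightarrow> nat) \<Rightarrow> (nat \<Rightarrow> complex Matrix.mat) set" where
  "null_seqs k \<equiv> c0_sum (\<lambda>n. matrix_alg (k n))"

text \<open>
  All elements of the quotient arise from bounded sequences in the corners, and two sequences give the
  same element iff their difference tends to \<open>0\<close>.
\<close>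

definition matrix_class :: "(nat \<Rightarrow> nat) \<Rightarrow> (nat \<Rightarrow> 'h \<Rightarrow>\<^sub>L 'h) \<Rightarrow> (nat \<Rightarrow> complex Matrix.mat) set" where
  "matrix_class k X = coset_sa (matrix_prod k) (null_seqs k) (matrices_of k X)"

lemma corner_seqsD: "X \<in> corner_seqs k \<Longrightarrow> X n \<in> corner (k n)" "X \<in> corner_seqs k \<Longrightarrow> bounded_seq X"
  by (auto simp: corner_seqs_def)

lemma bounded_seq_simps:
  "bounded_seq X \<Longrightarrow> bounded_seq (\<lambda>n. scale_op c (X n))"
  "bounded_seq X \<Longrightarrow> bounded_seq Y \<Longrightarrow> bounded_seq (\<lambda>n. X n o\<^sub>L Y n)"
proof -
  assume "bounded_seq X"
  then obtain K where K: "K > 0" "\<And>n. norm (X n) \<le> K" using bounded_seqE[of X] by blast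
  then show "bounded_seq (\<lambda>n. scale_op c (X n))"
    by (intro bounded_seqI[of _ "cmod c * K"]) (simp add: norm_scale_op mult_left_mono)
  assume "bounded_seq Y"
  then obtain L where L: "L > 0" "\<And>n. norm (Y n) \<le> L" using bounded_seqE[of Y] by blast
  show "bounded_seq (\<lambda>n. X n o\<^sub>L Y n)"
    by (intro bounded_seqI[of _ "K * L"] order_trans[OF norm_blinfun_compose] mult_mono) (use K L in \<open>auto intro: less_imp_le\<close>)
qed

lemma corner_seqs_simps:
  assumes "X \<in> corner_seqs k"
  shows "Y \<in> corner_seqs k \<Longrightarrow> (\<lambda>n. X n + Y n) \<in> corner_seqs k"
    "Y \<in> corner_seqs k \<Longrightarrow> (\<lambda>n. X n o\<^sub>L Y n) \<in> corner_seqs k"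
    "(\<lambda>n. scale_op c (X n)) \<in> corner_seqs k"
    "(\<lambda>n. cadjoint (X n)) \<in> corner_seqs k"
proof -
  have "norm (cadjoint (X n)) = norm (X n)" for n
    using assms norm_cadjoint[OF cornerD(1), of "X n" "k n"] by (simp add: corner_seqs_def)
  then show "(\<lambda>n. cadjoint (X n)) \<in> corner_seqs k"
    using assms by (simp add: corner_seqs_def corner_cadjoint bounded_seq_def)
qed (use assms in \<open>simp_all add: corner_seqs_def corner_simps bounded_seq_add bounded_seq_simps\<close>)

lemma corner_seqs_diff: "X \<in> corner_seqs k \<Longrightarrow> Y \<in> corner_seqs k \<Longrightarrow> (\<lambda>n. X n + scale_op (- 1) (Y n)) \<in> corner_seqs k"
  by (intro corner_seqs_simps)

lemma matrix_prod_elems: "elems (matrix_prod k) = matrices_of k ` corner_seqs k"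
proof (intro equalityI subsetI)
  fix A assume "A \<in> elems (matrix_prod k)"
  then have A: "A n \<in> carrier_mat (k n) (k n)" and bdd: "bdd_above (range (\<lambda>n. mat_opnorm (A n)))" for n
    by (auto simp: bounded_prod_def matrix_alg_def)
  have "\<exists>T\<in>corner (k n). matrix_of (k n) T = A n" for n using matrix_of_surj[OF A[of n]] by blast
  then obtain X where X: "\<And>n. X n \<in> corner (k n)" "\<And>n. matrix_of (k n) (X n) = A n" by metis
  have "norm (X n) = mat_opnorm (A n)" for n using mat_opnorm_matrix_of[OF X(1)[of n]] X(2)[of n] by simp
  then have "X \<in> corner_seqs k" using X(1) bdd by (simp add: corner_seqs_def bounded_seq_bdd_above)
  moreover have "matrices_of k X = A" using X(2) by (simp add: fun_eq_iff matrices_of_def)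
  ultimately show "A \<in> matrices_of k ` corner_seqs k" by blast
qed (auto simp: bounded_prod_def matrix_alg_def matrices_of_def corner_seqs_def mat_opnorm_matrix_of bounded_seq_bdd_above)

lemma matrix_prod_simps:
  assumes "X \<in> corner_seqs k"
  shows "add_sa (matrix_prod k) (matrices_of k X) (matrices_of k Y) = matrices_of k (\<lambda>n. X n + Y n)"
    "mult_sa (matrix_prod k) (matrices_of k X) (matrices_of k Y) = matrices_of k (\<lambda>n. X n o\<^sub>L Y n)"
    "scale_sa (matrix_prod k) c (matrices_of k X) = matrices_of k (\<lambda>n. scale_op c (X n))"
    "star_sa (matrix_prod k) (matrices_of k X) = matrices_of k (\<lambda>n. cadjoint (X n))"
  using corner_seqsD[OF assms]
  by (simp_all add: fun_eq_iff bounded_prod_def matrix_alg_def matrices_of_def matrix_of_add matrix_of_scale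
      matrix_of_compose matrix_of_cadjoint[OF cornerD(1)[OF corner_seqsD(1)[OF assms]]])

lemma matrices_of_null_iff:
  assumes "X \<in> corner_seqs k" "Y \<in> corner_seqs k"
  shows "diff_sa (matrix_prod k) (matrices_of k X) (matrices_of k Y) \<in> null_seqs k \<longleftrightarrow> close X Y"
proof -
  let ?Z = "\<lambda>n. X n + scale_op (- 1) (Y n)"
  have Z: "?Z n = X n - Y n" for n
    by (rule blinfun_eqI) (simp add: blinfun.add_left blinfun.diff_left)
  note mem = corner_seqs_diff[OF assms]
  have "diff_sa (matrix_prod k) (matrices_of k X) (matrices_of k Y) = matrices_of k ?Z"
    unfolding diff_sa_def matrix_prod_simps(3)[OF assms(2)] matrix_prod_simps(1)[OF assms(1)] ..
  moreover have "matrices_of k ?Z \<in> null_seqs k \<longleftrightarrow> (\<lambda>n. mat_opnorm (matrix_of (k n) (?Z n))) \<longlonglongrightarrow> 0"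
    using mem unfolding c0_sum_def matrix_prod_elems by (auto simp: matrix_alg_def matrices_of_def)
  moreover have "mat_opnorm (matrix_of (k n) (?Z n)) = norm (X n - Y n)" for n
    using mat_opnorm_matrix_of[OF corner_seqsD(1)[OF mem]] Z by simp
  ultimately show ?thesis by (simp add: close_def)
qed

lemma matrix_class_mem:
  assumes "X \<in> corner_seqs k"
  shows "matrix_class k X = matrices_of k ` {Y \<in> corner_seqs k. close Y X}"
  unfolding matrix_class_def coset_sa_def matrix_prod_elems using matrices_of_null_iff[OF _ assms] by auto

lemma matrix_class_eq_iff:
  assumes X: "X \<in> corner_seqs k" and Y: "Y \<in> corner_seqs k"
  shows "matrix_class k X = matrix_class k Y \<longleftrightarrow> close X Y"
proof
  assume "matrix_class k X = matrix_class k Y"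
  then have "matrices_of k X \<in> matrix_class k Y" using X matrix_class_mem[OF X] by auto
  then show "close X Y" using matrices_of_null_iff[OF X Y] by (simp add: matrix_class_def coset_sa_def)
next
  assume "close X Y"
  then have "close Z X \<longleftrightarrow> close Z Y" for Z using close_trans close_sym by metis
  then show "matrix_class k X = matrix_class k Y" by (simp add: matrix_class_mem X Y)
qed

abbreviation matrix_quotient :: "(nat \<Rightarrow> nat) \<Rightarrow> (nat \<Rightarrow> complex Matrix.mat) set star_algebra" where
  "matrix_quotient k \<equiv> quotient_alg (matrix_prod k) (null_seqs k)"

lemma close_cadjoint:
  assumes "\<And>n. X n \<in> bounded_ops" "\<And>n. Y n \<in> bounded_ops" "close X Y"
  shows "close (\<lambda>n. cadjoint (X n)) (\<lambda>n. cadjoint (Y n))"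
  using assms(3) unfolding close_def by (simp add: cadjoint_diff[symmetric] norm_cadjoint assms(1,2))

text \<open>
  The operations of the quotient are unions of cosets over all representatives.  Since the operations
  respect closeness of bounded sequences, all these cosets coincide.
\<close>

lemma matrix_quotient_simps:
  assumes X: "X \<in> corner_seqs k"
  shows "Y \<in> corner_seqs k \<Longrightarrow> add_sa (matrix_quotient k) (matrix_class k X) (matrix_class k Y) = matrix_class k (\<lambda>n. X n + Y n)"
    "Y \<in> corner_seqs k \<Longrightarrow> mult_sa (matrix_quotient k) (matrix_class k X) (matrix_class k Y) = matrix_class k (\<lambda>n. X n o\<^sub>L Y n)"
    "scale_sa (matrix_quotient k) c (matrix_class k X) = matrix_class k (\<lambda>n. scale_op c (X n))"
    "star_sa (matrix_quotient k) (matrix_class k X) = matrix_class k (\<lambda>n. cadjoint (X n))"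
proof -
  let ?C = "\<lambda>X. {Y \<in> corner_seqs k. close Y X}"
  have self: "Z \<in> ?C Z" if "Z \<in> corner_seqs k" for Z using that by simp
  have coset: "coset_sa (matrix_prod k) (null_seqs k) (matrices_of k Z) = matrix_class k Z" for Z
    by (simp add: matrix_class_def)
  have UN1: "(\<Union>x\<in>matrix_class k X. coset_sa (matrix_prod k) (null_seqs k) (g x)) = matrix_class k Z"
    if "\<And>X'. X' \<in> ?C X \<Longrightarrow> coset_sa (matrix_prod k) (null_seqs k) (g (matrices_of k X')) = matrix_class k Z" for g Z
    unfolding matrix_class_mem[OF X] by (rule SUP_eq_const) (use that self[OF X] in auto)
  have UN2: "(\<Union>x\<in>matrix_class k X. \<Union>y\<in>matrix_class k Y. coset_sa (matrix_prod k) (null_seqs k) (g x y)) = matrix_class k Z"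
    if Y: "Y \<in> corner_seqs k" and g: "\<And>X' Y'. X' \<in> ?C X \<Longrightarrow> Y' \<in> ?C Y \<Longrightarrow>
      coset_sa (matrix_prod k) (null_seqs k) (g (matrices_of k X') (matrices_of k Y')) = matrix_class k Z" for g Y Z
    unfolding matrix_class_mem[OF X] matrix_class_mem[OF Y]
  proof (rule SUP_eq_const)
    fix x assume "x \<in> matrices_of k ` ?C X"
    then obtain X' where x: "x = matrices_of k X'" "X' \<in> ?C X" by blast
    show "(\<Union>y\<in>matrices_of k ` ?C Y. coset_sa (matrix_prod k) (null_seqs k) (g x y)) = matrix_class k Z"
      by (rule SUP_eq_const) (use g[OF x(2)] x(1) self[OF Y] in auto)
  qed (use self[OF X] in auto)
  have bo: "Z n \<in> bounded_ops" and bd: "bounded_seq Z" if "Z \<in> corner_seqs k" for Z n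
    using cornerD(1)[OF corner_seqsD(1)[OF that]] corner_seqsD(2)[OF that] by auto
  have cad: "close (\<lambda>n. cadjoint (X' n)) (\<lambda>n. cadjoint (X n))" if "X' \<in> corner_seqs k" "close X' X" for X'
    by (rule close_cadjoint[OF bo[OF that(1)] bo[OF X] that(2)])
  show "scale_sa (matrix_quotient k) c (matrix_class k X) = matrix_class k (\<lambda>n. scale_op c (X n))"
    unfolding quotient_alg_def star_algebra.simps
    by (rule UN1) (auto simp: matrix_prod_simps coset matrix_class_eq_iff corner_seqs_simps X close_scale)
  show "star_sa (matrix_quotient k) (matrix_class k X) = matrix_class k (\<lambda>n. cadjoint (X n))"
    unfolding quotient_alg_def star_algebra.simps
    by (rule UN1) (auto simp: matrix_prod_simps coset matrix_class_eq_iff corner_seqs_simps X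
        intro!: cad)
  assume Y: "Y \<in> corner_seqs k"
  show "add_sa (matrix_quotient k) (matrix_class k X) (matrix_class k Y) = matrix_class k (\<lambda>n. X n + Y n)"
    unfolding quotient_alg_def star_algebra.simps
    by (rule UN2[OF Y]) (auto simp: matrix_prod_simps coset matrix_class_eq_iff corner_seqs_simps X Y close_add)
  show "mult_sa (matrix_quotient k) (matrix_class k X) (matrix_class k Y) = matrix_class k (\<lambda>n. X n o\<^sub>L Y n)"
    unfolding quotient_alg_def star_algebra.simps
    by (rule UN2[OF Y]) (auto simp: matrix_prod_simps coset matrix_class_eq_iff corner_seqs_simps X Y
        intro!: close_compose corner_seqsD(2)[OF Y] bd)
qed

lemma matrix_quotient_elems: "elems (matrix_quotient k) = matrix_class k ` corner_seqs k"
  by (simp add: quotient_alg_def matrix_prod_elems image_image matrix_class_def)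

lemma faithful_asymptotic_rep_of_embedding:
  fixes F :: "'a::cstar_algebra \<Rightarrow> (nat \<Rightarrow> complex Matrix.mat) set"
  assumes F: "embedding (matrix_quotient k) F"
  shows "\<exists>\<psi> :: nat \<Rightarrow> 'a \<Rightarrow> 'h \<Rightarrow>\<^sub>L 'h. faithful_asymptotic_rep e \<psi> k"
proof -
  have hom: "star_hom (matrix_quotient k) F" and inj: "inj F" using F by (simp_all add: embedding_def)
  have "\<exists>X\<in>corner_seqs k. F a = matrix_class k X" for a
  proof -
    have "F a \<in> elems (matrix_quotient k)" using hom by (simp add: star_hom_def)
    then show ?thesis unfolding matrix_quotient_elems by blast
  qed
  then obtain x where x: "\<And>a. x a \<in> corner_seqs k" and Fx: "\<And>a. F a = matrix_class k (x a)" by metis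
  note mem = x corner_seqs_simps[OF x] corner_seqs_simps(1)[OF _ x]
  have add: "close (x (a + b)) (\<lambda>n. x a n + x b n)" for a b
    using hom unfolding star_hom_def Fx by (simp add: matrix_quotient_simps matrix_class_eq_iff mem)
  have scale: "close (x (c *\<^sub>C a)) (\<lambda>n. scale_op c (x a n))" for a c
    using hom unfolding star_hom_def Fx by (simp add: matrix_quotient_simps matrix_class_eq_iff mem)
  have mult: "close (x (a * b)) (\<lambda>n. x a n o\<^sub>L x b n)" for a b
    using hom unfolding star_hom_def Fx by (simp add: matrix_quotient_simps matrix_class_eq_iff mem)
  have star: "close (x (cstar a)) (\<lambda>n. cadjoint (x a n))" for a
    using hom unfolding star_hom_def Fx by (simp add: matrix_quotient_simps matrix_class_eq_iff mem)
  have rep: "asymptotic_rep (\<lambda>n a. x a n)"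
    unfolding asymptotic_rep_iff
  proof (intro conjI allI)
    show "close (\<lambda>n. x (c *\<^sub>C a + d *\<^sub>C b) n) (\<lambda>n. scale_op c (x a n) + scale_op d (x b n))" for a b c d
      by (rule close_trans[OF add close_add[OF scale scale]])
  qed (use star mult corner_seqsD[OF x] cornerD(1)[OF corner_seqsD(1)[OF x]] in auto)
  have "a = 0" if "(\<lambda>n. norm (x a n)) \<longlonglongrightarrow> 0" for a
  proof -
    have "close (x a) (\<lambda>n. 0)" using that by (simp add: close_def)
    then have "close (x a) (x 0)" by (rule close_trans[OF _ close_sym[OF rep_zero[OF rep]]])
    then have "F a = F 0" by (simp add: Fx matrix_class_eq_iff x)
    then show "a = 0" using inj by (simp add: inj_eq)
  qed
  then have "faithful_asymptotic_rep e (\<lambda>n a. x a n) k"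
    by unfold_locales (use rep corner_seqsD(1)[OF x] in auto)
  then show ?thesis by blast
qed

lemma embedding_of_faithful_asymptotic_rep:
  fixes \<psi> :: "nat \<Rightarrow> 'a::cstar_algebra \<Rightarrow> 'h \<Rightarrow>\<^sub>L 'h"
  assumes "faithful_asymptotic_rep e \<psi> k"
  shows "embedding (matrix_quotient k) (\<lambda>a. matrix_class k (\<lambda>n. \<psi> n a))"
proof -
  interpret faithful_asymptotic_rep e \<psi> k by (rule assms)
  have mem: "(\<lambda>n. \<psi> n a) \<in> corner_seqs k" for a
    by (simp add: corner_seqs_def \<psi>_corner rep_bounded[OF \<psi>])
  note mems = mem corner_seqs_simps[OF mem] corner_seqs_simps(1)[OF _ mem]
  have "star_hom (matrix_quotient k) (\<lambda>a. matrix_class k (\<lambda>n. \<psi> n a))"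
    unfolding star_hom_def matrix_quotient_elems
    by (simp add: matrix_quotient_simps matrix_class_eq_iff mems rep_add[OF \<psi>] rep_scaleC[OF \<psi>] rep_mult[OF \<psi>] rep_cstar[OF \<psi>])
  moreover have "a = b" if "matrix_class k (\<lambda>n. \<psi> n a) = matrix_class k (\<lambda>n. \<psi> n b)" for a b
  proof -
    have "close (\<lambda>n. \<psi> n a) (\<lambda>n. \<psi> n b)" using that by (simp add: matrix_class_eq_iff mem)
    from close_diff[OF this close_refl[of "\<lambda>n. \<psi> n b"]]
    have "close (\<lambda>n. \<psi> n (a - b)) (\<lambda>n. 0)" using close_trans[OF rep_diff[OF \<psi>]] by simp
    then show "a = b" using faithful[of "a - b"] by (simp add: close_def)
  qed
  ultimately show ?thesis by (simp add: embedding_def inj_def)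
qed

text \<open>
  The maps \<open>\<psi> n\<close> are the entries of chosen representatives of the cosets.
\<close>

theorem MF_iff_faithful_asymptotic_rep:
  "MF TYPE('a::cstar_algebra) \<longleftrightarrow>
    (\<exists>k \<psi>. (\<forall>n. 0 < k n) \<and> faithful_asymptotic_rep e (\<psi> :: nat \<Rightarrow> 'a \<Rightarrow> 'h \<Rightarrow>\<^sub>L 'h) k)"
  unfolding MF_def using faithful_asymptotic_rep_of_embedding embedding_of_faithful_asymptotic_rep by blast

end

section \<open>Characterizations of MF algebras\<close>

theorem theorem15:
  fixes P :: "nat \<Rightarrow> 'h::chilbert_space \<Rightarrow>\<^sub>L 'h"
  assumes "separable_space (euclidean :: 'a::cstar_algebra topology)"
    and "projection_filtration P"
  shows "(MF TYPE('a) \<longleftrightarrow>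
            (\<forall>f :: 'a \<Rightarrow> 'h \<Rightarrow>\<^sub>L 'h. star_hom bounded_op_alg f \<longrightarrow> lifts P f)) \<and>
         (MF TYPE('a) \<longleftrightarrow>
            (\<forall>f :: 'a \<Rightarrow> 'h \<Rightarrow>\<^sub>L 'h. star_hom bounded_op_alg f \<longrightarrow> asymptotically_lifts P f)) \<and>
         (MF TYPE('a) \<longleftrightarrow>
            (\<exists>f :: 'a \<Rightarrow> 'h \<Rightarrow>\<^sub>L 'h. embedding bounded_op_alg f \<and> asymptotically_lifts P f))"
proof -
  obtain e where basis: "orthonormal_basis e" and P: "\<And>n. P n = orthonormal_basis.proj e n"
    using projection_filtration_basis[OF assms(2)] by blast
  interpret orthonormal_basis e by (rule basis)
  have Pe: "P = proj" using P by (simp add: fun_eq_iff)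
  obtain s :: "nat \<Rightarrow> 'a" where s: "\<And>a r. r > 0 \<Longrightarrow> \<exists>n. dist a (s n) < r"
    using dense_sequence[OF assms(1)] by blast
  have lift: "lifts P f" if MF: "MF TYPE('a)" and f: "star_hom bounded_op_alg f" for f :: "'a \<Rightarrow> 'h \<Rightarrow>\<^sub>L 'h"
  proof -
    obtain k and \<psi> :: "nat \<Rightarrow> 'a \<Rightarrow> 'h \<Rightarrow>\<^sub>L 'h" where \<psi>: "faithful_asymptotic_rep e \<psi> k"
      using MF MF_iff_faithful_asymptotic_rep[where ?'a = 'a] by blast
    interpret faithful_asymptotic_rep e \<psi> k by (rule \<psi>)
    interpret lifting_problem e \<psi> k f s by unfold_locales (use f s in auto)
    show ?thesis unfolding Pe by (rule lifts_proj)
  qed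
  have weaken: "asymptotically_lifts P f" if "lifts P f" for f :: "'a \<Rightarrow> 'h \<Rightarrow>\<^sub>L 'h"
  proof -
    obtain \<phi> where "discrete_asymptotic_hom (convergent_matrix_alg P) \<phi>" "\<forall>n a. limit_map (\<phi> n a) = f a"
      using \<open>lifts P f\<close> unfolding lifts_def by blast
    then show ?thesis unfolding asymptotically_lifts_def by (intro exI[of _ \<phi>]) simp
  qed
  obtain g :: "'a \<Rightarrow> 'h \<Rightarrow>\<^sub>L 'h" where g: "embedding bounded_op_alg g"
    using gelfand_naimark_separable[OF assms(1) basis] by blast
  then have g_hom: "star_hom bounded_op_alg g" by (simp add: embedding_def)
  have MF: "MF TYPE('a)" if "embedding bounded_op_alg f" "asymptotically_lifts P f" for f :: "'a \<Rightarrow> 'h \<Rightarrow>\<^sub>L 'h"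
    unfolding MF_iff_faithful_asymptotic_rep using diagonal_rep[OF _ that(1) s] that(2) by (simp add: Pe)
  show ?thesis using lift weaken g g_hom MF by blast
qed

end
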